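(* Let $K$ be a field of characteristic zero, and let $V$ and $W$ be finite dimensional $K$-vector spaces with $\dim(V)=d_1$ and $\dim(W)=d_2$. Then for every $n\geq 0$ the dimension over $K$ of the $n$-th homogeneous component of the graded ring $K[\mathrm{End}(V\otimes W)]^{\mathrm{GL}(V)\times \mathrm{GL}(W)}$ is $$\sum_{\substack{\lambda,\mu,\nu\vdash n\\ r(\lambda)\leq d_1 \\ r(\mu)\leq d_2}} g(\lambda,\mu,\nu)^2,$$ where $g(\lambda,\mu,\nu)$ are the Kronecker coefficients of $S_n$; the sum is over all partitions $\lambda$ of $n$ with at most $d_1$ rows, all partitions $\mu$ of $n$ with at most $d_2$ rows, and all partitions $\nu$ of $n$.
   Context: For a finite dimensional $K$-vector space $U$, $K[U]$ denotes the ring of polynomial functions on $U$, graded by polynomial degree. The group $\mathrm{GL}(V)\times\mathrm{GL}(W)$ acts on $V\otimes W$ by $(g,h)\cdot(v\otimes w)=gv\otimes hw$, and on $\mathrm{End}(V\otimes W)$ by conjugation; $K[\mathrm{End}(V\otimes W)]^{\mathrm{GL}(V)\times \mathrm{GL}(W)}$ is the graded subring of polynomial functions invariant under this action. For a partition $\lambda=(l_1\geq \dots\geq l_r>0)$ of $n$ (written $\lambda\vdash n$), $r(\lambda)=r$ is its number of rows. $\mathbb{S}_\lambda$ is the Specht module, the irreducible representation of $S_n$ corresponding to $\lambda$. The Kronecker coefficient $g(\lambda,\mu,\nu)$ is the multiplicity of $\mathbb{S}_\nu$ in $\mathbb{S}_\lambda\otimes\mathbb{S}_\mu$ (with diagonal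 $S_n$-action), i.e. $\mathbb{S}_\lambda\otimes\mathbb{S}_\mu\cong\bigoplus_{\nu\vdash n}\mathbb{S}_\nu^{g(\lambda,\mu,\nu)}$. *)

theory Defs
  imports
    Complex_Main
    "HOL-Library.Function_Algebras"
    "HOL-Combinatorics.Permutations"
begin

section \<open>Linear algebra over a field\<close>

text \<open>
  Addition of functions is pointwise (\<^theory>\<open>HOL-Library.Function_Algebras\<close>); the following is
  the matching scalar multiplication on functions with values in a vector space with scaling
  \<open>s\<close>.  Spans and dimensions of spaces of functions are taken with respect to it.
\<close>

definition pscale :: "('k \<Rightarrow> 'b \<Rightarrow> 'b) \<Rightarrow> 'k \<Rightarrow> ('a \<Rightarrow> 'b) \<Rightarrow> 'a \<Rightarrow> 'b" where
  "pscale s c f = (\<lambda>x. s c (f x))"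

lemma vector_space_pscale:
  assumes "vector_space s"
  shows "vector_space (pscale s)"
proof -
  interpret vector_space s by fact
  show ?thesis
    by unfold_locales
      (simp_all add: pscale_def fun_eq_iff scale_right_distrib scale_left_distrib)
qed

lemma vector_space_times: "vector_space ((*) :: 'k::field \<Rightarrow> 'k \<Rightarrow> 'k)"
  by unfold_locales (simp_all add: algebra_simps)

text \<open>Linearity of a map defined on a subspace \<open>A\<close> of a vector space.\<close>

definition linear_on ::
    "('k \<Rightarrow> 'a::plus \<Rightarrow> 'a) \<Rightarrow> ('k \<Rightarrow> 'b::plus \<Rightarrow> 'b) \<Rightarrow> 'a set \<Rightarrow> ('a \<Rightarrow> 'b) \<Rightarrow> bool" where
  "linear_on s1 s2 A f \<longleftrightarrow>
     (\<forall>x\<in>A. \<forall>y\<in>A. f (x + y) = f x + f y) \<and> (\<forall>c. \<forall>x\<in>A. f (s1 c x) = s2 c (f x))"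

definition End :: "('k::field \<Rightarrow> 't::ab_group_add \<Rightarrow> 't) \<Rightarrow> ('t \<Rightarrow> 't) set" where
  "End s = {X. Vector_Spaces.linear s s X}"

definition GL :: "('k::field \<Rightarrow> 'v::ab_group_add \<Rightarrow> 'v) \<Rightarrow> ('v \<Rightarrow> 'v) set" where
  "GL s = {g. Vector_Spaces.linear s s g \<and> bij g}"


section \<open>Tensor products\<close>

definition bilinear_map ::
    "('k::field \<Rightarrow> 'v::ab_group_add \<Rightarrow> 'v) \<Rightarrow> ('k \<Rightarrow> 'w::ab_group_add \<Rightarrow> 'w) \<Rightarrow>
     ('k \<Rightarrow> 'x::ab_group_add \<Rightarrow> 'x) \<Rightarrow> ('v \<Rightarrow> 'w \<Rightarrow> 'x) \<Rightarrow> bool" where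
  "bilinear_map sV sW sX b \<longleftrightarrow>
     (\<forall>v. Vector_Spaces.linear sW sX (b v)) \<and> (\<forall>w. Vector_Spaces.linear sV sX (\<lambda>v. b v w))"

text \<open>
  A vector space \<open>T\<close> with a bilinear map \<open>tens\<close> from \<open>V \<times> W\<close> to \<open>T\<close> is a tensor product of \<open>V\<close> and
  \<open>W\<close> if it has the universal property.  A definition cannot quantify over the types of all target
  spaces, so only bilinear maps into the ground field are mentioned; over a field this is enough,
  and lemma \<open>tensor_product_universal\<close> recovers the universal property for every target.
\<close>

definition is_tensor_product ::
    "('k::field \<Rightarrow> 'v::ab_group_add \<Rightarrow> 'v) \<Rightarrow> ('k \<Rightarrow> 'w::ab_group_add \<Rightarrow> 'w) \<Rightarrow>
     ('k \<Rightarrow> 't::ab_group_add \<Rightarrow> 't) \<Rightarrow> ('v \<Rightarrow> 'w \<Rightarrow> 't) \<Rightarrow> bool" where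
  "is_tensor_product sV sW sT tens \<longleftrightarrow>
     vector_space sT \<and> bilinear_map sV sW sT tens \<and>
     (\<forall>b. bilinear_map sV sW (*) b \<longrightarrow>
        (\<exists>!f. Vector_Spaces.linear sT (*) f \<and> (\<forall>v w. f (tens v w) = b v w)))"

lemma bilinear_map_eq_on_bases:
  assumes b: "bilinear_map sV sW sX b" and c: "bilinear_map sV sW sX c"
    and BV: "module.span sV BV = UNIV" and BW: "module.span sW BW = UNIV"
    and eq: "\<And>v w. v \<in> BV \<Longrightarrow> w \<in> BW \<Longrightarrow> b v w = c v w"
  shows "b v w = c v w"
proof -
  have lb: "Vector_Spaces.linear sW sX (b v)" "Vector_Spaces.linear sV sX (\<lambda>v. b v w)" for v w
    using b by (auto simp: bilinear_map_def)
  have lc: "Vector_Spaces.linear sW sX (c v)" "Vector_Spaces.linear sV sX (\<lambda>v. c v w)" for v w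
    using c by (auto simp: bilinear_map_def)
  interpret V: vector_space sV using lb(2) by (simp add: Vector_Spaces.linear_iff)
  interpret W: vector_space sW using lb(1) by (simp add: Vector_Spaces.linear_iff)
  interpret X: vector_space sX using lb(1) by (simp add: Vector_Spaces.linear_iff)
  interpret VX: vector_space_pair sV sX ..
  interpret WX: vector_space_pair sW sX ..
  have 1: "b v w = c v w" if "v \<in> BV" for v w
    by (rule WX.linear_eq_on[OF lb(1) lc(1), of w BW]) (use that eq BW in auto)
  show ?thesis
    by (rule VX.linear_eq_on[OF lb(2) lc(2), of v BV w]) (use 1 BV in auto)
qed

lemma bilinear_map_compose:
  assumes b: "bilinear_map sV sW sT b" and f: "Vector_Spaces.linear sT sX f"
  shows "bilinear_map sV sW sX (\<lambda>v w. f (b v w))"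
  using Vector_Spaces.linear_compose[of sW sT "b _" sX f]
        Vector_Spaces.linear_compose[of sV sT "\<lambda>v. b v _" sX f] assms
  by (auto simp: bilinear_map_def o_def)

lemma bilinear_map_exists:
  assumes "vector_space sV" "vector_space sW" "vector_space sX"
    and "module.independent sV BV" "module.independent sW BW"
  shows "\<exists>b. bilinear_map sV sW sX b \<and> (\<forall>v\<in>BV. \<forall>w\<in>BW. b v w = h v w)"
proof -
  interpret V: vector_space sV by fact
  interpret W: vector_space sW by fact
  interpret X: vector_space sX by fact
  interpret VX: vector_space_pair sV sX ..
  interpret WX: vector_space_pair sW sX ..
  have BV: "V.independent BV" and BW: "W.independent BW" by fact+
  define g where "g = (\<lambda>v. WX.construct BW (h v))"
  define b where "b = (\<lambda>v w. VX.construct BV (\<lambda>v. g v w) v)"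
  have g: "Vector_Spaces.linear sW sX (g v)" for v
    unfolding g_def by (rule WX.linear_construct[OF BW])
  have "Vector_Spaces.linear sV sX (\<lambda>v. b v w)" for w
    unfolding b_def by (rule VX.linear_construct[OF BV])
  moreover have "Vector_Spaces.linear sW sX (b v)" for v
    using W.vector_space_axioms X.vector_space_axioms g
    by (auto simp: Vector_Spaces.linear_iff b_def VX.construct_add[OF BV] VX.construct_scale[OF BV])
  moreover have "b v w = h v w" if "v \<in> BV" "w \<in> BW" for v w
    using that by (simp add: b_def g_def VX.construct_basis[OF BV] WX.construct_basis[OF BW])
  ultimately show ?thesis unfolding bilinear_map_def by blast
qed

lemma is_tensor_product_span:
  assumes T: "is_tensor_product sV sW sT tens"
  shows "module.span sT {tens v w | v w. True} = UNIV"
proof (rule ccontr)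
  let ?P = "{tens v w | v w. True}"
  have sT: "vector_space sT" and bt: "bilinear_map sV sW sT tens"
    and ex1: "\<And>b. bilinear_map sV sW (*) b \<Longrightarrow>
        \<exists>!f. Vector_Spaces.linear sT (*) f \<and> (\<forall>v w. f (tens v w) = b v w)"
    using T by (auto simp: is_tensor_product_def)
  interpret T: vector_space sT by (rule sT)
  interpret K: vector_space "(*) :: 'a \<Rightarrow> 'a \<Rightarrow> 'a" by (rule vector_space_times)
  interpret TK: vector_space_pair sT "(*) :: 'a \<Rightarrow> 'a \<Rightarrow> 'a" ..
  assume "T.span ?P \<noteq> UNIV"
  then obtain t where t: "t \<notin> T.span ?P" by auto
  obtain B where B: "B \<subseteq> ?P" "T.independent B" "?P \<subseteq> T.span B"
    using T.maximal_independent_subset[of ?P] by blast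
  have tB: "t \<notin> T.span B" using t T.span_mono[OF B(1)] by auto
  have ind: "T.independent (insert t B)" by (rule T.independent_insertI[OF tB B(2)])
  obtain f where f: "Vector_Spaces.linear sT (*) f"
      and f': "\<forall>x\<in>insert t B. f x = (if x = t then 1 else 0)"
    using TK.linear_independent_extend[OF ind, of "\<lambda>x. if x = t then 1 else 0"] by blast
  have z: "Vector_Spaces.linear sT ((*) :: 'a \<Rightarrow> 'a \<Rightarrow> 'a) (\<lambda>x. 0)"
    by (rule TK.linear_zero)
  have f0: "f x = 0" if "x \<in> B" for x
    using f' that tB T.span_base by force
  have "f x = 0" if "x \<in> T.span B" for x
    by (rule TK.linear_eq_on[OF f z that]) (rule f0)
  then have "f (tens v w) = 0" for v w using B(3) by blast
  then have "f = (\<lambda>x. 0)"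
    using ex1[OF bilinear_map_compose[OF bt z]] f z by blast
  then show False using f' by auto
qed

lemma tensor_product_universal:
  assumes T: "is_tensor_product sV sW sT tens" and b: "bilinear_map sV sW sX b"
  shows "\<exists>!f. Vector_Spaces.linear sT sX f \<and> (\<forall>v w. f (tens v w) = b v w)"
proof -
  have sT: "vector_space sT" and bt: "bilinear_map sV sW sT tens"
    and ex1: "\<And>b. bilinear_map sV sW (*) b \<Longrightarrow>
        \<exists>!f. Vector_Spaces.linear sT (*) f \<and> (\<forall>v w. f (tens v w) = b v w)"
    using T by (auto simp: is_tensor_product_def)
  interpret T: vector_space sT by (rule sT)
  interpret V: vector_space sV using b by (simp add: bilinear_map_def Vector_Spaces.linear_iff)
  interpret W: vector_space sW using b by (simp add: bilinear_map_def Vector_Spaces.linear_iff)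
  interpret X: vector_space sX using b by (simp add: bilinear_map_def Vector_Spaces.linear_iff)
  interpret TX: vector_space_pair sT sX ..
  interpret K: vector_space "(*) :: 'a \<Rightarrow> 'a \<Rightarrow> 'a" by (rule vector_space_times)
  obtain BV where BV: "V.independent BV" "V.span BV = UNIV"
    using V.maximal_independent_subset[of UNIV] by (metis top.extremum_uniqueI)
  obtain BW where BW: "W.independent BW" "W.span BW = UNIV"
    using W.maximal_independent_subset[of UNIV] by (metis top.extremum_uniqueI)
  have dual: "\<exists>f. Vector_Spaces.linear sT (*) f \<and>
      (\<forall>v\<in>BV. \<forall>w\<in>BW. f (tens v w) = (if v = v0 \<and> w = w0 then 1 else 0))" for v0 w0
  proof -
    obtain c :: "'b \<Rightarrow> 'c \<Rightarrow> 'a" where c: "bilinear_map sV sW (*) c"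
        "\<forall>v\<in>BV. \<forall>w\<in>BW. c v w = (if v = v0 \<and> w = w0 then 1 else 0)"
      using bilinear_map_exists[OF V.vector_space_axioms W.vector_space_axioms
          K.vector_space_axioms BV(1) BW(1),
          of "\<lambda>v w. if v = v0 \<and> w = w0 then 1 else 0"] by blast
    then show ?thesis using ex1[OF c(1)] by auto
  qed
  let ?h = "\<lambda>(v, w). tens v w"
  have inj: "inj_on ?h (BV \<times> BW)"
  proof (rule inj_onI, clarify)
    fix v w v' w'
    assume *: "v \<in> BV" "w \<in> BW" "v' \<in> BV" "w' \<in> BW" "tens v w = tens v' w'"
    obtain f where "\<forall>x\<in>BV. \<forall>y\<in>BW. f (tens x y) = (if x = v \<and> y = w then 1 else (0::'a))"
      using dual by blast
    then show "v = v' \<and> w = w'" using * by (metis zero_neq_one)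
  qed
  have ind: "T.independent (?h ` (BV \<times> BW))"
  proof
    assume "T.dependent (?h ` (BV \<times> BW))"
    then obtain v w where vw: "v \<in> BV" "w \<in> BW"
        and sp: "tens v w \<in> T.span (?h ` (BV \<times> BW) - {tens v w})"
      unfolding T.dependent_def by auto
    obtain f where f: "Vector_Spaces.linear sT (*) f"
      "\<forall>x\<in>BV. \<forall>y\<in>BW. f (tens x y) = (if x = v \<and> y = w then 1 else (0::'a))"
      using dual by blast
    interpret TK: vector_space_pair sT "(*) :: 'a \<Rightarrow> 'a \<Rightarrow> 'a" ..
    have "f (tens v w) = 0"
      by (rule TK.linear_eq_on[OF f(1) TK.linear_zero sp]) (use f(2) in auto)
    then show False using f(2) vw by simp
  qed
  obtain f where f: "Vector_Spaces.linear sT sX f"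
      and f': "\<forall>x\<in>?h ` (BV \<times> BW). f x = (case the_inv_into (BV \<times> BW) ?h x of (v, w) \<Rightarrow> b v w)"
    using TX.linear_independent_extend[OF ind,
        of "\<lambda>x. case the_inv_into (BV \<times> BW) ?h x of (v, w) \<Rightarrow> b v w"] by blast
  have fb: "f (tens v w) = b v w" if "v \<in> BV" "w \<in> BW" for v w
  proof -
    have "the_inv_into (BV \<times> BW) ?h (?h (v, w)) = (v, w)"
      by (rule the_inv_into_f_f[OF inj]) (use that in auto)
    then show ?thesis using f' that by force
  qed
  have ff: "f (tens v w) = b v w" for v w
    by (rule bilinear_map_eq_on_bases[OF bilinear_map_compose[OF bt f] b BV(2) BW(2) fb])
  show ?thesis
  proof (rule ex1I[of _ f])
    fix f2 assume f2: "Vector_Spaces.linear sT sX f2 \<and> (\<forall>v w. f2 (tens v w) = b v w)"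
    show "f2 = f"
    proof
      fix t
      have "t \<in> T.span {tens v w | v w. True}" using is_tensor_product_span[OF T] by simp
      then show "f2 t = f t"
        by (rule TX.linear_eq_on[of f2 f, rotated 2]) (use f f2 ff in auto)
    qed
  qed (use f ff in auto)
qed

text \<open>The linear map \<open>g \<otimes> h\<close> of \<open>V \<otimes> W\<close>, for linear \<open>g\<close> and \<open>h\<close>.\<close>

definition tensor_map ::
    "('k::field \<Rightarrow> 't::ab_group_add \<Rightarrow> 't) \<Rightarrow> ('v \<Rightarrow> 'w \<Rightarrow> 't) \<Rightarrow> ('v \<Rightarrow> 'v) \<Rightarrow> ('w \<Rightarrow> 'w) \<Rightarrow> 't \<Rightarrow> 't"
  where
  "tensor_map sT tens g h =
     (THE A. Vector_Spaces.linear sT sT A \<and> (\<forall>v w. A (tens v w) = tens (g v) (h w)))"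

lemma tensor_map_welldefined:
  assumes T: "is_tensor_product sV sW sT tens"
    and g: "Vector_Spaces.linear sV sV g" and h: "Vector_Spaces.linear sW sW h"
  shows "Vector_Spaces.linear sT sT (tensor_map sT tens g h)"
    and "tensor_map sT tens g h (tens v w) = tens (g v) (h w)"
proof -
  have bt: "bilinear_map sV sW sT tens" using T by (simp add: is_tensor_product_def)
  have "bilinear_map sV sW sT (\<lambda>v w. tens (g v) (h w))"
    using bt Vector_Spaces.linear_compose[OF h, of sT "tens _"]
      Vector_Spaces.linear_compose[OF g, of sT "\<lambda>v. tens v _"]
    by (auto simp: bilinear_map_def o_def)
  from theI'[OF tensor_product_universal[OF T this]]
  show "Vector_Spaces.linear sT sT (tensor_map sT tens g h)"
    and "tensor_map sT tens g h (tens v w) = tens (g v) (h w)"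
    by (auto simp: tensor_map_def)
qed


section \<open>Polynomial functions and invariants\<close>

text \<open>
  Here \<open>U\<close> is a subspace of a vector space with scaling \<open>s\<close>.  Functions on \<open>U\<close> are represented by
  functions on the whole type that vanish outside \<open>U\<close>, so that equality is equality on \<open>U\<close>.
\<close>

definition dual_space :: "('k::field \<Rightarrow> 'u::ab_group_add \<Rightarrow> 'u) \<Rightarrow> 'u set \<Rightarrow> ('u \<Rightarrow> 'k) set" where
  "dual_space s U = {f. linear_on s (*) U f \<and> (\<forall>x. x \<notin> U \<longrightarrow> f x = 0)}"

inductive_set poly_funs :: "('k::field \<Rightarrow> 'u::ab_group_add \<Rightarrow> 'u) \<Rightarrow> 'u set \<Rightarrow> ('u \<Rightarrow> 'k) set"
  for s :: "'k \<Rightarrow> 'u \<Rightarrow> 'u" and U :: "'u set" where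
  const: "(\<lambda>x. if x \<in> U then c else 0) \<in> poly_funs s U"
| linear: "f \<in> dual_space s U \<Longrightarrow> f \<in> poly_funs s U"
| add: "f \<in> poly_funs s U \<Longrightarrow> g \<in> poly_funs s U \<Longrightarrow> (\<lambda>x. f x + g x) \<in> poly_funs s U"
| mult: "f \<in> poly_funs s U \<Longrightarrow> g \<in> poly_funs s U \<Longrightarrow> (\<lambda>x. f x * g x) \<in> poly_funs s U"

text \<open>The homogeneous polynomial functions of degree \<open>n\<close>: the span of \<open>n\<close>-fold products of linear forms.\<close>

definition homogeneous_funs ::
    "('k::field \<Rightarrow> 'u::ab_group_add \<Rightarrow> 'u) \<Rightarrow> 'u set \<Rightarrow> nat \<Rightarrow> ('u \<Rightarrow> 'k) set" where
  "homogeneous_funs s U n =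
     module.span (pscale (*))
       {(\<lambda>x. if x \<in> U then \<Prod>i<n. l i x else 0) | l. \<forall>i<n. l i \<in> dual_space s U}"

definition invariant_ring ::
    "('k::field \<Rightarrow> 'v::ab_group_add \<Rightarrow> 'v) \<Rightarrow> ('k \<Rightarrow> 'w::ab_group_add \<Rightarrow> 'w) \<Rightarrow>
     ('k \<Rightarrow> 't::ab_group_add \<Rightarrow> 't) \<Rightarrow> ('v \<Rightarrow> 'w \<Rightarrow> 't) \<Rightarrow> (('t \<Rightarrow> 't) \<Rightarrow> 'k) set" where
  "invariant_ring sV sW sT tens =
     {f \<in> poly_funs (pscale sT) (End sT).
        \<forall>g\<in>GL sV. \<forall>h\<in>GL sW. \<forall>X\<in>End sT.
          f (tensor_map sT tens g h \<circ> X \<circ> inv (tensor_map sT tens g h)) = f X}"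

definition invariant_component ::
    "('k::field \<Rightarrow> 'v::ab_group_add \<Rightarrow> 'v) \<Rightarrow> ('k \<Rightarrow> 'w::ab_group_add \<Rightarrow> 'w) \<Rightarrow>
     ('k \<Rightarrow> 't::ab_group_add \<Rightarrow> 't) \<Rightarrow> ('v \<Rightarrow> 'w \<Rightarrow> 't) \<Rightarrow> nat \<Rightarrow> (('t \<Rightarrow> 't) \<Rightarrow> 'k) set" where
  "invariant_component sV sW sT tens n =
     invariant_ring sV sW sT tens \<inter> homogeneous_funs (pscale sT) (End sT) n"


section \<open>Specht modules and Kronecker coefficients\<close>

definition partitions :: "nat \<Rightarrow> nat list set" where
  "partitions n = {la. sorted_wrt (\<ge>) la \<and> (\<forall>l\<in>set la. l > 0) \<and> sum_list la = n}"

lemma finite_partitions: "finite (partitions n)"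
proof (rule finite_subset)
  have "length la \<le> sum_list la" if "\<forall>l\<in>set la. l > 0" for la :: "nat list"
    using that by (induction la) auto
  then show "partitions n \<subseteq> {la. set la \<subseteq> {..n} \<and> length la \<le> n}"
    using member_le_sum_list by (fastforce simp: partitions_def)
  show "finite {la. set la \<subseteq> {..n} \<and> length la \<le> n}"
    by (rule finite_lists_length_le) simp
qed

definition diagram :: "nat list \<Rightarrow> (nat \<times> nat) set" where
  "diagram la = {(i, j). i < length la \<and> j < la ! i}"

text \<open>The symmetric group \<open>S\<^sub>n\<close> is the group of permutations of \<open>{..<n}\<close>.\<close>

definition tableaux :: "nat list \<Rightarrow> (nat \<times> nat \<Rightarrow> nat) set" where
  "tableaux la = {t. bij_betw t (diagram la) {..<sum_list la}}"

text \<open>The tabloid of a tableau is the list of the sets of entries of its rows.\<close>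

type_synonym tabloid = "nat set list"

definition tabloid_of :: "nat list \<Rightarrow> (nat \<times> nat \<Rightarrow> nat) \<Rightarrow> tabloid" where
  "tabloid_of la t = map (\<lambda>i. {t (i, j) | j. j < la ! i}) [0..<length la]"

definition permute_tabloid :: "(nat \<Rightarrow> nat) \<Rightarrow> tabloid \<Rightarrow> tabloid" where
  "permute_tabloid p = map ((`) p)"

definition column_stabilizer :: "nat list \<Rightarrow> (nat \<times> nat \<Rightarrow> nat) \<Rightarrow> (nat \<Rightarrow> nat) set" where
  "column_stabilizer la t =
     {p. p permutes {..<sum_list la} \<and>
         (\<forall>(i, j)\<in>diagram la. \<exists>i'. (i', j) \<in> diagram la \<and> p (t (i, j)) = t (i', j))}"

text \<open>
  Elements of the permutation module on tabloids are written as functions from tabloids to \<open>K\<close>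
  (coefficient families).
\<close>

definition polytabloid :: "nat list \<Rightarrow> (nat \<times> nat \<Rightarrow> nat) \<Rightarrow> tabloid \<Rightarrow> 'k::field" where
  "polytabloid la t =
     (\<lambda>x. \<Sum>p\<in>column_stabilizer la t.
        of_int (sign p) * (if x = permute_tabloid p (tabloid_of la t) then 1 else 0))"

definition specht :: "nat list \<Rightarrow> (tabloid \<Rightarrow> 'k::field) set" where
  "specht la = module.span (pscale (*)) (polytabloid la ` tableaux la)"

text \<open>
  The left action on coefficient families: the basis element \<open>x\<close> is sent to the basis element
  \<open>permute_tabloid p x\<close>.
\<close>

definition specht_act :: "(nat \<Rightarrow> nat) \<Rightarrow> (tabloid \<Rightarrow> 'k) \<Rightarrow> tabloid \<Rightarrow> 'k" where
  "specht_act p f = (\<lambda>x. f (permute_tabloid (inv p) x))"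

text \<open>
  The tensor product of two spaces of coefficient families, inside the families indexed by pairs,
  with the diagonal action.
\<close>

definition specht_tensor :: "nat list \<Rightarrow> nat list \<Rightarrow> (tabloid \<times> tabloid \<Rightarrow> 'k::field) set" where
  "specht_tensor la mu =
     module.span (pscale (*)) {(\<lambda>(x, y). f x * g y) | f g. f \<in> specht la \<and> g \<in> specht mu}"

definition specht_tensor_act ::
    "(nat \<Rightarrow> nat) \<Rightarrow> (tabloid \<times> tabloid \<Rightarrow> 'k) \<Rightarrow> tabloid \<times> tabloid \<Rightarrow> 'k" where
  "specht_tensor_act p F =
     (\<lambda>(x, y). F (permute_tabloid (inv p) x, permute_tabloid (inv p) y))"

text \<open>
  The direct sum over \<open>\<nu> \<turnstile> n\<close> of \<open>m \<nu>\<close> copies of the Specht module of \<open>\<nu>\<close>; the copies are indexed by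
  the pairs \<open>(\<nu>, i)\<close> with \<open>i < m \<nu>\<close>.
\<close>

definition specht_sum ::
    "nat \<Rightarrow> (nat list \<Rightarrow> nat) \<Rightarrow> (nat list \<times> nat \<Rightarrow> tabloid \<Rightarrow> 'k::field) set" where
  "specht_sum n m =
     {F. \<forall>nu i. if nu \<in> partitions n \<and> i < m nu then F (nu, i) \<in> specht nu else F (nu, i) = 0}"

definition specht_sum_act ::
    "(nat \<Rightarrow> nat) \<Rightarrow> (nat list \<times> nat \<Rightarrow> tabloid \<Rightarrow> 'k) \<Rightarrow> nat list \<times> nat \<Rightarrow> tabloid \<Rightarrow> 'k" where
  "specht_sum_act p F = (\<lambda>c. specht_act p (F c))"

definition rep_isomorphic ::
    "nat \<Rightarrow> ('k \<Rightarrow> 'a::plus \<Rightarrow> 'a) \<Rightarrow> ((nat \<Rightarrow> nat) \<Rightarrow> 'a \<Rightarrow> 'a) \<Rightarrow> 'a set \<Rightarrow>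
     ('k \<Rightarrow> 'b::plus \<Rightarrow> 'b) \<Rightarrow> ((nat \<Rightarrow> nat) \<Rightarrow> 'b \<Rightarrow> 'b) \<Rightarrow> 'b set \<Rightarrow> bool" where
  "rep_isomorphic n s1 act1 M s2 act2 N \<longleftrightarrow>
     (\<exists>\<phi>. linear_on s1 s2 M \<phi> \<and> bij_betw \<phi> M N \<and>
       (\<forall>p. p permutes {..<n} \<longrightarrow> (\<forall>x\<in>M. \<phi> (act1 p x) = act2 p (\<phi> x))))"

text \<open>
  The family of Kronecker coefficients for fixed \<open>\<lambda>, \<mu> \<turnstile> n\<close> is the unique family of multiplicities in the
  decomposition of the tensor product into Specht modules; the values at arguments that are not
  partitions of \<open>n\<close> are fixed to be \<open>0\<close> to make it unique.  The first argument is the ground field of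
  the Specht modules.
\<close>

definition kronecker ::
    "'k::field_char_0 itself \<Rightarrow> nat \<Rightarrow> nat list \<Rightarrow> nat list \<Rightarrow> nat list \<Rightarrow> nat" where
  "kronecker K n la mu =
     (THE m. (\<forall>nu. nu \<notin> partitions n \<longrightarrow> m nu = 0) \<and>
        rep_isomorphic n
          (pscale (*)) specht_tensor_act (specht_tensor la mu :: (tabloid \<times> tabloid \<Rightarrow> 'k) set)
          (pscale (pscale (*))) specht_sum_act (specht_sum n m))"

end

theory Submission
  imports Defs "HOL-Library.FuncSet" "HOL-Computational_Algebra.Polynomial" "HOL-Combinatorics.Cycles"
begin

text \<open>
The theorem follows from a double centralizer argument and from counting the matrices that commute
with a representation of the symmetric group.

\<^bold>\<open>Invariant forms are matrices.\<close>  Choose bases of \<open>V\<close> and \<open>W\<close>.  A form of degree \<open>n\<close> on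
\<open>End (V \<otimes> W)\<close> is \<open>X \<mapsto> tr (A\<^sup>T X\<^bsup>\<otimes>n\<^esup>)\<close> for a matrix \<open>A\<close> whose rows and columns are pairs of words
of length \<open>n\<close>, in \<open>d\<^sub>1\<close> and in \<open>d\<^sub>2\<close> letters.  In characteristic zero, \<open>A\<close> is unique once it is invariant
under the simultaneous permutations of all places (\<open>form_symmetrize\<close>, \<open>form_eq_0\<close>).  The form is
invariant under \<open>GL(V) \<times> GL(W)\<close> if and only if \<open>A\<^sup>T\<close> commutes with all \<open>(g \<otimes> h)\<^bsup>\<otimes>n\<^esup>\<close>.  Polarizing this
identity in \<open>g\<close> and in \<open>h\<close>, where the invertible matrices are dense enough, shows that \<open>A\<^sup>T\<close> commutes
with every matrix \<open>\<theta>\<close> that commutes with \<open>S\<^sub>n \<times> S\<^sub>n\<close>, which permutes the places of both words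
independently (\<open>GL_commuting_iff\<close>, \<open>invariant_component_iff\<close>).

\<^bold>\<open>The double commutant.\<close>  The group algebra of \<open>S\<^sub>n\<close> has a basis of matrix units, one square block for
every Specht module (\<open>matrix_units_exist\<close>).  This contains the classification of the irreducible
representations.  The matrix coefficients of all Specht modules are independent functions because the
column alternators act on the Specht modules in a triangular way
(\<open>matrix_coefficients_independent\<close>).  They span all functions on the group because there are no more
conjugacy classes than partitions (\<open>delta_function_from_traces\<close>).  Products of matrix units are
matrix units for \<open>S\<^sub>n \<times> S\<^sub>n\<close>, and the matrices \<open>A\<close> above are exactly their combinations
(\<open>double_commutant\<close>).  On words in \<open>d\<^sub>1\<close> and \<open>d\<^sub>2\<close> letters, the block \<open>(\<lambda>, \<mu>)\<close> acts as zero if \<open>\<lambda>\<close> has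
more than \<open>d\<^sub>1\<close> rows or \<open>\<mu>\<close> has more than \<open>d\<^sub>2\<close> rows (\<open>E_eq_0\<close>), and the remaining matrix units are
independent (\<open>unit_coeffs_independent\<close>).

\<^bold>\<open>Counting.\<close>  So \<open>A\<close> is a family of square matrices, one for each remaining block \<open>(\<lambda>, \<mu>)\<close>, indexed by a
basis of \<open>S\<^sub>\<lambda> \<otimes> S\<^sub>\<mu>\<close>.  The invariance of \<open>A\<close> under simultaneous permutations says that each of them
commutes with the diagonal action of \<open>S\<^sub>n\<close> on this tensor product (\<open>sym_coeffs_iff\<close>).  In this
representation \<open>S\<^sub>\<nu>\<close> has multiplicity \<open>g(\<lambda>, \<mu>, \<nu>)\<close>, so that its commutant has the dimension
\<open>\<Sum>\<^sub>\<nu> g(\<lambda>, \<mu>, \<nu>)\<^sup>2\<close> by Schur's lemma (\<open>kronecker_adapted_basis\<close>, \<open>commutant_basis\<close>).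
\<close>

section \<open>Finite bases as indexed families\<close>

lemma sum_fun_apply: "(\<Sum>j\<in>J. f j) x = (\<Sum>j\<in>J. f j x)"
  by (induction J rule: infinite_finite_induct) auto

text \<open>Bases are families and not sets, so that vectors and linear maps have coordinates over the index set.\<close>

definition family_basis ::
    "('k::field \<Rightarrow> 'a::ab_group_add \<Rightarrow> 'a) \<Rightarrow> 'a set \<Rightarrow> 'j set \<Rightarrow> ('j \<Rightarrow> 'a) \<Rightarrow> bool" where
  "family_basis s X J b \<longleftrightarrow> finite J \<and> b ` J \<subseteq> X \<and>
     (\<forall>c. (\<Sum>j\<in>J. s (c j) (b j)) = 0 \<longrightarrow> (\<forall>j\<in>J. c j = 0)) \<and>
     (\<forall>x\<in>X. \<exists>c. x = (\<Sum>j\<in>J. s (c j) (b j)))"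

text \<open>Only the values on \<open>J\<close> are determined.\<close>

definition coords ::
    "('k::field \<Rightarrow> 'a::ab_group_add \<Rightarrow> 'a) \<Rightarrow> 'j set \<Rightarrow> ('j \<Rightarrow> 'a) \<Rightarrow> 'a \<Rightarrow> 'j \<Rightarrow> 'k" where
  "coords s J b x = (SOME c. x = (\<Sum>j\<in>J. s (c j) (b j)))"

lemma family_basisD:
  assumes "family_basis s X J b"
  shows "finite J" "j \<in> J \<Longrightarrow> b j \<in> X" "(\<Sum>j\<in>J. s (c j) (b j)) = 0 \<Longrightarrow> j \<in> J \<Longrightarrow> c j = 0"
  using assms unfolding family_basis_def by (blast, blast, blast)

lemma coords_expand:
  assumes "family_basis s X J b" "x \<in> X"
  shows "(\<Sum>j\<in>J. s (coords s J b x j) (b j)) = x"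
proof -
  have "\<exists>c. x = (\<Sum>j\<in>J. s (c j) (b j))" using assms unfolding family_basis_def by blast
  from someI_ex[OF this] show ?thesis unfolding coords_def by simp
qed

context vector_space
begin

lemma sum_scale_eq_iff:
  assumes "family_basis scale X J b"
  shows "(\<Sum>j\<in>J. scale (c j) (b j)) = (\<Sum>j\<in>J. scale (d j) (b j)) \<longleftrightarrow> (\<forall>j\<in>J. c j = d j)"
proof
  assume "(\<Sum>j\<in>J. scale (c j) (b j)) = (\<Sum>j\<in>J. scale (d j) (b j))"
  then have "(\<Sum>j\<in>J. scale (c j - d j) (b j)) = 0"
    by (simp add: scale_left_diff_distrib sum_subtractf)
  from family_basisD(3)[OF assms this] show "\<forall>j\<in>J. c j = d j" by auto
qed auto

lemma coords_eqI:
  assumes "family_basis scale X J b" "x = (\<Sum>j\<in>J. scale (c j) (b j))" "j \<in> J"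
  shows "coords scale J b x j = c j"
proof -
  have "x = (\<Sum>j\<in>J. scale (coords scale J b x j) (b j))"
    unfolding coords_def by (rule someI[of "\<lambda>c. x = (\<Sum>j\<in>J. scale (c j) (b j))"], rule assms(2))
  then show ?thesis using assms sum_scale_eq_iff[OF assms(1)] by metis
qed

lemma coords_sum:
  assumes fb: "family_basis scale X J b" and y: "\<And>k. k \<in> K \<Longrightarrow> y k \<in> X" and j: "j \<in> J"
  shows "coords scale J b (\<Sum>k\<in>K. scale (a k) (y k)) j = (\<Sum>k\<in>K. a k * coords scale J b (y k) j)"
proof (rule coords_eqI[OF fb _ j])
  have "(\<Sum>k\<in>K. scale (a k) (y k)) = (\<Sum>k\<in>K. scale (a k) (\<Sum>j\<in>J. scale (coords scale J b (y k) j) (b j)))"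
    using coords_expand[OF fb y] by simp
  also have "\<dots> = (\<Sum>k\<in>K. \<Sum>j\<in>J. scale (a k * coords scale J b (y k) j) (b j))"
    by (simp add: scale_sum_right)
  also have "\<dots> = (\<Sum>j\<in>J. scale (\<Sum>k\<in>K. a k * coords scale J b (y k) j) (b j))"
    by (subst sum.swap) (simp add: scale_sum_left)
  finally show "(\<Sum>k\<in>K. scale (a k) (y k)) =
    (\<Sum>j\<in>J. scale (\<Sum>k\<in>K. a k * coords scale J b (y k) j) (b j))" .
qed

lemma coords_basis:
  assumes fb: "family_basis scale X J b" and "i \<in> J" "j \<in> J"
  shows "coords scale J b (b i) j = (if j = i then 1 else 0)"
proof (rule coords_eqI[OF fb _ assms(3)])
  have "(\<Sum>j\<in>J. scale (if j = i then 1 else 0) (b j)) = (\<Sum>j\<in>J. if j = i then b j else 0)"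
    by (rule sum.cong) auto
  then show "b i = (\<Sum>j\<in>J. scale (if j = i then 1 else 0) (b j))"
    using assms family_basisD(1)[OF fb] by simp
qed

lemma coords_add_scale:
  assumes fb: "family_basis scale X J b" and X: "subspace X" and x: "x \<in> X" "y \<in> X" and j: "j \<in> J"
  shows "coords scale J b (x + y) j = coords scale J b x j + coords scale J b y j"
    and "coords scale J b (scale c x) j = c * coords scale J b x j"
proof -
  have ex: "(\<Sum>j\<in>J. scale (coords scale J b x j) (b j)) = x" and ey: "(\<Sum>j\<in>J. scale (coords scale J b y j) (b j)) = y"
    by (rule coords_expand[OF fb x(1)], rule coords_expand[OF fb x(2)])
  show "coords scale J b (x + y) j = coords scale J b x j + coords scale J b y j"
    by (rule coords_eqI[OF fb _ j]) (simp add: scale_left_distrib sum.distrib ex ey)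
  show "coords scale J b (scale c x) j = c * coords scale J b x j"
    by (rule coords_eqI[OF fb _ j]) (simp add: scale_scale[symmetric] scale_sum_right[symmetric] ex del: scale_scale)
qed

lemma span_family:
  assumes J: "finite J" and x: "x \<in> span (y ` J)"
  shows "\<exists>c. x = (\<Sum>j\<in>J. scale (c j) (y j))"
proof -
  let ?S = "{x. \<exists>c. x = (\<Sum>j\<in>J. scale (c j) (y j))}"
  have "span (y ` J) \<subseteq> ?S"
  proof (rule span_minimal)
    show "y ` J \<subseteq> ?S"
    proof clarify
      fix i assume i: "i \<in> J"
      have "(\<Sum>j\<in>J. scale (if j = i then 1 else 0) (y j)) = (\<Sum>j\<in>J. if j = i then y j else 0)"
        by (rule sum.cong) auto
      then show "\<exists>c. y i = (\<Sum>j\<in>J. scale (c j) (y j))" using i J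
        by (intro exI[of _ "\<lambda>j. if j = i then 1 else 0"]) simp
    qed
    show "subspace ?S"
      unfolding subspace_def
    proof (intro conjI ballI allI; clarify)
      show "\<exists>c. 0 = (\<Sum>j\<in>J. scale (c j) (y j))" by (rule exI[of _ "\<lambda>_. 0"]) simp
      fix c d
      show "\<exists>e. (\<Sum>j\<in>J. scale (c j) (y j)) + (\<Sum>j\<in>J. scale (d j) (y j)) = (\<Sum>j\<in>J. scale (e j) (y j))"
        by (rule exI[of _ "\<lambda>j. c j + d j"]) (simp only: scale_left_distrib sum.distrib)
      fix a
      show "\<exists>e. scale a (\<Sum>j\<in>J. scale (c j) (y j)) = (\<Sum>j\<in>J. scale (e j) (y j))"
        by (rule exI[of _ "\<lambda>j. a * c j"]) (simp only: scale_sum_right scale_scale)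
    qed
  qed
  then show ?thesis using x by blast
qed

lemma family_basis_independent:
  assumes "family_basis scale X J b"
  shows "inj_on b J" "independent (b ` J)" "X \<subseteq> span (b ` J)"
proof -
  have J: "finite J" using assms by (rule family_basisD)
  show inj: "inj_on b J"
  proof (rule inj_onI)
    fix i j assume ij: "i \<in> J" "j \<in> J" "b i = b j"
    have "(\<Sum>k\<in>J. scale (if k = i then 1 else 0) (b k)) = (\<Sum>k\<in>J. scale (if k = j then 1 else 0) (b k))"
      using ij J by (simp add: if_distrib[of "\<lambda>c. scale c _"] sum.delta cong: if_cong)
    then have "\<forall>k\<in>J. (if k = i then 1 else 0::'a) = (if k = j then 1 else 0)"
      by (subst (asm) sum_scale_eq_iff[OF assms])
    then show "i = j" using ij by (metis zero_neq_one)
  qed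
  show "independent (b ` J)"
  proof (rule independent_if_scalars_zero)
    fix f x assume "(\<Sum>x\<in>b ` J. scale (f x) x) = 0" and x: "x \<in> b ` J"
    then have "(\<Sum>j\<in>J. scale (f (b j)) (b j)) = 0" by (simp add: sum.reindex[OF inj])
    from family_basisD(3)[OF assms this] x show "f x = 0" by auto
  qed (use J in simp)
  show "X \<subseteq> span (b ` J)"
  proof
    fix x assume "x \<in> X"
    then obtain c where "x = (\<Sum>j\<in>J. scale (c j) (b j))" using assms unfolding family_basis_def by blast
    then show "x \<in> span (b ` J)" by (simp only:) (intro span_sum span_scale span_base, auto)
  qed
qed

lemma family_basis_dim:
  assumes "family_basis scale X J b"
  shows "dim X = card J"
  using family_basis_independent[OF assms] assms
  by (intro dim_unique[of "b ` J"]) (auto simp: family_basis_def card_image)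

lemma family_basis_exists:
  assumes "X \<subseteq> span B" "finite B"
  shows "\<exists>b. family_basis scale X {..<dim X} b"
proof -
  obtain A where A: "A \<subseteq> X" "independent A" "X \<subseteq> span A" "card A = dim X"
    using basis_exists by blast
  have fA: "finite A" using independent_span_bound[OF assms(2) A(2)] A(1) assms(1) by blast
  obtain b where b: "bij_betw b {..<dim X} A"
    using ex_bij_betw_nat_finite[OF fA] A(4) by (auto simp: atLeast0LessThan)
  have img: "b ` {..<dim X} = A" and inj: "inj_on b {..<dim X}" using b by (auto simp: bij_betw_def)
  have conv: "(\<Sum>v\<in>A. scale (u v) v) = (\<Sum>j<dim X. scale (u (b j)) (b j))" for u
    unfolding img[symmetric] by (subst sum.reindex[OF inj]) simp
  show ?thesis
  proof (intro exI[of _ b], unfold family_basis_def, intro conjI allI ballI impI)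
    fix c j assume 0: "(\<Sum>j<dim X. scale (c j) (b j)) = 0" and j: "j \<in> {..<dim X}"
    have "(\<Sum>v\<in>A. scale (c (the_inv_into {..<dim X} b v)) v) = 0"
      unfolding conv using 0 by (simp add: the_inv_into_f_f[OF inj])
    moreover have "b j \<in> A" using j img by auto
    ultimately show "c j = 0" using independentD[OF A(2) fA subset_refl, of _ "b j"] j
      by (fastforce simp: the_inv_into_f_f[OF inj])
  next
    fix x assume "x \<in> X"
    then have "x \<in> span A" using A(3) by auto
    then obtain u where "x = (\<Sum>v\<in>A. scale (u v) v)" unfolding span_finite[OF fA] by auto
    then show "\<exists>c. x = (\<Sum>j<dim X. scale (c j) (b j))" unfolding conv
      by (auto intro!: exI[of _ "\<lambda>j. u (b j)"])
  qed (use img A(1) in auto)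
qed

end

interpretation funs: vector_space "pscale ((*) :: 'k::field \<Rightarrow> 'k \<Rightarrow> 'k)"
  by (rule vector_space_pscale[OF vector_space_times])

lemma pscale_apply [simp]: "pscale s c f x = s c (f x)"
  by (simp add: pscale_def)

text \<open>As many independent functions on a finite set as it has points span all functions on it.\<close>

lemma independent_functions_span:
  fixes f :: "'j \<Rightarrow> 'p \<Rightarrow> 'k::field"
  assumes J: "finite J" and P: "finite P" and card: "card P \<le> card J"
    and ind: "\<And>c. (\<And>x. x \<in> P \<Longrightarrow> (\<Sum>j\<in>J. c j * f j x) = 0) \<Longrightarrow> \<forall>j\<in>J. c j = 0"
  shows "\<exists>c. \<forall>x\<in>P. h x = (\<Sum>j\<in>J. c j * f j x)"
proof -
  define r where "r g = (\<lambda>x. if x \<in> P then g x else 0)" for g :: "'p \<Rightarrow> 'k"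
  define D where "D = (\<lambda>p x. if x = p then 1 else (0::'k)) ` P"
  have fD: "finite D" using P by (simp add: D_def)
  have rD: "r g \<in> funs.span D" for g
  proof -
    have "r g = (\<Sum>p\<in>P. pscale (*) (g p) (\<lambda>x. if x = p then 1 else 0))"
      using P by (auto simp: r_def sum_fun_apply fun_eq_iff if_distrib[of "\<lambda>c. _ * c"] cong: if_cong)
    then show ?thesis
      by (simp only:) (intro funs.span_sum funs.span_scale funs.span_base, auto simp: D_def)
  qed
  have fb: "family_basis (pscale (*)) (funs.span ((\<lambda>j. r (f j)) ` J)) J (\<lambda>j. r (f j))"
    unfolding family_basis_def
  proof (intro conjI allI impI ballI)
    fix c j assume 0: "(\<Sum>j\<in>J. pscale (*) (c j) (r (f j))) = 0" and j: "j \<in> J"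
    have "(\<Sum>j\<in>J. c j * f j x) = 0" if "x \<in> P" for x
      using fun_cong[OF 0, of x] that by (simp add: sum_fun_apply r_def)
    then show "c j = 0" using ind[of c] j by blast
  next
    fix x assume "x \<in> funs.span ((\<lambda>j. r (f j)) ` J)"
    then show "\<exists>c. x = (\<Sum>j\<in>J. pscale (*) (c j) (r (f j)))" by (rule funs.span_family[OF J])
  next
    show "(\<lambda>j. r (f j)) ` J \<subseteq> funs.span ((\<lambda>j. r (f j)) ` J)" by (rule funs.span_superset)
  qed (rule J)
  let ?S = "(\<lambda>j. r (f j)) ` J"
  have inj: "inj_on (\<lambda>j. r (f j)) J" and i: "funs.independent ?S"
    using funs.family_basis_independent[OF fb] by auto
  have "r h \<in> funs.span ?S"
  proof (rule ccontr)
    assume n: "r h \<notin> funs.span ?S"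
    then have "funs.independent (insert (r h) ?S)" using i by (rule funs.independent_insertI)
    moreover have "insert (r h) ?S \<subseteq> funs.span D" using rD by auto
    ultimately have "card (insert (r h) ?S) \<le> card D"
      using funs.independent_span_bound[OF fD] by blast
    moreover have "card D \<le> card P" unfolding D_def using P by (rule card_image_le)
    moreover have "card (insert (r h) ?S) = Suc (card J)"
      using n J funs.span_superset[of ?S] by (subst card_insert_disjoint) (auto simp: card_image[OF inj])
    ultimately show False using card by simp
  qed
  then obtain c where c: "r h = (\<Sum>j\<in>J. pscale (*) (c j) (r (f j)))"
    using fb unfolding family_basis_def by blast
  have "h x = (\<Sum>j\<in>J. c j * f j x)" if "x \<in> P" for x
    using that fun_cong[OF c, of x] by (simp add: sum_fun_apply r_def)
  then show ?thesis by blast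
qed

section \<open>Rows and columns of a tableau\<close>

abbreviation Sym :: "nat \<Rightarrow> (nat \<Rightarrow> nat) set" where
  "Sym n \<equiv> {p. p permutes {..<n}}"

lemma finite_Sym [simp]: "finite (Sym n)"
  by (rule finite_permutations) simp

lemma card_Sym: "card (Sym n) = fact n"
  by (rule card_permutations) auto

lemma of_nat_fact_nonzero: "(of_nat (fact n) :: 'k::field_char_0) \<noteq> 0"
  by (metis fact_nonzero of_nat_fact)

lemma sum_Sym_left: "q permutes {..<n} \<Longrightarrow> (\<Sum>p\<in>Sym n. f (q \<circ> p)) = (\<Sum>p\<in>Sym n. f p)"
  by (rule sum.reindex_bij_witness[of _ "\<lambda>p. inv q \<circ> p" "\<lambda>p. q \<circ> p"])
    (auto intro: permutes_compose permutes_inv simp: fun_eq_iff permutes_inverses)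

lemma partitionsD:
  assumes "la \<in> partitions n"
  shows "sorted_wrt (\<ge>) la" "\<And>l. l \<in> set la \<Longrightarrow> l > 0" "sum_list la = n"
  using assms by (auto simp: partitions_def)

lemma diagram_Sigma: "diagram la = (SIGMA i:{..<length la}. {..<la ! i})"
  by (auto simp: diagram_def)

lemma finite_diagram [simp]: "finite (diagram la)"
  unfolding diagram_Sigma by auto

lemma card_diagram: "card (diagram la) = sum_list la"
  unfolding diagram_Sigma by (subst card_SigmaI) (auto simp: sum_list_sum_nth atLeast0LessThan)

lemma diagram_up:
  assumes "la \<in> partitions n" "(i, j) \<in> diagram la" "i' \<le> i"
  shows "(i', j) \<in> diagram la"
proof (cases "i' = i")
  case False
  then have "la ! i' \<ge> la ! i"
    using assms sorted_wrt_nth_less[OF partitionsD(1)[OF assms(1)], of i' i] by (auto simp: diagram_def)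
  then show ?thesis using assms by (auto simp: diagram_def)
qed (use assms in auto)

text \<open>The statistic of a partition by which Specht modules are separated: the sum of the row indices
  of its boxes.\<close>

definition weight :: "nat list \<Rightarrow> nat" where
  "weight la = (\<Sum>(i, j)\<in>diagram la. i)"

definition row :: "nat list \<Rightarrow> (nat \<times> nat \<Rightarrow> nat) \<Rightarrow> nat \<Rightarrow> nat" where
  "row la t e = fst (the_inv_into (diagram la) t e)"

definition col :: "nat list \<Rightarrow> (nat \<times> nat \<Rightarrow> nat) \<Rightarrow> nat \<Rightarrow> nat" where
  "col la t e = snd (the_inv_into (diagram la) t e)"

locale tableau =
  fixes n :: nat and la :: "nat list" and t :: "nat \<times> nat \<Rightarrow> nat"
  assumes la: "la \<in> partitions n" and t: "t \<in> tableaux la"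
begin

lemma bij_t: "bij_betw t (diagram la) {..<n}"
  using t la by (simp add: tableaux_def partitions_def)

lemma row_t [simp]: "(i, j) \<in> diagram la \<Longrightarrow> row la t (t (i, j)) = i"
  and col_t [simp]: "(i, j) \<in> diagram la \<Longrightarrow> col la t (t (i, j)) = j"
  using bij_t by (simp_all add: row_def col_def the_inv_into_f_f bij_betw_imp_inj_on)

lemma row_col:
  assumes "e < n"
  shows "(row la t e, col la t e) \<in> diagram la" "t (row la t e, col la t e) = e"
  using assms bij_t f_the_inv_into_f_bij_betw[OF bij_t] the_inv_into_into[of t "diagram la" e "diagram la"]
  by (auto simp: row_def col_def bij_betw_def)

lemma row_less: "e < n \<Longrightarrow> row la t e < length la"
  using row_col(1)[of e] by (auto simp: diagram_def)

lemma t_less: "(i, j) \<in> diagram la \<Longrightarrow> t (i, j) < n"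
  using bij_t by (auto simp: bij_betw_def)

lemma column_stabilizer_iff:
  "p \<in> column_stabilizer la t \<longleftrightarrow> p permutes {..<n} \<and> (\<forall>e<n. col la t (p e) = col la t e)"
  (is "?L \<longleftrightarrow> ?R")
proof
  assume L: ?L
  have p: "p permutes {..<n}" using L la by (simp add: column_stabilizer_def partitions_def)
  have "col la t (p e) = col la t e" if "e < n" for e
  proof -
    have "\<forall>(i, j)\<in>diagram la. \<exists>i'. (i', j) \<in> diagram la \<and> p (t (i, j)) = t (i', j)"
      using L by (simp add: column_stabilizer_def)
    from bspec[OF this row_col(1)[OF that]] obtain i' where
      "(i', col la t e) \<in> diagram la" "p (t (row la t e, col la t e)) = t (i', col la t e)" by auto
    then show ?thesis using row_col(2)[OF that] by simp
  qed
  then show ?R using p by blast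
next
  assume R: ?R
  have "\<exists>i'. (i', j) \<in> diagram la \<and> p (t (i, j)) = t (i', j)" if ij: "(i, j) \<in> diagram la" for i j
  proof -
    have "p (t (i, j)) < n" using R t_less[OF ij] permutes_in_image[of p "{..<n}" "t (i, j)"] by auto
    from row_col[OF this] R t_less[OF ij] ij show ?thesis
      by (intro exI[of _ "row la t (p (t (i, j)))"]) auto
  qed
  then show ?L using R la by (auto simp: column_stabilizer_def partitions_def)
qed

lemma finite_column_stabilizer [simp]: "finite (column_stabilizer la t)"
  by (rule finite_subset[of _ "Sym n"]) (auto simp: column_stabilizer_iff)

lemma column_stabilizer_permutes: "p \<in> column_stabilizer la t \<Longrightarrow> p permutes {..<n}"
  by (simp add: column_stabilizer_iff)

lemma column_stabilizer_id: "id \<in> column_stabilizer la t"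
  by (simp add: column_stabilizer_iff permutes_id)

lemma column_stabilizer_comp:
  "p \<in> column_stabilizer la t \<Longrightarrow> q \<in> column_stabilizer la t \<Longrightarrow> p \<circ> q \<in> column_stabilizer la t"
  using permutes_in_image[of q "{..<n}"] by (auto simp: column_stabilizer_iff intro!: permutes_compose)

lemma column_stabilizer_inv:
  assumes "p \<in> column_stabilizer la t" shows "inv p \<in> column_stabilizer la t"
proof -
  have p: "p permutes {..<n}" using assms column_stabilizer_iff by blast
  have "col la t (inv p e) = col la t e" if "e < n" for e
  proof -
    have "inv p e < n" using that p permutes_in_image[OF permutes_inv[OF p], of e] by auto
    then show ?thesis using assms p permutes_inverses(1)[OF p, of e] by (auto simp: column_stabilizer_iff)
  qed
  then show ?thesis using p by (auto simp: column_stabilizer_iff permutes_inv)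
qed

lemma sum_column_stabilizer_left:
  "q \<in> column_stabilizer la t \<Longrightarrow>
    (\<Sum>p\<in>column_stabilizer la t. f (q \<circ> p)) = (\<Sum>p\<in>column_stabilizer la t. f p)"
  by (rule sum.reindex_bij_witness[of _ "\<lambda>p. inv q \<circ> p" "\<lambda>p. q \<circ> p"])
    (auto intro: column_stabilizer_comp column_stabilizer_inv dest: column_stabilizer_permutes
      simp: fun_eq_iff permutes_inverses)

lemma sum_column_stabilizer_right:
  "q \<in> column_stabilizer la t \<Longrightarrow>
    (\<Sum>p\<in>column_stabilizer la t. f (p \<circ> q)) = (\<Sum>p\<in>column_stabilizer la t. f p)"
  by (rule sum.reindex_bij_witness[of _ "\<lambda>p. p \<circ> inv q" "\<lambda>p. p \<circ> q"])
    (auto intro: column_stabilizer_comp column_stabilizer_inv dest: column_stabilizer_permutes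
      simp: fun_eq_iff permutes_inverses)

lemma transpose_in_column_stabilizer:
  assumes "a < n" "b < n" "col la t a = col la t b"
  shows "transpose a b \<in> column_stabilizer la t"
  using assms permutes_swap_id[of a "{..<n}" b] by (simp add: column_stabilizer_iff transpose_def)

end

lemma sum_initial_segment_le:
  fixes S :: "nat set"
  assumes "finite S"
  shows "\<Sum>{..<card S} \<le> \<Sum>S \<and> (\<Sum>{..<card S} = \<Sum>S \<longrightarrow> S = {..<card S})"
  using assms
proof (induction "card S" arbitrary: S)
  case 0
  then show ?case by simp
next
  case (Suc k)
  note f = \<open>finite S\<close>
  define m where "m = Max S"
  have ne: "S \<noteq> {}" using Suc(2) by auto
  have m: "m \<in> S" "\<And>x. x \<in> S \<Longrightarrow> x \<le> m" using ne f by (auto simp: m_def)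
  have c: "card (S - {m}) = k" using Suc(2) m f by simp
  have "S \<subseteq> {..m}" using m by auto
  then have km: "k \<le> m" using card_mono[of "{..m}" S] Suc(2) by simp
  have s: "\<Sum>S = m + \<Sum>(S - {m})" using m f by (simp add: sum.remove)
  have s': "\<Sum>{..<card S} = k + \<Sum>{..<k}" using Suc(2)[symmetric] by simp
  have I: "\<Sum>{..<k} \<le> \<Sum>(S - {m})" "\<Sum>{..<k} = \<Sum>(S - {m}) \<Longrightarrow> S - {m} = {..<k}"
    using Suc(1)[OF c[symmetric]] c f by auto
  have "S = {..<card S}" if "\<Sum>{..<card S} = \<Sum>S"
  proof -
    have mk: "m = k" using that s s' I km by linarith
    then have "S - {m} = {..<k}" using that s s' I by linarith
    then have "S = insert k {..<k}" using m(1) mk by blast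
    then show ?thesis using Suc(2) by (metis lessThan_Suc)
  qed
  then show ?case using s s' I km by linarith
qed

context tableau
begin

definition column :: "nat \<Rightarrow> nat set" where "column j = {e. e < n \<and> col la t e = j}"

lemma inj_row_column: "inj_on (row la t) (column j)"
  by (rule inj_onI) (metis (mono_tags, lifting) column_def mem_Collect_eq row_col(2))

text \<open>The lengths of the rows decrease, so a column meets an initial segment of them.\<close>

lemma row_column: "row la t ` column j = {..<card (column j)}"
proof -
  have f: "finite (column j)" by (simp add: column_def)
  have c: "card (column j) = card (row la t ` column j)" by (simp add: card_image inj_row_column)
  have dc: "x \<in> row la t ` column j" if "y \<in> row la t ` column j" "x \<le> y" for x y
  proof -
    obtain e where e: "e < n" "col la t e = j" "y = row la t e" using \<open>y \<in> _\<close> by (auto simp: column_def)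
    then have "(x, j) \<in> diagram la" using row_col(1)[OF e(1)] diagram_up[OF la _ that(2)] by auto
    then show ?thesis using t_less[of x j] by (force simp: column_def image_iff intro!: exI[of _ "t (x, j)"])
  qed
  have "row la t ` column j = {..<card (row la t ` column j)}"
  proof (cases "row la t ` column j = {}")
    case False
    define m where "m = Max (row la t ` column j)"
    have "row la t ` column j = {..m}"
      using False f dc Max_in[of "row la t ` column j"] Max_ge[of "row la t ` column j"]
      unfolding m_def by (metis (no_types, lifting) atMost_iff finite_imageI set_eqI)
    then show ?thesis by (simp add: lessThan_Suc_atMost)
  qed auto
  then show ?thesis using c by simp
qed

lemma sum_over_columns: "(\<Sum>e<n. f e) = (\<Sum>j\<in>col la t ` {..<n}. \<Sum>e\<in>column j. f e)"
proof -
  have "sum f {..<n} = (\<Sum>j\<in>col la t ` {..<n}. sum f {x \<in> {..<n}. col la t x = j})"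
    by (rule sum.image_gen) simp
  then show ?thesis by (simp add: column_def)
qed

lemma weight_eq_sum_row: "weight la = (\<Sum>e<n. row la t e)"
  unfolding weight_def by (rule sum.reindex_bij_betw[OF bij_t, symmetric, THEN trans, rotated, symmetric])
     (auto intro!: sum.cong)

text \<open>A word without repetition on the columns has letters at least as large as \<open>0, 1, 2, \<dots>\<close> in each
  of them, and the row indices of \<open>t\<close> attain this bound.  Comparing the weights in this way plays the
  part of the dominance order.\<close>

lemma column_injective_word:
  assumes w: "\<And>j. inj_on w (column j)"
  shows "weight la \<le> (\<Sum>e<n. w e)"
    and "weight la = (\<Sum>e<n. w e) \<Longrightarrow> \<exists>q\<in>column_stabilizer la t. \<forall>e<n. w e = row la t (q e)"
proof -
  have fin: "finite (column j)" for j by (simp add: column_def)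
  have sw: "(\<Sum>e\<in>column j. w e) = \<Sum>(w ` column j)" for j
    using sum.reindex[OF w, of id] by simp
  have sr: "(\<Sum>e\<in>column j. row la t e) = \<Sum>{..<card (column j)}" for j
    using sum.reindex[OF inj_row_column, of id j] row_column[of j] by simp
  have cw: "card (w ` column j) = card (column j)" for j by (simp add: card_image w)
  have le: "(\<Sum>e\<in>column j. row la t e) \<le> (\<Sum>e\<in>column j. w e)" for j
    using sum_initial_segment_le[of "w ` column j"] fin[of j] unfolding sw sr cw by simp
  show "weight la \<le> (\<Sum>e<n. w e)"
    unfolding weight_eq_sum_row sum_over_columns[of "row la t"] sum_over_columns[of w] by (rule sum_mono[OF le])
  assume "weight la = (\<Sum>e<n. w e)"
  then have "(\<Sum>e<n. row la t e) = (\<Sum>e<n. w e)" unfolding weight_eq_sum_row .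
  then have cs: "(\<Sum>j\<in>col la t ` {..<n}. \<Sum>e\<in>column j. row la t e) = (\<Sum>j\<in>col la t ` {..<n}. \<Sum>e\<in>column j. w e)"
    unfolding sum_over_columns[of "row la t"] sum_over_columns[of w] .
  have eq: "(\<Sum>e\<in>column j. row la t e) = (\<Sum>e\<in>column j. w e)" if "j \<in> col la t ` {..<n}" for j
    using sum_mono_inv[OF cs le that] by simp
  have im: "w ` column j = row la t ` column j" if "j \<in> col la t ` {..<n}" for j
    using sum_initial_segment_le[of "w ` column j"] fin[of j] eq[OF that] row_column[of j]
    unfolding sw sr cw by simp
  have wd: "(w e, col la t e) \<in> diagram la" if "e < n" for e
  proof -
    have "w e \<in> w ` column (col la t e)" using that by (simp add: column_def)
    then have "w e \<in> row la t ` column (col la t e)" using im[of "col la t e"] that by simp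
    then obtain e' where e': "e' < n" "col la t e' = col la t e" "w e = row la t e'"
      unfolding column_def by blast
    then show ?thesis using row_col(1)[of e'] by simp
  qed
  \<comment> \<open>Each entry is moved inside its column to the row that is named by its letter.\<close>
  define q where "q e = (if e < n then t (w e, col la t e) else e)" for e
  have q: "q e < n" "row la t (q e) = w e" "col la t (q e) = col la t e" if "e < n" for e
    using wd[OF that] t_less that by (auto simp: q_def)
  have "inj_on q {..<n}"
  proof (rule inj_onI)
    fix a b assume ab: "a \<in> {..<n}" "b \<in> {..<n}" "q a = q b"
    then have "w a = w b" "col la t a = col la t b" using q by (metis lessThan_iff)+
    then show "a = b" using w[of "col la t a"] ab by (auto simp: column_def inj_on_def)
  qed
  then have "bij_betw q {..<n} {..<n}"
    using endo_inj_surj[of "{..<n}" q] q(1) by (auto simp: bij_betw_def)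
  then have "q permutes {..<n}" by (rule bij_imp_permutes) (simp add: q_def)
  then have "q \<in> column_stabilizer la t" using q by (simp add: column_stabilizer_iff)
  then show "\<exists>q\<in>column_stabilizer la t. \<forall>e<n. w e = row la t (q e)" using q by metis
qed

lemma row_eq_imp_eq:
  assumes "p \<in> column_stabilizer la t" "q \<in> column_stabilizer la t"
    and "\<And>e. e < n \<Longrightarrow> row la t (p e) = row la t (q e)"
  shows "p = q"
proof
  fix e show "p e = q e"
  proof (cases "e < n")
    case True
    then have "p e < n" "q e < n" "col la t (p e) = col la t (q e)"
      using assms(1,2) permutes_in_image[of _ "{..<n}" e] by (auto simp: column_stabilizer_iff)
    then show ?thesis using assms(3)[OF True] row_col(2) by metis
  next
    case False
    then show ?thesis using assms(1,2) permutes_not_in[of p "{..<n}" e] permutes_not_in[of q "{..<n}" e]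
      by (simp add: column_stabilizer_iff)
  qed
qed

end

section \<open>Representations of the symmetric group\<close>

locale sym_rep = vector_space s
  for s :: "'k::field_char_0 \<Rightarrow> 'a::ab_group_add \<Rightarrow> 'a" +
  fixes n :: nat and act :: "(nat \<Rightarrow> nat) \<Rightarrow> 'a \<Rightarrow> 'a"
  assumes act_linear: "p permutes {..<n} \<Longrightarrow> Vector_Spaces.linear s s (act p)"
    and act_comp: "p permutes {..<n} \<Longrightarrow> q permutes {..<n} \<Longrightarrow> act (p \<circ> q) x = act p (act q x)"
    and act_id: "act id x = x"
begin

lemma act_add: "p permutes {..<n} \<Longrightarrow> act p (x + y) = act p x + act p y"
  and act_scale: "p permutes {..<n} \<Longrightarrow> act p (s c x) = s c (act p x)"
  using act_linear[of p] by (auto simp: Vector_Spaces.linear_iff)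

lemma act_0: "p permutes {..<n} \<Longrightarrow> act p 0 = 0"
  using act_scale[of p 0 0] by simp

lemma act_sum: "p permutes {..<n} \<Longrightarrow> act p (\<Sum>j\<in>J. f j) = (\<Sum>j\<in>J. act p (f j))"
  by (induction J rule: infinite_finite_induct) (simp_all add: act_0 act_add)

text \<open>Maschke's theorem: averaging a linear projection over the group makes it equivariant.\<close>

lemma equivariant_projection:
  assumes U: "subspace U" and inv: "\<And>p x. p permutes {..<n} \<Longrightarrow> x \<in> U \<Longrightarrow> act p x \<in> U"
  shows "\<exists>\<pi>. Vector_Spaces.linear s s \<pi> \<and> (\<forall>x. \<pi> x \<in> U) \<and> (\<forall>x\<in>U. \<pi> x = x) \<and>
    (\<forall>p x. p permutes {..<n} \<longrightarrow> \<pi> (act p x) = act p (\<pi> x))"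
proof -
  interpret ss: vector_space_pair s s ..
  obtain g where gU: "g ` UNIV \<subseteq> U" and g: "Vector_Spaces.linear s s g" and gid: "\<forall>x\<in>U. g x = x"
    using ss.linear_exists_left_inverse_on[OF linear_id U] by auto
  \<comment> \<open>The average of the conjugates of an arbitrary linear projection onto \<open>U\<close>.\<close>
  define \<pi> where "\<pi> x = s (1 / of_nat (fact n)) (\<Sum>p\<in>Sym n. act p (g (act (inv p) x)))" for x
  have ga: "g (x + y) = g x + g y" and gs: "g (s c x) = s c (g x)" for x y c
    using g by (auto simp: Vector_Spaces.linear_iff)
  show ?thesis
  proof (intro exI[of _ \<pi>] conjI allI ballI impI)
    show "Vector_Spaces.linear s s \<pi>"
      unfolding Vector_Spaces.linear_iff
    proof (intro conjI allI)
      show "\<pi> (x + y) = \<pi> x + \<pi> y" for x y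
        by (simp add: \<pi>_def permutes_inv act_add ga sum.distrib scale_right_distrib)
      show "\<pi> (s c x) = s c (\<pi> x)" for c x
        by (simp add: \<pi>_def permutes_inv act_scale gs scale_sum_right mult.commute)
    qed (rule vector_space_axioms)+
    show "\<pi> x \<in> U" for x
      unfolding \<pi>_def using gU by (intro subspace_scale[OF U] subspace_sum[OF U] inv) auto
    show "\<pi> x = x" if "x \<in> U" for x
    proof -
      have "act p (g (act (inv p) x)) = x" if p: "p permutes {..<n}" for p
        using gid inv[OF permutes_inv[OF p] \<open>x \<in> U\<close>] act_comp[OF p permutes_inv[OF p], of x]
        by (simp add: permutes_inv_o[OF p] act_id)
      then have "(\<Sum>p\<in>Sym n. act p (g (act (inv p) x))) = (\<Sum>p\<in>Sym n. x)" by (intro sum.cong) auto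
      then show ?thesis by (simp add: \<pi>_def sum_constant_scale card_Sym of_nat_fact_nonzero)
    qed
    show "\<pi> (act q x) = act q (\<pi> x)" if q: "q permutes {..<n}" for q x
    proof -
      have "act q (\<pi> x) = s (1 / of_nat (fact n)) (\<Sum>p\<in>Sym n. act (q \<circ> p) (g (act (inv p) x)))"
        using q by (simp add: \<pi>_def act_scale act_sum act_comp)
      also have "(\<Sum>p\<in>Sym n. act (q \<circ> p) (g (act (inv p) x))) =
          (\<Sum>p\<in>Sym n. act (q \<circ> p) (g (act (inv (q \<circ> p)) (act q x))))"
      proof (rule sum.cong[OF refl])
        fix p assume "p \<in> Sym n"
        then have p: "p permutes {..<n}" by simp
        have "act (inv (q \<circ> p)) (act q x) = act (inv (q \<circ> p) \<circ> q) x"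
          using q p by (intro act_comp[symmetric] permutes_inv permutes_compose)
        also have "inv (q \<circ> p) \<circ> q = inv p"
          using permutes_inv_o[OF q] permutes_inv_o[OF p]
          by (simp add: o_inv_distrib permutes_bij[OF q] permutes_bij[OF p] o_assoc[symmetric])
        finally show "act (q \<circ> p) (g (act (inv p) x)) = act (q \<circ> p) (g (act (inv (q \<circ> p)) (act q x)))"
          by (simp only:)
      qed
      also have "\<dots> = (\<Sum>p\<in>Sym n. act p (g (act (inv p) (act q x))))"
        by (rule sum_Sym_left[OF q])
      finally show ?thesis by (simp add: \<pi>_def)
    qed
  qed
qed

text \<open>The column alternator (column antisymmetrizer) of the tableau \<open>t\<close>, as an operator on an arbitrary
representation.\<close>

definition colsum :: "nat list \<Rightarrow> (nat \<times> nat \<Rightarrow> nat) \<Rightarrow> 'a \<Rightarrow> 'a" where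
  "colsum la t x = (\<Sum>p\<in>column_stabilizer la t. s (of_int (sign p)) (act p x))"

lemma colsum_linear:
  assumes "tableau n la t"
  shows "colsum la t (x + y) = colsum la t x + colsum la t y" "colsum la t (s c x) = s c (colsum la t x)"
proof -
  interpret tableau n la t by fact
  show "colsum la t (x + y) = colsum la t x + colsum la t y"
    unfolding colsum_def sum.distrib[symmetric]
    by (intro sum.cong) (auto simp: act_add column_stabilizer_permutes scale_right_distrib)
  show "colsum la t (s c x) = s c (colsum la t x)"
    unfolding colsum_def scale_sum_right
    by (intro sum.cong) (auto simp: act_scale column_stabilizer_permutes mult.commute)
qed

lemma sign_square: "of_int (sign p) * of_int (sign p) = (1 :: 'k)"
  by (simp add: sign_def)

lemma colsum_act:
  assumes "tableau n la t" "q \<in> column_stabilizer la t"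
  shows "colsum la t (act q x) = s (of_int (sign q)) (colsum la t x)"
proof -
  interpret tableau n la t by fact
  have q: "q permutes {..<n}" using assms column_stabilizer_permutes by blast
  have "colsum la t (act q x) = s (of_int (sign q))
      (\<Sum>p\<in>column_stabilizer la t. s (of_int (sign (p \<circ> q))) (act (p \<circ> q) x))"
    unfolding colsum_def scale_sum_right
  proof (rule sum.cong[OF refl])
    fix p assume "p \<in> column_stabilizer la t"
    then have p: "p permutes {..<n}" using column_stabilizer_permutes by blast
    have "sign (p \<circ> q) = sign p * sign q"
      using p q by (auto intro!: sign_compose simp: permutation_permutes)
    then show "s (of_int (sign p)) (act p (act q x)) =
        s (of_int (sign q)) (s (of_int (sign (p \<circ> q))) (act (p \<circ> q) x))"
      using sign_square[of q] by (simp add: act_comp[OF p q] mult.commute mult.left_commute)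
  qed
  also have "\<dots> = s (of_int (sign q)) (colsum la t x)"
    unfolding colsum_def by (subst sum_column_stabilizer_right[OF assms(2)]) simp
  finally show ?thesis .
qed

lemma colsum_colsum:
  assumes "tableau n la t"
  shows "colsum la t (colsum la t x) = s (of_nat (card (column_stabilizer la t))) (colsum la t x)"
proof -
  interpret tableau n la t by fact
  interpret ss: vector_space_pair s s ..
  have "Vector_Spaces.linear s s (colsum la t)"
    using colsum_linear[OF assms] vector_space_axioms by (auto simp: Vector_Spaces.linear_iff)
  then have "colsum la t (colsum la t x) =
      (\<Sum>p\<in>column_stabilizer la t. colsum la t (s (of_int (sign p)) (act p x)))"
    by (subst (2) colsum_def) (simp add: ss.linear_sum)
  also have "\<dots> = (\<Sum>p\<in>column_stabilizer la t. colsum la t x)"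
    by (intro sum.cong) (auto simp: colsum_linear[OF assms] colsum_act[OF assms] sign_square)
  finally show ?thesis by (simp add: sum_constant_scale)
qed

end

section \<open>Specht modules\<close>

lemma permute_tabloid_comp: "permute_tabloid (p \<circ> q) x = permute_tabloid p (permute_tabloid q x)"
  by (simp add: permute_tabloid_def image_comp comp_def)

lemma permute_tabloid_id: "permute_tabloid id x = x"
  by (simp add: permute_tabloid_def)

interpretation specht: sym_rep "pscale ((*) :: 'k::field_char_0 \<Rightarrow> 'k \<Rightarrow> 'k)" n specht_act for n
proof
  fix p q :: "nat \<Rightarrow> nat" and x y :: "tabloid \<Rightarrow> 'k" and c :: 'k
  show "specht_act p (x + y) = specht_act p x + specht_act p y"
    and "specht_act p (pscale (*) c x) = pscale (*) c (specht_act p x)"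
    by (auto simp: specht_act_def fun_eq_iff)
  show "specht_act id x = x" by (simp add: specht_act_def permute_tabloid_id)
  assume "p permutes {..<n}" "q permutes {..<n}"
  then have "inv (p \<circ> q) = inv q \<circ> inv p" by (intro o_inv_distrib permutes_bij)
  then show "specht_act (p \<circ> q) x = specht_act p (specht_act q x)"
    by (simp add: specht_act_def permute_tabloid_comp)
qed

definition word_act :: "(nat \<Rightarrow> nat) \<Rightarrow> ((nat \<Rightarrow> nat) \<Rightarrow> 'k) \<Rightarrow> (nat \<Rightarrow> nat) \<Rightarrow> 'k" where
  "word_act p F = (\<lambda>w. F (w \<circ> p))"

interpretation word: sym_rep "pscale ((*) :: 'k::field_char_0 \<Rightarrow> 'k \<Rightarrow> 'k)" n word_act for n
  by unfold_locales (simp_all add: word_act_def comp_assoc fun_eq_iff)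

text \<open>Tabloids are words in disguise: the letter of an entry is the index of its row.\<close>

definition word_tabloid :: "nat \<Rightarrow> nat \<Rightarrow> (nat \<Rightarrow> nat) \<Rightarrow> tabloid" where
  "word_tabloid n r w = map (\<lambda>i. {e. e < n \<and> w e = i}) [0..<r]"

lemma word_tabloid_cong: "(\<And>e. e < n \<Longrightarrow> w e = w' e) \<Longrightarrow> word_tabloid n r w = word_tabloid n r w'"
  unfolding word_tabloid_def by (auto intro!: map_cong)

lemma word_tabloid_eq_iff:
  assumes "\<And>e. e < n \<Longrightarrow> w' e < r"
  shows "word_tabloid n r w = word_tabloid n r w' \<longleftrightarrow> (\<forall>e<n. w e = w' e)"
proof
  assume eq: "word_tabloid n r w = word_tabloid n r w'"
  show "\<forall>e<n. w e = w' e"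
  proof (intro allI impI)
    fix e assume e: "e < n"
    have "word_tabloid n r w ! w' e = word_tabloid n r w' ! w' e" by (simp add: eq)
    then have "{x. x < n \<and> w x = w' e} = {x. x < n \<and> w' x = w' e}"
      using assms[OF e] by (simp add: word_tabloid_def)
    then show "w e = w' e" using e by blast
  qed
qed (rule word_tabloid_cong, simp)

lemma permute_word_tabloid:
  assumes p: "p permutes {..<n}"
  shows "permute_tabloid (inv p) (word_tabloid n r w) = word_tabloid n r (w \<circ> p)"
proof -
  have "inv p ` {e. e < n \<and> w e = i} = {e. e < n \<and> w (p e) = i}" for i
  proof safe
    fix e assume "e < n"
    then show "inv p e < n" using permutes_in_image[OF permutes_inv[OF p], of e] by simp
    show "w (p (inv p e)) = w e" by (simp add: permutes_inverses[OF p])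
  next
    fix e assume "e < n"
    then have "p e < n" using permutes_in_image[OF p, of e] by simp
    then show "e \<in> inv p ` {x. x < n \<and> w x = w (p e)}"
      by (intro image_eqI[of _ _ "p e"]) (auto simp: permutes_inverses[OF p])
  qed
  then show ?thesis by (simp add: permute_tabloid_def word_tabloid_def comp_def)
qed

lemma specht_act_word_tabloid:
  "p permutes {..<n} \<Longrightarrow> specht_act p f (word_tabloid n r w) = f (word_tabloid n r (w \<circ> p))"
  by (simp add: specht_act_def permute_word_tabloid)

lemma (in tableau) tabloid_of_eq: "tabloid_of la t = word_tabloid n (length la) (row la t)"
  unfolding tabloid_of_def word_tabloid_def
proof (rule map_cong[OF refl])
  fix i assume "i \<in> set [0..<length la]"
  then have i: "i < length la" by simp
  show "{t (i, j) |j. j < la ! i} = {e. e < n \<and> row la t e = i}"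
  proof safe
    fix j assume "j < la ! i"
    then have ij: "(i, j) \<in> diagram la" using i by (simp add: diagram_def)
    show "t (i, j) < n" "row la t (t (i, j)) = i" using ij t_less by auto
  next
    fix e assume "e < n"
    then show "\<exists>j. e = t (row la t e, j) \<and> j < la ! row la t e"
      using row_col[of e] by (auto simp: diagram_def intro!: exI[of _ "col la t e"])
  qed
qed

context tableau
begin

lemma permute_tabloid_of:
  assumes "p permutes {..<n}"
  shows "permute_tabloid p (tabloid_of la t) = word_tabloid n (length la) (row la t \<circ> inv p)"
  using permute_word_tabloid[OF permutes_inv[OF assms]] by (simp add: tabloid_of_eq permutes_inv_inv[OF assms])

text \<open>Different elements of the column stabilizer move the tabloid to different tabloids, so there is no
cancellation in the polytabloid.\<close>

lemma polytabloid_at: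
  assumes "q \<in> column_stabilizer la t"
  shows "polytabloid la t (word_tabloid n (length la) (row la t \<circ> q)) = (of_int (sign q) :: 'k::field)"
proof -
  have eq: "word_tabloid n (length la) (row la t \<circ> q) = permute_tabloid p (tabloid_of la t) \<longleftrightarrow> p = inv q"
    if p: "p \<in> column_stabilizer la t" for p
  proof -
    have pp: "p permutes {..<n}" and qp: "q permutes {..<n}"
      using p assms column_stabilizer_permutes by auto
    have "word_tabloid n (length la) (row la t \<circ> q) = permute_tabloid p (tabloid_of la t) \<longleftrightarrow>
        (\<forall>e<n. row la t (q e) = row la t (inv p e))"
      unfolding permute_tabloid_of[OF pp]
      using permutes_in_image[OF permutes_inv[OF pp]] row_less by (subst word_tabloid_eq_iff) auto
    also have "\<dots> \<longleftrightarrow> q = inv p"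
      using row_eq_imp_eq[OF assms column_stabilizer_inv[OF p]] by auto
    finally show ?thesis using permutes_inv_inv[OF pp] permutes_inv_inv[OF qp] by auto
  qed
  have "polytabloid la t (word_tabloid n (length la) (row la t \<circ> q)) =
      (\<Sum>p\<in>column_stabilizer la t. if p = inv q then of_int (sign p) else (0::'k))"
    unfolding polytabloid_def by (rule sum.cong[OF refl]) (simp add: eq)
  also have "\<dots> = of_int (sign (inv q))" using column_stabilizer_inv[OF assms] by simp
  also have "\<dots> = of_int (sign q)"
    using sign_inverse[OF permutes_imp_permutation[OF _ column_stabilizer_permutes[OF assms]]] by simp
  finally show ?thesis .
qed

lemma polytabloid_nonzero_at:
  assumes "polytabloid la t x \<noteq> (0 :: 'k::field)"
  shows "\<exists>q\<in>column_stabilizer la t. x = word_tabloid n (length la) (row la t \<circ> q)"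
proof -
  obtain p where p: "p \<in> column_stabilizer la t"
      and nz: "of_int (sign p) * (if x = permute_tabloid p (tabloid_of la t) then 1 else 0) \<noteq> (0 :: 'k)"
    using assms unfolding polytabloid_def by (rule sum.not_neutral_contains_not_neutral)
  have "x = permute_tabloid p (tabloid_of la t)" using nz by (cases "x = permute_tabloid p (tabloid_of la t)") simp_all
  then have "x = word_tabloid n (length la) (row la t \<circ> inv p)"
    using permute_tabloid_of[OF column_stabilizer_permutes[OF p]] by simp
  then show ?thesis using column_stabilizer_inv[OF p] by blast
qed

lemma polytabloid_nonzero: "polytabloid la t \<noteq> (0 :: tabloid \<Rightarrow> 'k::field)"
proof
  assume "polytabloid la t = (0 :: tabloid \<Rightarrow> 'k)"
  then show False using polytabloid_at[OF column_stabilizer_id, where 'k = 'k] by simp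
qed

lemma polytabloid_in_specht: "polytabloid la t \<in> specht la"
  unfolding specht_def using t by (intro funs.span_base) auto

lemma tableau_comp:
  assumes "p permutes {..<n}"
  shows "tableau n la (p \<circ> t)"
  using bij_betw_trans[OF bij_t permutes_imp_bij[OF assms]] la
  by unfold_locales (auto simp: tableaux_def partitions_def)

lemma column_stabilizer_comp_left:
  assumes "p permutes {..<n}"
  shows "column_stabilizer la (p \<circ> t) = (\<lambda>q. p \<circ> q \<circ> inv p) ` column_stabilizer la t" (is "?L = ?R")
proof -
  have n: "sum_list la = n" using la by (simp add: partitions_def)
  have sub: "p \<circ> q \<circ> inv p \<in> column_stabilizer la (p \<circ> t)"
    if "q \<in> column_stabilizer la t" "p permutes {..<n}" for p q t
  proof -
    have "(p \<circ> q \<circ> inv p) permutes {..<n}"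
      using that n by (auto simp: column_stabilizer_def intro!: permutes_compose permutes_inv)
    then show ?thesis using that n by (fastforce simp: column_stabilizer_def permutes_inverses)
  qed
  show ?thesis
  proof
    show "?R \<subseteq> ?L" using sub assms by blast
    show "?L \<subseteq> ?R"
    proof
      fix q assume q: "q \<in> ?L"
      have "inv p \<circ> q \<circ> inv (inv p) \<in> column_stabilizer la (inv p \<circ> (p \<circ> t))"
        using sub[OF q permutes_inv[OF assms]] .
      then have "inv p \<circ> q \<circ> p \<in> column_stabilizer la t"
        using permutes_inv_o[OF assms] by (simp add: o_assoc permutes_inv_inv[OF assms])
      moreover have "q = p \<circ> (inv p \<circ> q \<circ> p) \<circ> inv p"
        by (simp add: fun_eq_iff permutes_inverses[OF assms])
      ultimately show "q \<in> ?R" by blast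
    qed
  qed
qed

lemma specht_act_polytabloid:
  assumes p: "p permutes {..<n}"
  shows "specht_act p (polytabloid la t) = (polytabloid la (p \<circ> t) :: tabloid \<Rightarrow> 'k::field)"
proof
  fix x
  interpret pt: tableau n la "p \<circ> t" by (rule tableau_comp[OF p])
  have inj: "inj_on (\<lambda>q. p \<circ> q \<circ> inv p) (column_stabilizer la t)"
  proof (rule inj_onI)
    fix q q' assume "p \<circ> q \<circ> inv p = p \<circ> q' \<circ> inv p"
    then have "inv p \<circ> (p \<circ> q \<circ> inv p) \<circ> p = inv p \<circ> (p \<circ> q' \<circ> inv p) \<circ> p" by simp
    then show "q = q'" by (simp add: fun_eq_iff permutes_inverses[OF p])
  qed
  have tab: "tabloid_of la (p \<circ> t) = permute_tabloid p (tabloid_of la t)"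
    by (auto simp: tabloid_of_def permute_tabloid_def)
  have "polytabloid la (p \<circ> t) x = (\<Sum>q\<in>column_stabilizer la t. of_int (sign (p \<circ> q \<circ> inv p)) *
      (if x = permute_tabloid (p \<circ> q \<circ> inv p) (permute_tabloid p (tabloid_of la t)) then 1 else (0::'k)))"
    by (simp add: polytabloid_def column_stabilizer_comp_left[OF p] sum.reindex[OF inj] tab)
  also have "\<dots> = (\<Sum>q\<in>column_stabilizer la t. of_int (sign q) *
      (if permute_tabloid (inv p) x = permute_tabloid q (tabloid_of la t) then 1 else 0))"
  proof (rule sum.cong[OF refl])
    fix q assume "q \<in> column_stabilizer la t"
    then have q: "q permutes {..<n}" by (rule column_stabilizer_permutes)
    have perm: "permutation p" "permutation q" "permutation (inv p)"
      using p q permutes_inv[OF p] by (auto simp: permutation_permutes)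
    have "sign (p \<circ> q \<circ> inv p) = sign p * sign q * sign (inv p)"
      using perm by (simp add: sign_compose permutation_compose)
    then have sg: "sign (p \<circ> q \<circ> inv p) = sign q"
      using perm sign_idempotent[of p] by (simp add: sign_inverse mult.commute mult.left_commute)
    have "permute_tabloid (p \<circ> q \<circ> inv p) (permute_tabloid p (tabloid_of la t)) = permute_tabloid p (permute_tabloid q (tabloid_of la t))"
      unfolding permute_tabloid_comp[symmetric] by (simp add: o_assoc[symmetric] permutes_inv_o[OF p])
    moreover have "x = permute_tabloid p y \<longleftrightarrow> permute_tabloid (inv p) x = y" for y
    proof -
      have "permute_tabloid (inv p) (permute_tabloid p y) = y" "permute_tabloid p (permute_tabloid (inv p) x) = x"
        unfolding permute_tabloid_comp[symmetric] by (simp_all add: permutes_inv_o[OF p] permute_tabloid_id)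
      then show ?thesis by metis
    qed
    ultimately show "of_int (sign (p \<circ> q \<circ> inv p)) *
        (if x = permute_tabloid (p \<circ> q \<circ> inv p) (permute_tabloid p (tabloid_of la t)) then 1 else (0::'k)) =
      of_int (sign q) * (if permute_tabloid (inv p) x = permute_tabloid q (tabloid_of la t) then 1 else 0)"
      by (simp add: sg)
  qed
  also have "\<dots> = specht_act p (polytabloid la t) x" by (simp add: polytabloid_def specht_act_def)
  finally show "specht_act p (polytabloid la t) x = (polytabloid la (p \<circ> t) x :: 'k)" by simp
qed

text \<open>All tableaux of a shape are permutations of one of them, so a Specht module is cyclic.\<close>

lemma specht_eq_span_orbit: "(specht la :: (tabloid \<Rightarrow> 'k::field) set) = funs.span ((\<lambda>p. specht_act p (polytabloid la t)) ` Sym n)"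
proof -
  have "polytabloid la ` tableaux la = (\<lambda>p. specht_act p (polytabloid la t :: tabloid \<Rightarrow> 'k)) ` Sym n" (is "?L = ?R")
  proof
    show "?R \<subseteq> ?L" using tableau_comp by (auto simp: specht_act_polytabloid tableau_def)
    show "?L \<subseteq> ?R"
    proof clarify
      fix u assume u: "u \<in> tableaux la"
      interpret u: tableau n la u using la u by unfold_locales
      define p where "p e = (if e < n then u (row la t e, col la t e) else e)" for e
      have pt: "p (t ij) = u ij" if "ij \<in> diagram la" for ij
        using that t_less by (cases ij) (auto simp: p_def)
      have "bij_betw (u \<circ> the_inv_into (diagram la) t) {..<n} {..<n}"
        using bij_betw_trans[OF bij_betw_the_inv_into[OF bij_t] u.bij_t] .
      moreover have "bij_betw p {..<n} {..<n} = bij_betw (u \<circ> the_inv_into (diagram la) t) {..<n} {..<n}"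
        by (rule bij_betw_cong) (auto simp: p_def row_def col_def)
      ultimately have p: "p permutes {..<n}" by (intro bij_imp_permutes) (auto simp: p_def)
      have "tabloid_of la (p \<circ> t) = tabloid_of la u"
        unfolding tabloid_of_def
      proof (rule map_cong[OF refl])
        fix i assume "i \<in> set [0..<length la]"
        then have "(p \<circ> t) (i, j) = u (i, j)" if "j < la ! i" for j
          using that pt[of "(i, j)"] by (simp add: diagram_def)
        then show "{(p \<circ> t) (i, j) |j. j < la ! i} = {u (i, j) |j. j < la ! i}" by metis
      qed
      moreover have "column_stabilizer la (p \<circ> t) = column_stabilizer la u"
        unfolding column_stabilizer_def using pt by (auto simp: split_beta) (metis (no_types, lifting) fst_conv pt snd_conv)+
      ultimately have "polytabloid la (p \<circ> t) = (polytabloid la u :: tabloid \<Rightarrow> 'k)" by (simp add: polytabloid_def fun_eq_iff)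
      then show "polytabloid la u \<in> ?R" 
        using p specht_act_polytabloid[OF p] by (metis image_eqI mem_Collect_eq)
    qed
  qed
  then show ?thesis by (simp add: specht_def)
qed

text \<open>The polytabloid is itself an alternating sum, and the alternator is idempotent up to a factor.\<close>

lemma colsum_polytabloid:
  "specht.colsum la t (polytabloid la t) =
    pscale (*) (of_nat (card (column_stabilizer la t))) (polytabloid la t :: tabloid \<Rightarrow> 'k::field_char_0)"
proof -
  have "polytabloid la t = specht.colsum la t (\<lambda>y. if y = tabloid_of la t then 1 else (0::'k))"
  proof
    fix x
    have "permute_tabloid (inv p) x = y \<longleftrightarrow> x = permute_tabloid p y" if "p \<in> column_stabilizer la t" for p y
    proof -
      have p: "p permutes {..<n}" using that by (rule column_stabilizer_permutes)
      have "permute_tabloid (inv p) (permute_tabloid p y) = y" "permute_tabloid p (permute_tabloid (inv p) x) = x"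
        unfolding permute_tabloid_comp[symmetric] by (simp_all add: permutes_inv_o[OF p] permute_tabloid_id)
      then show ?thesis by metis
    qed
    then show "polytabloid la t x = specht.colsum la t (\<lambda>y. if y = tabloid_of la t then 1 else (0::'k)) x"
      by (auto simp: polytabloid_def specht.colsum_def sum_fun_apply specht_act_def intro!: sum.cong)
  qed
  then show ?thesis using specht.colsum_colsum[OF tableau_axioms] by metis
qed

end

lemma tableau_exists:
  assumes "la \<in> partitions n"
  shows "\<exists>t. tableau n la t"
proof -
  have "card (diagram la) = card {..<n}" using assms by (simp add: card_diagram partitions_def)
  then obtain t where "bij_betw t (diagram la) {..<n}"
    using finite_same_card_bij[of "diagram la" "{..<n}"] by auto
  then show ?thesis using assms by (intro exI[of _ t]) (auto simp: tableau_def tableaux_def partitions_def)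
qed

lemma specht_subspace: "funs.subspace (specht la)"
  by (simp add: specht_def)

lemma specht_act_in_specht:
  fixes f :: "tabloid \<Rightarrow> 'k::field_char_0"
  assumes la: "la \<in> partitions n" and p: "p permutes {..<n}" and f: "f \<in> specht la"
  shows "specht_act p f \<in> specht la"
proof -
  obtain t where "tableau n la t" using tableau_exists[OF la] by blast
  then interpret tableau n la t .
  have "f \<in> funs.span ((\<lambda>p. specht_act p (polytabloid la t)) ` Sym n)"
    using f by (simp add: specht_eq_span_orbit)
  then show ?thesis
  proof (induction rule: funs.span_induct_alt)
    case base show ?case unfolding specht.act_0[OF p] by (rule funs.subspace_0[OF specht_subspace])
  next
    case (step c x y)
    then obtain q where q: "q permutes {..<n}" "x = specht_act q (polytabloid la t)" by auto
    have "specht_act p x = polytabloid la ((p \<circ> q) \<circ> t)"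
      by (simp only: q(2) specht.act_comp[OF p q(1), symmetric] specht_act_polytabloid[OF permutes_compose[OF q(1) p]])
    also have "\<dots> \<in> specht la"
      by (rule tableau.polytabloid_in_specht[OF tableau_comp[OF permutes_compose[OF q(1) p]]])
    finally show ?case unfolding specht.act_add[OF p] specht.act_scale[OF p]
      by (intro funs.subspace_add funs.subspace_scale specht_subspace step.IH)
  qed
qed

text \<open>A polytabloid is supported on the permutations of its tabloid, which are words by
\<open>permute_tabloid_of\<close>.\<close>

lemma specht_support:
  fixes f :: "tabloid \<Rightarrow> 'k::field_char_0"
  assumes la: "la \<in> partitions n" and f: "f \<in> specht la" and x: "f x \<noteq> 0"
  shows "\<exists>t p. tableau n la t \<and> p permutes {..<n} \<and> x = word_tabloid n (length la) (row la t \<circ> p)"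
proof -
  let ?P = "\<lambda>x. \<exists>t p. tableau n la t \<and> p permutes {..<n} \<and> x = word_tabloid n (length la) (row la t \<circ> p)"
  have "\<forall>x. f x \<noteq> 0 \<longrightarrow> ?P x" using f unfolding specht_def
  proof (induction rule: funs.span_induct_alt)
    case (step c y z)
    then obtain t where t: "t \<in> tableaux la" and y: "y = polytabloid la t" by blast
    interpret tableau n la t using la t by unfold_locales
    have "?P x" if "y x \<noteq> 0" for x
      using polytabloid_nonzero_at[OF that[unfolded y]] tableau_axioms column_stabilizer_permutes by blast
    then show ?case using step by (metis add.right_neutral mult_zero_right plus_fun_apply pscale_apply)
  qed simp
  then show ?thesis using x by blast
qed

text \<open>An alternating sum over a column vanishes on words with a repeated letter in it: exchanging the
  two places changes the sign.\<close>

lemma (in tableau) alternating_sum_eq_0: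
  fixes F :: "(nat \<Rightarrow> nat) \<Rightarrow> 'k::field_char_0"
  assumes "\<not> inj_on w (column j)"
  shows "(\<Sum>p\<in>column_stabilizer la t. of_int (sign p) * F (w \<circ> p)) = 0" (is "?S = 0")
proof -
  obtain a b where ab: "a < n" "b < n" "col la t a = col la t b" "w a = w b" "a \<noteq> b"
    using assms by (auto simp: inj_on_def column_def)
  let ?q = "Transposition.transpose a b"
  have wq: "w \<circ> ?q = w" using ab by (auto simp: fun_eq_iff transpose_def)
  have "?S = (\<Sum>p\<in>column_stabilizer la t. of_int (sign (?q \<circ> p)) * F (w \<circ> (?q \<circ> p)))"
    by (rule sum_column_stabilizer_left[symmetric, OF transpose_in_column_stabilizer]) (use ab in auto)
  also have "\<dots> = (\<Sum>p\<in>column_stabilizer la t. - (of_int (sign p) * F (w \<circ> p)))"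
  proof (rule sum.cong[OF refl])
    fix p assume "p \<in> column_stabilizer la t"
    then have "permutation p" using column_stabilizer_permutes by (auto simp: permutation_permutes)
    then have "sign (?q \<circ> p) = - sign p"
      using ab by (simp add: sign_compose permutation_swap_id sign_swap_id)
    then show "of_int (sign (?q \<circ> p)) * F (w \<circ> (?q \<circ> p)) = - (of_int (sign p) * F (w \<circ> p))"
      by (simp add: o_assoc wq)
  qed
  also have "\<dots> = - ?S" by (simp add: sum_negf)
  finally have "2 * ?S = 0" by (simp only: mult_2 eq_neg_iff_add_eq_0)
  then show ?thesis by simp
qed

lemma sum_comp_permutes: "p permutes {..<n} \<Longrightarrow> (\<Sum>e<n. f (p e)) = (\<Sum>e<n. f e)"
  by (rule sum.reindex_bij_betw) (rule permutes_imp_bij)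

lemma card_row: 
  assumes "tableau n la t" "p permutes {..<n}"
  shows "card {e. e < n \<and> row la t (p e) = i} = (if i < length la then la ! i else 0)"
proof -
  interpret tableau n la t by fact
  have "{e. e < n \<and> row la t e = i} = (\<lambda>j. t (i, j)) ` {j. (i, j) \<in> diagram la}"
    using row_col t_less by (force simp: image_iff)
  moreover have "inj_on (\<lambda>j. t (i, j)) {j. (i, j) \<in> diagram la}"
    using bij_t by (auto simp: bij_betw_def inj_on_def)
  ultimately have c: "card {e. e < n \<and> row la t e = i} = card {j. (i, j) \<in> diagram la}"
    by (simp add: card_image)
  have "p ` {e. e < n \<and> row la t (p e) = i} = {e. e < n \<and> row la t e = i}"
  proof safe
    fix e assume "e < n"
    then show "p e < n" using permutes_in_image[OF assms(2), of e] by simp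
  next
    fix e assume "e < n"
    then have "inv p e < n" using permutes_in_image[OF permutes_inv[OF assms(2)], of e] by simp
    then show "e \<in> p ` {x. x < n \<and> row la t (p x) = row la t e}"
      by (intro image_eqI[of _ _ "inv p e"]) (auto simp: permutes_inverses[OF assms(2)])
  qed
  then have "card {e. e < n \<and> row la t (p e) = i} = card {e. e < n \<and> row la t e = i}"
    using card_image[OF inj_on_subset[OF permutes_inj_on[OF assms(2)] subset_UNIV], of "{e. e < n \<and> row la t (p e) = i}"]
    by simp
  then show ?thesis using c by (auto simp: diagram_def)
qed

text \<open>Specht modules are triangular for the weight: an alternator of shape \<open>\<lambda>\<close> kills the Specht modules of
  the other shapes of at most the same weight, and it maps its own Specht module to the multiples of one
  polytabloid.  If the alternating sum of \<open>f\<close> does not vanish at a word, then the word has no repetition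
  on the columns of \<open>t\<close>.  The sum of its letters is the weight of \<open>\<mu>\<close>, so \<open>column_injective_word\<close> forces
  equality of the weights and turns the word into a column permutation of \<open>t\<close>.\<close>

context
  fixes n la mu t and f :: "tabloid \<Rightarrow> 'k::field_char_0"
  assumes tab: "tableau n la t" and mu: "mu \<in> partitions n" and f: "f \<in> specht mu"
    and wt: "weight mu \<le> weight la"
begin

interpretation tableau n la t by (rule tab)

lemma colsum_specht_aux:
  assumes x: "specht.colsum la t f x \<noteq> 0"
  shows "mu = la \<and> (\<exists>q\<in>column_stabilizer la t. x = word_tabloid n (length la) (row la t \<circ> q))"
proof -
  have "specht.colsum la t f \<in> specht mu"
    unfolding specht.colsum_def
    by (intro funs.subspace_sum funs.subspace_scale specht_subspace specht_act_in_specht[OF mu _ f] column_stabilizer_permutes)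
  from specht_support[OF mu this x] obtain t' p where t': "tableau n mu t'" and p: "p permutes {..<n}"
    and xw: "x = word_tabloid n (length mu) (row mu t' \<circ> p)" by blast
  let ?w = "row mu t' \<circ> p"
  have eq: "specht.colsum la t f x = (\<Sum>p\<in>column_stabilizer la t. of_int (sign p) *
      f (word_tabloid n (length mu) (?w \<circ> p)))"
    unfolding specht.colsum_def sum_fun_apply xw
    by (rule sum.cong[OF refl]) (simp only: pscale_apply specht_act_word_tabloid[OF column_stabilizer_permutes])
  have inj: "inj_on ?w (column j)" for j
  proof (rule ccontr)
    assume "\<not> inj_on ?w (column j)"
    from alternating_sum_eq_0[OF this, of "\<lambda>w. f (word_tabloid n (length mu) w)"]
    have "specht.colsum la t f x = 0" unfolding eq .
    with x show False by contradiction
  qed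
  have "(\<Sum>e<n. ?w e) = weight mu"
    using sum_comp_permutes[OF p, of "row mu t'"] tableau.weight_eq_sum_row[OF t'] by simp
  then have "weight la = (\<Sum>e<n. ?w e)" using column_injective_word(1)[OF inj] wt by linarith
  from column_injective_word(2)[OF inj this] obtain q where q: "q \<in> column_stabilizer la t"
    "\<forall>e<n. ?w e = row la t (q e)" by blast
  \<comment> \<open>The multiplicities of the letters are the lengths of the rows of both shapes.\<close>
  have cards: "(if i < length mu then mu ! i else 0) = (if i < length la then la ! i else 0)" for i
  proof -
    have "{e. e < n \<and> row mu t' (p e) = i} = {e. e < n \<and> row la t (q e) = i}" using q by auto
    then show ?thesis
      using card_row[OF t' p, of i] card_row[OF tab column_stabilizer_permutes[OF q(1)], of i] by simp
  qed
  have pos: "la ! i > 0" if "i < length la" for i using partitionsD(2)[OF la, of "la ! i"] that by simp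
  have pos': "mu ! i > 0" if "i < length mu" for i using partitionsD(2)[OF mu, of "mu ! i"] that by simp
  have "i < length mu \<longleftrightarrow> i < length la" for i
    using cards[of i] pos[of i] pos'[of i] by (auto split: if_splits)
  then have "length mu = length la" by (metis linorder_neqE_nat nat_less_le)
  then have eq: "mu = la" using cards by (metis nth_equalityI)
  then show ?thesis using q xw word_tabloid_cong[of n ?w "row la t \<circ> q"] by auto
qed

lemma colsum_specht_other:
  assumes "mu \<noteq> la"
  shows "specht.colsum la t f = 0"
proof
  fix x show "specht.colsum la t f x = 0 x" using colsum_specht_aux[of x] assms by auto
qed

lemma colsum_specht_same:
  assumes "mu = la"
  shows "specht.colsum la t f = pscale (*) (specht.colsum la t f (tabloid_of la t)) (polytabloid la t)"
proof
  fix x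
  have at: "specht.colsum la t f (word_tabloid n (length la) (row la t \<circ> q)) =
      of_int (sign q) * specht.colsum la t f (tabloid_of la t)" if q: "q \<in> column_stabilizer la t" for q
  proof -
    have "specht.colsum la t f (word_tabloid n (length la) (row la t \<circ> q)) =
        specht_act q (specht.colsum la t f) (tabloid_of la t)"
      using column_stabilizer_permutes[OF q] by (simp add: tabloid_of_eq specht_act_word_tabloid)
    also have "specht_act q (specht.colsum la t f) =
        (\<Sum>p\<in>column_stabilizer la t. pscale (*) (of_int (sign p)) (specht_act (q \<circ> p) f))"
      unfolding specht.colsum_def specht.act_sum[OF column_stabilizer_permutes[OF q]]
      by (rule sum.cong[OF refl]) (simp add: specht.act_scale[OF column_stabilizer_permutes[OF q]]
          specht.act_comp[OF column_stabilizer_permutes[OF q] column_stabilizer_permutes])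
    also have "\<dots> = (\<Sum>p\<in>column_stabilizer la t. pscale (*) (of_int (sign q))
        (pscale (*) (of_int (sign (q \<circ> p))) (specht_act (q \<circ> p) f)))"
    proof (rule sum.cong[OF refl])
      fix p assume "p \<in> column_stabilizer la t"
      then have "sign (q \<circ> p) = sign q * sign p"
        using column_stabilizer_permutes q by (intro sign_compose) (auto simp: permutation_permutes)
      then show "pscale (*) (of_int (sign p)) (specht_act (q \<circ> p) f) = pscale (*) (of_int (sign q))
        (pscale (*) (of_int (sign (q \<circ> p))) (specht_act (q \<circ> p) f))"
        by (auto simp: fun_eq_iff sign_def)
    qed
    also have "\<dots> = pscale (*) (of_int (sign q)) (specht.colsum la t f)"
      unfolding funs.scale_sum_right[symmetric] specht.colsum_def
      by (subst sum_column_stabilizer_left[OF q, of "\<lambda>p. pscale (*) (of_int (sign p)) (specht_act p f)"]) (rule refl)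
    finally show ?thesis by (rule trans) (rule pscale_apply)
  qed
  show "specht.colsum la t f x = pscale (*) (specht.colsum la t f (tabloid_of la t)) (polytabloid la t) x"
  proof (cases "\<exists>q\<in>column_stabilizer la t. x = word_tabloid n (length la) (row la t \<circ> q)")
    case True
    then obtain q where q: "q \<in> column_stabilizer la t" "x = word_tabloid n (length la) (row la t \<circ> q)" by blast
    show ?thesis unfolding q(2) at[OF q(1)] pscale_apply polytabloid_at[OF q(1)] by (rule mult.commute)
  next
    case False
    then have "specht.colsum la t f x = 0" "polytabloid la t x = (0::'k)"
      using colsum_specht_aux[of x] polytabloid_nonzero_at[of x] by blast+
    then show ?thesis by (simp only: pscale_apply mult_zero_right)
  qed
qed

end

text \<open>By Maschke's theorem, the vectors of the Specht module that all column alternators annihilate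
  form a direct summand; the corresponding projection kills the generator.\<close>

lemma colsum_nondegenerate:
  fixes v :: "tabloid \<Rightarrow> 'k::field_char_0"
  assumes tab: "tableau n la t" and v: "v \<in> specht la"
    and 0: "\<And>p. p permutes {..<n} \<Longrightarrow> specht.colsum la t (specht_act p v) = 0"
  shows "v = 0"
proof -
  interpret tableau n la t by (rule tab)
  define U where "U = {v \<in> specht la. \<forall>p. p permutes {..<n} \<longrightarrow> specht.colsum la t (specht_act p v) = (0 :: tabloid \<Rightarrow> 'k)}"
  have cl0: "specht.colsum la t (0 :: tabloid \<Rightarrow> 'k) = 0"
    using specht.colsum_linear(2)[OF tab, of 0 0] by simp
  have U: "funs.subspace U"
    unfolding funs.subspace_def U_def
    by (auto simp: specht.act_0 cl0 specht.act_add specht.act_scale specht.colsum_linear[OF tab]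
        specht_subspace funs.subspace_0 funs.subspace_add funs.subspace_scale)
  have inv: "specht_act p x \<in> U" if "p permutes {..<n}" "x \<in> U" for p x
    using that specht_act_in_specht[OF la] permutes_compose[OF that(1)]
    by (auto simp: U_def specht.act_comp[OF _ that(1), symmetric])
  obtain \<pi> where lin: "Vector_Spaces.linear (pscale (*)) (pscale (*)) \<pi>"
    and pU: "\<And>x. \<pi> x \<in> U" and pid: "\<And>x. x \<in> U \<Longrightarrow> \<pi> x = x"
    and eqv: "\<And>p x. p permutes {..<n} \<Longrightarrow> \<pi> (specht_act p x) = specht_act p (\<pi> x)"
    using specht.equivariant_projection[OF U, of n] inv by blast
  interpret ff: vector_space_pair "pscale (*) :: 'k \<Rightarrow> (tabloid \<Rightarrow> 'k) \<Rightarrow> _" "pscale (*) :: 'k \<Rightarrow> (tabloid \<Rightarrow> 'k) \<Rightarrow> _" ..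
  let ?e = "polytabloid la t :: tabloid \<Rightarrow> 'k"
  have "\<pi> (specht.colsum la t ?e) = specht.colsum la t (\<pi> ?e)"
    unfolding specht.colsum_def ff.linear_sum[OF lin]
    by (rule sum.cong) (auto simp: ff.linear_scale[OF lin] eqv column_stabilizer_permutes)
  also have "\<dots> = 0"
    using pU[of ?e] specht.act_id[of "\<pi> ?e"] permutes_id[of "{..<n}"] unfolding U_def by fastforce
  finally have "pscale (*) (of_nat (card (column_stabilizer la t))) (\<pi> ?e) = 0"
    by (simp only: colsum_polytabloid ff.linear_scale[OF lin])
  moreover have "card (column_stabilizer la t) \<noteq> 0" using column_stabilizer_id by auto
  ultimately have pe: "\<pi> ?e = 0" by (metis funs.scale_eq_0_iff of_nat_eq_0_iff)
  have "\<pi> x = 0" if "x \<in> specht la" for x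
  proof (rule ff.linear_eq_on[OF lin ff.linear_zero])
    show "x \<in> funs.span ((\<lambda>p. specht_act p ?e) ` Sym n)" using that by (simp add: specht_eq_span_orbit)
  qed (auto simp: eqv pe specht.act_0)
  moreover have "v \<in> U" using v 0 by (simp add: U_def)
  ultimately show "v = 0" using pid v by metis
qed

section \<open>Conjugacy classes\<close>

text \<open>A permutation is a disjoint union of rotations, one for each row of a diagram.\<close>

lemma cycle_decomposition_rows:
  assumes p: "permutation p" and A: "finite A" "p ` A = A"
  shows "\<exists>la f. (\<forall>l\<in>set la. l > 0) \<and> bij_betw f (diagram la) A \<and>
    (\<forall>i j. (i, j) \<in> diagram la \<longrightarrow> p (f (i, j)) = f (i, Suc j mod la ! i))"
  using A
proof (induction "card A" arbitrary: A rule: less_induct)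
  case less
  show ?case
  proof (cases "A = {}")
    case True
    then show ?thesis by (intro exI[of _ "[]"]) (auto simp: diagram_def bij_betw_def)
  next
    case False
    then obtain x where x: "x \<in> A" by blast
    define m where "m = least_power p x"
    have m: "(p ^^ m) x = x" "m > 0" using least_power_of_permutation[OF p, of x] by (auto simp: m_def)
    have "distinct (map (\<lambda>i. (p ^^ i) x) [0..<m])"
      using cycle_of_permutation[OF p, of x] by (simp add: m_def)
    then have inj: "inj_on (\<lambda>i. (p ^^ i) x) {..<m}"
      by (simp add: distinct_map atLeast0LessThan)
    define O' where "O' = (\<lambda>i. (p ^^ i) x) ` {..<m}"
    have step: "p ((p ^^ i) x) = (p ^^ (Suc i mod m)) x" if "i < m" for i
      using that m by (cases "Suc i = m") auto
    have OA: "O' \<subseteq> A"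
    proof -
      have "(p ^^ i) x \<in> A" for i using x less.prems(2) by (induction i) auto
      then show ?thesis by (auto simp: O'_def)
    qed
    have pO: "p ` O' \<subseteq> O'" using step m(2) by (auto simp: O'_def)
    have injp: "inj p" using p by (simp add: permutation_bijective bij_is_inj)
    have pO': "p ` O' = O'"
      using pO endo_inj_surj[OF _ pO] injp by (auto simp: O'_def inj_on_def inj_def)
    have "p ` (A - O') = A - O'" using less.prems(2) pO' image_set_diff[OF injp, of A O'] by simp
    moreover have "card (A - O') < card A"
    proof -
      have "x \<in> O'" using m(2) by (auto simp: O'_def intro!: image_eqI[of _ _ 0])
      then show ?thesis using x less.prems(1) by (intro psubset_card_mono) auto
    qed
    ultimately obtain la f where la: "\<forall>l\<in>set la. l > 0" and f: "bij_betw f (diagram la) (A - O')"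
      and pf: "\<forall>i j. (i, j) \<in> diagram la \<longrightarrow> p (f (i, j)) = f (i, Suc j mod la ! i)"
      using less.hyps[of "A - O'"] less.prems(1) by auto
    define g where "g = (\<lambda>(i, j). case i of 0 \<Rightarrow> (p ^^ j) x | Suc i \<Rightarrow> f (i, j))"
    have diag: "diagram (m # la) = {0} \<times> {..<m} \<union> map_prod Suc id ` diagram la"
    proof -
      have "(i, j) \<in> diagram (m # la) \<longleftrightarrow> (i, j) \<in> {0} \<times> {..<m} \<union> map_prod Suc id ` diagram la" for i j
        by (cases i) (auto simp: diagram_def image_iff)
      then show ?thesis by auto
    qed
    have "bij_betw g (diagram (m # la)) (O' \<union> (A - O'))"
      unfolding diag
    proof (rule bij_betw_combine)
      show "bij_betw g ({0} \<times> {..<m}) O'"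
        using inj by (auto simp: bij_betw_def g_def O'_def inj_on_def image_iff)
      have "inj_on g (map_prod Suc id ` diagram la)"
        using f by (auto simp: bij_betw_def inj_on_def g_def)
      moreover have "g ` map_prod Suc id ` diagram la = f ` diagram la"
        by (force simp: g_def image_iff)
      ultimately show "bij_betw g (map_prod Suc id ` diagram la) (A - O')"
        using f by (auto simp: bij_betw_def)
    qed auto
    moreover have "O' \<union> (A - O') = A" using OA by auto
    moreover have "p (g (i, j)) = g (i, Suc j mod (m # la) ! i)" if "(i, j) \<in> diagram (m # la)" for i j
      using that step pf by (cases i) (auto simp: g_def diagram_def)
    ultimately show ?thesis using la m(2) by (intro exI[of _ "m # la"] exI[of _ g]) auto
  qed
qed

text \<open>Sorting the cycles by length makes the shape of \<open>cycle_decomposition_rows\<close> a partition.\<close>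

lemma cycle_decomposition:
  assumes p: "p permutes {..<n}"
  shows "\<exists>la\<in>partitions n. \<exists>f. bij_betw f (diagram la) {..<n} \<and>
    (\<forall>i j. (i, j) \<in> diagram la \<longrightarrow> p (f (i, j)) = f (i, Suc j mod la ! i))"
proof -
  have "permutation p" using p by (auto simp: permutation_permutes)
  from cycle_decomposition_rows[OF this, of "{..<n}"] permutes_image[OF p]
  obtain mu f where mu: "\<forall>l\<in>set mu. l > 0" and f: "bij_betw f (diagram mu) {..<n}"
    and pf: "\<And>i j. (i, j) \<in> diagram mu \<Longrightarrow> p (f (i, j)) = f (i, Suc j mod mu ! i)" by auto
  define la where "la = rev (sort mu)"
  have "mset la = mset mu" by (simp add: la_def)
  then obtain \<pi> where \<pi>: "\<pi> permutes {..<length mu}" "permute_list \<pi> mu = la"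
    by (rule mset_eq_permutation)
  have len: "length la = length mu" by (simp add: la_def)
  have nth: "la ! i = mu ! \<pi> i" if "i < length mu" for i
    using that \<pi> by (metis permute_list_nth)
  have \<pi>l: "\<pi> i < length mu \<longleftrightarrow> i < length mu" for i using permutes_in_image[OF \<pi>(1), of i] by simp
  have d: "(i, j) \<in> diagram la \<longleftrightarrow> (\<pi> i, j) \<in> diagram mu" for i j
    using nth[of i] by (auto simp: diagram_def \<pi>l len)
  have "bij_betw (\<lambda>(i, j). (\<pi> i, j)) (diagram la) (diagram mu)"
  proof (rule bij_betw_byWitness[where f' = "\<lambda>(i, j). (inv \<pi> i, j)"])
    have "\<pi> (inv \<pi> i) = i" for i by (rule permutes_inverses(1)[OF \<pi>(1)])
    then show "(\<lambda>(i, j). (inv \<pi> i, j)) ` diagram mu \<subseteq> diagram la" by (auto simp: d)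
  qed (auto simp: d permutes_inverses[OF \<pi>(1)])
  from bij_betw_trans[OF this f] have bij: "bij_betw (f \<circ> (\<lambda>(i, j). (\<pi> i, j))) (diagram la) {..<n}" .
  have "sum_list la = n"
    using bij_betw_same_card[OF bij] by (simp add: card_diagram)
  moreover have "sorted_wrt (\<ge>) la" by (simp add: la_def sorted_wrt_rev)
  ultimately have "la \<in> partitions n" using mu by (auto simp: partitions_def la_def)
  moreover have "p ((f \<circ> (\<lambda>(i, j). (\<pi> i, j))) (i, j)) = (f \<circ> (\<lambda>(i, j). (\<pi> i, j))) (i, Suc j mod la ! i)"
    if "(i, j) \<in> diagram la" for i j
    using that pf[of "\<pi> i" j] nth[of i] by (auto simp: d diagram_def \<pi>l len)
  ultimately show ?thesis using bij by blast
qed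

text \<open>The label is the shape of a decomposition into cycles.  Two permutations with the same label are
conjugated by the bijection that matches their diagrams of cycles.  It follows that there are no more
conjugacy classes than partitions.\<close>

lemma conjugacy_class_labels:
  "\<exists>ct. (\<forall>p\<in>Sym n. ct p \<in> partitions n) \<and>
    (\<forall>p\<in>Sym n. \<forall>q\<in>Sym n. ct p = ct q \<longrightarrow> (\<exists>h\<in>Sym n. q = h \<circ> p \<circ> inv h))"
proof -
  have "\<forall>p\<in>Sym n. \<exists>la. la \<in> partitions n \<and> (\<exists>f. bij_betw f (diagram la) {..<n} \<and>
    (\<forall>i j. (i, j) \<in> diagram la \<longrightarrow> p (f (i, j)) = f (i, Suc j mod la ! i)))"
    using cycle_decomposition by blast
  from bchoice[OF this] obtain ct where ct: "\<And>p. p permutes {..<n} \<Longrightarrow> ct p \<in> partitions n"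
    and ex: "\<And>p. p permutes {..<n} \<Longrightarrow> \<exists>f. bij_betw f (diagram (ct p)) {..<n} \<and>
    (\<forall>i j. (i, j) \<in> diagram (ct p) \<longrightarrow> p (f (i, j)) = f (i, Suc j mod ct p ! i))" by auto
  have "\<exists>h\<in>Sym n. q = h \<circ> p \<circ> inv h" if p: "p permutes {..<n}" and q: "q permutes {..<n}" and eq: "ct p = ct q" for p q
  proof -
    obtain f where f: "bij_betw f (diagram (ct p)) {..<n}"
      and pf: "\<And>i j. (i, j) \<in> diagram (ct p) \<Longrightarrow> p (f (i, j)) = f (i, Suc j mod ct p ! i)" using ex[OF p] by blast
    obtain g where g: "bij_betw g (diagram (ct p)) {..<n}"
      and qg: "\<And>i j. (i, j) \<in> diagram (ct p) \<Longrightarrow> q (g (i, j)) = g (i, Suc j mod ct p ! i)"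
      using ex[OF q] eq by auto
    define h where "h e = (if e < n then g (the_inv_into (diagram (ct p)) f e) else e)" for e
    have hf: "h (f x) = g x" if "x \<in> diagram (ct p)" for x
      using that f bij_betw_apply[OF f that] by (simp add: h_def the_inv_into_f_f bij_betw_imp_inj_on)
    have "bij_betw (g \<circ> the_inv_into (diagram (ct p)) f) {..<n} {..<n}"
      by (rule bij_betw_trans[OF bij_betw_the_inv_into[OF f] g])
    moreover have "bij_betw h {..<n} {..<n} = bij_betw (g \<circ> the_inv_into (diagram (ct p)) f) {..<n} {..<n}"
      by (rule bij_betw_cong) (auto simp: h_def)
    ultimately have h: "h permutes {..<n}" by (intro bij_imp_permutes) (auto simp: h_def)
    have "h (p e) = q (h e)" for e
    proof (cases "e < n")
      case True
      then obtain i j where ij: "(i, j) \<in> diagram (ct p)" "e = f (i, j)"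
        using bij_betw_imp_surj_on[OF f] by (metis imageE lessThan_iff surj_pair)
      have "(i, Suc j mod ct p ! i) \<in> diagram (ct p)" using ij(1) by (auto simp: diagram_def)
      then show ?thesis using pf[OF ij(1)] qg[OF ij(1)] hf ij by simp
    next
      case False
      then show ?thesis using p q by (simp add: h_def permutes_not_in)
    qed
    then have "h \<circ> p = q \<circ> h" by auto
    then have "h \<circ> p \<circ> inv h = q" by (metis (no_types, lifting) comp_assoc comp_id permutes_inv_o(1) h)
    then show ?thesis using h by auto
  qed
  then show ?thesis using ct by (intro exI[of _ ct]) auto
qed

section \<open>Matrix coefficients of Specht modules\<close>

text \<open>The bases are indexed by initial segments, so \<open>dm la\<close> is the dimension.\<close>

locale specht_bases =
  fixes n :: nat and dm :: "nat list \<Rightarrow> nat" and b :: "nat list \<Rightarrow> nat \<Rightarrow> tabloid \<Rightarrow> 'k::field_char_0"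
  assumes fb: "la \<in> partitions n \<Longrightarrow> family_basis (pscale (*)) (specht la) {..<dm la} (b la)"
begin

abbreviation cf :: "nat list \<Rightarrow> (tabloid \<Rightarrow> 'k) \<Rightarrow> nat \<Rightarrow> 'k" where
  "cf la \<equiv> coords (pscale (*)) {..<dm la} (b la)"

definition rho :: "nat list \<Rightarrow> (nat \<Rightarrow> nat) \<Rightarrow> nat \<Rightarrow> nat \<Rightarrow> 'k" where
  "rho la p i j = cf la (specht_act p (b la j)) i"

lemma b_in: "la \<in> partitions n \<Longrightarrow> i < dm la \<Longrightarrow> b la i \<in> specht la"
  using family_basisD(2)[OF fb] by auto

lemma act_b:
  assumes "la \<in> partitions n" "p permutes {..<n}" "j < dm la"
  shows "specht_act p (b la j) = (\<Sum>i<dm la. pscale (*) (rho la p i j) (b la i))"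
  unfolding rho_def by (rule coords_expand[OF fb[OF assms(1)], symmetric])
    (rule specht_act_in_specht[OF assms(1,2) b_in[OF assms(1,3)]])

lemma act_vector:
  assumes la: "la \<in> partitions n" and p: "p permutes {..<n}" and x: "x \<in> specht la" and i: "i < dm la"
  shows "cf la (specht_act p x) i = (\<Sum>j<dm la. rho la p i j * cf la x j)"
proof -
  have "specht_act p x = specht_act p (\<Sum>j<dm la. pscale (*) (cf la x j) (b la j))"
    using coords_expand[OF fb[OF la] x] by simp
  also have "\<dots> = (\<Sum>j<dm la. pscale (*) (cf la x j) (specht_act p (b la j)))"
    by (simp only: specht.act_sum[OF p] specht.act_scale[OF p])
  finally have eq: "specht_act p x = (\<Sum>j<dm la. pscale (*) (cf la x j) (specht_act p (b la j)))" .
  have "cf la (specht_act p x) i = (\<Sum>j<dm la. cf la x j * cf la (specht_act p (b la j)) i)"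
    unfolding eq using i by (intro funs.coords_sum[OF fb[OF la]] specht_act_in_specht[OF la p] b_in[OF la]) simp_all
  then show ?thesis unfolding rho_def by (simp only: mult.commute)
qed

lemma rho_comp:
  assumes la: "la \<in> partitions n" and p: "p permutes {..<n}" and q: "q permutes {..<n}"
    and ij: "i < dm la" "j < dm la"
  shows "rho la (p \<circ> q) i j = (\<Sum>k<dm la. rho la p i k * rho la q k j)"
  using act_vector[OF la p specht_act_in_specht[OF la q b_in[OF la ij(2)]] ij(1)]
  unfolding rho_def specht.act_comp[OF p q] .

lemma rho_id:
  assumes la: "la \<in> partitions n" and ij: "i < dm la" "j < dm la"
  shows "rho la id i j = (if i = j then 1 else 0)"
  unfolding rho_def specht.act_id using ij by (intro funs.coords_basis[OF fb[OF la]]) auto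

lemma dm_pos:
  assumes la: "la \<in> partitions n"
  shows "dm la > 0"
proof (rule ccontr)
  assume 0: "\<not> dm la > 0"
  obtain t where "tableau n la t" using tableau_exists[OF la] by blast
  then interpret tableau n la t .
  have "polytabloid la t = (\<Sum>j<dm la. pscale (*) (cf la (polytabloid la t) j) (b la j))"
    by (rule coords_expand[OF fb[OF la] polytabloid_in_specht, symmetric])
  then have "polytabloid la t = (0 :: tabloid \<Rightarrow> 'k)" using 0 by simp
  then show False using polytabloid_nonzero by blast
qed

text \<open>The matrix coefficients of all Specht modules are linearly independent functions on the group.
  In a relation, take a shape \<open>\<lambda>\<close> of largest weight that occurs.  A column alternator for \<open>\<lambda>\<close> kills
  the other shapes and has rank one on the Specht module of \<open>\<lambda>\<close>; its translates are enough to
  separate all matrix coefficients.\<close>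

lemma matrix_coefficients_independent:
  assumes rel: "\<And>p. p permutes {..<n} \<Longrightarrow>
      (\<Sum>la\<in>partitions n. \<Sum>i<dm la. \<Sum>j<dm la. c la i j * rho la p i j) = 0"
    and "la \<in> partitions n" "i < dm la" "j < dm la"
  shows "c la i j = 0"
proof (rule ccontr)
  define S where "S = {la \<in> partitions n. \<exists>i<dm la. \<exists>j<dm la. c la i j \<noteq> 0}"
  assume "c la i j \<noteq> 0"
  then have "la \<in> S" using assms by (auto simp: S_def)
  moreover have fS: "finite S" using finite_partitions[of n] by (simp add: S_def)
  ultimately have "Max (weight ` S) \<in> weight ` S" by (intro Max_in) auto
  then obtain nu where nu: "nu \<in> S" and "Max (weight ` S) = weight nu" by blast
  then have max: "weight mu \<le> weight nu" if "mu \<in> S" for mu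
    using Max_ge[of "weight ` S" "weight mu"] fS that by simp
  have nup: "nu \<in> partitions n" using nu by (simp add: S_def)
  obtain t where tab: "tableau n nu t" using tableau_exists[OF nup] by blast
  interpret tableau n nu t by (rule tab)
  let ?C = "column_stabilizer nu t" and ?e = "polytabloid nu t :: tabloid \<Rightarrow> 'k"
  have Cp: "q permutes {..<n}" if "q \<in> ?C" for q using that by (rule column_stabilizer_permutes)
  \<comment> \<open>On the Specht module of \<open>\<nu>\<close>, the alternator is \<open>x \<mapsto> \<phi> x\<close> times the polytabloid \<open>?e\<close>.\<close>
  define \<phi> where "\<phi> x = specht.colsum nu t x (tabloid_of nu t)" for x :: "tabloid \<Rightarrow> 'k"
  \<comment> \<open>The alternating sum of the relation at \<open>\<sigma> q \<tau>\<close>, where \<open>q\<close> runs through the column stabilizer.\<close>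
  have "(\<Sum>i<dm nu. \<Sum>j<dm nu. c nu i j * (\<phi> (specht_act \<tau> (b nu j)) * cf nu (specht_act \<sigma> ?e) i)) = 0"
    if \<sigma>: "\<sigma> permutes {..<n}" and \<tau>: "\<tau> permutes {..<n}" for \<sigma> \<tau>
  proof -
    have coef: "(\<Sum>q\<in>?C. of_int (sign q) * rho mu (\<sigma> \<circ> (q \<circ> \<tau>)) i j) =
        cf mu (specht_act \<sigma> (specht.colsum nu t (specht_act \<tau> (b mu j)))) i"
      if mu: "mu \<in> partitions n" and ij: "i < dm mu" "j < dm mu" for mu i j
    proof -
      have eq: "specht_act \<sigma> (specht.colsum nu t (specht_act \<tau> (b mu j))) =
          (\<Sum>q\<in>?C. pscale (*) (of_int (sign q)) (specht_act (\<sigma> \<circ> (q \<circ> \<tau>)) (b mu j)))"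
        unfolding specht.colsum_def specht.act_sum[OF \<sigma>]
        by (rule sum.cong[OF refl]) (simp only: specht.act_scale[OF \<sigma>] specht.act_comp[OF \<sigma> permutes_compose[OF \<tau> Cp]]
            specht.act_comp[OF Cp \<tau>])
      have "cf mu (specht_act \<sigma> (specht.colsum nu t (specht_act \<tau> (b mu j)))) i = (\<Sum>q\<in>?C. of_int (sign q) * cf mu (specht_act (\<sigma> \<circ> (q \<circ> \<tau>)) (b mu j)) i)"
        unfolding eq using ij by (intro funs.coords_sum[OF fb[OF mu]] specht_act_in_specht[OF mu] b_in[OF mu]
            permutes_compose \<sigma> \<tau> Cp) simp_all
      then show ?thesis unfolding rho_def by (rule sym)
    qed
    have other: "(\<Sum>i<dm mu. \<Sum>j<dm mu. c mu i j * cf mu (specht_act \<sigma> (specht.colsum nu t (specht_act \<tau> (b mu j)))) i) = 0"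
      if mu: "mu \<in> partitions n - {nu}" for mu
    proof (cases "mu \<in> S")
      case True
      have "cf mu (specht_act \<sigma> (specht.colsum nu t (specht_act \<tau> (b mu j)))) i = 0" if "i < dm mu" "j < dm mu" for i j
      proof -
        have "specht.colsum nu t (specht_act \<tau> (b mu j)) = 0"
          using mu that by (intro colsum_specht_other[OF tab _ _ max[OF True]] specht_act_in_specht[OF _ \<tau>] b_in) auto
        moreover have "cf mu 0 i = 0"
          by (rule funs.coords_eqI[OF fb]) (use mu that in auto)
        ultimately show ?thesis by (simp only: specht.act_0[OF \<sigma>])
      qed
      then show ?thesis by simp
    next
      case False
      then show ?thesis using mu by (auto simp: S_def)
    qed
    have "0 = (\<Sum>q\<in>?C. of_int (sign q) * (\<Sum>la\<in>partitions n. \<Sum>i<dm la. \<Sum>j<dm la. c la i j * rho la (\<sigma> \<circ> (q \<circ> \<tau>)) i j))"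
      using rel[OF permutes_compose[OF permutes_compose[OF \<tau> Cp] \<sigma>]] by simp
    also have "\<dots> = (\<Sum>la\<in>partitions n. \<Sum>i<dm la. \<Sum>j<dm la. c la i j * (\<Sum>q\<in>?C. of_int (sign q) * rho la (\<sigma> \<circ> (q \<circ> \<tau>)) i j))"
      unfolding sum_distrib_left
      by (subst sum.swap, rule sum.cong[OF refl], subst sum.swap, rule sum.cong[OF refl], subst sum.swap, rule sum.cong[OF refl])
        (simp only: mult.left_commute)
    also have "\<dots> = (\<Sum>mu\<in>partitions n. \<Sum>i<dm mu. \<Sum>j<dm mu. c mu i j * cf mu (specht_act \<sigma> (specht.colsum nu t (specht_act \<tau> (b mu j)))) i)"
      by (intro sum.cong refl) (simp add: coef)
    also have "\<dots> = (\<Sum>i<dm nu. \<Sum>j<dm nu. c nu i j * cf nu (specht_act \<sigma> (specht.colsum nu t (specht_act \<tau> (b nu j)))) i)"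
      by (rule trans[OF sum.mono_neutral_right[of "partitions n" "{nu}"]])
        (rule finite_partitions, use nup in simp, rule ballI, erule other, simp)
    also have "\<dots> = (\<Sum>i<dm nu. \<Sum>j<dm nu. c nu i j * (\<phi> (specht_act \<tau> (b nu j)) * cf nu (specht_act \<sigma> ?e) i))"
    proof (intro sum.cong refl)
      fix i j assume ij: "i \<in> {..<dm nu}" "j \<in> {..<dm nu}"
      have "specht.colsum nu t (specht_act \<tau> (b nu j)) = pscale (*) (\<phi> (specht_act \<tau> (b nu j))) ?e"
        unfolding \<phi>_def using ij by (intro colsum_specht_same[OF tab nup] specht_act_in_specht[OF nup \<tau>] b_in[OF nup]) auto
      then have "specht_act \<sigma> (specht.colsum nu t (specht_act \<tau> (b nu j))) =
          (\<Sum>k\<in>{0::nat}. pscale (*) (\<phi> (specht_act \<tau> (b nu j))) (specht_act \<sigma> ?e))"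
        by (simp only: specht.act_scale[OF \<sigma>]) simp
      then show "c nu i j * cf nu (specht_act \<sigma> (specht.colsum nu t (specht_act \<tau> (b nu j)))) i =
          c nu i j * (\<phi> (specht_act \<tau> (b nu j)) * cf nu (specht_act \<sigma> ?e) i)"
        using ij by (simp only: funs.coords_sum[OF fb[OF nup] specht_act_in_specht[OF nup \<sigma> polytabloid_in_specht]]) simp
    qed
    finally show ?thesis by simp
  qed
  note rel' = this
  \<comment> \<open>The translates of \<open>?e\<close> by \<open>\<sigma>\<close> span the module, which eliminates \<open>\<sigma>\<close> and \<open>i\<close>.\<close>
  have key: "(\<Sum>j<dm nu. c nu i j * \<phi> (specht_act \<tau> (b nu j))) = 0"
    if \<tau>: "\<tau> permutes {..<n}" and i: "i < dm nu" for \<tau> i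
  proof -
    define d where "d i = (\<Sum>j<dm nu. c nu i j * \<phi> (specht_act \<tau> (b nu j)))" for i
    have L: "(\<Sum>i<dm nu. d i * cf nu (specht_act \<sigma> ?e) i) = 0" if "\<sigma> permutes {..<n}" for \<sigma>
      using rel'[OF that \<tau>] by (simp add: d_def sum_distrib_right mult.assoc)
    have "x \<in> specht nu \<and> (\<Sum>i<dm nu. d i * cf nu x i) = 0" if "x \<in> specht nu" for x
      using that[unfolded specht_eq_span_orbit]
    proof (induction rule: funs.span_induct_alt)
      case base
      have "cf nu 0 i = 0" if "i < dm nu" for i by (rule funs.coords_eqI[OF fb[OF nup]]) (use that in auto)
      then have "(\<Sum>i<dm nu. d i * cf nu 0 i) = 0" by simp
      then show ?case using funs.subspace_0[OF specht_subspace[of nu]] by blast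
    next
      case (step a x y)
      then obtain \<sigma> where \<sigma>: "\<sigma> permutes {..<n}" "x = specht_act \<sigma> ?e" by auto
      have xs: "x \<in> specht nu" unfolding \<sigma>(2) by (rule specht_act_in_specht[OF nup \<sigma>(1) polytabloid_in_specht])
      have "cf nu (pscale (*) a x + y) i = a * cf nu x i + cf nu y i" if "i < dm nu" for i
        using xs step.IH that funs.subspace_scale[OF specht_subspace xs]
        by (simp add: funs.coords_add_scale[OF fb[OF nup] specht_subspace])
      then have C: "(\<Sum>i<dm nu. d i * cf nu (pscale (*) a x + y) i) =
          a * (\<Sum>i<dm nu. d i * cf nu x i) + (\<Sum>i<dm nu. d i * cf nu y i)"
        by (simp add: sum_distrib_left distrib_left sum.distrib mult.left_commute)
      have A: "(\<Sum>i<dm nu. d i * cf nu y i) = 0" using step.IH by blast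
      have B: "(\<Sum>i<dm nu. d i * cf nu x i) = 0" using L[OF \<sigma>(1)] \<sigma>(2) by (simp only:)
      have "(\<Sum>i<dm nu. d i * cf nu (pscale (*) a x + y) i) = 0" unfolding C A B by simp
      then show ?case using step.IH xs
        by (blast intro: funs.subspace_add funs.subspace_scale specht_subspace)
    qed
    from this[OF b_in[OF nup i]] have "(\<Sum>k<dm nu. d k * cf nu (b nu i) k) = 0" by simp
    moreover have "(\<Sum>k<dm nu. d k * cf nu (b nu i) k) = (\<Sum>k<dm nu. if k = i then d k else 0)"
      using i by (intro sum.cong refl) (simp add: funs.coords_basis[OF fb[OF nup]])
    ultimately show ?thesis using i by (simp add: d_def)
  qed
  have "c nu i j = 0" if i: "i < dm nu" and j: "j < dm nu" for i j
  proof -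
    \<comment> \<open>All alternators kill the vector with the coordinates \<open>c nu i j\<close>, hence it is zero.\<close>
    define v where "v = (\<Sum>j<dm nu. pscale (*) (c nu i j) (b nu j))"
    have v: "v \<in> specht nu" unfolding v_def
      by (intro funs.subspace_sum funs.subspace_scale specht_subspace b_in[OF nup]) auto
    have "specht.colsum nu t (specht_act \<tau> v) = 0" if \<tau>: "\<tau> permutes {..<n}" for \<tau>
    proof -
      interpret ff: vector_space_pair "pscale (*) :: 'k \<Rightarrow> (tabloid \<Rightarrow> 'k) \<Rightarrow> _" "pscale (*) :: 'k \<Rightarrow> (tabloid \<Rightarrow> 'k) \<Rightarrow> _" ..
      have lin: "Vector_Spaces.linear (pscale (*)) (pscale (*)) (specht.colsum nu t :: (tabloid \<Rightarrow> 'k) \<Rightarrow> _)"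
        unfolding Vector_Spaces.linear_iff by (intro conjI allI specht.colsum_linear[OF tab] funs.vector_space_axioms)
      have "specht.colsum nu t (specht_act \<tau> v) = (\<Sum>j<dm nu. pscale (*) (c nu i j) (specht.colsum nu t (specht_act \<tau> (b nu j))))"
        unfolding v_def specht.act_sum[OF \<tau>] specht.act_scale[OF \<tau>] ff.linear_sum[OF lin] ff.linear_scale[OF lin] ..
      also have "\<dots> = (\<Sum>j<dm nu. pscale (*) (c nu i j * \<phi> (specht_act \<tau> (b nu j))) ?e)"
      proof (rule sum.cong[OF refl])
        fix j assume "j \<in> {..<dm nu}"
        then have "specht.colsum nu t (specht_act \<tau> (b nu j)) = pscale (*) (\<phi> (specht_act \<tau> (b nu j))) ?e"
          unfolding \<phi>_def by (intro colsum_specht_same[OF tab nup] specht_act_in_specht[OF nup \<tau>] b_in[OF nup]) auto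
        then show "pscale (*) (c nu i j) (specht.colsum nu t (specht_act \<tau> (b nu j))) =
            pscale (*) (c nu i j * \<phi> (specht_act \<tau> (b nu j))) ?e"
          by (simp only: funs.scale_scale)
      qed
      also have "\<dots> = 0" unfolding funs.scale_sum_left[symmetric] key[OF \<tau> i] by (rule funs.scale_zero_left)
      finally show ?thesis .
    qed
    then have "v = 0" by (rule colsum_nondegenerate[OF tab v])
    then show ?thesis using family_basisD(3)[OF fb[OF nup], of "c nu i" j] j by (simp only: v_def) simp
  qed
  then show False using nu by (auto simp: S_def)
qed

text \<open>The traces are as many independent class functions as there are partitions, and there are no more
  conjugacy classes than that, so they span all class functions.  The translates of the delta function
  are then combinations of matrix coefficients, which therefore span all functions on the group.\<close>

lemma delta_function_from_traces:
  "\<exists>a. \<forall>p. p permutes {..<n} \<longrightarrow> (\<Sum>la\<in>partitions n. a la * (\<Sum>i<dm la. rho la p i i)) = (if p = id then 1 else 0)"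
proof -
  define chi where "chi la p = (\<Sum>i<dm la. rho la p i i)" for la p
  have tr: "chi la (p \<circ> q) = chi la (q \<circ> p)" if "la \<in> partitions n" "p permutes {..<n}" "q permutes {..<n}" for la p q
  proof -
    have "chi la (p \<circ> q) = (\<Sum>i<dm la. \<Sum>k<dm la. rho la p i k * rho la q k i)"
      using that by (simp add: chi_def rho_comp)
    also have "\<dots> = chi la (q \<circ> p)"
      using that by (subst sum.swap) (simp add: chi_def rho_comp mult.commute)
    finally show ?thesis .
  qed
  obtain ct where ct: "\<And>p. p permutes {..<n} \<Longrightarrow> ct p \<in> partitions n"
    and conj: "\<And>p q. p permutes {..<n} \<Longrightarrow> q permutes {..<n} \<Longrightarrow> ct p = ct q \<Longrightarrow>
      \<exists>h. h permutes {..<n} \<and> q = h \<circ> p \<circ> inv h"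
    using conjugacy_class_labels[of n] unfolding mem_Collect_eq Ball_def Bex_def by blast
  have class_fun: "chi la p = chi la q"
    if la: "la \<in> partitions n" and p: "p permutes {..<n}" and q: "q permutes {..<n}" and eq: "ct p = ct q" for la p q
  proof -
    obtain h where h: "h permutes {..<n}" "q = h \<circ> p \<circ> inv h" using conj[OF p q eq] by blast
    have "chi la q = chi la (inv h \<circ> (h \<circ> p))"
      unfolding h(2) by (rule tr[OF la permutes_compose[OF p h(1)] permutes_inv[OF h(1)]])
    also have "inv h \<circ> (h \<circ> p) = p" by (simp add: fun_eq_iff permutes_inverses[OF h(1)])
    finally show ?thesis by simp
  qed
  \<comment> \<open>Class functions are functions of the label, evaluated at a representative.\<close>
  define rep where "rep x = (SOME p. p permutes {..<n} \<and> ct p = x)" for x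
  have rep: "rep (ct p) permutes {..<n}" "ct (rep (ct p)) = ct p" if "p permutes {..<n}" for p
    using someI[of "\<lambda>q. q permutes {..<n} \<and> ct q = ct p" p] that by (auto simp: rep_def)
  have "\<exists>a. \<forall>x\<in>ct ` Sym n. (if x = ct id then 1 else 0) = (\<Sum>la\<in>partitions n. a la * chi la (rep x))"
  proof (rule independent_functions_span)
    show "finite (partitions n)" by (rule finite_partitions)
    show "finite (ct ` Sym n)" by simp
    show "card (ct ` Sym n) \<le> card (partitions n)"
      by (rule card_mono[OF finite_partitions]) (use ct in auto)
    fix a assume a: "\<And>x. x \<in> ct ` Sym n \<Longrightarrow> (\<Sum>la\<in>partitions n. a la * chi la (rep x)) = 0"
    have "(\<Sum>la\<in>partitions n. \<Sum>i<dm la. \<Sum>j<dm la. (if i = j then a la else 0) * rho la p i j) = 0"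
      if p: "p permutes {..<n}" for p
    proof -
      have "(\<Sum>la\<in>partitions n. \<Sum>i<dm la. \<Sum>j<dm la. (if i = j then a la else 0) * rho la p i j) =
          (\<Sum>la\<in>partitions n. a la * chi la p)"
        by (rule sum.cong[OF refl])
          (simp add: chi_def sum_distrib_left if_distrib[of "\<lambda>c. c * _"] cong: if_cong)
      also have "\<dots> = (\<Sum>la\<in>partitions n. a la * chi la (rep (ct p)))"
        by (rule sum.cong[OF refl]) (simp add: class_fun[OF _ p rep(1)[OF p]] rep(2)[OF p])
      finally show ?thesis using a p by simp
    qed
    then have "(if (0::nat) = 0 then a la else 0) = 0" if "la \<in> partitions n" for la
      by (rule matrix_coefficients_independent[where c = "\<lambda>la i j. if i = j then a la else 0"])
        (use that dm_pos in auto)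
    then show "\<forall>la\<in>partitions n. a la = 0" by simp
  qed
  then obtain a where a: "\<And>p. p permutes {..<n} \<Longrightarrow>
      (if ct p = ct id then 1 else 0) = (\<Sum>la\<in>partitions n. a la * chi la (rep (ct p)))" by auto
  have "(\<Sum>la\<in>partitions n. a la * chi la p) = (if p = id then 1 else 0)" if p: "p permutes {..<n}" for p
  proof -
    \<comment> \<open>The identity is alone in its conjugacy class.\<close>
    have "ct p = ct id \<longleftrightarrow> p = id"
    proof
      assume "ct p = ct id"
      then obtain h where "h permutes {..<n}" "p = h \<circ> id \<circ> inv h" using conj[OF permutes_id p] by metis
      then show "p = id" by (simp add: permutes_inv_o)
    qed simp
    moreover have "(\<Sum>la\<in>partitions n. a la * chi la p) = (\<Sum>la\<in>partitions n. a la * chi la (rep (ct p)))"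
      by (rule sum.cong[OF refl]) (simp add: class_fun[OF _ p rep(1)[OF p]] rep(2)[OF p])
    ultimately show ?thesis using a[OF p] by simp
  qed
  then show ?thesis unfolding chi_def by blast
qed

end

text \<open>A complete system of irreducible matrix representations with its dual basis: \<open>u la i j\<close> is the
  element of the group algebra that acts as the matrix unit \<open>(i, j)\<close> on the representation \<open>la\<close> and as
  zero on the others.\<close>

locale matrix_units =
  fixes n :: nat and L :: "'l set" and dm :: "'l \<Rightarrow> nat"
    and rho :: "'l \<Rightarrow> (nat \<Rightarrow> nat) \<Rightarrow> nat \<Rightarrow> nat \<Rightarrow> 'k::field_char_0"
    and u :: "'l \<Rightarrow> nat \<Rightarrow> nat \<Rightarrow> (nat \<Rightarrow> nat) \<Rightarrow> 'k"
  assumes finite_L: "finite L" and dm_pos: "l \<in> L \<Longrightarrow> dm l > 0"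
    and rho_comp: "l \<in> L \<Longrightarrow> p permutes {..<n} \<Longrightarrow> q permutes {..<n} \<Longrightarrow> i < dm l \<Longrightarrow> j < dm l \<Longrightarrow>
        rho l (p \<circ> q) i j = (\<Sum>k<dm l. rho l p i k * rho l q k j)"
    and rho_id: "l \<in> L \<Longrightarrow> i < dm l \<Longrightarrow> j < dm l \<Longrightarrow> rho l id i j = (if i = j then 1 else 0)"
    and u_complete: "\<sigma> permutes {..<n} \<Longrightarrow> \<tau> permutes {..<n} \<Longrightarrow>
        (\<Sum>l\<in>L. \<Sum>i<dm l. \<Sum>j<dm l. u l i j \<sigma> * rho l \<tau> i j) = (if \<sigma> = \<tau> then 1 else 0)"
    and u_dual: "l \<in> L \<Longrightarrow> m \<in> L \<Longrightarrow> i < dm l \<Longrightarrow> j < dm l \<Longrightarrow> k < dm m \<Longrightarrow> r < dm m \<Longrightarrow>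
        (\<Sum>\<sigma>\<in>Sym n. u l i j \<sigma> * rho m \<sigma> k r) = (if l = m \<and> i = k \<and> j = r then 1 else 0)"

text \<open>Fourier inversion.  With the coefficients \<open>a \<lambda>\<close> of the delta function (classically the dimension
divided by \<open>n!\<close>), the dual basis is \<open>a \<lambda>\<close> times the transposed inverse matrix.  Completeness is the
trace formula for the delta function at \<open>\<tau> \<sigma>\<^sup>-\<^sup>1\<close>, and duality follows from completeness by the
independence of the matrix coefficients.\<close>

lemma (in specht_bases) matrix_units_exist: "\<exists>u. matrix_units n (partitions n) dm rho u"
proof -
  obtain a where a: "\<And>p. p permutes {..<n} \<Longrightarrow>
      (\<Sum>la\<in>partitions n. a la * (\<Sum>i<dm la. rho la p i i)) = (if p = id then 1 else 0)"
    using delta_function_from_traces by blast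
  define u where "u la i j \<sigma> = a la * rho la (inv \<sigma>) j i" for la i j \<sigma>
  have complete: "(\<Sum>l\<in>partitions n. \<Sum>i<dm l. \<Sum>j<dm l. u l i j \<sigma> * rho l \<tau> i j) = (if \<sigma> = \<tau> then 1 else 0)"
    if \<sigma>: "\<sigma> permutes {..<n}" and \<tau>: "\<tau> permutes {..<n}" for \<sigma> \<tau>
  proof -
    have "(\<Sum>l\<in>partitions n. \<Sum>i<dm l. \<Sum>j<dm l. u l i j \<sigma> * rho l \<tau> i j) =
        (\<Sum>l\<in>partitions n. a l * (\<Sum>i<dm l. rho l (\<tau> \<circ> inv \<sigma>) i i))"
      using \<tau> permutes_inv[OF \<sigma>]
      by (intro sum.cong refl) (simp add: u_def rho_comp sum_distrib_left mult_ac)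
    also have "\<dots> = (if \<tau> \<circ> inv \<sigma> = id then 1 else 0)"
      by (rule a[OF permutes_compose[OF permutes_inv[OF \<sigma>] \<tau>]])
    also have "\<tau> \<circ> inv \<sigma> = id \<longleftrightarrow> \<sigma> = \<tau>"
    proof
      assume "\<tau> \<circ> inv \<sigma> = id"
      then have "\<tau> \<circ> inv \<sigma> \<circ> \<sigma> = \<sigma>" by simp
      then show "\<sigma> = \<tau>" by (simp add: comp_assoc permutes_inv_o[OF \<sigma>])
    qed (simp add: permutes_inv_o[OF \<tau>])
    finally show ?thesis by simp
  qed
  have "matrix_units n (partitions n) dm rho u"
  proof
    fix l m i j k q assume l: "l \<in> partitions n" "i < dm l" "j < dm l" and m: "m \<in> partitions n" "k < dm m" "q < dm m"
    \<comment> \<open>By completeness, both terms are the coefficients of \<open>rho m _ k q\<close> in the matrix coefficients.\<close>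
    define D where "D l i j = (\<Sum>\<sigma>\<in>Sym n. u l i j \<sigma> * rho m \<sigma> k q) - (if l = m \<and> i = k \<and> j = q then 1 else 0)" for l i j
    have "D l i j = 0"
    proof (rule matrix_coefficients_independent[OF _ l])
      fix \<tau> assume \<tau>: "\<tau> permutes {..<n}"
      have "(\<Sum>l\<in>partitions n. \<Sum>i<dm l. \<Sum>j<dm l. (\<Sum>\<sigma>\<in>Sym n. u l i j \<sigma> * rho m \<sigma> k q) * rho l \<tau> i j) =
          (\<Sum>\<sigma>\<in>Sym n. rho m \<sigma> k q * (\<Sum>l\<in>partitions n. \<Sum>i<dm l. \<Sum>j<dm l. u l i j \<sigma> * rho l \<tau> i j))"
        unfolding sum_distrib_left sum_distrib_right
        by (subst (2) sum.swap, rule sum.cong[OF refl], subst (2) sum.swap, rule sum.cong[OF refl],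
            subst (2) sum.swap, rule sum.cong[OF refl]) (simp add: mult_ac)
      also have "\<dots> = (\<Sum>\<sigma>\<in>Sym n. if \<sigma> = \<tau> then rho m \<sigma> k q else 0)"
        by (intro sum.cong refl) (simp add: complete[OF _ \<tau>])
      also have "\<dots> = rho m \<tau> k q" using \<tau> by simp
      finally have 1: "(\<Sum>l\<in>partitions n. \<Sum>i<dm l. \<Sum>j<dm l. (\<Sum>\<sigma>\<in>Sym n. u l i j \<sigma> * rho m \<sigma> k q) * rho l \<tau> i j) = rho m \<tau> k q" .
      have "(\<Sum>l\<in>partitions n. \<Sum>i<dm l. \<Sum>j<dm l. (if l = m \<and> i = k \<and> j = q then 1 else 0) * rho l \<tau> i j) =
          (\<Sum>l\<in>partitions n. if l = m then rho m \<tau> k q else 0)"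
      proof (rule sum.cong[OF refl])
        fix l
        show "(\<Sum>i<dm l. \<Sum>j<dm l. (if l = m \<and> i = k \<and> j = q then 1 else 0) * rho l \<tau> i j) =
            (if l = m then rho m \<tau> k q else 0)"
        proof (cases "l = m")
          case True
          have "(\<Sum>j<dm m. (if i = k \<and> j = q then 1 else 0) * rho m \<tau> i j) = (if i = k then rho m \<tau> k q else 0)" for i
            using m by (cases "i = k") (simp_all add: if_distrib[of "\<lambda>c. c * _"] cong: if_cong)
          then show ?thesis using True m by simp
        qed simp
      qed
      also have "\<dots> = rho m \<tau> k q" using m finite_partitions[of n] by simp
      finally show "(\<Sum>l\<in>partitions n. \<Sum>i<dm l. \<Sum>j<dm l. D l i j * rho l \<tau> i j) = 0"
        using 1 by (simp add: D_def left_diff_distrib sum_subtractf)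
    qed
    then show "(\<Sum>\<sigma>\<in>Sym n. u l i j \<sigma> * rho m \<sigma> k q) = (if l = m \<and> i = k \<and> j = q then 1 else 0)"
      by (simp add: D_def)
  qed (use finite_partitions dm_pos rho_comp rho_id complete in auto)
  then show ?thesis by blast
qed

lemma specht_bases_exist: "\<exists>dm (b :: nat list \<Rightarrow> nat \<Rightarrow> tabloid \<Rightarrow> 'k::field_char_0). specht_bases n dm b"
proof -
  have "\<exists>b. family_basis (pscale (*)) (specht la :: (tabloid \<Rightarrow> 'k) set) {..<funs.dim (specht la :: (tabloid \<Rightarrow> 'k) set)} b"
    if la: "la \<in> partitions n" for la
  proof -
    obtain t where "tableau n la t" using tableau_exists[OF la] by blast
    then interpret tableau n la t .
    show ?thesis by (rule funs.family_basis_exists[of _ "(\<lambda>p. specht_act p (polytabloid la t)) ` Sym n"])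
      (simp_all add: specht_eq_span_orbit)
  qed
  then have "\<forall>la\<in>partitions n. \<exists>b. family_basis (pscale (*)) (specht la :: (tabloid \<Rightarrow> 'k) set)
      {..<funs.dim (specht la :: (tabloid \<Rightarrow> 'k) set)} b" by blast
  from bchoice[OF this] obtain b :: "nat list \<Rightarrow> nat \<Rightarrow> tabloid \<Rightarrow> 'k" where "\<forall>la\<in>partitions n.
      family_basis (pscale (*)) (specht la) {..<funs.dim (specht la :: (tabloid \<Rightarrow> 'k) set)} (b la)" ..
  then have "specht_bases n (\<lambda>la. funs.dim (specht la :: (tabloid \<Rightarrow> 'k) set)) b"
    unfolding specht_bases_def by blast
  then show ?thesis by blast
qed

section \<open>Decomposition of representations\<close>

lemma linear_on_sum:
  assumes s: "vector_space s1" "vector_space s2" and X: "module.subspace s1 X" and lin: "linear_on s1 s2 X \<phi>"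
    and y: "\<And>j. j \<in> J \<Longrightarrow> y j \<in> X"
  shows "\<phi> (\<Sum>j\<in>J. s1 (c j) (y j)) = (\<Sum>j\<in>J. s2 (c j) (\<phi> (y j)))"
proof -
  interpret V: vector_space s1 by fact
  interpret W: vector_space s2 by fact
  have \<phi>0: "\<phi> 0 = 0"
    using lin V.subspace_0[OF X] V.scale_zero_left[of 0] W.scale_zero_left unfolding linear_on_def by metis
  show ?thesis using y
  proof (induction J rule: infinite_finite_induct)
    case (insert j J)
    have "\<phi> (s1 (c j) (y j) + (\<Sum>j\<in>J. s1 (c j) (y j))) = \<phi> (s1 (c j) (y j)) + \<phi> (\<Sum>j\<in>J. s1 (c j) (y j))"
      using lin insert.prems unfolding linear_on_def
      by (meson V.subspace_scale[OF X] V.subspace_sum[OF X] insertCI)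
    moreover have "\<phi> (s1 (c j) (y j)) = s2 (c j) (\<phi> (y j))"
      using lin insert.prems unfolding linear_on_def by simp
    ultimately show ?case using insert by simp
  qed (simp_all add: \<phi>0)
qed

text \<open>A representation on \<open>X\<close> written in a basis \<open>y\<close>.\<close>

definition matrix_rep_on ::
    "('k::field \<Rightarrow> 'a::ab_group_add \<Rightarrow> 'a) \<Rightarrow> nat \<Rightarrow> ((nat \<Rightarrow> nat) \<Rightarrow> 'a \<Rightarrow> 'a) \<Rightarrow> 'a set \<Rightarrow> 'j set \<Rightarrow>
     ('j \<Rightarrow> 'a) \<Rightarrow> ((nat \<Rightarrow> nat) \<Rightarrow> 'j \<Rightarrow> 'j \<Rightarrow> 'k) \<Rightarrow> bool" where
  "matrix_rep_on s n act X J y M \<longleftrightarrow> family_basis s X J y \<and>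
     (\<forall>p. p permutes {..<n} \<longrightarrow> (\<forall>j\<in>J. act p (y j) = (\<Sum>k\<in>J. s (M p k j) (y k))))"

lemma matrix_rep_onD:
  assumes "matrix_rep_on s n act X J y M"
  shows "family_basis s X J y"
    and "p permutes {..<n} \<Longrightarrow> j \<in> J \<Longrightarrow> act p (y j) = (\<Sum>k\<in>J. s (M p k j) (y k))"
  using assms unfolding matrix_rep_on_def by auto

text \<open>A basis with the same matrices is carried over by the isomorphism.\<close>

lemma rep_isomorphic_matrix_rep:
  assumes s: "sym_rep s1 n act1" "sym_rep s2 n act2"
    and X: "module.subspace s1 X" and inv: "\<And>p x. p permutes {..<n} \<Longrightarrow> x \<in> X \<Longrightarrow> act1 p x \<in> X"
    and iso: "rep_isomorphic n s1 act1 X s2 act2 Y" and Y: "matrix_rep_on s2 n act2 Y J e M"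
  shows "\<exists>y. matrix_rep_on s1 n act1 X J y M"
proof -
  interpret V: sym_rep s1 n act1 by fact
  interpret W: sym_rep s2 n act2 by fact
  obtain \<phi> where lin: "linear_on s1 s2 X \<phi>" and bij: "bij_betw \<phi> X Y"
    and eqv: "\<And>p x. p permutes {..<n} \<Longrightarrow> x \<in> X \<Longrightarrow> \<phi> (act1 p x) = act2 p (\<phi> x)"
    using iso unfolding rep_isomorphic_def by blast
  note fbY = matrix_rep_onD(1)[OF Y]
  define y where "y j = inv_into X \<phi> (e j)" for j
  have yX: "y j \<in> X" and \<phi>y: "\<phi> (y j) = e j" if "j \<in> J" for j
    using family_basisD(2)[OF fbY that] bij by (auto simp: y_def bij_betw_def inv_into_into f_inv_into_f)
  have \<phi>sum: "\<phi> (\<Sum>j\<in>J. s1 (c j) (y j)) = (\<Sum>j\<in>J. s2 (c j) (e j))" for c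
    using linear_on_sum[OF V.vector_space_axioms W.vector_space_axioms X lin yX, of J] \<phi>y by simp
  have sumX: "(\<Sum>j\<in>J. s1 (c j) (y j)) \<in> X" for c
    by (intro V.subspace_sum[OF X] V.subspace_scale[OF X] yX)
  have inj: "x = x'" if "\<phi> x = \<phi> x'" "x \<in> X" "x' \<in> X" for x x'
    using bij that by (auto simp: bij_betw_def inj_on_def)
  have "family_basis s1 X J y"
    unfolding family_basis_def
  proof (intro conjI allI impI)
    show "finite J" by (rule family_basisD(1)[OF fbY])
    show "y ` J \<subseteq> X" using yX by auto
    fix c assume "(\<Sum>j\<in>J. s1 (c j) (y j)) = 0"
    then have "(\<Sum>j\<in>J. s1 (c j) (y j)) = (\<Sum>j\<in>J. s1 0 (y j))" by simp
    then have "(\<Sum>j\<in>J. s2 (c j) (e j)) = (\<Sum>j\<in>J. s2 0 (e j))" using \<phi>sum[of c] \<phi>sum[of "\<lambda>_. 0"] by simp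
    then show "\<forall>j\<in>J. c j = 0" by (simp add: W.sum_scale_eq_iff[OF fbY, of c "\<lambda>_. 0", symmetric])
  next
    show "\<forall>x\<in>X. \<exists>c. x = (\<Sum>j\<in>J. s1 (c j) (y j))"
    proof
      fix x assume x: "x \<in> X"
      then have "\<phi> x \<in> Y" using bij by (auto simp: bij_betw_def)
      then obtain c where "\<phi> x = (\<Sum>j\<in>J. s2 (c j) (e j))" using fbY unfolding family_basis_def by blast
      then show "\<exists>c. x = (\<Sum>j\<in>J. s1 (c j) (y j))" using inj[OF _ x sumX] \<phi>sum by metis
    qed
  qed
  moreover have "act1 p (y j) = (\<Sum>k\<in>J. s1 (M p k j) (y k))" if "p permutes {..<n}" "j \<in> J" for p j
    using that by (intro inj inv yX sumX) (simp_all add: \<phi>sum eqv yX \<phi>y matrix_rep_onD(2)[OF Y])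
  ultimately show ?thesis unfolding matrix_rep_on_def by blast
qed

lemma coords_act:
  assumes s: "sym_rep s n act" and M: "matrix_rep_on s n act X J y M" and p: "p permutes {..<n}" and x: "x \<in> X"
  shows "act p x = (\<Sum>k\<in>J. s (\<Sum>j\<in>J. M p k j * coords s J y x j) (y k))"
proof -
  interpret sym_rep s n act by fact
  have "act p x = act p (\<Sum>j\<in>J. s (coords s J y x j) (y j))"
    using coords_expand[OF matrix_rep_onD(1)[OF M] x] by simp
  also have "\<dots> = (\<Sum>j\<in>J. \<Sum>k\<in>J. s (M p k j * coords s J y x j) (y k))"
    by (simp add: act_sum[OF p] act_scale[OF p] matrix_rep_onD(2)[OF M p] scale_sum_right mult.commute)
  also have "\<dots> = (\<Sum>k\<in>J. s (\<Sum>j\<in>J. M p k j * coords s J y x j) (y k))"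
    by (subst sum.swap) (simp add: scale_sum_left)
  finally show ?thesis .
qed

text \<open>The linear map that matches the two bases is equivariant.\<close>

lemma matrix_rep_rep_isomorphic:
  assumes s: "sym_rep s1 n act1" "sym_rep s2 n act2"
    and X: "module.subspace s1 X" and Y: "module.subspace s2 Y"
    and MX: "matrix_rep_on s1 n act1 X J y M" and MY: "matrix_rep_on s2 n act2 Y J e M"
  shows "rep_isomorphic n s1 act1 X s2 act2 Y"
proof -
  interpret V: sym_rep s1 n act1 by fact
  interpret W: sym_rep s2 n act2 by fact
  note fx = matrix_rep_onD(1)[OF MX] and fy = matrix_rep_onD(1)[OF MY]
  define \<phi> where "\<phi> x = (\<Sum>j\<in>J. s2 (coords s1 J y x j) (e j))" for x
  have \<phi>sum: "\<phi> (\<Sum>j\<in>J. s1 (c j) (y j)) = (\<Sum>j\<in>J. s2 (c j) (e j))" for c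
    unfolding \<phi>_def by (rule sum.cong[OF refl]) (simp add: V.coords_eqI[OF fx refl])
  have rep: "\<exists>c. x = (\<Sum>j\<in>J. s1 (c j) (y j))" if "x \<in> X" for x
    using fx that unfolding family_basis_def by blast
  have "linear_on s1 s2 X \<phi>"
    unfolding linear_on_def
  proof (intro conjI ballI allI)
    fix x z assume "x \<in> X" "z \<in> X"
    then obtain c d where cd: "x = (\<Sum>j\<in>J. s1 (c j) (y j))" "z = (\<Sum>j\<in>J. s1 (d j) (y j))" using rep by blast
    have "x + z = (\<Sum>j\<in>J. s1 (c j + d j) (y j))" by (simp add: cd V.scale_left_distrib sum.distrib)
    then show "\<phi> (x + z) = \<phi> x + \<phi> z"
      unfolding cd by (simp add: \<phi>sum W.scale_left_distrib sum.distrib)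
  next
    fix a x assume "x \<in> X"
    then obtain c where c: "x = (\<Sum>j\<in>J. s1 (c j) (y j))" using rep by blast
    have "s1 a x = (\<Sum>j\<in>J. s1 (a * c j) (y j))" by (simp add: c V.scale_sum_right)
    then show "\<phi> (s1 a x) = s2 a (\<phi> x)" by (simp add: c \<phi>sum W.scale_sum_right)
  qed
  moreover have "bij_betw \<phi> X Y"
  proof (rule bij_betw_imageI)
    show "inj_on \<phi> X"
    proof (rule inj_onI)
      fix x z assume "x \<in> X" "z \<in> X" and eq: "\<phi> x = \<phi> z"
      then obtain c d where cd: "x = (\<Sum>j\<in>J. s1 (c j) (y j))" "z = (\<Sum>j\<in>J. s1 (d j) (y j))" using rep by blast
      then have "\<forall>j\<in>J. c j = d j" using eq by (simp add: \<phi>sum W.sum_scale_eq_iff[OF fy])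
      then show "x = z" by (simp add: cd)
    qed
    have "\<phi> x \<in> Y" for x
      unfolding \<phi>_def by (intro W.subspace_sum[OF Y] W.subspace_scale[OF Y] family_basisD(2)[OF fy])
    moreover have "z \<in> \<phi> ` X" if z: "z \<in> Y" for z
    proof -
      obtain c where "z = (\<Sum>j\<in>J. s2 (c j) (e j))" using fy z unfolding family_basis_def by blast
      then have "z = \<phi> (\<Sum>j\<in>J. s1 (c j) (y j))" by (simp add: \<phi>sum)
      moreover have "(\<Sum>j\<in>J. s1 (c j) (y j)) \<in> X"
        by (intro V.subspace_sum[OF X] V.subspace_scale[OF X] family_basisD(2)[OF fx])
      ultimately show ?thesis by blast
    qed
    ultimately show "\<phi> ` X = Y" by blast
  qed
  moreover have "\<phi> (act1 p x) = act2 p (\<phi> x)" if p: "p permutes {..<n}" and x: "x \<in> X" for p x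
  proof -
    have "act2 p (\<phi> x) = (\<Sum>j\<in>J. \<Sum>k\<in>J. s2 (M p k j * coords s1 J y x j) (e k))"
      by (simp add: \<phi>_def W.act_sum[OF p] W.act_scale[OF p] matrix_rep_onD(2)[OF MY p] W.scale_sum_right mult.commute)
    also have "\<dots> = \<phi> (act1 p x)"
      unfolding coords_act[OF s(1) MX p x] \<phi>sum by (subst sum.swap) (simp add: W.scale_sum_left)
    finally show ?thesis by simp
  qed
  ultimately show ?thesis unfolding rep_isomorphic_def by blast
qed

locale unit_rep = matrix_units n L dm rho u + sym_rep s n act
  for n :: nat and L :: "'l set" and dm :: "'l \<Rightarrow> nat"
    and rho :: "'l \<Rightarrow> (nat \<Rightarrow> nat) \<Rightarrow> nat \<Rightarrow> nat \<Rightarrow> 'k::field_char_0" and u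
    and s :: "'k \<Rightarrow> 'a::ab_group_add \<Rightarrow> 'a" and act
begin

text \<open>The matrix units as operators on an arbitrary representation.\<close>

definition U :: "'l \<Rightarrow> nat \<Rightarrow> nat \<Rightarrow> 'a \<Rightarrow> 'a" where
  "U l i j x = (\<Sum>\<sigma>\<in>Sym n. s (u l i j \<sigma>) (act \<sigma> x))"

lemma U_add: "U l i j (x + y) = U l i j x + U l i j y"
  and U_scale: "U l i j (s c x) = s c (U l i j x)"
  unfolding U_def by (simp_all add: act_add act_scale scale_right_distrib sum.distrib scale_sum_right mult.commute)

lemma U_0: "U l i j 0 = 0"
  using U_scale[of l i j 0 0] by simp

lemma U_sum: "U l i j (\<Sum>k\<in>K. f k) = (\<Sum>k\<in>K. U l i j (f k))"
  by (induction K rule: infinite_finite_induct) (simp_all add: U_0 U_add)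

lemma U_in: "subspace X \<Longrightarrow> (\<And>p x. p permutes {..<n} \<Longrightarrow> x \<in> X \<Longrightarrow> act p x \<in> X) \<Longrightarrow> x \<in> X \<Longrightarrow> U l i j x \<in> X"
  unfolding U_def by (intro subspace_sum subspace_scale) auto

lemma act_eq_U:
  assumes \<tau>: "\<tau> permutes {..<n}"
  shows "act \<tau> x = (\<Sum>l\<in>L. \<Sum>i<dm l. \<Sum>j<dm l. s (rho l \<tau> i j) (U l i j x))"
proof -
  have "(\<Sum>l\<in>L. \<Sum>i<dm l. \<Sum>j<dm l. s (rho l \<tau> i j) (U l i j x)) =
      (\<Sum>\<sigma>\<in>Sym n. \<Sum>l\<in>L. \<Sum>i<dm l. \<Sum>j<dm l. s (u l i j \<sigma> * rho l \<tau> i j) (act \<sigma> x))"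
    unfolding U_def scale_sum_right scale_scale
    by (subst (2) sum.swap, rule sum.cong[OF refl], subst (2) sum.swap, rule sum.cong[OF refl],
            subst (2) sum.swap, rule sum.cong[OF refl]) (simp add: mult.commute)
  also have "\<dots> = (\<Sum>\<sigma>\<in>Sym n. s (if \<sigma> = \<tau> then 1 else 0) (act \<sigma> x))"
    using \<tau> by (intro sum.cong refl) (simp add: scale_sum_left[symmetric] u_complete)
  also have "\<dots> = (\<Sum>\<sigma>\<in>Sym n. if \<sigma> = \<tau> then act \<sigma> x else 0)" by (rule sum.cong) auto
  also have "\<dots> = act \<tau> x" using \<tau> by simp
  finally show ?thesis by simp
qed

lemma act_U:
  assumes \<tau>: "\<tau> permutes {..<n}" and l: "l \<in> L" "i < dm l" "j < dm l"
  shows "act \<tau> (U l i j x) = (\<Sum>k<dm l. s (rho l \<tau> k i) (U l k j x))"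
proof -
  have "act \<tau> (U l i j x) = (\<Sum>\<sigma>\<in>Sym n. s (u l i j \<sigma>) (act (\<tau> \<circ> \<sigma>) x))"
    by (simp add: U_def act_sum[OF \<tau>] act_scale[OF \<tau>] act_comp[OF \<tau>])
  also have "\<dots> = (\<Sum>\<sigma>\<in>Sym n. \<Sum>m\<in>L. \<Sum>k<dm m. \<Sum>q<dm m. s (u l i j \<sigma> * rho m (\<tau> \<circ> \<sigma>) k q) (U m k q x))"
    by (intro sum.cong refl) (simp add: act_eq_U[OF permutes_compose[OF _ \<tau>]] scale_sum_right)
  also have "\<dots> = (\<Sum>m\<in>L. \<Sum>k<dm m. \<Sum>q<dm m. s (\<Sum>\<sigma>\<in>Sym n. u l i j \<sigma> * rho m (\<tau> \<circ> \<sigma>) k q) (U m k q x))"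
    unfolding scale_sum_left
    by (subst sum.swap, rule sum.cong[OF refl], subst sum.swap, rule sum.cong[OF refl], rule sum.swap)
  also have "\<dots> = (\<Sum>m\<in>L. \<Sum>k<dm m. \<Sum>q<dm m. \<Sum>r<dm m. if l = m \<and> i = r \<and> j = q then s (rho m \<tau> k r) (U m k q x) else 0)"
  proof (intro sum.cong refl)
    fix m k q assume m: "m \<in> L" "k \<in> {..<dm m}" "q \<in> {..<dm m}"
    have "(\<Sum>\<sigma>\<in>Sym n. u l i j \<sigma> * rho m (\<tau> \<circ> \<sigma>) k q) = (\<Sum>\<sigma>\<in>Sym n. \<Sum>r<dm m. rho m \<tau> k r * (u l i j \<sigma> * rho m \<sigma> r q))"
      using m by (intro sum.cong refl) (simp add: rho_comp[OF _ \<tau>] sum_distrib_left mult_ac)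
    also have "\<dots> = (\<Sum>r<dm m. rho m \<tau> k r * (if l = m \<and> i = r \<and> j = q then 1 else 0))"
      using m l by (subst sum.swap) (simp add: sum_distrib_left[symmetric] u_dual)
    finally show "s (\<Sum>\<sigma>\<in>Sym n. u l i j \<sigma> * rho m (\<tau> \<circ> \<sigma>) k q) (U m k q x) =
        (\<Sum>r<dm m. if l = m \<and> i = r \<and> j = q then s (rho m \<tau> k r) (U m k q x) else 0)"
      by (simp only: scale_sum_left) (auto intro!: sum.cong)
  qed
  also have "\<dots> = (\<Sum>m\<in>L. \<Sum>k<dm m. if l = m then s (rho l \<tau> k i) (U l k j x) else 0)"
  proof (intro sum.cong refl)
    fix m k assume m: "m \<in> L" "k \<in> {..<dm m}"
    show "(\<Sum>q<dm m. \<Sum>r<dm m. if l = m \<and> i = r \<and> j = q then s (rho m \<tau> k r) (U m k q x) else 0) =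
      (if l = m then s (rho l \<tau> k i) (U l k j x) else 0)"
    proof (cases "l = m")
      case True
      have "(\<Sum>r<dm m. if i = r \<and> j = q then s (rho m \<tau> k r) (U m k q x) else 0) =
          (if j = q then s (rho m \<tau> k i) (U m k j x) else 0)" for q
        using l True by (cases "j = q") simp_all
      then show ?thesis using l True by simp
    qed simp
  qed
  also have "\<dots> = (\<Sum>m\<in>L. if l = m then \<Sum>k<dm l. s (rho l \<tau> k i) (U l k j x) else 0)"
    by (rule sum.cong) auto
  finally show ?thesis using l finite_L by simp
qed

lemma U_U:
  assumes l: "l \<in> L" "i < dm l" "j < dm l" and m: "m \<in> L" "k < dm m" "q < dm m"
  shows "U l i j (U m k q x) = (if l = m \<and> j = k then U l i q x else 0)"
proof -
  have "U l i j (U m k q x) = (\<Sum>\<tau>\<in>Sym n. \<Sum>r<dm m. s (u l i j \<tau> * rho m \<tau> r k) (U m r q x))"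
    by (subst (1) U_def) (simp add: act_U[OF _ m] scale_sum_right)
  also have "\<dots> = (\<Sum>r<dm m. s (\<Sum>\<tau>\<in>Sym n. u l i j \<tau> * rho m \<tau> r k) (U m r q x))"
    by (subst sum.swap) (simp add: scale_sum_left)
  also have "\<dots> = (\<Sum>r<dm m. if l = m \<and> i = r \<and> j = k then U m r q x else 0)"
    using l m by (intro sum.cong refl) (simp add: u_dual)
  also have "\<dots> = (if l = m \<and> j = k then U l i q x else 0)"
    using l by (cases "l = m \<and> j = k") auto
  finally show ?thesis .
qed

lemma U_resolution: "(\<Sum>l\<in>L. \<Sum>i<dm l. U l i i x) = x"
proof -
  have "x = act id x" by (simp add: act_id)
  also have "\<dots> = (\<Sum>l\<in>L. \<Sum>i<dm l. \<Sum>j<dm l. if i = j then U l i j x else 0)"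
    unfolding act_eq_U[OF permutes_id] by (intro sum.cong refl) (simp add: rho_id)
  also have "\<dots> = (\<Sum>l\<in>L. \<Sum>i<dm l. U l i i x)" by (intro sum.cong refl) simp
  finally show ?thesis by simp
qed

text \<open>Bases adapted to the matrix units are indexed by \<open>(l, a, r)\<close>: the vector \<open>a\<close> of the copy \<open>r\<close> of the
  representation \<open>l\<close>, which occurs \<open>m l\<close> times.\<close>

definition block_index :: "('l \<Rightarrow> nat) \<Rightarrow> ('l \<times> nat \<times> nat) set" where
  "block_index m = (SIGMA l:L. {..<dm l} \<times> {..<m l})"

lemma block_index_iff: "(l, a, r) \<in> block_index m \<longleftrightarrow> l \<in> L \<and> a < dm l \<and> r < m l"
  by (simp add: block_index_def)

lemma finite_block_index: "finite (block_index m)"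
  by (simp add: block_index_def finite_L)

definition block_matrix :: "(nat \<Rightarrow> nat) \<Rightarrow> 'l \<times> nat \<times> nat \<Rightarrow> 'l \<times> nat \<times> nat \<Rightarrow> 'k" where
  "block_matrix p = (\<lambda>(l', a', r') (l, a, r). if l' = l \<and> r' = r then rho l p a' a else 0)"

lemma sum_block_index:
  assumes "l \<in> L" "r < m l"
  shows "(\<Sum>d\<in>block_index m. case d of (l', a', r') \<Rightarrow> if l' = l \<and> r' = r then f a' else 0) = (\<Sum>a<dm l. f a :: 'b::comm_monoid_add)"
proof -
  have "(\<Sum>d\<in>block_index m. case d of (l', a', r') \<Rightarrow> if l' = l \<and> r' = r then f a' else 0) =
      (\<Sum>d\<in>(\<lambda>a. (l, a, r)) ` {..<dm l}. case d of (l', a', r') \<Rightarrow> f a')"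
    using assms finite_block_index by (intro sum.mono_neutral_cong_right) (auto simp: block_index_iff)
  also have "\<dots> = (\<Sum>a<dm l. f a)" by (subst sum.reindex) (auto simp: inj_on_def)
  finally show ?thesis .
qed

lemma U_adapted:
  assumes M: "matrix_rep_on s n act X (block_index m) y block_matrix"
    and l: "l \<in> L" "i < dm l" "j < dm l" and d: "(l', a, r) \<in> block_index m"
  shows "U l i j (y (l', a, r)) = (if l = l' \<and> j = a then y (l, i, r) else 0)"
proof -
  have d': "l' \<in> L" "a < dm l'" "r < m l'" using d by (auto simp: block_index_iff)
  have act: "act p (y (l', a, r)) = (\<Sum>b<dm l'. s (rho l' p b a) (y (l', b, r)))" if p: "p permutes {..<n}" for p
  proof -
    have "act p (y (l', a, r)) = (\<Sum>k\<in>block_index m. s (block_matrix p k (l', a, r)) (y k))"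
      by (rule matrix_rep_onD(2)[OF M p d])
    also have "\<dots> = (\<Sum>k\<in>block_index m. case k of (l'', b, r') \<Rightarrow>
        if l'' = l' \<and> r' = r then s (rho l' p b a) (y (l', b, r)) else 0)"
      by (rule sum.cong) (auto simp: block_matrix_def)
    also have "\<dots> = (\<Sum>b<dm l'. s (rho l' p b a) (y (l', b, r)))" by (rule sum_block_index) (use d' in auto)
    finally show ?thesis .
  qed
  have "U l i j (y (l', a, r)) = (\<Sum>b<dm l'. s (\<Sum>\<sigma>\<in>Sym n. u l i j \<sigma> * rho l' \<sigma> b a) (y (l', b, r)))"
    unfolding U_def scale_sum_left by (subst sum.swap) (simp add: act scale_sum_right)
  also have "\<dots> = (\<Sum>b<dm l'. if l = l' \<and> i = b \<and> j = a then y (l', b, r) else 0)"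
    using l d' by (intro sum.cong refl) (simp add: u_dual)
  also have "\<dots> = (if l = l' \<and> j = a then y (l, i, r) else 0)"
    using l by (cases "l = l' \<and> j = a") auto
  finally show ?thesis .
qed

text \<open>The matrix unit \<open>(0, 0)\<close> keeps one basis vector of each copy of \<open>l\<close>.  So the multiplicities do not
depend on the adapted basis.\<close>

lemma multiplicity_eq_dim:
  assumes X: "subspace X" and M: "matrix_rep_on s n act X (block_index m) y block_matrix" and l: "l \<in> L"
  shows "dim (U l 0 0 ` X) = m l"
proof -
  note fb = matrix_rep_onD(1)[OF M]
  have yX: "y d \<in> X" if "d \<in> block_index m" for d by (rule family_basisD(2)[OF fb that])
  have d0: "(l, 0, r) \<in> block_index m" if "r < m l" for r using that l dm_pos by (simp add: block_index_iff)
  have "family_basis s (U l 0 0 ` X) {..<m l} (\<lambda>r. y (l, 0, r))"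
    unfolding family_basis_def
  proof (intro conjI allI ballI impI)
    have "y (l, 0, r) \<in> U l 0 0 ` X" if "r < m l" for r
      using U_adapted[OF M l _ _ d0[OF that], of 0 0] dm_pos[OF l] yX[OF d0[OF that]] by force
    then show "(\<lambda>r. y (l, 0, r)) ` {..<m l} \<subseteq> U l 0 0 ` X" by auto
  next
    fix c r assume c: "(\<Sum>r<m l. s (c r) (y (l, 0, r))) = 0" and r: "r \<in> {..<m l}"
    have "(\<Sum>d\<in>block_index m. s (case d of (l', a, r) \<Rightarrow> if l' = l \<and> a = 0 then c r else 0) (y d)) =
        (\<Sum>d\<in>(\<lambda>r. (l, 0, r)) ` {..<m l}. s (case d of (l', a, r) \<Rightarrow> c r) (y d))"
      using finite_block_index d0 by (intro sum.mono_neutral_cong_right) (auto simp: block_index_iff)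
    also have "\<dots> = 0" using c by (subst sum.reindex) (auto simp: inj_on_def)
    finally show "c r = 0" using family_basisD(3)[OF fb _ d0] r by fastforce
  next
    fix z assume "z \<in> U l 0 0 ` X"
    then obtain x where x: "x \<in> X" "z = U l 0 0 x" by blast
    obtain c where c: "x = (\<Sum>d\<in>block_index m. s (c d) (y d))" using fb x(1) unfolding family_basis_def by blast
    have "z = (\<Sum>d\<in>block_index m. s (c d) (U l 0 0 (y d)))" by (simp add: x(2) c U_sum U_scale)
    also have "\<dots> = (\<Sum>d\<in>(\<lambda>r. (l, 0, r)) ` {..<m l}. s (c d) (y d))"
      using finite_block_index d0 dm_pos[OF l] l
      by (intro sum.mono_neutral_cong_right) (auto simp: block_index_iff U_adapted[OF M] image_iff split: if_splits)
    also have "\<dots> = (\<Sum>r<m l. s (c (l, 0, r)) (y (l, 0, r)))" by (subst sum.reindex) (auto simp: inj_on_def)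
    finally show "\<exists>c. z = (\<Sum>r<m l. s (c r) (y (l, 0, r)))" by (intro exI[of _ "\<lambda>r. c (l, 0, r)"])
  qed simp
  then show ?thesis using family_basis_dim by fastforce
qed

text \<open>Complete reducibility: a basis of the image of the matrix unit \<open>(0, 0)\<close> is moved through the
  whole block by the matrix units \<open>(a, 0)\<close>.\<close>

lemma adapted_basis_exists:
  assumes X: "subspace X" "X \<subseteq> span B" "finite B" and inv: "\<And>p x. p permutes {..<n} \<Longrightarrow> x \<in> X \<Longrightarrow> act p x \<in> X"
  shows "\<exists>m y. (\<forall>l. l \<notin> L \<longrightarrow> m l = 0) \<and> matrix_rep_on s n act X (block_index m) y block_matrix"
proof -
  \<comment> \<open>The multiplicity spaces.\<close>
  define N where "N l = U l 0 0 ` X" for l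
  have UX: "U l i j x \<in> X" if "x \<in> X" for l i j x by (rule U_in[OF X(1) inv that])
  have "\<exists>z. family_basis s (N l) {..<dim (N l)} z" for l
    by (rule family_basis_exists[of _ B]) (use UX X in \<open>auto simp: N_def\<close>)
  then obtain z where z: "\<And>l. family_basis s (N l) {..<dim (N l)} (z l)" by metis
  define m where "m l = (if l \<in> L then dim (N l) else 0)" for l
  define y where "y = (\<lambda>(l, a, r). U l a 0 (z l r))"
  have ml: "m l = dim (N l)" if "l \<in> L" for l using that by (simp add: m_def)
  have zN: "z l r \<in> N l" if "l \<in> L" "r < m l" for l r using family_basisD(2)[OF z] that ml by auto
  have Uz: "U l 0 0 (z l r) = z l r" "z l r \<in> X" if lr: "l \<in> L" "r < m l" for l r
  proof -
    obtain x where "x \<in> X" "z l r = U l 0 0 x" using zN[OF lr] by (auto simp: N_def)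
    then show "U l 0 0 (z l r) = z l r" "z l r \<in> X" using lr dm_pos UX by (auto simp: U_U)
  qed
  have Uy: "U l 0 a (y (l', a', r)) = (if l = l' \<and> a = a' then z l r else 0)"
    if "l \<in> L" "a < dm l" "(l', a', r) \<in> block_index m" for l a l' a' r
    using that dm_pos by (auto simp: y_def U_U block_index_iff Uz)
  have "family_basis s X (block_index m) y"
    unfolding family_basis_def
  proof (intro conjI allI impI ballI)
    show "y ` block_index m \<subseteq> X" by (auto simp: y_def block_index_iff intro!: UX Uz)
  next
    fix c d assume c: "(\<Sum>d\<in>block_index m. s (c d) (y d)) = 0" and d: "d \<in> block_index m"
    obtain l a r where lar: "d = (l, a, r)" "l \<in> L" "a < dm l" "r < m l" using d by (cases d) (auto simp: block_index_iff)
    have "0 = U l 0 a (\<Sum>d\<in>block_index m. s (c d) (y d))" by (simp add: c U_0)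
    also have "\<dots> = (\<Sum>d\<in>block_index m. s (c d) (U l 0 a (y d)))" by (simp add: U_sum U_scale)
    also have "\<dots> = (\<Sum>d\<in>(\<lambda>r. (l, a, r)) ` {..<m l}. s (c d) (case d of (l, a, r) \<Rightarrow> z l r))"
      using finite_block_index lar
      by (intro sum.mono_neutral_cong_right) (auto simp: Uy block_index_iff image_iff split: if_splits)
    also have "\<dots> = (\<Sum>r<dim (N l). s (c (l, a, r)) (z l r))" using ml[OF lar(2)] by (subst sum.reindex) (auto simp: inj_on_def)
    finally show "c d = 0" using family_basisD(3)[OF z, of "\<lambda>r. c (l, a, r)" l r] lar ml by simp
  next
    fix x assume x: "x \<in> X"
    have "\<exists>c. U l 0 a x = (\<Sum>r<m l. s (c r) (z l r))" if "l \<in> L" "a < dm l" for l a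
    proof -
      have "U l 0 a x = U l 0 0 (U l 0 a x)" using that dm_pos by (simp add: U_U)
      then have "U l 0 a x \<in> N l" using UX[OF x] by (auto simp: N_def)
      then show ?thesis using z[of l] ml[OF that(1)] unfolding family_basis_def by auto
    qed
    then obtain c where c: "\<And>l a. l \<in> L \<Longrightarrow> a < dm l \<Longrightarrow> U l 0 a x = (\<Sum>r<m l. s (c l a r) (z l r))" by metis
    have "x = (\<Sum>l\<in>L. \<Sum>a<dm l. U l a 0 (U l 0 a x))"
      using U_resolution[of x] dm_pos by (simp add: U_U)
    also have "\<dots> = (\<Sum>l\<in>L. \<Sum>a<dm l. \<Sum>r<m l. s (c l a r) (y (l, a, r)))"
      by (intro sum.cong refl) (simp add: c U_sum U_scale y_def)
    also have "\<dots> = (\<Sum>d\<in>block_index m. s (case d of (l, a, r) \<Rightarrow> c l a r) (y d))"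
      unfolding block_index_def using finite_L by (simp add: sum.Sigma sum.cartesian_product split_beta)
    finally show "\<exists>c. x = (\<Sum>d\<in>block_index m. s (c d) (y d))" by blast
  qed (rule finite_block_index)
  moreover have "act p (y d) = (\<Sum>k\<in>block_index m. s (block_matrix p k d) (y k))"
    if p: "p permutes {..<n}" and d: "d \<in> block_index m" for p d
  proof -
    obtain l a r where lar: "d = (l, a, r)" "l \<in> L" "a < dm l" "r < m l" using d by (cases d) (auto simp: block_index_iff)
    have "act p (y d) = (\<Sum>b<dm l. s (rho l p b a) (y (l, b, r)))"
      using lar dm_pos by (simp add: y_def act_U[OF p])
    also have "\<dots> = (\<Sum>k\<in>block_index m. case k of (l', b, r') \<Rightarrow> if l' = l \<and> r' = r then s (rho l p b a) (y (l, b, r)) else 0)"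
      by (rule sum_block_index[symmetric]) (use lar in auto)
    also have "\<dots> = (\<Sum>k\<in>block_index m. s (block_matrix p k d) (y k))"
      by (rule sum.cong) (auto simp: block_matrix_def lar)
    finally show ?thesis .
  qed
  ultimately have "matrix_rep_on s n act X (block_index m) y block_matrix" unfolding matrix_rep_on_def by blast
  then show ?thesis by (intro exI[of _ m] exI[of _ y]) (auto simp: m_def)
qed

end

section \<open>Kronecker coefficients and commutants\<close>

definition mat_mul :: "'j set \<Rightarrow> ('i \<Rightarrow> 'j \<Rightarrow> 'k::comm_ring_1) \<Rightarrow> ('j \<Rightarrow> 'l \<Rightarrow> 'k) \<Rightarrow> 'i \<Rightarrow> 'l \<Rightarrow> 'k" where
  "mat_mul J A B = (\<lambda>i l. \<Sum>j\<in>J. A i j * B j l)"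

lemma mat_mul_assoc: "mat_mul J A (mat_mul I B C) = mat_mul I (mat_mul J A B) C"
proof (intro ext)
  fix i k
  have "mat_mul J A (mat_mul I B C) i k = (\<Sum>j\<in>J. \<Sum>l\<in>I. A i j * B j l * C l k)"
    by (simp add: mat_mul_def sum_distrib_left mult.assoc)
  also have "\<dots> = mat_mul I (mat_mul J A B) C i k" by (subst sum.swap) (simp add: mat_mul_def sum_distrib_right)
  finally show "mat_mul J A (mat_mul I B C) i k = mat_mul I (mat_mul J A B) C i k" .
qed

lemma mat_mul_cong:
  assumes "\<And>j. j \<in> J \<Longrightarrow> A i j = A' i j" "\<And>j. j \<in> J \<Longrightarrow> B j k = B' j k"
  shows "mat_mul J A B i k = mat_mul J A' B' i k"
  unfolding mat_mul_def using assms by (intro sum.cong) auto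

lemma mat_mul_one_left:
  assumes "finite J" "i \<in> J" "\<And>j. j \<in> J \<Longrightarrow> A i j = (if i = j then 1 else 0)"
  shows "mat_mul J A B i k = B i k"
proof -
  have "mat_mul J A B i k = (\<Sum>j\<in>J. if i = j then B j k else 0)"
    unfolding mat_mul_def using assms by (intro sum.cong) auto
  then show ?thesis using assms by simp
qed

lemma mat_mul_one_right:
  assumes "finite J" "k \<in> J" "\<And>j. j \<in> J \<Longrightarrow> B j k = (if j = k then 1 else 0)"
  shows "mat_mul J A B i k = A i k"
proof -
  have "mat_mul J A B i k = (\<Sum>j\<in>J. if j = k then A i j else 0)"
    unfolding mat_mul_def using assms by (intro sum.cong) auto
  then show ?thesis using assms by simp
qed

definition commutes_with :: "nat \<Rightarrow> 'j set \<Rightarrow> ((nat \<Rightarrow> nat) \<Rightarrow> 'j \<Rightarrow> 'j \<Rightarrow> 'k::comm_ring_1) \<Rightarrow> ('j \<Rightarrow> 'j \<Rightarrow> 'k) \<Rightarrow> bool" where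
  "commutes_with n J M C \<longleftrightarrow> (\<forall>p. p permutes {..<n} \<longrightarrow> (\<forall>i\<in>J. \<forall>j\<in>J. mat_mul J (M p) C i j = mat_mul J C (M p) i j))"

text \<open>The transition matrices between two bases of a representation, by which commutants are carried from one
basis to the other.\<close>

lemma base_change:
  assumes s: "sym_rep s n act" and M1: "matrix_rep_on s n act X J1 y1 M1" and M2: "matrix_rep_on s n act X J2 y2 M2"
  defines "Q \<equiv> (\<lambda>i d. coords s J1 y1 (y2 d) i)" and "Q' \<equiv> (\<lambda>d i. coords s J2 y2 (y1 i) d)"
  shows "i \<in> J1 \<Longrightarrow> i' \<in> J1 \<Longrightarrow> mat_mul J2 Q Q' i i' = (if i = i' then 1 else 0)"
    and "p permutes {..<n} \<Longrightarrow> i \<in> J1 \<Longrightarrow> d \<in> J2 \<Longrightarrow> mat_mul J1 (M1 p) Q i d = mat_mul J2 Q (M2 p) i d"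
proof -
  interpret sym_rep s n act by fact
  note f1 = matrix_rep_onD(1)[OF M1] and f2 = matrix_rep_onD(1)[OF M2]
  have y2: "y2 d = (\<Sum>i\<in>J1. s (Q i d) (y1 i))" if "d \<in> J2" for d
    unfolding Q_def using coords_expand[OF f1 family_basisD(2)[OF f2 that]] by simp
  have y1: "y1 i = (\<Sum>d\<in>J2. s (Q' d i) (y2 d))" if "i \<in> J1" for i
    unfolding Q'_def using coords_expand[OF f2 family_basisD(2)[OF f1 that]] by simp
  show "mat_mul J2 Q Q' i i' = (if i = i' then 1 else 0)" if "i \<in> J1" "i' \<in> J1"
  proof -
    have "y1 i' = (\<Sum>d\<in>J2. \<Sum>i\<in>J1. s (Q i d * Q' d i') (y1 i))"
      by (subst y1[OF that(2)]) (simp add: y2 scale_sum_right mult.commute)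
    also have "\<dots> = (\<Sum>i\<in>J1. s (mat_mul J2 Q Q' i i') (y1 i))"
      by (subst sum.swap) (simp add: scale_sum_left mat_mul_def)
    finally have "coords s J1 y1 (y1 i') i = mat_mul J2 Q Q' i i'" by (rule coords_eqI[OF f1 _ that(1)])
    then show ?thesis using coords_basis[OF f1 that(2,1)] by simp
  qed
  show "mat_mul J1 (M1 p) Q i d = mat_mul J2 Q (M2 p) i d" if p: "p permutes {..<n}" and i: "i \<in> J1" and d: "d \<in> J2"
  proof -
    have "act p (y2 d) = (\<Sum>j\<in>J1. \<Sum>i\<in>J1. s (M1 p i j * Q j d) (y1 i))"
      by (simp add: y2[OF d] act_sum[OF p] act_scale[OF p] matrix_rep_onD(2)[OF M1 p] scale_sum_right mult.commute)
    also have "\<dots> = (\<Sum>i\<in>J1. s (mat_mul J1 (M1 p) Q i d) (y1 i))"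
      by (subst sum.swap) (simp add: scale_sum_left mat_mul_def)
    finally have 1: "act p (y2 d) = (\<Sum>i\<in>J1. s (mat_mul J1 (M1 p) Q i d) (y1 i))" .
    have "act p (y2 d) = (\<Sum>d'\<in>J2. \<Sum>i\<in>J1. s (Q i d' * M2 p d' d) (y1 i))"
      by (simp add: matrix_rep_onD(2)[OF M2 p d] y2 scale_sum_right mult.commute)
    also have "\<dots> = (\<Sum>i\<in>J1. s (mat_mul J2 Q (M2 p) i d) (y1 i))"
      by (subst sum.swap) (simp add: scale_sum_left mat_mul_def)
    finally have 2: "act p (y2 d) = (\<Sum>i\<in>J1. s (mat_mul J2 Q (M2 p) i d) (y1 i))" .
    from trans[OF 1[symmetric] 2] have "\<forall>i\<in>J1. mat_mul J1 (M1 p) Q i d = mat_mul J2 Q (M2 p) i d"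
      by (rule sum_scale_eq_iff[OF f1, THEN iffD1])
    then show ?thesis using i by blast
  qed
qed

context unit_rep
begin

lemma sum_block_unit:
  assumes d: "(l1, i1, r1) \<in> block_index m" "(l2, i2, r2) \<in> block_index m" and l: "l \<in> L" "i < dm l" "j < dm l"
  shows "(\<Sum>p\<in>Sym n. u l i j p * block_matrix p (l1, i1, r1) (l2, i2, r2)) =
    (if (l1, i1, r1) = (l, i, r2) \<and> (l2, i2) = (l, j) then 1 else 0)"
proof (cases "l1 = l2 \<and> r1 = r2")
  case True
  then show ?thesis using d l by (simp add: block_matrix_def u_dual block_index_iff)
qed (auto simp: block_matrix_def)

text \<open>A block of multiplicity \<open>m l\<close> contributes the square matrices of this size to the commutant.\<close>

definition hom_index :: "('l \<Rightarrow> nat) \<Rightarrow> ('l \<times> nat \<times> nat) set" where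
  "hom_index m = (SIGMA l:L. {..<m l} \<times> {..<m l})"

lemma card_hom_index: "card (hom_index m) = (\<Sum>l\<in>L. (m l)\<^sup>2)"
  unfolding hom_index_def using finite_L by (subst card_SigmaI) (auto simp: power2_eq_square)

lemma finite_hom_index: "finite (hom_index m)"
  unfolding hom_index_def using finite_L by auto

lemma sum_block_index_iterated:
  "(\<Sum>d\<in>block_index m. f d) = (\<Sum>l\<in>L. \<Sum>a<dm l. \<Sum>r<m l. f (l, a, r))"
proof -
  have "(\<Sum>d\<in>block_index m. f d) = (\<Sum>l\<in>L. \<Sum>x\<in>{..<dm l} \<times> {..<m l}. f (l, x))"
    unfolding block_index_def using finite_L by (subst sum.Sigma) auto
  then show ?thesis by (simp add: sum.cartesian_product split_beta)
qed

lemma sum_hom_index_iterated: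
  "(\<Sum>d\<in>hom_index m. f d) = (\<Sum>l\<in>L. \<Sum>r<m l. \<Sum>r'<m l. f (l, r, r'))"
proof -
  have "(\<Sum>d\<in>hom_index m. f d) = (\<Sum>l\<in>L. \<Sum>x\<in>{..<m l} \<times> {..<m l}. f (l, x))"
    unfolding hom_index_def using finite_L by (subst sum.Sigma) auto
  then show ?thesis by (simp add: sum.cartesian_product split_beta)
qed

text \<open>Schur's lemma: in an adapted basis, a matrix in the commutant is made of scalar blocks, since it
  commutes with the matrix unit \<open>(0, j)\<close> of each block.\<close>

lemma commutant_block_matrix:
  assumes C: "commutes_with n (block_index m) block_matrix C"
    and d: "(l, j, r) \<in> block_index m" "(l2, a, r2) \<in> block_index m"
  shows "C (l, j, r) (l2, a, r2) = (if l2 = l \<and> a = j then C (l, 0, r) (l, 0, r2) else 0)"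
proof -
  let ?D = "block_index m"
  have l: "l \<in> L" "j < dm l" "0 < dm l" "r < m l" using d(1) dm_pos by (auto simp: block_index_iff)
  have l0: "(l, 0, r) \<in> ?D" using l by (simp add: block_index_iff)
  have eq: "(\<Sum>p\<in>Sym n. u l 0 j p * mat_mul ?D (block_matrix p) C (l, 0, r) (l2, a, r2)) =
      (\<Sum>p\<in>Sym n. u l 0 j p * mat_mul ?D C (block_matrix p) (l, 0, r) (l2, a, r2))"
    using C l0 d(2) unfolding commutes_with_def by (intro sum.cong) auto
  have "(\<Sum>p\<in>Sym n. u l 0 j p * mat_mul ?D (block_matrix p) C (l, 0, r) (l2, a, r2)) =
      (\<Sum>d\<in>?D. (\<Sum>p\<in>Sym n. u l 0 j p * block_matrix p (l, 0, r) d) * C d (l2, a, r2))"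
    by (simp add: mat_mul_def sum_distrib_left sum_distrib_right mult.assoc) (rule sum.swap)
  also have "\<dots> = (\<Sum>d\<in>?D. if d = (l, j, r) then C d (l2, a, r2) else 0)"
  proof (rule sum.cong[OF refl])
    fix d assume d: "d \<in> ?D"
    obtain l' a' r' where d': "d = (l', a', r')" by (cases d)
    have "(\<Sum>p\<in>Sym n. u l 0 j p * block_matrix p (l, 0, r) d) = (if d = (l, j, r) then 1 else 0)"
      unfolding d' sum_block_unit[OF l0 d[unfolded d'] l(1,3,2)] by auto
    then show "(\<Sum>p\<in>Sym n. u l 0 j p * block_matrix p (l, 0, r) d) * C d (l2, a, r2) =
        (if d = (l, j, r) then C d (l2, a, r2) else 0)" by simp
  qed
  also have "\<dots> = C (l, j, r) (l2, a, r2)" using d(1) finite_block_index by simp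
  finally have 1: "(\<Sum>p\<in>Sym n. u l 0 j p * mat_mul ?D (block_matrix p) C (l, 0, r) (l2, a, r2)) = C (l, j, r) (l2, a, r2)" .
  have "(\<Sum>p\<in>Sym n. u l 0 j p * mat_mul ?D C (block_matrix p) (l, 0, r) (l2, a, r2)) =
      (\<Sum>d\<in>?D. C (l, 0, r) d * (\<Sum>p\<in>Sym n. u l 0 j p * block_matrix p d (l2, a, r2)))"
    by (simp add: mat_mul_def sum_distrib_left mult.left_commute) (rule sum.swap)
  also have "\<dots> = (\<Sum>d\<in>?D. if d = (l, 0, r2) then (if l2 = l \<and> a = j then C (l, 0, r) d else 0) else 0)"
  proof (rule sum.cong[OF refl])
    fix e assume e: "e \<in> ?D"
    obtain l' a' r' where e': "e = (l', a', r')" by (cases e)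
    have "(\<Sum>p\<in>Sym n. u l 0 j p * block_matrix p e (l2, a, r2)) =
        (if e = (l, 0, r2) \<and> (l2, a) = (l, j) then 1 else 0)"
      unfolding e' by (rule sum_block_unit[OF e[unfolded e'] d(2) l(1,3,2)])
    then show "C (l, 0, r) e * (\<Sum>p\<in>Sym n. u l 0 j p * block_matrix p e (l2, a, r2)) =
        (if e = (l, 0, r2) then (if l2 = l \<and> a = j then C (l, 0, r) e else 0) else 0)" by simp
  qed
  also have "\<dots> = (if l2 = l \<and> a = j then C (l, 0, r) (l, 0, r2) else 0)"
    using d(2) finite_block_index l by (cases "l2 = l") (auto simp: block_index_iff)
  finally show ?thesis using 1 eq by simp
qed

text \<open>By Schur's lemma, the commutant in an adapted basis has a basis of block matrices.  The transition
matrices carry it over to an arbitrary basis.\<close>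

lemma commutant_basis:
  assumes M1: "matrix_rep_on s n act X J y1 M1" and M2: "matrix_rep_on s n act X (block_index m) y2 block_matrix"
  shows "\<exists>B. (\<forall>k\<in>hom_index m. commutes_with n J M1 (B k)) \<and>
    (\<forall>c. (\<forall>i\<in>J. \<forall>j\<in>J. (\<Sum>k\<in>hom_index m. c k * B k i j) = 0) \<longrightarrow> (\<forall>k\<in>hom_index m. c k = 0)) \<and>
    (\<forall>C. commutes_with n J M1 C \<longrightarrow> (\<exists>c. \<forall>i\<in>J. \<forall>j\<in>J. C i j = (\<Sum>k\<in>hom_index m. c k * B k i j)))"
proof -
  let ?D = "block_index m" and ?H = "hom_index m"
  define Q where "Q = (\<lambda>i d. coords s J y1 (y2 d) i)"
  define Q' where "Q' = (\<lambda>d i. coords s ?D y2 (y1 i) d)"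
  note bc1 = base_change[OF sym_rep_axioms M1 M2, folded Q_def Q'_def]
  note bc2 = base_change[OF sym_rep_axioms M2 M1, folded Q_def Q'_def]
  have fJ: "finite J" using family_basisD(1)[OF matrix_rep_onD(1)[OF M1]] .
  note fD = finite_block_index[of m]
  \<comment> \<open>The map from copy \<open>r'\<close> to copy \<open>r\<close> of the representation \<open>l\<close>, in the basis \<open>y1\<close>.\<close>
  define B where "B = (\<lambda>(l, r, r') i j. \<Sum>a<dm l. Q i (l, a, r) * Q' (l, a, r') j)"
  have comm: "commutes_with n J M1 (B k)" if k: "k \<in> ?H" for k
    unfolding commutes_with_def
  proof (intro allI impI ballI)
    fix p i j assume p: "p permutes {..<n}" and ij: "i \<in> J" "j \<in> J"
    obtain l r r' where lr: "k = (l, r, r')" "l \<in> L" "r < m l" "r' < m l" using k by (auto simp: hom_index_def)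
    have inD: "(l, a, r) \<in> ?D" "(l, a, r') \<in> ?D" if "a < dm l" for a using that lr by (auto simp: block_index_iff)
    have e1: "mat_mul J (M1 p) Q i (l, a, r) = (\<Sum>b<dm l. Q i (l, b, r) * rho l p b a)" if "a < dm l" for a
    proof -
      have "mat_mul J (M1 p) Q i (l, a, r) = (\<Sum>d\<in>?D. case d of (l', b, r'') \<Rightarrow> if l' = l \<and> r'' = r then Q i (l, b, r) * rho l p b a else 0)"
        unfolding bc1(2)[OF p ij(1) inD(1)[OF that]] unfolding mat_mul_def by (rule sum.cong) (auto simp: block_matrix_def)
      also have "\<dots> = (\<Sum>b<dm l. Q i (l, b, r) * rho l p b a)" by (rule sum_block_index) (use lr in auto)
      finally show ?thesis .
    qed
    have e2: "mat_mul J Q' (M1 p) (l, b, r') j = (\<Sum>a<dm l. rho l p b a * Q' (l, a, r') j)" if "b < dm l" for b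
    proof -
      have "mat_mul J Q' (M1 p) (l, b, r') j = (\<Sum>d\<in>?D. case d of (l', a, r'') \<Rightarrow> if l' = l \<and> r'' = r' then rho l p b a * Q' (l, a, r') j else 0)"
        unfolding bc2(2)[OF p inD(2)[OF that] ij(2), symmetric] unfolding mat_mul_def by (rule sum.cong) (auto simp: block_matrix_def)
      also have "\<dots> = (\<Sum>a<dm l. rho l p b a * Q' (l, a, r') j)" by (rule sum_block_index) (use lr in auto)
      finally show ?thesis .
    qed
    have "mat_mul J (M1 p) (B k) i j = (\<Sum>a<dm l. mat_mul J (M1 p) Q i (l, a, r) * Q' (l, a, r') j)"
      by (simp add: mat_mul_def B_def lr sum_distrib_left sum_distrib_right mult.assoc) (rule sum.swap)
    also have "\<dots> = (\<Sum>a<dm l. \<Sum>b<dm l. Q i (l, b, r) * rho l p b a * Q' (l, a, r') j)"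
      by (simp add: e1 sum_distrib_right)
    also have "\<dots> = (\<Sum>b<dm l. Q i (l, b, r) * mat_mul J Q' (M1 p) (l, b, r') j)"
      by (subst sum.swap) (simp add: e2 sum_distrib_left mult.assoc)
    also have "\<dots> = mat_mul J (B k) (M1 p) i j"
      by (simp add: mat_mul_def B_def lr sum_distrib_left sum_distrib_right mult.assoc) (rule sum.swap)
    finally show "mat_mul J (M1 p) (B k) i j = mat_mul J (B k) (M1 p) i j" .
  qed
  \<comment> \<open>Back in the adapted basis, one entry of each block recovers the coefficients.\<close>
  have QBQ: "mat_mul J Q' (mat_mul J (B k) Q) (l, 0, r) (l, 0, r') = (if k = (l, r, r') then 1 else 0)"
    if k: "k \<in> ?H" and h: "(l, r, r') \<in> ?H" for k l r r'
  proof -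
    obtain lk rk rk' where lr: "k = (lk, rk, rk')" "lk \<in> L" "rk < m lk" "rk' < m lk" using k by (auto simp: hom_index_def)
    have in0: "(l, 0, r) \<in> ?D" "(l, 0, r') \<in> ?D" using h dm_pos by (auto simp: hom_index_def block_index_iff)
    have inD: "(lk, a, rk) \<in> ?D" "(lk, a, rk') \<in> ?D" if "a < dm lk" for a using that lr by (auto simp: block_index_iff)
    have "mat_mul J Q' (mat_mul J (B k) Q) (l, 0, r) (l, 0, r') =
        (\<Sum>i\<in>J. \<Sum>j\<in>J. \<Sum>a<dm lk. Q' (l, 0, r) i * Q i (lk, a, rk) * (Q' (lk, a, rk') j * Q j (l, 0, r')))"
      by (simp add: mat_mul_def B_def lr sum_distrib_left sum_distrib_right mult.assoc)
    also have "\<dots> = (\<Sum>a<dm lk. mat_mul J Q' Q (l, 0, r) (lk, a, rk) * mat_mul J Q' Q (lk, a, rk') (l, 0, r'))"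
      unfolding mat_mul_def sum_product
      by (subst (2) sum.swap, subst sum.swap) (rule refl)
    also have "\<dots> = (\<Sum>a<dm lk. if a = 0 then (if k = (l, r, r') then 1 else 0) else 0)"
      using inD in0 lr by (intro sum.cong refl) (auto simp: bc2(1))
    finally show ?thesis using dm_pos[OF lr(2)] by simp
  qed
  have ind: "c k = 0" if z: "\<forall>i\<in>J. \<forall>j\<in>J. (\<Sum>k\<in>?H. c k * B k i j) = 0" and k: "k \<in> ?H" for c k
  proof -
    obtain l r r' where lr: "k = (l, r, r')" by (cases k)
    have "0 = mat_mul J Q' (mat_mul J (\<lambda>i j. \<Sum>k\<in>?H. c k * B k i j) Q) (l, 0, r) (l, 0, r')"
      using z by (simp add: mat_mul_def)
    also have "\<dots> = (\<Sum>i\<in>J. \<Sum>j\<in>J. \<Sum>k\<in>?H. c k * (Q' (l, 0, r) i * (B k i j * Q j (l, 0, r'))))"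
      by (simp add: mat_mul_def sum_distrib_left sum_distrib_right mult_ac)
    also have "\<dots> = (\<Sum>k\<in>?H. c k * mat_mul J Q' (mat_mul J (B k) Q) (l, 0, r) (l, 0, r'))"
      unfolding mat_mul_def sum_distrib_left by (subst (2) sum.swap, subst sum.swap) (rule refl)
    also have "\<dots> = (\<Sum>k'\<in>?H. if k' = k then c k' else 0)"
      using k lr by (intro sum.cong refl) (simp add: QBQ)
    also have "\<dots> = c k" using k finite_hom_index by simp
    finally show ?thesis by simp
  qed
  have span: "\<exists>c. \<forall>i\<in>J. \<forall>j\<in>J. C i j = (\<Sum>k\<in>?H. c k * B k i j)" if C: "commutes_with n J M1 C" for C
  proof -
    define E where "E = mat_mul J Q' (mat_mul J C Q)"
    have "commutes_with n ?D block_matrix E"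
      unfolding commutes_with_def
    proof (intro allI impI ballI)
      fix p d d' assume p: "p permutes {..<n}" and d: "d \<in> ?D" "d' \<in> ?D"
      have "mat_mul ?D (block_matrix p) E d d' = mat_mul J (mat_mul ?D (block_matrix p) Q') (mat_mul J C Q) d d'"
        unfolding E_def mat_mul_assoc ..
      also have "\<dots> = mat_mul J (mat_mul J Q' (M1 p)) (mat_mul J C Q) d d'"
        by (rule mat_mul_cong) (simp_all add: bc2(2)[OF p d(1)])
      also have "\<dots> = mat_mul J Q' (mat_mul J (mat_mul J (M1 p) C) Q) d d'"
        unfolding mat_mul_assoc ..
      also have "\<dots> = mat_mul J Q' (mat_mul J (mat_mul J C (M1 p)) Q) d d'"
      proof (rule mat_mul_cong)
        fix i assume i: "i \<in> J"
        show "mat_mul J (mat_mul J (M1 p) C) Q i d' = mat_mul J (mat_mul J C (M1 p)) Q i d'"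
          by (rule mat_mul_cong) (use C p i in \<open>simp_all add: commutes_with_def\<close>)
      qed simp
      also have "\<dots> = mat_mul J (mat_mul J Q' C) (mat_mul J (M1 p) Q) d d'"
        unfolding mat_mul_assoc ..
      also have "\<dots> = mat_mul J (mat_mul J Q' C) (mat_mul ?D Q (block_matrix p)) d d'"
        by (rule mat_mul_cong) (simp_all add: bc1(2)[OF p _ d(2)])
      also have "\<dots> = mat_mul ?D E (block_matrix p) d d'"
        unfolding E_def mat_mul_assoc ..
      finally show "mat_mul ?D (block_matrix p) E d d' = mat_mul ?D E (block_matrix p) d d'" .
    qed
    note E = commutant_block_matrix[OF this]
    define c where "c = (\<lambda>(l, r, r'). E (l, 0, r) (l, 0, r'))"
    have "C i j = (\<Sum>k\<in>?H. c k * B k i j)" if ij: "i \<in> J" "j \<in> J" for i j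
    proof -
      have "mat_mul ?D Q (mat_mul ?D E Q') i j = mat_mul J (mat_mul ?D Q Q') (mat_mul J C (mat_mul ?D Q Q')) i j"
        unfolding E_def mat_mul_assoc ..
      also have "\<dots> = mat_mul J C (mat_mul ?D Q Q') i j" using ij fJ by (intro mat_mul_one_left) (auto simp: bc1(1))
      also have "\<dots> = C i j" using ij fJ by (intro mat_mul_one_right) (auto simp: bc1(1))
      finally have "C i j = (\<Sum>d\<in>?D. Q i d * (\<Sum>d'\<in>?D. E d d' * Q' d' j))" by (simp add: mat_mul_def)
      also have "\<dots> = (\<Sum>d\<in>?D. case d of (l, a, r) \<Rightarrow> \<Sum>r'<m l. c (l, r, r') * (Q i (l, a, r) * Q' (l, a, r') j))"
      proof (rule sum.cong[OF refl])
        fix d assume d: "d \<in> ?D"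
        obtain l a r where lar: "d = (l, a, r)" by (cases d)
        have la: "l \<in> L" "a < dm l" using d lar by (auto simp: block_index_iff)
        have Ed: "E (l, a, r) (l', a', r') = (if l' = l \<and> a' = a then c (l, r, r') else 0)" if "(l', a', r') \<in> ?D" for l' a' r'
          using E[OF d[unfolded lar] that] by (simp add: lar c_def)
        have "(\<Sum>d'\<in>?D. E d d' * Q' d' j) = (\<Sum>d'\<in>(\<lambda>r'. (l, a, r')) ` {..<m l}. case d' of (l', a', r') \<Rightarrow> c (l, r, r') * Q' (l, a, r') j)"
          using fD d lar la by (intro sum.mono_neutral_cong_right) (auto simp: block_index_iff Ed image_iff split: if_splits)
        also have "\<dots> = (\<Sum>r'<m l. c (l, r, r') * Q' (l, a, r') j)" by (subst sum.reindex) (auto simp: inj_on_def)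
        finally show "Q i d * (\<Sum>d'\<in>?D. E d d' * Q' d' j) = (case d of (l, a, r) \<Rightarrow> \<Sum>r'<m l. c (l, r, r') * (Q i (l, a, r) * Q' (l, a, r') j))"
          by (simp add: lar sum_distrib_left mult_ac)
      qed
      also have "\<dots> = (\<Sum>l\<in>L. \<Sum>a<dm l. \<Sum>r<m l. \<Sum>r'<m l. c (l, r, r') * (Q i (l, a, r) * Q' (l, a, r') j))"
        by (simp add: sum_block_index_iterated)
      also have "\<dots> = (\<Sum>l\<in>L. \<Sum>r<m l. \<Sum>r'<m l. c (l, r, r') * B (l, r, r') i j)"
        unfolding B_def case_prod_conv sum_distrib_left
        by (rule sum.cong[OF refl], subst sum.swap, rule sum.cong[OF refl], rule sum.swap)
      also have "\<dots> = (\<Sum>k\<in>?H. c k * B k i j)"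
        by (simp add: sum_hom_index_iterated)
      finally show ?thesis .
    qed
    then show ?thesis by blast
  qed
  show ?thesis using comm ind span by (intro exI[of _ B]) blast
qed

end

interpretation specht_sum: sym_rep "pscale (pscale ((*) :: 'k::field_char_0 \<Rightarrow> 'k \<Rightarrow> 'k))" n specht_sum_act for n
proof -
  interpret vector_space "pscale (pscale ((*) :: 'k \<Rightarrow> 'k \<Rightarrow> 'k)) :: 'k \<Rightarrow> (nat list \<times> nat \<Rightarrow> tabloid \<Rightarrow> 'k) \<Rightarrow> _"
    by (rule vector_space_pscale[OF funs.vector_space_axioms])
  show "sym_rep (pscale (pscale ((*) :: 'k \<Rightarrow> 'k \<Rightarrow> 'k))) n specht_sum_act"
    by unfold_locales
      (auto simp: specht_sum_act_def fun_eq_iff specht.act_add specht.act_scale specht.act_comp specht.act_id)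
qed

interpretation specht_tensor: sym_rep "pscale ((*) :: 'k::field_char_0 \<Rightarrow> 'k \<Rightarrow> 'k)" n specht_tensor_act for n
proof
  fix p q :: "nat \<Rightarrow> nat" and x y :: "tabloid \<times> tabloid \<Rightarrow> 'k" and c :: 'k
  show "specht_tensor_act p (x + y) = specht_tensor_act p x + specht_tensor_act p y"
    and "specht_tensor_act p (pscale (*) c x) = pscale (*) c (specht_tensor_act p x)"
    and "specht_tensor_act id x = x"
    by (auto simp: specht_tensor_act_def fun_eq_iff permute_tabloid_id)
  assume "p permutes {..<n}" "q permutes {..<n}"
  then have "inv (p \<circ> q) = inv q \<circ> inv p" by (intro o_inv_distrib permutes_bij)
  then show "specht_tensor_act (p \<circ> q) x = specht_tensor_act p (specht_tensor_act q x)"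
    by (simp only: specht_tensor_act_def permute_tabloid_comp case_prod_conv)
qed

definition outer :: "('a \<Rightarrow> 'k) \<Rightarrow> ('b \<Rightarrow> 'k) \<Rightarrow> 'a \<times> 'b \<Rightarrow> 'k::times" where
  "outer f g = (\<lambda>(x, y). f x * g y)"

lemma specht_tensor_act_outer: "specht_tensor_act p (outer f g) = outer (specht_act p f) (specht_act p g)"
  by (simp add: specht_tensor_act_def outer_def specht_act_def fun_eq_iff)

lemma outer_sum:
  fixes f :: "'i \<Rightarrow> 'a \<Rightarrow> 'k::field" and g :: "'j \<Rightarrow> 'b \<Rightarrow> 'k"
  shows "outer (\<Sum>i\<in>I. pscale (*) (c i) (f i)) (\<Sum>j\<in>J. pscale (*) (d j) (g j)) =
    (\<Sum>(i, j)\<in>I \<times> J. pscale (*) (c i * d j) (outer (f i) (g j)))"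
  by (auto simp: fun_eq_iff outer_def sum_fun_apply sum_product sum.cartesian_product split_beta mult_ac intro!: sum.cong)

locale specht_units = specht_bases n dm b + matrix_units n "partitions n" dm rho u
  for n dm and b :: "nat list \<Rightarrow> nat \<Rightarrow> tabloid \<Rightarrow> 'k::field_char_0" and u
begin

sublocale tens: unit_rep n "partitions n" dm rho u "pscale (*)" specht_tensor_act
  by unfold_locales

sublocale summ: unit_rep n "partitions n" dm rho u "pscale (pscale (*))" specht_sum_act
  by unfold_locales

definition summand_basis :: "nat list \<times> nat \<times> nat \<Rightarrow> nat list \<times> nat \<Rightarrow> tabloid \<Rightarrow> 'k" where
  "summand_basis = (\<lambda>(l, a, r) (l', r'). if l' = l \<and> r' = r then b l a else 0)"

lemma specht_sum_eval:
  assumes "l \<in> partitions n" "r < m l"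
  shows "(\<Sum>d\<in>summ.block_index m. pscale (pscale (*)) (c d) (summand_basis d)) (l, r) =
    (\<Sum>a<dm l. pscale (*) (c (l, a, r)) (b l a))"
proof -
  have "(\<Sum>d\<in>summ.block_index m. pscale (pscale (*)) (c d) (summand_basis d)) (l, r) =
     (\<Sum>d\<in>summ.block_index m. case d of (l', a', r') \<Rightarrow> if l' = l \<and> r' = r then pscale (*) (c (l, a', r)) (b l a') else 0)"
    by (rule trans[OF sum_fun_apply sum.cong[OF refl]]) (auto simp: summand_basis_def fun_eq_iff)
  also have "\<dots> = (\<Sum>a<dm l. pscale (*) (c (l, a, r)) (b l a))"
    by (rule summ.sum_block_index) (use assms in auto)
  finally show ?thesis .
qed

lemma specht_sum_subspace: "specht_sum.subspace (specht_sum n m :: (nat list \<times> nat \<Rightarrow> tabloid \<Rightarrow> 'k) set)"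
  unfolding specht_sum.subspace_def specht_sum_def
  by (auto simp: funs.subspace_0[OF specht_subspace] funs.subspace_add[OF specht_subspace] funs.subspace_scale[OF specht_subspace] split: if_splits)

lemma specht_sum_matrix_rep:
  "matrix_rep_on (pscale (pscale (*))) n specht_sum_act (specht_sum n m) (summ.block_index m) summand_basis summ.block_matrix"
proof -
  let ?D = "summ.block_index m"
  have mem: "summand_basis d \<in> specht_sum n m" if "d \<in> ?D" for d
    using that b_in by (cases d) (auto simp: summ.block_index_iff summand_basis_def specht_sum_def funs.subspace_0[OF specht_subspace])
  have sum_mem: "(\<Sum>d\<in>?D. pscale (pscale (*)) (c d) (summand_basis d)) \<in> specht_sum n m" for c
    by (intro specht_sum.subspace_sum[OF specht_sum_subspace] specht_sum.subspace_scale[OF specht_sum_subspace] mem)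
  have eqI: "F = (\<Sum>d\<in>?D. pscale (pscale (*)) (c d) (summand_basis d))"
    if F: "F \<in> specht_sum n m"
      and eq: "\<And>l r. l \<in> partitions n \<Longrightarrow> r < m l \<Longrightarrow> F (l, r) = (\<Sum>a<dm l. pscale (*) (c (l, a, r)) (b l a))" for F c
  proof
    fix z :: "nat list \<times> nat"
    obtain l r where z: "z = (l, r)" by (cases z)
    show "F z = (\<Sum>d\<in>?D. pscale (pscale (*)) (c d) (summand_basis d)) z"
    proof (cases "l \<in> partitions n \<and> r < m l")
      case True
      then show ?thesis unfolding z by (simp only: eq specht_sum_eval)
    next
      case False
      then show ?thesis using F sum_mem[of c] unfolding z specht_sum_def by auto
    qed
  qed
  have "family_basis (pscale (pscale (*))) (specht_sum n m) ?D summand_basis"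
    unfolding family_basis_def
  proof (intro conjI allI impI ballI)
    show "summand_basis ` ?D \<subseteq> specht_sum n m" using mem by auto
  next
    fix c d assume 0: "(\<Sum>d\<in>?D. pscale (pscale (*)) (c d) (summand_basis d)) = 0" and d: "d \<in> ?D"
    obtain l a r where lar: "d = (l, a, r)" "l \<in> partitions n" "a < dm l" "r < m l"
      using d by (cases d) (auto simp: summ.block_index_iff)
    have "(\<Sum>a<dm l. pscale (*) (c (l, a, r)) (b l a)) = 0"
      unfolding specht_sum_eval[where m = m, OF lar(2,4), symmetric] 0 by simp
    from family_basisD(3)[OF fb[OF lar(2)] this] lar show "c d = 0" by simp
  next
    fix F :: "nat list \<times> nat \<Rightarrow> tabloid \<Rightarrow> 'k"
    assume F: "F \<in> specht_sum n m"
    have "F (l, r) = (\<Sum>a<dm l. pscale (*) (cf l (F (l, r)) a) (b l a))" if "l \<in> partitions n" "r < m l" for l r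
      using F that by (intro coords_expand[OF fb, symmetric]) (auto simp: specht_sum_def)
    then show "\<exists>c. F = (\<Sum>d\<in>?D. pscale (pscale (*)) (c d) (summand_basis d))"
      by (intro exI[of _ "\<lambda>(l, a, r). cf l (F (l, r)) a"] eqI[OF F]) (simp only: case_prod_conv)
  qed (rule summ.finite_block_index)
  moreover have "specht_sum_act p (summand_basis d) = (\<Sum>k\<in>?D. pscale (pscale (*)) (summ.block_matrix p k d) (summand_basis k))"
    if p: "p permutes {..<n}" and d: "d \<in> ?D" for p d
  proof (rule eqI)
    obtain l a r where lar: "d = (l, a, r)" "l \<in> partitions n" "a < dm l" "r < m l"
      using d by (cases d) (auto simp: summ.block_index_iff)
    have act: "specht_sum_act p (summand_basis d) (l', r') = (if l' = l \<and> r' = r then specht_act p (b l a) else 0)" for l' r'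
      using specht.act_0[OF p] by (simp only: specht_sum_act_def summand_basis_def lar case_prod_conv) (simp only: if_distrib[of "specht_act p"] specht.act_0[OF p])
    show "specht_sum_act p (summand_basis d) \<in> specht_sum n m"
      unfolding specht_sum_def mem_Collect_eq act
      using lar specht_act_in_specht[OF lar(2) p b_in[OF lar(2,3)]] by (auto simp: funs.subspace_0[OF specht_subspace])
    fix l' r' assume l': "l' \<in> partitions n" "r' < m l'"
    show "specht_sum_act p (summand_basis d) (l', r') =
        (\<Sum>a'<dm l'. pscale (*) (summ.block_matrix p (l', a', r') d) (b l' a'))"
    proof (cases "l' = l \<and> r' = r")
      case True
      then show ?thesis unfolding act using lar by (simp only: act_b[OF lar(2) p lar(3)] summ.block_matrix_def case_prod_conv) simp
    next
      case False
      have "(\<Sum>a'<dm l'. pscale (*) (summ.block_matrix p (l', a', r') d) (b l' a')) = 0"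
        using False by (intro sum.neutral) (auto simp: summ.block_matrix_def lar)
      then show ?thesis unfolding act using False by (simp only: if_False)
    qed
  qed
  ultimately show ?thesis unfolding matrix_rep_on_def by blast
qed

definition tensor_matrix :: "nat list \<Rightarrow> nat list \<Rightarrow> (nat \<Rightarrow> nat) \<Rightarrow> nat \<times> nat \<Rightarrow> nat \<times> nat \<Rightarrow> 'k" where
  "tensor_matrix la mu p = (\<lambda>(i, k) (j, q). rho la p i j * rho mu p k q)"

lemma specht_tensor_subspace: "funs.subspace (specht_tensor la mu)"
  by (simp add: specht_tensor_def)

lemma specht_tensor_matrix_rep:
  assumes la: "la \<in> partitions n" and mu: "mu \<in> partitions n"
  shows "matrix_rep_on (pscale (*)) n specht_tensor_act (specht_tensor la mu) ({..<dm la} \<times> {..<dm mu})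
    (\<lambda>(i, k). outer (b la i) (b mu k)) (tensor_matrix la mu)"
proof -
  let ?J = "{..<dm la} \<times> {..<dm mu}" and ?y = "\<lambda>(i, k). outer (b la i) (b mu k)"
  have mem: "outer f g \<in> specht_tensor la mu" if "f \<in> specht la" "g \<in> specht mu" for f g :: "tabloid \<Rightarrow> 'k"
    unfolding specht_tensor_def outer_def by (rule funs.span_base) (use that in blast)
  have "family_basis (pscale (*)) (specht_tensor la mu) ?J ?y"
    unfolding family_basis_def
  proof (intro conjI allI impI ballI)
    show "?y ` ?J \<subseteq> specht_tensor la mu" using mem b_in la mu by auto
  next
    fix c d assume 0: "(\<Sum>j\<in>?J. pscale (*) (c j) (?y j)) = 0" and d: "d \<in> ?J"
    have "(\<Sum>k<dm mu. pscale (*) (c (fst d, k)) (b mu k)) = 0"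
    proof
      fix y
      have "(\<Sum>i<dm la. pscale (*) (\<Sum>k<dm mu. c (i, k) * b mu k y) (b la i)) = 0"
      proof
        fix x
        have "(\<Sum>i<dm la. pscale (*) (\<Sum>k<dm mu. c (i, k) * b mu k y) (b la i)) x = (\<Sum>j\<in>?J. pscale (*) (c j) (?y j)) (x, y)"
          by (simp add: sum_fun_apply outer_def sum.cartesian_product sum_distrib_left sum_distrib_right mult_ac split_beta)
        then show "(\<Sum>i<dm la. pscale (*) (\<Sum>k<dm mu. c (i, k) * b mu k y) (b la i)) x = 0 x" by (simp add: 0)
      qed
      from family_basisD(3)[OF fb[OF la] this, of "fst d"] d
      show "(\<Sum>k<dm mu. pscale (*) (c (fst d, k)) (b mu k)) y = 0 y" by (auto simp: sum_fun_apply)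
    qed
    from family_basisD(3)[OF fb[OF mu] this, of "snd d"] d show "c d = 0" by auto
  next
    fix F :: "tabloid \<times> tabloid \<Rightarrow> 'k"
    assume "F \<in> specht_tensor la mu"
    then have "F \<in> funs.span (?y ` ?J)"
    proof (rule set_rev_mp)
      show "specht_tensor la mu \<subseteq> funs.span (?y ` ?J)"
        unfolding specht_tensor_def
      proof (rule funs.span_minimal)
        have "outer f g \<in> funs.span (?y ` ?J)" if f: "f \<in> specht la" and g: "g \<in> specht mu" for f g
        proof -
          have "outer f g = outer (\<Sum>i<dm la. pscale (*) (cf la f i) (b la i)) (\<Sum>k<dm mu. pscale (*) (cf mu g k) (b mu k))"
            by (simp only: coords_expand[OF fb[OF la] f] coords_expand[OF fb[OF mu] g])
          also have "\<dots> \<in> funs.span (?y ` ?J)"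
            unfolding outer_sum
          proof (rule funs.span_sum, clarify)
            fix i k assume "i < dm la" "k < dm mu"
            then have "outer (b la i) (b mu k) \<in> ?y ` ?J" by force
            then show "pscale (*) (cf la f i * cf mu g k) (outer (b la i) (b mu k)) \<in> funs.span (?y ` ?J)"
              by (intro funs.span_scale funs.span_base)
          qed
          finally show ?thesis .
        qed
        then show "{\<lambda>(x, y). f x * g y |f g. f \<in> specht la \<and> g \<in> specht mu} \<subseteq> funs.span (?y ` ?J)"
          unfolding outer_def by blast
      qed (rule funs.subspace_span)
    qed
    then show "\<exists>c. F = (\<Sum>j\<in>?J. pscale (*) (c j) (?y j))" by (rule funs.span_family[rotated]) simp
  qed simp
  moreover have "specht_tensor_act p (?y j) = (\<Sum>k\<in>?J. pscale (*) (tensor_matrix la mu p k j) (?y k))"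
    if p: "p permutes {..<n}" and j: "j \<in> ?J" for p j
  proof -
    obtain i k where ik: "j = (i, k)" "i < dm la" "k < dm mu" using j by auto
    have "specht_tensor_act p (?y j) = outer (specht_act p (b la i)) (specht_act p (b mu k))"
      by (simp only: ik case_prod_conv specht_tensor_act_outer)
    also have "\<dots> = (\<Sum>(i', k')\<in>?J. pscale (*) (rho la p i' i * rho mu p k' k) (outer (b la i') (b mu k')))"
      unfolding act_b[OF la p ik(2)] act_b[OF mu p ik(3)] outer_sum ..
    also have "\<dots> = (\<Sum>k\<in>?J. pscale (*) (tensor_matrix la mu p k j) (?y k))"
      by (rule sum.cong) (auto simp: tensor_matrix_def ik)
    finally show ?thesis .
  qed
  ultimately show ?thesis unfolding matrix_rep_on_def by blast
qed

lemma specht_tensor_invariant: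
  fixes F :: "tabloid \<times> tabloid \<Rightarrow> 'k"
  assumes "la \<in> partitions n" "mu \<in> partitions n" "p permutes {..<n}" "F \<in> specht_tensor la mu"
  shows "specht_tensor_act p F \<in> specht_tensor la mu"
proof -
  note M = specht_tensor_matrix_rep[OF assms(1,2)]
  show ?thesis
    unfolding coords_act[OF specht_tensor.sym_rep_axioms M assms(3,4)]
    by (intro funs.subspace_sum[OF specht_tensor_subspace] funs.subspace_scale[OF specht_tensor_subspace]
        family_basisD(2)[OF matrix_rep_onD(1)[OF M]])
qed

text \<open>The definite description in the definition of the Kronecker coefficients is met by the multiplicities
  in a basis adapted to the matrix units, and only by them: an isomorphism with a sum of Specht modules
  yields such a basis, and \<open>multiplicity_eq_dim\<close> makes its multiplicities unique.\<close>

lemma kronecker_adapted_basis: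
  assumes la: "la \<in> partitions n" and mu: "mu \<in> partitions n"
  shows "\<exists>y. matrix_rep_on (pscale (*)) n specht_tensor_act (specht_tensor la mu)
    (tens.block_index (kronecker TYPE('k) n la mu)) y tens.block_matrix"
proof -
  let ?X = "specht_tensor la mu :: (tabloid \<times> tabloid \<Rightarrow> 'k) set"
  note M = specht_tensor_matrix_rep[OF la mu]
  note inv = specht_tensor_invariant[OF la mu]
  have "?X \<subseteq> funs.span ((\<lambda>(i, k). outer (b la i) (b mu k)) ` ({..<dm la} \<times> {..<dm mu}))"
    by (rule funs.family_basis_independent(3)[OF matrix_rep_onD(1)[OF M]])
  from tens.adapted_basis_exists[OF specht_tensor_subspace this _ inv]
  obtain m y where m0: "\<And>l. l \<notin> partitions n \<Longrightarrow> m l = 0"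
    and y: "matrix_rep_on (pscale (*)) n specht_tensor_act ?X (tens.block_index m) y tens.block_matrix" by auto
  define P where "P m \<longleftrightarrow> (\<forall>nu. nu \<notin> partitions n \<longrightarrow> m nu = 0) \<and>
      rep_isomorphic n (pscale (*)) specht_tensor_act ?X
        (pscale (pscale (*))) specht_sum_act (specht_sum n m :: (nat list \<times> nat \<Rightarrow> tabloid \<Rightarrow> 'k) set)" for m
  have ex: "\<exists>y. matrix_rep_on (pscale (*)) n specht_tensor_act ?X (tens.block_index m') y tens.block_matrix" if "P m'" for m'
    by (rule rep_isomorphic_matrix_rep[OF specht_tensor.sym_rep_axioms specht_sum.sym_rep_axioms
          specht_tensor_subspace inv _ specht_sum_matrix_rep]) (use that in \<open>auto simp: P_def\<close>)
  have Pm: "P m"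
    unfolding P_def using m0 matrix_rep_rep_isomorphic[OF specht_tensor.sym_rep_axioms specht_sum.sym_rep_axioms
        specht_tensor_subspace specht_sum_subspace y specht_sum_matrix_rep] by blast
  have uniq: "m' = m" if P: "P m'" for m'
  proof
    fix l
    obtain y' where y': "matrix_rep_on (pscale (*)) n specht_tensor_act ?X (tens.block_index m') y' tens.block_matrix"
      using ex[OF P] by blast
    show "m' l = m l"
      using tens.multiplicity_eq_dim[OF specht_tensor_subspace y, of l] tens.multiplicity_eq_dim[OF specht_tensor_subspace y', of l]
        m0[of l] P by (cases "l \<in> partitions n") (auto simp: P_def)
  qed
  have "kronecker TYPE('k) n la mu = (THE m. P m)" unfolding kronecker_def P_def ..
  also have "\<dots> = m" using Pm uniq by (rule the_equality)
  finally show ?thesis using y by (intro exI[of _ y]) (simp only:)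
qed

end

section \<open>Polarization\<close>

lemma alternating_sum_supersets:
  fixes N A :: "'a set"
  assumes "finite N" "A \<subseteq> N"
  shows "(\<Sum>S\<in>Pow N. if A \<subseteq> S then (- 1) ^ card (N - S) else 0) = (if A = N then 1 else (0 :: 'k::comm_ring_1))"
proof -
  have "(\<Sum>S\<in>Pow N. if A \<subseteq> S then (- 1) ^ card (N - S) else 0) = (\<Sum>S\<in>{S \<in> Pow N. A \<subseteq> S}. (- 1) ^ card (N - S) :: 'k)"
    using assms by (subst sum.inter_filter) auto
  also have "\<dots> = (\<Sum>X\<in>Pow (N - A). (- 1) ^ card X)"
    by (rule sum.reindex_bij_witness[of _ "\<lambda>X. N - X" "\<lambda>S. N - S"]) (use assms in \<open>auto simp: double_diff\<close>)
  also have "\<dots> = (\<Prod>x\<in>N - A. 1 - 1)"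
    using prod_diff_conv_sum[of "N - A" "\<lambda>_. 1 :: 'k" "\<lambda>_. 1"] assms by simp
  also have "\<dots> = (if A = N then 1 else 0)"
    using assms by (auto simp: prod_zero_iff card_gt_0_iff power_0_left)
  finally show ?thesis .
qed

text \<open>Ryser's formula for the permanent: expand the products over all maps and keep, by inclusion and
  exclusion, the surjective ones.  It serves as the polarization identity, which extracts the
  coefficient of \<open>x\<^sub>0 \<cdots> x\<^bsub>n-1\<^esub>\<close> of a form of degree \<open>n\<close> from its values.\<close>

lemma permanent_inclusion_exclusion:
  fixes m :: "nat \<Rightarrow> nat \<Rightarrow> 'k::comm_ring_1"
  shows "(\<Sum>S\<in>Pow {..<n}. (- 1) ^ card ({..<n} - S) * (\<Prod>k<n. \<Sum>l\<in>S. m k l)) = (\<Sum>\<pi>\<in>Sym n. \<Prod>k<n. m k (\<pi> k))"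
proof -
  let ?N = "{..<n}"
  let ?G = "PiE ?N (\<lambda>_. ?N)"
  have fG: "finite ?G" by (intro finite_PiE) auto
  have exp: "(\<Prod>k<n. \<Sum>l\<in>S. m k l) = (\<Sum>g\<in>?G. if g ` ?N \<subseteq> S then \<Prod>k<n. m k (g k) else 0)" if "S \<in> Pow ?N" for S
  proof -
    have "finite S" using that by (auto intro: finite_subset)
    then have "(\<Prod>k<n. \<Sum>l\<in>S. m k l) = (\<Sum>g\<in>PiE ?N (\<lambda>_. S). \<Prod>k<n. m k (g k))"
      by (intro prod_sum_PiE) auto
    also have "\<dots> = (\<Sum>g\<in>?G. if g ` ?N \<subseteq> S then \<Prod>k<n. m k (g k) else 0)"
      using that fG by (intro sum.mono_neutral_cong_left) (auto simp: PiE_def Pi_def)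
    finally show ?thesis .
  qed
  have "(\<Sum>S\<in>Pow ?N. (- 1) ^ card (?N - S) * (\<Prod>k<n. \<Sum>l\<in>S. m k l)) =
      (\<Sum>S\<in>Pow ?N. \<Sum>g\<in>?G. (\<Prod>k<n. m k (g k)) * (if g ` ?N \<subseteq> S then (- 1) ^ card (?N - S) else 0))"
    by (rule sum.cong[OF refl]) (simp only: exp sum_distrib_left, rule sum.cong, auto)
  also have "\<dots> = (\<Sum>g\<in>?G. (\<Prod>k<n. m k (g k)) * (\<Sum>S\<in>Pow ?N. if g ` ?N \<subseteq> S then (- 1) ^ card (?N - S) else 0))"
    by (subst sum.swap) (simp only: sum_distrib_left)
  also have "\<dots> = (\<Sum>g\<in>?G. if g ` ?N = ?N then \<Prod>k<n. m k (g k) else 0)"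
  proof (rule sum.cong[OF refl])
    fix g assume "g \<in> ?G"
    then have "g ` ?N \<subseteq> ?N" by auto
    then show "(\<Prod>k<n. m k (g k)) * (\<Sum>S\<in>Pow ?N. if g ` ?N \<subseteq> S then (- 1) ^ card (?N - S) else 0) =
        (if g ` ?N = ?N then \<Prod>k<n. m k (g k) else 0)"
      by (simp add: alternating_sum_supersets)
  qed
  also have "\<dots> = (\<Sum>g\<in>{g \<in> ?G. g ` ?N = ?N}. \<Prod>k<n. m k (g k))"
    using fG by (subst sum.inter_filter) auto
  also have "\<dots> = (\<Sum>\<pi>\<in>Sym n. \<Prod>k<n. m k (\<pi> k))"
  proof (rule sum.reindex_bij_witness[of _ "\<lambda>\<pi>. restrict \<pi> ?N" "\<lambda>g k. if k < n then g k else k"])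
    fix g assume g: "g \<in> {g \<in> ?G. g ` ?N = ?N}"
    then have "bij_betw g ?N ?N" using eq_card_imp_inj_on[of ?N g] by (auto simp: bij_betw_def)
    moreover have "bij_betw (\<lambda>k. if k < n then g k else k) ?N ?N = bij_betw g ?N ?N"
      by (rule bij_betw_cong) auto
    ultimately have "(\<lambda>k. if k < n then g k else k) permutes ?N" by (intro bij_imp_permutes) auto
    then show "(\<lambda>k. if k < n then g k else k) \<in> Sym n" by simp
    show "restrict (\<lambda>k. if k < n then g k else k) ?N = g"
      using g by (auto simp: restrict_def PiE_def extensional_def fun_eq_iff)
  next
    fix \<pi> assume "\<pi> \<in> Sym n"
    then have p: "\<pi> permutes ?N" by simp
    have "\<pi> ` ?N = ?N" by (rule permutes_image[OF p])
    then show "restrict \<pi> ?N \<in> {g \<in> ?G. g ` ?N = ?N}" by auto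
    show "(\<lambda>k. if k < n then restrict \<pi> ?N k else k) = \<pi>"
      using permutes_not_in[OF p] by (auto simp: fun_eq_iff)
  qed auto
  finally show ?thesis .
qed

lemma prod_indicator: "(\<Prod>k<(n::nat). if P k then 1 else (0 :: 'k::comm_ring_1)) = (if \<forall>k<n. P k then 1 else 0)"
  by (induction n) (auto simp: less_Suc_eq)

text \<open>If a form of degree \<open>n\<close> in commuting variables vanishes identically, then so do the sums of its
  coefficients over the words with the same letters.\<close>

lemma polarization:
  fixes a :: "'w \<Rightarrow> 'k::comm_ring_1" and ev :: "'w \<Rightarrow> nat \<Rightarrow> 'j"
  assumes zero: "\<And>x :: 'j \<Rightarrow> 'k. (\<Sum>w\<in>W. a w * (\<Prod>k<n. x (ev w k))) = 0"
  shows "(\<Sum>\<pi>\<in>Sym n. \<Sum>w\<in>W. if \<forall>k<n. ev w k = q (\<pi> k) then a w else 0) = 0"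
proof -
  let ?N = "{..<n}"
  \<comment> \<open>The form is evaluated at the sums, over \<open>l \<in> S\<close>, of the unit vectors \<open>q l\<close>.\<close>
  have "0 = (\<Sum>S\<in>Pow ?N. (- 1) ^ card (?N - S) * (\<Sum>w\<in>W. a w * (\<Prod>k<n. \<Sum>l\<in>S. if ev w k = q l then 1 else 0)))"
    using zero[of "\<lambda>j. \<Sum>l\<in>_. if j = q l then 1 else 0"] by simp
  also have "\<dots> = (\<Sum>w\<in>W. a w * (\<Sum>S\<in>Pow ?N. (- 1) ^ card (?N - S) * (\<Prod>k<n. \<Sum>l\<in>S. if ev w k = q l then 1 else 0)))"
    unfolding sum_distrib_left by (subst sum.swap) (simp only: mult.left_commute)
  also have "\<dots> = (\<Sum>w\<in>W. a w * (\<Sum>\<pi>\<in>Sym n. \<Prod>k<n. if ev w k = q (\<pi> k) then 1 else 0))"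
    by (simp only: permanent_inclusion_exclusion)
  also have "\<dots> = (\<Sum>\<pi>\<in>Sym n. \<Sum>w\<in>W. if \<forall>k<n. ev w k = q (\<pi> k) then a w else 0)"
    unfolding sum_distrib_left prod_indicator
    by (subst sum.swap) (intro sum.cong refl, auto)
  finally show ?thesis by simp
qed

section \<open>Density of the general linear group\<close>

lemma (in vector_space) eigenvectors_independent:
  assumes g: "Vector_Spaces.linear scale scale g" and S: "finite S"
    and x: "\<And>c. c \<in> S \<Longrightarrow> x c \<noteq> 0 \<and> g (x c) = scale c (x c)"
    and 0: "(\<Sum>c\<in>S. scale (u c) (x c)) = 0"
  shows "\<forall>c\<in>S. u c = 0"
  using S x 0
proof (induction S arbitrary: u rule: finite_induct)
  case (insert c0 S)
  interpret ss: vector_space_pair scale scale ..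
  have "g (\<Sum>c\<in>insert c0 S. scale (u c) (x c)) = (\<Sum>c\<in>insert c0 S. scale (u c * c) (x c))"
    using insert.prems(1) by (simp only: ss.linear_sum[OF g] ss.linear_scale[OF g]) (auto intro!: sum.cong)
  moreover have "scale c0 (\<Sum>c\<in>insert c0 S. scale (u c) (x c)) = (\<Sum>c\<in>insert c0 S. scale (u c * c0) (x c))"
    by (simp only: scale_sum_right scale_scale mult.commute)
  ultimately have "(\<Sum>c\<in>insert c0 S. scale (u c * c) (x c)) = (\<Sum>c\<in>insert c0 S. scale (u c * c0) (x c))"
    using insert.prems(2) ss.linear_0[OF g] by (metis scale_zero_right)
  then have "(\<Sum>c\<in>insert c0 S. scale (u c * (c - c0)) (x c)) = 0"
    by (simp only: right_diff_distrib scale_left_diff_distrib sum_subtractf) simp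
  then have "(\<Sum>c\<in>S. scale (u c * (c - c0)) (x c)) = 0" using insert.hyps by simp
  then have "\<forall>c\<in>S. u c * (c - c0) = 0" using insert.IH[of "\<lambda>c. u c * (c - c0)"] insert.prems(1) by blast
  then have u: "\<forall>c\<in>S. u c = 0" using insert.hyps(2) by auto
  then have "scale (u c0) (x c0) = 0" using insert.prems(2) insert.hyps by simp
  then show ?case using u insert.prems(1) by auto
qed simp

text \<open>Eigenvectors for different eigenvalues are independent.\<close>

lemma (in finite_dimensional_vector_space) finite_eigenvalues:
  assumes g: "Vector_Spaces.linear scale scale g"
  shows "finite {c. \<exists>x. x \<noteq> 0 \<and> g x = scale c x}"
proof -
  let ?E = "{c. \<exists>x. x \<noteq> 0 \<and> g x = scale c x}"
  define x where "x c = (SOME x. x \<noteq> 0 \<and> g x = scale c x)" for c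
  have x: "x c \<noteq> 0 \<and> g (x c) = scale c (x c)" if "c \<in> ?E" for c
    unfolding x_def by (rule someI_ex) (use that in simp)
  have inj: "inj_on x ?E"
    by (rule inj_onI) (metis x scale_right_imp_eq)
  have "independent (x ` ?E)"
    unfolding independent_explicit_finite_subsets
  proof (intro allI impI ballI)
    fix S u v assume S: "S \<subseteq> x ` ?E" "finite S" "(\<Sum>v\<in>S. scale (u v) v) = 0" and v: "v \<in> S"
    obtain S' where S': "S' \<subseteq> ?E" "S = x ` S'" using S(1) by (auto simp: subset_image_iff)
    have inj': "inj_on x S'" using inj S'(1) by (rule inj_on_subset)
    have fS': "finite S'" using S(2) S'(2) inj' by (simp add: finite_image_iff)
    have "(\<Sum>c\<in>S'. scale (u (x c)) (x c)) = 0" using S(3) by (simp add: S'(2) sum.reindex[OF inj'])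
    from eigenvectors_independent[OF g fS' _ this] x S'(1) show "u v = 0" using v S'(2) by blast
  qed
  then have "finite (x ` ?E)" by (rule finiteI_independent)
  then show ?thesis using inj by (rule finite_imageD)
qed

lemma (in vector_space) linear_map_with_matrix:
  assumes fb: "family_basis scale UNIV J b"
  shows "\<exists>g. Vector_Spaces.linear scale scale g \<and>
    (\<forall>i\<in>J. \<forall>j\<in>J. coords scale J b (g (b j)) i = A i j)"
proof -
  define g where "g x = (\<Sum>i\<in>J. scale (\<Sum>j\<in>J. A i j * coords scale J b x j) (b i))" for x
  have "Vector_Spaces.linear scale scale g"
    unfolding Vector_Spaces.linear_iff
  proof (intro conjI allI)
    show "g (x + y) = g x + g y" for x y
      by (simp add: g_def coords_add_scale[OF fb subspace_UNIV] distrib_left sum.distrib scale_left_distrib)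
    show "g (scale c x) = scale c (g x)" for c x
      by (simp add: g_def coords_add_scale[OF fb subspace_UNIV] scale_sum_right sum_distrib_left mult.left_commute)
  qed (rule vector_space_axioms)+
  moreover have "coords scale J b (g (b j)) i = A i j" if ij: "i \<in> J" "j \<in> J" for i j
  proof -
    have "coords scale J b (g (b j)) i = (\<Sum>k\<in>J. A i k * coords scale J b (b j) k)"
      by (rule coords_eqI[OF fb _ ij(1)]) (rule g_def)
    also have "\<dots> = (\<Sum>k\<in>J. if k = j then A i k else 0)"
      by (rule sum.cong) (simp_all add: coords_basis[OF fb ij(2)])
    finally show ?thesis using ij family_basisD(1)[OF fb] by simp
  qed
  ultimately show ?thesis by blast
qed

text \<open>A polynomial identity between the entries of all invertible matrices can be polarized: adding a
  scalar matrix makes any matrix invertible, up to finitely many exceptions.\<close>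

lemma GL_polarization:
  fixes s :: "'k::field_char_0 \<Rightarrow> 'v::ab_group_add \<Rightarrow> 'v" and a :: "'w \<Rightarrow> 'k" and p q :: "'w \<Rightarrow> nat \<Rightarrow> nat"
  assumes fd: "finite_dimensional_vector_space s BV" and fb: "family_basis s UNIV {..<d} v"
    and pq: "\<And>w k. w \<in> W \<Longrightarrow> k < n \<Longrightarrow> p w k < d \<and> q w k < d"
    and zero: "\<And>g. g \<in> GL s \<Longrightarrow> (\<Sum>w\<in>W. a w * (\<Prod>k<n. coords s {..<d} v (g (v (q w k))) (p w k))) = 0"
  shows "(\<Sum>\<pi>\<in>Sym n. \<Sum>w\<in>W. if \<forall>k<n. p w k = p0 (\<pi> k) \<and> q w k = q0 (\<pi> k) then a w else 0) = 0"
proof -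
  interpret finite_dimensional_vector_space s BV by (rule fd)
  interpret ss: finite_dimensional_vector_space_pair_1 s BV s ..
  have "(\<Sum>w\<in>W. a w * (\<Prod>k<n. x (p w k, q w k))) = 0" for x :: "nat \<times> nat \<Rightarrow> 'k"
  proof -
    obtain g where g: "Vector_Spaces.linear s s g"
      and gx: "\<And>i j. i < d \<Longrightarrow> j < d \<Longrightarrow> coords s {..<d} v (g (v j)) i = x (i, j)"
      using linear_map_with_matrix[OF fb, of "\<lambda>i j. x (i, j)"] by auto
    \<comment> \<open>The linear map \<open>g\<close> has the matrix \<open>x\<close>, and \<open>g + c\<close> is invertible unless \<open>-c\<close> is an eigenvalue.\<close>
    define h where "h c = (\<lambda>z. g z + s c z)" for c
    have ga: "g (y + z) = g y + g z" and gs: "g (s c y) = s c (g y)" for y z c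
      using g by (auto simp: Vector_Spaces.linear_iff)
    have hlin: "Vector_Spaces.linear s s (h c)" for c
      using vector_space_axioms
      by (auto simp: Vector_Spaces.linear_iff h_def ga gs scale_right_distrib scale_left_commute)
    have hmat: "coords s {..<d} v (h c (v j)) i = x (i, j) + (if i = j then c else 0)" if "i < d" "j < d" for c i j
      using that gx coords_basis[OF fb, of j i]
      by (auto simp: h_def coords_add_scale[OF fb subspace_UNIV])
    have hGL: "h c \<in> GL s" if "- c \<notin> {c. \<exists>x. x \<noteq> 0 \<and> g x = s c x}" for c
    proof -
      have "y = 0" if "h c y = 0" for y
      proof -
        have "g y = s (- c) y" using that by (simp add: h_def eq_neg_iff_add_eq_0)
        then show ?thesis using \<open>- c \<notin> _\<close> by blast
      qed
      then have "inj (h c)" using hlin[of c] by (subst ss.linear_inj_iff_eq_0[OF hlin]) auto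
      moreover have "surj (h c)" using linear_inj_imp_surj[OF hlin \<open>inj (h c)\<close>] .
      ultimately show ?thesis using hlin by (simp add: GL_def bij_def)
    qed
    \<comment> \<open>The identity at \<open>g + c\<close> as a polynomial in \<open>c\<close>: it has infinitely many roots, so it vanishes at \<open>0\<close>.\<close>
    define P where "P = (\<Sum>w\<in>W. smult (a w) (\<Prod>k<n. [:x (p w k, q w k), if p w k = q w k then 1 else 0:]))"
    have P: "poly P c = (\<Sum>w\<in>W. a w * (\<Prod>k<n. x (p w k, q w k) + (if p w k = q w k then c else 0)))" for c
      by (auto simp: P_def poly_sum poly_prod intro!: sum.cong prod.cong)
    have "poly P c = 0" if "- c \<notin> {c. \<exists>x. x \<noteq> 0 \<and> g x = s c x}" for c
    proof -
      have "(\<Sum>w\<in>W. a w * (\<Prod>k<n. coords s {..<d} v (h c (v (q w k))) (p w k))) = 0"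
        by (rule zero[OF hGL[OF that]])
      then show ?thesis unfolding P using pq by (simp add: hmat)
    qed
    then have "uminus -` (- {c. \<exists>x. x \<noteq> 0 \<and> g x = s c x}) \<subseteq> {c. poly P c = 0}" by auto
    moreover have "infinite (uminus -` (- {c. \<exists>x. x \<noteq> 0 \<and> g x = s c x}))"
    proof
      assume f1: "finite (uminus -` (- {c. \<exists>x. x \<noteq> 0 \<and> g x = s c x}))"
      have f2: "finite (uminus -` {c. \<exists>x. x \<noteq> 0 \<and> g x = s c x})"
        by (rule finite_vimageI[OF finite_eigenvalues[OF g]]) (simp add: inj_def)
      have U: "(UNIV :: 'k set) = uminus -` (- {c. \<exists>x. x \<noteq> 0 \<and> g x = s c x}) \<union> uminus -` {c. \<exists>x. x \<noteq> 0 \<and> g x = s c x}"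
        by blast
      have "finite (UNIV :: 'k set)" by (subst U) (rule finite_UnI[OF f1 f2])
      then show False using infinite_UNIV_char_0 by blast
    qed
    ultimately have "infinite {c. poly P c = 0}" by (rule infinite_super)
    then have "P = 0" using poly_roots_finite by blast
    then have "poly P 0 = 0" by simp
    then show ?thesis unfolding P by (simp cong: if_cong)
  qed
  from polarization[where ev = "\<lambda>w k. (p w k, q w k)", OF this, of "\<lambda>k. (p0 k, q0 k)"] show ?thesis by simp
qed

section \<open>Forms on the endomorphisms of a tensor product\<close>

lemma GL_inv:
  assumes "g \<in> GL s"
  shows "inv g \<in> GL s"
proof -
  have g: "Vector_Spaces.linear s s g" and b: "bij g" using assms by (auto simp: GL_def)
  have gg: "g (inv g x) = x" "inv g (g x) = x" for x
    using b by (auto simp: bij_is_surj surj_f_inv_f bij_is_inj)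
  have ga: "g (x + y) = g x + g y" and gs: "g (s c x) = s c (g x)" for x y c
    using g by (auto simp: Vector_Spaces.linear_iff)
  have "inv g (x + y) = inv g x + inv g y" for x y by (metis gg ga)
  moreover have "inv g (s c x) = s c (inv g x)" for c x by (metis gg gs)
  ultimately show ?thesis using g b by (auto simp: GL_def Vector_Spaces.linear_iff bij_imp_bij_inv)
qed

lemma homogeneous_funs_subset_poly_funs: "homogeneous_funs s U n \<subseteq> poly_funs s U"
proof
  fix f assume "f \<in> homogeneous_funs s U n"
  then show "f \<in> poly_funs s U" unfolding homogeneous_funs_def
  proof (induction rule: funs.span_induct_alt)
    case base
    have "(\<lambda>x. if x \<in> U then 0 else 0) \<in> poly_funs s U" by (rule poly_funs.const)
    then show ?case by (simp add: zero_fun_def)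
  next
    case (step c f g)
    then obtain l where f: "f = (\<lambda>x. if x \<in> U then \<Prod>i<n. l i x else 0)" and l: "\<forall>i<n. l i \<in> dual_space s U" by auto
    have "(\<lambda>x. if x \<in> U then \<Prod>i<m. l i x else 0) \<in> poly_funs s U" if "m \<le> n" for m
      using that
    proof (induction m)
      case 0
      then show ?case using poly_funs.const[of U 1 s] by (simp cong: if_cong)
    next
      case (Suc m)
      have "(\<lambda>x. (if x \<in> U then \<Prod>i<m. l i x else 0) * l m x) \<in> poly_funs s U"
        by (rule poly_funs.mult[OF _ poly_funs.linear]) (use Suc l in auto)
      moreover have "(\<lambda>x. (if x \<in> U then \<Prod>i<m. l i x else 0) * l m x) = (\<lambda>x. if x \<in> U then \<Prod>i<Suc m. l i x else 0)"
        by auto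
      ultimately show ?case by simp
    qed
    then have "f \<in> poly_funs s U" using f by simp
    then have "(\<lambda>x. (if x \<in> U then c else 0) * f x + g x) \<in> poly_funs s U"
      using step.IH by (intro poly_funs.add poly_funs.mult poly_funs.const)
    moreover have "(\<lambda>x. (if x \<in> U then c else 0) * f x + g x) = pscale (*) c f + g"
      by (auto simp: f fun_eq_iff)
    ultimately have "pscale (*) c f + g \<in> poly_funs s U" by simp
    then show ?case .
  qed
qed

text \<open>A word of length \<open>n\<close> in pairs of letters is kept as a pair of words, so that the places of its two
  components can be permuted independently.\<close>

type_synonym word_pair = "(nat \<Rightarrow> nat) \<times> (nat \<Rightarrow> nat)"

locale tensor_frame =
  fixes sV :: "'k::field_char_0 \<Rightarrow> 'v::ab_group_add \<Rightarrow> 'v" and sW :: "'k \<Rightarrow> 'w::ab_group_add \<Rightarrow> 'w"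
    and sT :: "'k \<Rightarrow> 't::ab_group_add \<Rightarrow> 't" and tens :: "'v \<Rightarrow> 'w \<Rightarrow> 't"
    and BV :: "'v set" and BW :: "'w set" and d1 d2 n :: nat and v :: "nat \<Rightarrow> 'v" and w :: "nat \<Rightarrow> 'w"
  assumes fdV: "finite_dimensional_vector_space sV BV" and fdW: "finite_dimensional_vector_space sW BW"
    and tp: "is_tensor_product sV sW sT tens"
    and fv: "family_basis sV UNIV {..<d1} v" and fw: "family_basis sW UNIV {..<d2} w"
begin

sublocale V: finite_dimensional_vector_space sV BV by (rule fdV)
sublocale W: finite_dimensional_vector_space sW BW by (rule fdW)
sublocale T: vector_space sT using tp by (simp add: is_tensor_product_def)
sublocale E: vector_space "pscale sT :: 'k \<Rightarrow> ('t \<Rightarrow> 't) \<Rightarrow> 't \<Rightarrow> 't"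
  by (rule vector_space_pscale[OF T.vector_space_axioms])
sublocale TT: vector_space_pair sT sT ..
sublocale VT: vector_space_pair sV sT ..
sublocale WT: vector_space_pair sW sT ..

abbreviation mV :: "('v \<Rightarrow> 'v) \<Rightarrow> nat \<Rightarrow> nat \<Rightarrow> 'k" where "mV g i j \<equiv> coords sV {..<d1} v (g (v j)) i"
abbreviation mW :: "('w \<Rightarrow> 'w) \<Rightarrow> nat \<Rightarrow> nat \<Rightarrow> 'k" where "mW h i j \<equiv> coords sW {..<d2} w (h (w j)) i"

definition letters :: "(nat \<times> nat) set" where "letters = {..<d1} \<times> {..<d2}"

definition e :: "nat \<times> nat \<Rightarrow> 't" where "e P = tens (v (fst P)) (w (snd P))"

lemma finite_letters [simp]: "finite letters" by (simp add: letters_def)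

lemma tens_linear: "Vector_Spaces.linear sW sT (tens x)" "Vector_Spaces.linear sV sT (\<lambda>x. tens x y)"
  using tp by (auto simp: is_tensor_product_def bilinear_map_def)

lemma tens_sum:
  "tens (\<Sum>i\<in>I. sV (c i) (x i)) (\<Sum>j\<in>J. sW (d j) (y j)) = (\<Sum>i\<in>I. \<Sum>j\<in>J. sT (c i * d j) (tens (x i) (y j)))"
proof -
  have a: "tens (\<Sum>i\<in>I. sV (c i) (x i)) z = (\<Sum>i\<in>I. sT (c i) (tens (x i) z))" for z
    using VT.linear_sum[OF tens_linear(2)[of z], of "\<lambda>i. sV (c i) (x i)" I] VT.linear_scale[OF tens_linear(2)[of z]] by simp
  have b: "tens z (\<Sum>j\<in>J. sW (d j) (y j)) = (\<Sum>j\<in>J. sT (d j) (tens z (y j)))" for z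
    using WT.linear_sum[OF tens_linear(1)[of z], of "\<lambda>j. sW (d j) (y j)" J] WT.linear_scale[OF tens_linear(1)[of z]] by simp
  show ?thesis unfolding a unfolding b T.scale_sum_right T.scale_scale ..
qed

lemma tens_expand:
  "tens x y = (\<Sum>P\<in>letters. sT (coords sV {..<d1} v x (fst P) * coords sW {..<d2} w y (snd P)) (e P))"
proof -
  have "tens x y = tens (\<Sum>i<d1. sV (coords sV {..<d1} v x i) (v i)) (\<Sum>j<d2. sW (coords sW {..<d2} w y j) (w j))"
    by (simp add: coords_expand[OF fv] coords_expand[OF fw])
  then show ?thesis unfolding tens_sum by (simp add: letters_def e_def sum.cartesian_product split_beta)
qed

text \<open>Independence comes from the universal property, applied to the products of a coordinate on each
factor.\<close>

lemma fe: "family_basis sT UNIV letters e"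
  unfolding family_basis_def
proof (intro conjI allI impI ballI)
  fix c P assume 0: "(\<Sum>P\<in>letters. sT (c P) (e P)) = 0" and P: "P \<in> letters"
  interpret K: vector_space "(*) :: 'k \<Rightarrow> 'k \<Rightarrow> 'k" by (rule vector_space_times)
  interpret TK: vector_space_pair sT "(*) :: 'k \<Rightarrow> 'k \<Rightarrow> 'k" ..
  define b where "b x y = coords sV {..<d1} v x (fst P) * coords sW {..<d2} w y (snd P)" for x y
  have P12: "fst P \<in> {..<d1}" "snd P \<in> {..<d2}" using P by (auto simp: letters_def)
  have "bilinear_map sV sW (*) b"
    unfolding bilinear_map_def Vector_Spaces.linear_iff b_def
      V.coords_add_scale[OF fv V.subspace_UNIV UNIV_I UNIV_I P12(1)]
      W.coords_add_scale[OF fw W.subspace_UNIV UNIV_I UNIV_I P12(2)]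
    by (intro conjI allI V.vector_space_axioms W.vector_space_axioms K.vector_space_axioms)
      (simp_all only: distrib_left distrib_right mult.assoc mult.left_commute)
  then obtain f where f: "Vector_Spaces.linear sT (*) f" and fb: "\<And>x y. f (tens x y) = b x y"
    using tp unfolding is_tensor_product_def by metis
  have fe: "f (e Q) = (if Q = P then 1 else 0)" if "Q \<in> letters" for Q
    using that P12 V.coords_basis[OF fv, of "fst Q" "fst P"] W.coords_basis[OF fw, of "snd Q" "snd P"]
    by (auto simp: e_def fb b_def letters_def prod_eq_iff)
  have "0 = f (\<Sum>P\<in>letters. sT (c P) (e P))" using TK.linear_0[OF f] 0 by simp
  also have "\<dots> = (\<Sum>Q\<in>letters. if Q = P then c Q else 0)"
    unfolding TK.linear_sum[OF f] TK.linear_scale[OF f] by (rule sum.cong) (auto simp: fe)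
  also have "\<dots> = c P" using P by simp
  finally show "c P = 0" by simp
next
  fix x :: 't
  have "tens x y \<in> T.span (e ` letters)" for x y
    by (subst tens_expand) (rule T.span_sum, rule T.span_scale, rule T.span_base, rule imageI)
  then have "{tens x y |x y. True} \<subseteq> T.span (e ` letters)" by blast
  then have "T.span {tens x y |x y. True} \<subseteq> T.span (e ` letters)" by (rule T.span_minimal) (rule T.subspace_span)
  then have "x \<in> T.span (e ` letters)" using is_tensor_product_span[OF tp] by blast
  then show "\<exists>c. x = (\<Sum>P\<in>letters. sT (c P) (e P))" by (rule T.span_family[rotated]) simp
qed simp_all

definition mat :: "('t \<Rightarrow> 't) \<Rightarrow> nat \<times> nat \<Rightarrow> nat \<times> nat \<Rightarrow> 'k" where
  "mat X P Q = coords sT letters e (X (e Q)) P"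

lemma mat_expand: "X (e Q) = (\<Sum>P\<in>letters. sT (mat X P Q) (e P))"
  unfolding mat_def by (rule coords_expand[OF fe UNIV_I, symmetric])

lemma End_linear: "X \<in> End sT \<Longrightarrow> Vector_Spaces.linear sT sT X"
  by (simp add: End_def)

lemma End_comp: "X \<in> End sT \<Longrightarrow> Y \<in> End sT \<Longrightarrow> X \<circ> Y \<in> End sT"
  using Vector_Spaces.linear_compose[of sT sT Y sT X] by (simp add: End_def)

lemma mat_comp:
  assumes X: "X \<in> End sT" and P: "P \<in> letters"
  shows "mat (X \<circ> Y) P Q = (\<Sum>R\<in>letters. mat X P R * mat Y R Q)"
proof -
  have "X (Y (e Q)) = (\<Sum>R\<in>letters. sT (mat Y R Q) (X (e R)))"
    by (subst mat_expand[of Y]) (simp add: TT.linear_sum[OF End_linear[OF X]] TT.linear_scale[OF End_linear[OF X]])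
  then have "mat (X \<circ> Y) P Q = coords sT letters e (\<Sum>R\<in>letters. sT (mat Y R Q) (X (e R))) P" by (simp add: mat_def)
  also have "\<dots> = (\<Sum>R\<in>letters. mat Y R Q * coords sT letters e (X (e R)) P)"
    by (rule T.coords_sum[OF fe]) (use P in auto)
  finally show ?thesis by (simp add: mat_def mult.commute)
qed

lemma mat_eqI:
  assumes X: "X \<in> End sT" and Y: "Y \<in> End sT" and eq: "\<And>P Q. P \<in> letters \<Longrightarrow> Q \<in> letters \<Longrightarrow> mat X P Q = mat Y P Q"
  shows "X = Y"
proof
  fix x
  have "X (e Q) = Y (e Q)" if "Q \<in> letters" for Q
    unfolding mat_expand[of X] mat_expand[of Y] using eq that by simp
  then have "X (\<Sum>P\<in>letters. sT (coords sT letters e x P) (e P)) = Y (\<Sum>P\<in>letters. sT (coords sT letters e x P) (e P))"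
    by (simp add: TT.linear_sum[OF End_linear[OF X]] TT.linear_scale[OF End_linear[OF X]]
        TT.linear_sum[OF End_linear[OF Y]] TT.linear_scale[OF End_linear[OF Y]])
  then show "X x = Y x" by (simp add: coords_expand[OF fe])
qed

lemma mat_surj: "\<exists>X\<in>End sT. \<forall>P\<in>letters. \<forall>Q\<in>letters. mat X P Q = A P Q"
  using T.linear_map_with_matrix[OF fe, of A] by (auto simp: End_def mat_def)

lemma End_subspace: "E.subspace (End sT)"
  unfolding E.subspace_def End_def
  by (auto simp: Vector_Spaces.linear_iff T.vector_space_axioms T.scale_right_distrib T.scale_left_commute)

lemma mat_sum:
  assumes "P \<in> letters"
  shows "mat (\<Sum>j\<in>J. pscale sT (c j) (X j)) P Q = (\<Sum>j\<in>J. c j * mat (X j) P Q)"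
  unfolding mat_def sum_fun_apply pscale_apply by (rule T.coords_sum[OF fe]) (use assms in auto)

definition unit_end :: "(nat \<times> nat) \<times> (nat \<times> nat) \<Rightarrow> 't \<Rightarrow> 't" where
  "unit_end = (\<lambda>(P, Q). SOME X. X \<in> End sT \<and> (\<forall>P'\<in>letters. \<forall>Q'\<in>letters. mat X P' Q' = (if P' = P \<and> Q' = Q then 1 else 0)))"

lemma unit_end: "unit_end (P, Q) \<in> End sT"
  "P' \<in> letters \<Longrightarrow> Q' \<in> letters \<Longrightarrow> mat (unit_end (P, Q)) P' Q' = (if P' = P \<and> Q' = Q then 1 else 0)"
proof -
  have "\<exists>X. X \<in> End sT \<and> (\<forall>P'\<in>letters. \<forall>Q'\<in>letters. mat X P' Q' = (if P' = P \<and> Q' = Q then 1 else 0))"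
    using mat_surj[of "\<lambda>P' Q'. if P' = P \<and> Q' = Q then 1 else 0"] by blast
  from someI_ex[OF this] show "unit_end (P, Q) \<in> End sT"
    "P' \<in> letters \<Longrightarrow> Q' \<in> letters \<Longrightarrow> mat (unit_end (P, Q)) P' Q' = (if P' = P \<and> Q' = Q then 1 else 0)"
    unfolding unit_end_def by auto
qed

lemma End_expand:
  assumes X: "X \<in> End sT"
  shows "X = (\<Sum>PQ\<in>letters \<times> letters. pscale sT (mat X (fst PQ) (snd PQ)) (unit_end PQ))"
proof (rule mat_eqI[OF X])
  show "(\<Sum>PQ\<in>letters \<times> letters. pscale sT (mat X (fst PQ) (snd PQ)) (unit_end PQ)) \<in> End sT"
    by (intro E.subspace_sum[OF End_subspace] E.subspace_scale[OF End_subspace]) (auto simp: unit_end)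
  fix P Q assume PQ: "P \<in> letters" "Q \<in> letters"
  have "mat (\<Sum>PQ\<in>letters \<times> letters. pscale sT (mat X (fst PQ) (snd PQ)) (unit_end PQ)) P Q =
      (\<Sum>PQ\<in>letters \<times> letters. mat X (fst PQ) (snd PQ) * mat (unit_end PQ) P Q)"
    by (rule mat_sum[OF PQ(1)])
  also have "\<dots> = (\<Sum>PQ\<in>letters \<times> letters. if PQ = (P, Q) then mat X P Q else 0)"
    by (rule sum.cong) (auto simp: unit_end PQ split: if_splits)
  finally show "mat X P Q = mat (\<Sum>PQ\<in>letters \<times> letters. pscale sT (mat X (fst PQ) (snd PQ)) (unit_end PQ)) P Q"
    using PQ by simp
qed

lemma dual_expand:
  assumes l: "l \<in> dual_space (pscale sT) (End sT)" and X: "X \<in> End sT"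
  shows "l X = (\<Sum>P\<in>letters. \<Sum>Q\<in>letters. l (unit_end (P, Q)) * mat X P Q)"
proof -
  have lin: "linear_on (pscale sT) (*) (End sT) l" using l by (simp add: dual_space_def)
  have "l X = l (\<Sum>PQ\<in>letters \<times> letters. pscale sT (mat X (fst PQ) (snd PQ)) (unit_end PQ))"
    by (simp only: End_expand[OF X, symmetric])
  also have "\<dots> = (\<Sum>PQ\<in>letters \<times> letters. mat X (fst PQ) (snd PQ) * l (unit_end PQ))"
    by (rule linear_on_sum[OF E.vector_space_axioms vector_space_times End_subspace lin]) (auto simp: unit_end)
  finally show ?thesis by (simp add: sum.cartesian_product split_beta mult.commute)
qed

lemma mat_dual:
  assumes "P \<in> letters"
  shows "(\<lambda>X. if X \<in> End sT then mat X P Q else 0) \<in> dual_space (pscale sT) (End sT)"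
proof -
  have "X + Y \<in> End sT" "pscale sT c X \<in> End sT" if "X \<in> End sT" "Y \<in> End sT" for X Y c
    using that by (auto intro: E.subspace_add[OF End_subspace] E.subspace_scale[OF End_subspace])
  moreover have "mat (X + Y) P Q = mat X P Q + mat Y P Q" "mat (pscale sT c X) P Q = c * mat X P Q" for X Y c
    unfolding mat_def plus_fun_apply pscale_apply
    by (rule T.coords_add_scale[OF fe T.subspace_UNIV UNIV_I UNIV_I assms])+
  ultimately show ?thesis by (auto simp: dual_space_def linear_on_def)
qed

definition words :: "nat \<Rightarrow> (nat \<Rightarrow> nat) set" where "words d = PiE {..<n} (\<lambda>_. {..<d})"

definition word_pairs :: "word_pair set" where "word_pairs = words d1 \<times> words d2"

definition letter :: "word_pair \<Rightarrow> nat \<Rightarrow> nat \<times> nat" where "letter I k = (fst I k, snd I k)"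

lemma finite_words [simp]: "finite (words d)" unfolding words_def by (intro finite_PiE) auto
lemma finite_word_pairs [simp]: "finite word_pairs" by (simp add: word_pairs_def)

lemma letter_in_letters: "I \<in> word_pairs \<Longrightarrow> k < n \<Longrightarrow> letter I k \<in> letters"
  by (auto simp: word_pairs_def words_def letter_def letters_def PiE_def Pi_def)

lemma prod_sum_words:
  fixes f :: "nat \<Rightarrow> nat \<times> nat \<Rightarrow> 'k"
  shows "(\<Prod>k<n. \<Sum>P\<in>letters. f k P) = (\<Sum>I\<in>word_pairs. \<Prod>k<n. f k (letter I k))"
proof -
  have "(\<Prod>k<n. \<Sum>P\<in>letters. f k P) = (\<Prod>k<n. \<Sum>i<d1. \<Sum>a<d2. f k (i, a))"
    by (simp add: letters_def sum.cartesian_product split_beta)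
  also have "\<dots> = (\<Sum>i\<in>words d1. \<Prod>k<n. \<Sum>a<d2. f k (i k, a))"
    unfolding words_def by (rule prod_sum_PiE) auto
  also have "\<dots> = (\<Sum>i\<in>words d1. \<Sum>a\<in>words d2. \<Prod>k<n. f k (i k, a k))"
    unfolding words_def by (intro sum.cong refl prod_sum_PiE) auto
  finally show ?thesis by (simp add: word_pairs_def letter_def sum.cartesian_product split_beta)
qed

definition bishift :: "(nat \<Rightarrow> nat) \<Rightarrow> (nat \<Rightarrow> nat) \<Rightarrow> word_pair \<Rightarrow> word_pair" where
  "bishift p q I = (fst I \<circ> p, snd I \<circ> q)"

lemma words_comp:
  assumes "p permutes {..<n}"
  shows "i \<circ> p \<in> words d \<longleftrightarrow> i \<in> words d"
proof -
  have *: "i \<circ> p \<in> words d" if "i \<in> words d" "p permutes {..<n}" for i p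
    using that permutes_in_image[OF that(2)] permutes_not_in[OF that(2)]
    by (auto simp: words_def PiE_iff extensional_def)
  have "i \<circ> p \<circ> inv p = i" by (simp add: comp_assoc permutes_inv_o[OF assms])
  then show ?thesis using *[OF _ assms, of i] *[OF _ permutes_inv[OF assms], of "i \<circ> p"] by auto
qed

lemma bishift_word_pairs: "p permutes {..<n} \<Longrightarrow> q permutes {..<n} \<Longrightarrow> bishift p q I \<in> word_pairs \<longleftrightarrow> I \<in> word_pairs"
  by (simp add: bishift_def word_pairs_def mem_Times_iff words_comp)

lemma bishift_inv:
  assumes "p permutes {..<n}" "q permutes {..<n}"
  shows "bishift p q (bishift (inv p) (inv q) I) = I" "bishift (inv p) (inv q) (bishift p q I) = I"
  by (simp_all add: bishift_def comp_assoc permutes_inv_o[OF assms(1)] permutes_inv_o[OF assms(2)])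

lemma sum_word_pairs_bishift:
  assumes "p permutes {..<n}" "q permutes {..<n}"
  shows "(\<Sum>I\<in>word_pairs. f (bishift p q I)) = (\<Sum>I\<in>word_pairs. f I)"
  by (rule sum.reindex_bij_witness[of _ "bishift (inv p) (inv q)" "bishift p q"])
    (use assms in \<open>auto simp: bishift_word_pairs bishift_inv permutes_inv\<close>)

lemma words_eqI: "i \<in> words d \<Longrightarrow> j \<in> words d' \<Longrightarrow> (\<And>k. k < n \<Longrightarrow> i k = j k) \<Longrightarrow> i = j"
  unfolding words_def by (rule ext) (metis PiE_E lessThan_iff)

lemma letter_bishift: "letter (bishift p p I) k = letter I (p k)"
  by (simp add: letter_def bishift_def)

text \<open>The matrix entry \<open>(I, J)\<close> of the tensor power of \<open>X\<close>.\<close>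

definition mon :: "('t \<Rightarrow> 't) \<Rightarrow> word_pair \<Rightarrow> word_pair \<Rightarrow> 'k" where
  "mon X I J = (\<Prod>k<n. mat X (letter I k) (letter J k))"

lemma mon_bishift: "p permutes {..<n} \<Longrightarrow> mon X (bishift p p I) (bishift p p J) = mon X I J"
  unfolding mon_def letter_bishift
  by (rule prod.reindex_bij_betw[where h = p and g = "\<lambda>k. mat X (letter I k) (letter J k)"]) (rule permutes_imp_bij)

lemma mon_comp:
  assumes "X \<in> End sT" "I \<in> word_pairs"
  shows "mon (X \<circ> Y) I J = (\<Sum>R\<in>word_pairs. mon X I R * mon Y R J)"
proof -
  have "mon (X \<circ> Y) I J = (\<Prod>k<n. \<Sum>R\<in>letters. mat X (letter I k) R * mat Y R (letter J k))"
    unfolding mon_def using assms letter_in_letters by (intro prod.cong) (auto simp: mat_comp)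
  also have "\<dots> = (\<Sum>R\<in>word_pairs. mon X I R * mon Y R J)"
    unfolding prod_sum_words mon_def by (simp add: prod.distrib)
  finally show ?thesis .
qed

text \<open>The form with coefficients \<open>A\<close>, that is, the trace of \<open>A\<^sup>T X\<^bsup>\<otimes>n\<^esup>\<close>.\<close>

definition form :: "(word_pair \<Rightarrow> word_pair \<Rightarrow> 'k) \<Rightarrow> ('t \<Rightarrow> 't) \<Rightarrow> 'k" where
  "form A = (\<lambda>X. if X \<in> End sT then \<Sum>I\<in>word_pairs. \<Sum>J\<in>word_pairs. A I J * mon X I J else 0)"

lemma form_in_homogeneous: "form A \<in> homogeneous_funs (pscale sT) (End sT) n"
proof -
  have "form A = (\<Sum>I\<in>word_pairs. \<Sum>J\<in>word_pairs. pscale (*) (A I J)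
      (\<lambda>X. if X \<in> End sT then \<Prod>k<n. (if X \<in> End sT then mat X (letter I k) (letter J k) else 0) else 0))"
    by (rule ext) (simp add: form_def sum_fun_apply mon_def cong: if_cong)
  also have "\<dots> \<in> homogeneous_funs (pscale sT) (End sT) n"
    unfolding homogeneous_funs_def
  proof (intro funs.span_sum funs.span_scale funs.span_base)
    fix I J assume IJ: "I \<in> word_pairs" "J \<in> word_pairs"
    have "\<forall>k<n. (\<lambda>X. if X \<in> End sT then mat X (letter I k) (letter J k) else 0) \<in> dual_space (pscale sT) (End sT)"
      using IJ by (intro allI impI mat_dual letter_in_letters)
    then show "(\<lambda>X. if X \<in> End sT then \<Prod>k<n. (if X \<in> End sT then mat X (letter I k) (letter J k) else 0) else 0) \<in>
        {(\<lambda>x. if x \<in> End sT then \<Prod>i<n. l i x else 0) |l. \<forall>i<n. l i \<in> dual_space (pscale sT) (End sT)}"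
      by (intro CollectI exI[of _ "\<lambda>k X. if X \<in> End sT then mat X (letter I k) (letter J k) else 0"] conjI refl)
  qed
  finally show ?thesis .
qed

lemma form_add: "form A + form B = form (\<lambda>I J. A I J + B I J)"
  by (rule ext) (simp only: plus_fun_apply form_def sum.distrib distrib_right, simp)

lemma form_scale: "pscale (*) c (form A) = form (\<lambda>I J. c * A I J)"
proof
  fix X
  have eq: "c * (\<Sum>I\<in>word_pairs. \<Sum>J\<in>word_pairs. A I J * mon X I J) = (\<Sum>I\<in>word_pairs. \<Sum>J\<in>word_pairs. c * A I J * mon X I J)"
    unfolding sum_distrib_left by (intro sum.cong refl) (rule mult.assoc[symmetric])
  show "pscale (*) c (form A) X = form (\<lambda>I J. c * A I J) X"
    unfolding form_def pscale_apply eq[symmetric] by (cases "X \<in> End sT") (simp_all only: if_True if_False mult_zero_right)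
qed

lemma form_sum: "(\<Sum>k\<in>S. pscale (*) (c k) (form (A k))) = form (\<lambda>I J. \<Sum>k\<in>S. c k * A k I J)"
proof
  fix X
  show "(\<Sum>k\<in>S. pscale (*) (c k) (form (A k))) X = form (\<lambda>I J. \<Sum>k\<in>S. c k * A k I J) X"
  proof (cases "X \<in> End sT")
    case True
    have "(\<Sum>k\<in>S. c k * (\<Sum>I\<in>word_pairs. \<Sum>J\<in>word_pairs. A k I J * mon X I J)) =
        (\<Sum>I\<in>word_pairs. \<Sum>J\<in>word_pairs. (\<Sum>k\<in>S. c k * A k I J) * mon X I J)"
      unfolding sum_distrib_left sum_distrib_right
      by (subst sum.swap, rule sum.cong[OF refl], subst sum.swap) (simp add: mult.assoc)
    then show ?thesis using True by (simp add: form_def sum_fun_apply)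
  qed (simp add: form_def sum_fun_apply)
qed

lemma form_cong: "(\<And>I J. I \<in> word_pairs \<Longrightarrow> J \<in> word_pairs \<Longrightarrow> A I J = B I J) \<Longrightarrow> form A = form B"
  unfolding form_def by (intro ext if_cong sum.cong refl) simp

lemma homogeneous_is_form:
  assumes "f \<in> homogeneous_funs (pscale sT) (End sT) n"
  shows "\<exists>A. f = form A"
  using assms unfolding homogeneous_funs_def
proof (induction rule: funs.span_induct_alt)
  case base
  show ?case by (rule exI[of _ "\<lambda>_ _. 0"]) (simp add: form_def fun_eq_iff)
next
  case (step c f g)
  then obtain l where f: "f = (\<lambda>X. if X \<in> End sT then \<Prod>i<n. l i X else 0)"
    and l: "\<And>i. i < n \<Longrightarrow> l i \<in> dual_space (pscale sT) (End sT)" by auto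
  obtain B where g: "g = form B" using step.IH by blast
  have "f = form (\<lambda>I J. \<Prod>k<n. l k (unit_end (letter I k, letter J k)))"
  proof
    fix X
    show "f X = form (\<lambda>I J. \<Prod>k<n. l k (unit_end (letter I k, letter J k))) X"
    proof (cases "X \<in> End sT")
      case True
      have "(\<Prod>k<n. l k X) = (\<Prod>k<n. \<Sum>P\<in>letters. \<Sum>Q\<in>letters. l k (unit_end (P, Q)) * mat X P Q)"
        by (rule prod.cong) (auto simp: dual_expand[OF l True])
      also have "\<dots> = (\<Sum>I\<in>word_pairs. \<Sum>J\<in>word_pairs. \<Prod>k<n. l k (unit_end (letter I k, letter J k)) * mat X (letter I k) (letter J k))"
        by (simp only: prod_sum_words)
      finally show ?thesis using True by (simp add: f form_def mon_def prod.distrib)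
    qed (simp add: f form_def)
  qed
  then obtain A where A: "f = form A" by blast
  show ?case unfolding A g form_scale form_add by blast
qed

text \<open>The coefficient matrices that commute with the simultaneous permutations of all places.\<close>

definition sym_coeffs where
  "sym_coeffs A \<longleftrightarrow> (\<forall>p. p permutes {..<n} \<longrightarrow> (\<forall>I\<in>word_pairs. \<forall>J\<in>word_pairs. A (bishift p p I) (bishift p p J) = (A I J :: 'k)))"

text \<open>Permuting the places simultaneously does not change the monomials, so the coefficients may be
averaged.\<close>

lemma form_symmetrize:
  assumes f: "f \<in> homogeneous_funs (pscale sT) (End sT) n"
  shows "\<exists>A. sym_coeffs A \<and> f = form A"
proof -
  obtain A where A: "f = form A" using homogeneous_is_form[OF f] by blast
  define B where "B I J = (1 / of_nat (fact n)) * (\<Sum>p\<in>Sym n. A (bishift p p I) (bishift p p J))" for I J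
  have "sym_coeffs B"
    unfolding sym_coeffs_def
  proof (intro allI impI ballI)
    fix q I J assume q: "q permutes {..<n}"
    have "(\<Sum>p\<in>Sym n. A (bishift p p (bishift q q I)) (bishift p p (bishift q q J))) =
        (\<Sum>p\<in>Sym n. A (bishift (q \<circ> p) (q \<circ> p) I) (bishift (q \<circ> p) (q \<circ> p) J))"
      by (simp add: bishift_def comp_assoc)
    also have "\<dots> = (\<Sum>p\<in>Sym n. A (bishift p p I) (bishift p p J))"
      by (rule sum_Sym_left[OF q])
    finally show "B (bishift q q I) (bishift q q J) = B I J" by (simp add: B_def)
  qed
  moreover have "f = form B"
  proof -
    have p: "form (\<lambda>I J. A (bishift p p I) (bishift p p J)) = form A" if p: "p permutes {..<n}" for p
    proof
      fix X
      have "(\<Sum>I\<in>word_pairs. \<Sum>J\<in>word_pairs. A (bishift p p I) (bishift p p J) * mon X I J) =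
          (\<Sum>I\<in>word_pairs. \<Sum>J\<in>word_pairs. A (bishift p p I) (bishift p p J) * mon X (bishift p p I) (bishift p p J))"
        using p by (simp add: mon_bishift)
      also have "\<dots> = (\<Sum>I\<in>word_pairs. \<Sum>J\<in>word_pairs. A (bishift p p I) J * mon X (bishift p p I) J)"
        by (rule sum.cong[OF refl]) (rule sum_word_pairs_bishift[OF p p])
      also have "\<dots> = (\<Sum>I\<in>word_pairs. \<Sum>J\<in>word_pairs. A I J * mon X I J)" by (rule sum_word_pairs_bishift[OF p p])
      finally show "form (\<lambda>I J. A (bishift p p I) (bishift p p J)) X = form A X" by (simp add: form_def)
    qed
    have "form B = (\<Sum>p\<in>Sym n. pscale (*) (1 / of_nat (fact n)) (form (\<lambda>I J. A (bishift p p I) (bishift p p J))))"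
      unfolding form_sum by (rule form_cong) (simp only: B_def sum_distrib_left)
    also have "\<dots> = (\<Sum>p\<in>Sym n. pscale (*) (1 / of_nat (fact n)) (form A))"
      by (rule sum.cong) (auto simp: p)
    also have "\<dots> = form A"
      unfolding funs.sum_constant_scale card_Sym funs.scale_scale using of_nat_fact_nonzero by simp
    finally show ?thesis by (simp add: A)
  qed
  ultimately show ?thesis by blast
qed

text \<open>The orbit of a pair of words under simultaneous permutations is one monomial.  Polarization extracts
its coefficient, which is \<open>n!\<close> times the entry of a symmetric coefficient matrix.\<close>

lemma form_eq_0:
  assumes A: "sym_coeffs A" and 0: "form A = 0" and I: "I \<in> word_pairs" and J: "J \<in> word_pairs"
  shows "A I J = 0"
proof -
  have z: "(\<Sum>x\<in>word_pairs \<times> word_pairs. A (fst x) (snd x) * (\<Prod>k<n. X (letter (fst x) k, letter (snd x) k))) = 0" for X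
  proof -
    obtain Y where Y: "Y \<in> End sT" "\<And>P Q. P \<in> letters \<Longrightarrow> Q \<in> letters \<Longrightarrow> mat Y P Q = X (P, Q)"
      using mat_surj[of "\<lambda>P Q. X (P, Q)"] by blast
    have "0 = form A Y" by (simp add: 0)
    also have "\<dots> = (\<Sum>I\<in>word_pairs. \<Sum>J\<in>word_pairs. A I J * (\<Prod>k<n. X (letter I k, letter J k)))"
      using Y letter_in_letters by (simp add: form_def mon_def)
    finally show ?thesis by (simp add: sum.cartesian_product split_beta)
  qed
  have "0 = (\<Sum>p\<in>Sym n. \<Sum>x\<in>word_pairs \<times> word_pairs. if \<forall>k<n. (letter (fst x) k, letter (snd x) k) = (letter I (p k), letter J (p k))
      then A (fst x) (snd x) else 0)"
    by (rule polarization[where W = "word_pairs \<times> word_pairs" and a = "\<lambda>x. A (fst x) (snd x)" and n = n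
          and ev = "\<lambda>x k. (letter (fst x) k, letter (snd x) k)" and q = "\<lambda>k. (letter I k, letter J k)", OF z, symmetric])
  also have "\<dots> = (\<Sum>p\<in>Sym n. A I J)"
  proof (rule sum.cong[OF refl])
    fix p assume "p \<in> Sym n"
    then have p: "p permutes {..<n}" by simp
    have ext: "I' = J'" if "I' \<in> word_pairs" "J' \<in> word_pairs" "\<forall>k<n. letter I' k = letter J' k" for I' J'
      using that words_eqI[of "fst I'" d1 "fst J'" d1] words_eqI[of "snd I'" d2 "snd J'" d2]
      by (auto simp: word_pairs_def letter_def prod_eq_iff)
    have iff: "(\<forall>k<n. (letter (fst x) k, letter (snd x) k) = (letter I (p k), letter J (p k))) \<longleftrightarrow> x = (bishift p p I, bishift p p J)"
      if "x \<in> word_pairs \<times> word_pairs" for x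
      using that ext[of "fst x" "bishift p p I"] ext[of "snd x" "bishift p p J"] I J bishift_word_pairs[OF p p]
      by (auto simp: letter_bishift)
    have "(\<Sum>x\<in>word_pairs \<times> word_pairs. if \<forall>k<n. (letter (fst x) k, letter (snd x) k) = (letter I (p k), letter J (p k)) then A (fst x) (snd x) else 0) =
      (\<Sum>x\<in>word_pairs \<times> word_pairs. if x = (bishift p p I, bishift p p J) then A (bishift p p I) (bishift p p J) else 0)"
      by (rule sum.cong[OF refl]) (simp only: iff, auto)
    also have "\<dots> = A (bishift p p I) (bishift p p J)" using I J bishift_word_pairs[OF p p] by simp
    also have "\<dots> = A I J" using A p I J by (simp add: sym_coeffs_def)
    finally show "(\<Sum>x\<in>word_pairs \<times> word_pairs. if \<forall>k<n. (letter (fst x) k, letter (snd x) k) = (letter I (p k), letter J (p k)) then A (fst x) (snd x) else 0) = A I J" .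
  qed
  also have "\<dots> = of_nat (fact n) * A I J" by (simp add: card_Sym)
  finally show ?thesis using of_nat_fact_nonzero by simp
qed

end

section \<open>Invariant forms\<close>

context tensor_frame
begin

abbreviation tm :: "('v \<Rightarrow> 'v) \<Rightarrow> ('w \<Rightarrow> 'w) \<Rightarrow> 't \<Rightarrow> 't" where "tm \<equiv> tensor_map sT tens"

lemma GL_linear: "g \<in> GL sV \<Longrightarrow> Vector_Spaces.linear sV sV g" "h \<in> GL sW \<Longrightarrow> Vector_Spaces.linear sW sW h"
  by (auto simp: GL_def)

lemma tm_tens: "g \<in> GL sV \<Longrightarrow> h \<in> GL sW \<Longrightarrow> tm g h (tens x y) = tens (g x) (h y)"
  using tensor_map_welldefined(2)[OF tp] GL_linear by blast

lemma tm_End: "g \<in> GL sV \<Longrightarrow> h \<in> GL sW \<Longrightarrow> tm g h \<in> End sT"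
  using tensor_map_welldefined(1)[OF tp] GL_linear by (auto simp: End_def)

lemma tm_inverse:
  assumes "g \<in> GL sV" "h \<in> GL sW" "g' \<in> GL sV" "h' \<in> GL sW" "\<And>x. g (g' x) = x" "\<And>y. h (h' y) = y"
  shows "tm g h (tm g' h' z) = z"
proof -
  have lin: "Vector_Spaces.linear sT sT (tm g h \<circ> tm g' h')"
    using assms by (intro End_linear End_comp tm_End)
  have z: "z \<in> T.span {tens x y |x y. True}" using is_tensor_product_span[OF tp] by simp
  have eq: "(tm g h \<circ> tm g' h') b = id b" if "b \<in> {tens x y |x y. True}" for b
    using that assms by (auto simp: tm_tens)
  have "(tm g h \<circ> tm g' h') z = id z"
    by (rule TT.linear_eq_on[OF lin T.linear_id z eq])
  then show ?thesis by simp
qed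

lemma tm_bij:
  assumes g: "g \<in> GL sV" and h: "h \<in> GL sW"
  shows "bij (tm g h)"
proof -
  have b: "bij g" "bij h" using g h by (auto simp: GL_def)
  have "tm g h (tm (inv g) (inv h) z) = z" "tm (inv g) (inv h) (tm g h z) = z" for z
    using g h b by (auto intro!: tm_inverse GL_inv simp: bij_is_surj surj_f_inv_f bij_is_inj)
  then show ?thesis by (intro o_bij[of "tm (inv g) (inv h)"]) auto
qed

lemma inv_in_End:
  assumes "X \<in> End sT" "bij X"
  shows "inv X \<in> End sT"
proof -
  have "X \<in> GL sT" using assms by (simp add: GL_def End_def)
  then show ?thesis using GL_inv[of X sT] by (simp add: GL_def End_def)
qed

lemma mat_tm:
  assumes "g \<in> GL sV" "h \<in> GL sW" "P \<in> letters"
  shows "mat (tm g h) P Q = mV g (fst P) (fst Q) * mW h (snd P) (snd Q)"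
  unfolding mat_def
proof (rule T.coords_eqI[OF fe _ assms(3)])
  show "tm g h (e Q) = (\<Sum>P\<in>letters. sT (mV g (fst P) (fst Q) * mW h (snd P) (snd Q)) (e P))"
    unfolding e_def[of Q] tm_tens[OF assms(1,2)] by (rule tens_expand)
qed

lemma mon_tm:
  assumes "g \<in> GL sV" "h \<in> GL sW" "I \<in> word_pairs"
  shows "mon (tm g h) I J = (\<Prod>k<n. mV g (fst I k) (fst J k)) * (\<Prod>k<n. mW h (snd I k) (snd J k))"
  unfolding mon_def using mat_tm[OF assms(1,2) letter_in_letters[OF assms(3)]]
  by (simp add: prod.distrib[symmetric] letter_def)

lemma form_left:
  assumes "X \<in> End sT" "Y \<in> End sT"
  shows "form A (X \<circ> Y) = form (\<lambda>R J. \<Sum>I\<in>word_pairs. A I J * mon X I R) Y"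
proof -
  have "form A (X \<circ> Y) = (\<Sum>I\<in>word_pairs. \<Sum>J\<in>word_pairs. \<Sum>R\<in>word_pairs. A I J * mon X I R * mon Y R J)"
    using assms by (simp add: form_def End_comp mon_comp sum_distrib_left mult.assoc)
  also have "\<dots> = (\<Sum>R\<in>word_pairs. \<Sum>J\<in>word_pairs. \<Sum>I\<in>word_pairs. A I J * mon X I R * mon Y R J)"
    by (subst (2) sum.swap, subst sum.swap, subst (2) sum.swap) (rule refl)
  finally show ?thesis using assms by (simp add: form_def sum_distrib_right)
qed

lemma form_right:
  assumes "X \<in> End sT" "Y \<in> End sT"
  shows "form A (Y \<circ> X) = form (\<lambda>R J. \<Sum>I\<in>word_pairs. A R I * mon X J I) Y"
proof -
  have "form A (Y \<circ> X) = (\<Sum>R\<in>word_pairs. \<Sum>I\<in>word_pairs. \<Sum>J\<in>word_pairs. A R I * mon X J I * mon Y R J)"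
    using assms by (simp add: form_def End_comp mon_comp sum_distrib_left mult_ac)
  also have "\<dots> = (\<Sum>R\<in>word_pairs. \<Sum>J\<in>word_pairs. \<Sum>I\<in>word_pairs. A R I * mon X J I * mon Y R J)"
    by (rule sum.cong[OF refl], rule sum.swap)
  finally show ?thesis using assms by (simp add: form_def sum_distrib_right)
qed

text \<open>The transpose of \<open>A\<close> commutes with the tensor powers of all \<open>g \<otimes> h\<close>.\<close>

definition GL_commuting where
  "GL_commuting A \<longleftrightarrow> (\<forall>g\<in>GL sV. \<forall>h\<in>GL sW. \<forall>R\<in>word_pairs. \<forall>J\<in>word_pairs.
     (\<Sum>I\<in>word_pairs. A I J * mon (tm g h) I R) = (\<Sum>I\<in>word_pairs. A R I * mon (tm g h) J I))"

lemma sym_coeffs_left: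
  assumes "sym_coeffs A"
  shows "sym_coeffs (\<lambda>R J. \<Sum>I\<in>word_pairs. A I J * mon X I R)" "sym_coeffs (\<lambda>R J. \<Sum>I\<in>word_pairs. A R I * mon X J I)"
proof -
  have "(\<Sum>I\<in>word_pairs. A I (bishift p p J) * mon X I (bishift p p R)) = (\<Sum>I\<in>word_pairs. A I J * mon X I R)"
    if p: "p permutes {..<n}" and "R \<in> word_pairs" "J \<in> word_pairs" for p R J
  proof -
    have "(\<Sum>I\<in>word_pairs. A I (bishift p p J) * mon X I (bishift p p R)) =
        (\<Sum>I\<in>word_pairs. A (bishift p p I) (bishift p p J) * mon X (bishift p p I) (bishift p p R))"
      by (rule sum_word_pairs_bishift[OF p p, symmetric])
    also have "\<dots> = (\<Sum>I\<in>word_pairs. A I J * mon X I R)"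
      using assms that by (intro sum.cong refl) (simp add: sym_coeffs_def mon_bishift)
    finally show ?thesis .
  qed
  then show "sym_coeffs (\<lambda>R J. \<Sum>I\<in>word_pairs. A I J * mon X I R)" by (simp add: sym_coeffs_def)
  have "(\<Sum>I\<in>word_pairs. A (bishift p p R) I * mon X (bishift p p J) I) = (\<Sum>I\<in>word_pairs. A R I * mon X J I)"
    if p: "p permutes {..<n}" and "R \<in> word_pairs" "J \<in> word_pairs" for p R J
  proof -
    have "(\<Sum>I\<in>word_pairs. A (bishift p p R) I * mon X (bishift p p J) I) =
        (\<Sum>I\<in>word_pairs. A (bishift p p R) (bishift p p I) * mon X (bishift p p J) (bishift p p I))"
      by (rule sum_word_pairs_bishift[OF p p, symmetric])
    also have "\<dots> = (\<Sum>I\<in>word_pairs. A R I * mon X J I)"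
      using assms that by (intro sum.cong refl) (simp add: sym_coeffs_def mon_bishift)
    finally show ?thesis .
  qed
  then show "sym_coeffs (\<lambda>R J. \<Sum>I\<in>word_pairs. A R I * mon X J I)" by (simp add: sym_coeffs_def)
qed

lemma sym_coeffs_diff:
  "sym_coeffs A \<Longrightarrow> sym_coeffs B \<Longrightarrow> sym_coeffs (\<lambda>I J. A I J + (- 1) * B I J)"
  by (simp add: sym_coeffs_def)

text \<open>Substituting \<open>X = Y (g \<otimes> h)\<close>, invariance becomes \<open>f ((g \<otimes> h) Y) = f (Y (g \<otimes> h))\<close>.  Both sides are
forms in \<open>Y\<close> with symmetric coefficients, and these can be compared.\<close>

lemma form_invariant_iff:
  assumes A: "sym_coeffs A"
  shows "(\<forall>g\<in>GL sV. \<forall>h\<in>GL sW. \<forall>X\<in>End sT. form A (tm g h \<circ> X \<circ> inv (tm g h)) = form A X) \<longleftrightarrow> GL_commuting A"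
proof
  assume inv: "\<forall>g\<in>GL sV. \<forall>h\<in>GL sW. \<forall>X\<in>End sT. form A (tm g h \<circ> X \<circ> inv (tm g h)) = form A X"
  show "GL_commuting A"
    unfolding GL_commuting_def
  proof (intro ballI)
    fix g h R J assume g: "g \<in> GL sV" and h: "h \<in> GL sW" and RJ: "R \<in> word_pairs" "J \<in> word_pairs"
    define B where "B = (\<lambda>R J. \<Sum>I\<in>word_pairs. A I J * mon (tm g h) I R)"
    define C where "C = (\<lambda>R J. \<Sum>I\<in>word_pairs. A R I * mon (tm g h) J I)"
    have "form B Y = form C Y" if Y: "Y \<in> End sT" for Y
    proof -
      have "tm g h \<circ> (Y \<circ> tm g h) \<circ> inv (tm g h) = tm g h \<circ> Y"
        using tm_bij[OF g h] by (simp add: fun_eq_iff bij_is_surj surj_f_inv_f)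
      then have "form A (tm g h \<circ> Y) = form A (Y \<circ> tm g h)"
        using inv g h End_comp[OF Y tm_End[OF g h]] by metis
      then show ?thesis using form_left[OF tm_End[OF g h] Y] form_right[OF tm_End[OF g h] Y] by (simp add: B_def C_def)
    qed
    then have "form B = form C" by (intro ext) (metis form_def)
    then have "form (\<lambda>I J. B I J + (- 1) * C I J) = 0"
      unfolding form_add[symmetric] form_scale[symmetric] by (simp add: fun_eq_iff)
    moreover have "sym_coeffs (\<lambda>I J. B I J + (- 1) * C I J)"
      unfolding B_def C_def by (intro sym_coeffs_diff sym_coeffs_left A)
    ultimately have "B R J + (- 1) * C R J = 0" using form_eq_0 RJ by blast
    then show "(\<Sum>I\<in>word_pairs. A I J * mon (tm g h) I R) = (\<Sum>I\<in>word_pairs. A R I * mon (tm g h) J I)"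
      by (simp add: B_def C_def)
  qed
next
  assume c: "GL_commuting A"
  show "\<forall>g\<in>GL sV. \<forall>h\<in>GL sW. \<forall>X\<in>End sT. form A (tm g h \<circ> X \<circ> inv (tm g h)) = form A X"
  proof (intro ballI)
    fix g h X assume g: "g \<in> GL sV" and h: "h \<in> GL sW" and X: "X \<in> End sT"
    define Y where "Y = X \<circ> inv (tm g h)"
    have Y: "Y \<in> End sT" unfolding Y_def by (intro End_comp X inv_in_End tm_End tm_bij g h)
    have "form A (tm g h \<circ> Y) = form A (Y \<circ> tm g h)"
      unfolding form_left[OF tm_End[OF g h] Y] form_right[OF tm_End[OF g h] Y]
      using c g h by (intro fun_cong[OF form_cong]) (simp add: GL_commuting_def)
    also have "Y \<circ> tm g h = X" using tm_bij[OF g h] by (simp add: Y_def fun_eq_iff bij_is_inj)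
    finally show "form A (tm g h \<circ> X \<circ> inv (tm g h)) = form A X" unfolding Y_def comp_assoc .
  qed
qed

text \<open>The commutant of the independent permutations of the places of both words.\<close>

definition bi_invariant where
  "bi_invariant \<theta> \<longleftrightarrow> (\<forall>p q. p permutes {..<n} \<longrightarrow> q permutes {..<n} \<longrightarrow>
     (\<forall>I\<in>word_pairs. \<forall>J\<in>word_pairs. \<theta> (bishift p q I) (bishift p q J) = (\<theta> I J :: 'k)))"

text \<open>The transpose of \<open>A\<close> lies in the double commutant.\<close>

definition comm_coeffs where
  "comm_coeffs A \<longleftrightarrow> (\<forall>\<theta>. bi_invariant \<theta> \<longrightarrow> (\<forall>R\<in>word_pairs. \<forall>J\<in>word_pairs.
     (\<Sum>I\<in>word_pairs. A I J * \<theta> I R) = (\<Sum>I\<in>word_pairs. A R I * \<theta> J I)))"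

lemma bi_invariant_mon:
  assumes g: "g \<in> GL sV" and h: "h \<in> GL sW"
  shows "bi_invariant (mon (tm g h))"
  unfolding bi_invariant_def
proof (intro allI impI ballI)
  fix p q :: "nat \<Rightarrow> nat" and I J :: "word_pair"
  assume p: "p permutes {..<n}" and q: "q permutes {..<n}" and I: "I \<in> word_pairs"
  have "(\<Prod>k<n. mV g (fst I (p k)) (fst J (p k))) = (\<Prod>k<n. mV g (fst I k) (fst J k))"
    by (rule prod.reindex_bij_betw[where h = p and g = "\<lambda>k. mV g (fst I k) (fst J k)"]) (rule permutes_imp_bij[OF p])
  moreover have "(\<Prod>k<n. mW h (snd I (q k)) (snd J (q k))) = (\<Prod>k<n. mW h (snd I k) (snd J k))"
    by (rule prod.reindex_bij_betw[where h = q and g = "\<lambda>k. mW h (snd I k) (snd J k)"]) (rule permutes_imp_bij[OF q])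
  ultimately show "mon (tm g h) (bishift p q I) (bishift p q J) = mon (tm g h) I J"
    using I bishift_word_pairs[OF p q, of I] by (simp add: mon_tm[OF g h] bishift_def)
qed

text \<open>The symmetrized elementary matrices span the commutant of the place permutations: averaging a matrix
in the commutant does not change it.\<close>

lemma bi_invariant_average:
  assumes \<theta>: "bi_invariant \<theta>" and IR: "I \<in> word_pairs" "R \<in> word_pairs"
  shows "(\<Sum>P\<in>word_pairs. \<Sum>Q\<in>word_pairs. \<theta> P Q * (\<Sum>p\<in>Sym n. \<Sum>q\<in>Sym n. if I = bishift p q P \<and> R = bishift p q Q then 1 else 0)) =
    of_nat (fact n) * of_nat (fact n) * \<theta> I R"
proof -
  have "(\<Sum>P\<in>word_pairs. \<Sum>Q\<in>word_pairs. \<theta> P Q * (\<Sum>p\<in>Sym n. \<Sum>q\<in>Sym n. if I = bishift p q P \<and> R = bishift p q Q then 1 else 0)) =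
      (\<Sum>p\<in>Sym n. \<Sum>q\<in>Sym n. \<Sum>P\<in>word_pairs. \<Sum>Q\<in>word_pairs. \<theta> P Q * (if I = bishift p q P \<and> R = bishift p q Q then 1 else 0))"
    unfolding sum_distrib_left
    by (subst (2) sum.swap, subst sum.swap, rule sum.cong[OF refl], subst (2) sum.swap, rule sum.swap)
  also have "\<dots> = (\<Sum>p\<in>Sym n. \<Sum>q\<in>Sym n. \<theta> I R)"
  proof (intro sum.cong refl)
    fix p q assume "p \<in> Sym n" "q \<in> Sym n"
    then have p: "p permutes {..<n}" and q: "q permutes {..<n}" by auto
    have iff: "I = bishift p q P \<longleftrightarrow> P = bishift (inv p) (inv q) I" for I P
      using bishift_inv[OF p q] by metis
    have in': "bishift (inv p) (inv q) I \<in> word_pairs" "bishift (inv p) (inv q) R \<in> word_pairs"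
      using IR bishift_word_pairs[OF permutes_inv[OF p] permutes_inv[OF q]] by auto
    have "(\<Sum>P\<in>word_pairs. \<Sum>Q\<in>word_pairs. \<theta> P Q * (if I = bishift p q P \<and> R = bishift p q Q then 1 else 0)) =
        (\<Sum>P\<in>word_pairs. if P = bishift (inv p) (inv q) I then \<Sum>Q\<in>word_pairs. if Q = bishift (inv p) (inv q) R then \<theta> P Q else 0 else 0)"
    proof (rule sum.cong[OF refl])
      fix P
      show "(\<Sum>Q\<in>word_pairs. \<theta> P Q * (if I = bishift p q P \<and> R = bishift p q Q then 1 else 0)) =
        (if P = bishift (inv p) (inv q) I then \<Sum>Q\<in>word_pairs. if Q = bishift (inv p) (inv q) R then \<theta> P Q else 0 else 0)"
      proof (cases "P = bishift (inv p) (inv q) I")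
        case True
        show ?thesis unfolding if_P[OF True] by (rule sum.cong) (use True in \<open>simp_all add: iff\<close>)
      next
        case False
        show ?thesis unfolding if_not_P[OF False] by (rule sum.neutral) (use False in \<open>simp add: iff\<close>)
      qed
    qed
    also have "\<dots> = \<theta> (bishift (inv p) (inv q) I) (bishift (inv p) (inv q) R)" using in' by simp
    also have "\<dots> = \<theta> I R" using \<theta> IR permutes_inv[OF p] permutes_inv[OF q] by (simp add: bi_invariant_def)
    finally show "(\<Sum>P\<in>word_pairs. \<Sum>Q\<in>word_pairs. \<theta> P Q * (if I = bishift p q P \<and> R = bishift p q Q then 1 else 0)) = \<theta> I R" .
  qed
  finally show ?thesis by (simp add: card_Sym mult.assoc)
qed

text \<open>Commuting with the tensor powers of all \<open>g \<otimes> h\<close> is a family of polynomial identities in the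
  entries of \<open>g\<close> and of \<open>h\<close>.  Polarizing them in both arguments gives the symmetrized elementary
  tensors, and these span the commutant of the place permutations.\<close>

lemma GL_commuting_iff: "GL_commuting A \<longleftrightarrow> comm_coeffs A"
proof
  assume "comm_coeffs A"
  then show "GL_commuting A" using bi_invariant_mon by (simp add: comm_coeffs_def GL_commuting_def)
next
  assume GLc: "GL_commuting A"
  show "comm_coeffs A"
    unfolding comm_coeffs_def
  proof (intro allI impI ballI)
    fix \<theta> R J assume \<theta>: "bi_invariant \<theta>" and R: "R \<in> word_pairs" and J: "J \<in> word_pairs"
    \<comment> \<open>Both sides of the equation to be shown are collected in one sum over \<open>W\<close>, with coefficients \<open>a\<close> and
      matrix entries at \<open>(l x, r x)\<close>.\<close>
    define W where "W = (UNIV :: bool set) \<times> word_pairs"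
    define a where "a x = (if fst x then A (snd x) J else - A R (snd x))" for x
    define l where "l x = (if fst x then snd x else J)" for x
    define r where "r x = (if fst x then R else snd x)" for x
    have lr: "l x \<in> word_pairs" "r x \<in> word_pairs" if "x \<in> W" for x using that R J by (auto simp: W_def l_def r_def)
    have sumW: "(\<Sum>x\<in>W. a x * f (l x) (r x)) = (\<Sum>I\<in>word_pairs. A I J * f I R) - (\<Sum>I\<in>word_pairs. A R I * f J I)" for f
    proof -
      have "(\<Sum>x\<in>W. a x * f (l x) (r x)) = (\<Sum>c\<in>UNIV. \<Sum>I\<in>word_pairs. a (c, I) * f (l (c, I)) (r (c, I)))"
        by (simp add: W_def sum.cartesian_product split_beta)
      then show ?thesis by (simp add: UNIV_bool a_def l_def r_def sum_negf)
    qed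
    have bnd: "fst (l x) k < d1 \<and> fst (r x) k < d1" "snd (l x) k < d2 \<and> snd (r x) k < d2" if "x \<in> W" "k < n" for x k
    proof -
      have letter: "i k < d" if "i \<in> words d" for i d
        using that \<open>k < n\<close> unfolding words_def by (meson PiE_mem lessThan_iff)
      show "fst (l x) k < d1 \<and> fst (r x) k < d1" "snd (l x) k < d2 \<and> snd (r x) k < d2"
        using lr[OF that(1)] letter by (simp_all add: word_pairs_def mem_Times_iff)
    qed
    \<comment> \<open>The entries of a symmetrized elementary matrix on words in one alphabet.\<close>
    define N where "N p0 q0 p q = (\<Sum>\<pi>\<in>Sym n. if \<forall>k<n. p k = p0 (\<pi> k) \<and> q k = q0 (\<pi> k) then 1 else (0::'k))"
      for p0 q0 p q :: "nat \<Rightarrow> nat"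
    have Nsum: "(\<Sum>\<pi>\<in>Sym n. \<Sum>x\<in>W. if \<forall>k<n. p x k = p' (\<pi> k) \<and> q x k = q' (\<pi> k) then c x else 0) =
        (\<Sum>x\<in>W. N p' q' (p x) (q x) * c x)" for p q :: "_ \<Rightarrow> nat \<Rightarrow> nat" and p' q' and c :: "_ \<Rightarrow> 'k"
      unfolding N_def sum_distrib_right by (subst sum.swap) (intro sum.cong refl, auto)
    \<comment> \<open>Polarization in \<open>g\<close>, for fixed \<open>h\<close>.\<close>
    have 1: "(\<Sum>x\<in>W. N p0 q0 (fst (l x)) (fst (r x)) * (a x * (\<Prod>k<n. mW h (snd (l x) k) (snd (r x) k)))) = 0"
      if h: "h \<in> GL sW" for h p0 q0
    proof -
      have "(\<Sum>\<pi>\<in>Sym n. \<Sum>x\<in>W. if \<forall>k<n. fst (l x) k = p0 (\<pi> k) \<and> fst (r x) k = q0 (\<pi> k)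
          then a x * (\<Prod>k<n. mW h (snd (l x) k) (snd (r x) k)) else 0) = 0"
      proof (rule GL_polarization[OF fdV fv bnd(1)])
        fix g assume g: "g \<in> GL sV"
        have "(\<Sum>x\<in>W. a x * (\<Prod>k<n. mW h (snd (l x) k) (snd (r x) k)) * (\<Prod>k<n. mV g (fst (l x) k) (fst (r x) k))) =
            (\<Sum>x\<in>W. a x * mon (tm g h) (l x) (r x))"
          by (intro sum.cong refl) (simp add: mon_tm[OF g h lr(1)] mult_ac)
        also have "\<dots> = 0" using GLc g h R J unfolding sumW by (simp add: GL_commuting_def)
        finally show "(\<Sum>x\<in>W. a x * (\<Prod>k<n. mW h (snd (l x) k) (snd (r x) k)) * (\<Prod>k<n. mV g (fst (l x) k) (fst (r x) k))) = 0" .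
      qed
      with Nsum[where p = "\<lambda>x. fst (l x)" and q = "\<lambda>x. fst (r x)" and p' = p0 and q' = q0
          and c = "\<lambda>x. a x * (\<Prod>k<n. mW h (snd (l x) k) (snd (r x) k))"]
      show ?thesis by simp
    qed
    \<comment> \<open>Polarization in \<open>h\<close>.\<close>
    have 2: "(\<Sum>x\<in>W. a x * (N p0 q0 (fst (l x)) (fst (r x)) * N r0 s0 (snd (l x)) (snd (r x)))) = 0" for p0 q0 r0 s0
    proof -
      have "(\<Sum>\<pi>\<in>Sym n. \<Sum>x\<in>W. if \<forall>k<n. snd (l x) k = r0 (\<pi> k) \<and> snd (r x) k = s0 (\<pi> k)
          then N p0 q0 (fst (l x)) (fst (r x)) * a x else 0) = 0"
      proof (rule GL_polarization[OF fdW fw bnd(2)])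
        fix h assume "h \<in> GL sW"
        from 1[OF this, of p0 q0]
        show "(\<Sum>x\<in>W. N p0 q0 (fst (l x)) (fst (r x)) * a x * (\<Prod>k<n. mW h (snd (l x) k) (snd (r x) k))) = 0"
          by (simp only: mult.assoc)
      qed
      with Nsum[where p = "\<lambda>x. snd (l x)" and q = "\<lambda>x. snd (r x)" and p' = r0 and q' = s0
          and c = "\<lambda>x. N p0 q0 (fst (l x)) (fst (r x)) * a x"]
      show ?thesis by (simp add: mult_ac)
    qed
    have N: "N (fst P) (fst Q) (fst (l x)) (fst (r x)) * N (snd P) (snd Q) (snd (l x)) (snd (r x)) =
        (\<Sum>p\<in>Sym n. \<Sum>q\<in>Sym n. if l x = bishift p q P \<and> r x = bishift p q Q then 1 else 0)"
      if x: "x \<in> W" and PQ: "P \<in> word_pairs" "Q \<in> word_pairs" for x P Q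
    proof -
      have iff: "(\<forall>k<n. i k = i0 (p k)) \<longleftrightarrow> i = i0 \<circ> p" if "i \<in> words d" "i0 \<in> words d" "p permutes {..<n}" for i i0 p d
        using that words_eqI[of i d "i0 \<circ> p" d] words_comp[of p i0 d] by auto
      show ?thesis
        unfolding N_def sum_product
      proof (intro sum.cong refl)
        fix p q assume "p \<in> Sym n" "q \<in> Sym n"
        then have p: "p permutes {..<n}" and q: "q permutes {..<n}" by auto
        have "(\<forall>k<n. fst (l x) k = fst P (p k) \<and> fst (r x) k = fst Q (p k)) \<longleftrightarrow>
            fst (l x) = fst P \<circ> p \<and> fst (r x) = fst Q \<circ> p"
          using iff[of "fst (l x)" d1 "fst P" p] iff[of "fst (r x)" d1 "fst Q" p] lr[OF x] PQ p by (auto simp: word_pairs_def mem_Times_iff)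
        moreover have "(\<forall>k<n. snd (l x) k = snd P (q k) \<and> snd (r x) k = snd Q (q k)) \<longleftrightarrow>
            snd (l x) = snd P \<circ> q \<and> snd (r x) = snd Q \<circ> q"
          using iff[of "snd (l x)" d2 "snd P" q] iff[of "snd (r x)" d2 "snd Q" q] lr[OF x] PQ q by (auto simp: word_pairs_def mem_Times_iff)
        ultimately show "(if \<forall>k<n. fst (l x) k = fst P (p k) \<and> fst (r x) k = fst Q (p k) then 1 else 0) *
            (if \<forall>k<n. snd (l x) k = snd P (q k) \<and> snd (r x) k = snd Q (q k) then 1 else 0) =
            (if l x = bishift p q P \<and> r x = bishift p q Q then 1 else (0::'k))"
          by (auto simp: bishift_def prod_eq_iff)
      qed
    qed
    have "0 = (\<Sum>P\<in>word_pairs. \<Sum>Q\<in>word_pairs. \<theta> P Q * (\<Sum>x\<in>W. a x * (N (fst P) (fst Q) (fst (l x)) (fst (r x)) * N (snd P) (snd Q) (snd (l x)) (snd (r x)))))"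
      by (simp add: 2)
    also have "\<dots> = (\<Sum>P\<in>word_pairs. \<Sum>Q\<in>word_pairs. \<Sum>x\<in>W. a x * (\<theta> P Q *
        (\<Sum>p\<in>Sym n. \<Sum>q\<in>Sym n. if l x = bishift p q P \<and> r x = bishift p q Q then 1 else 0)))"
      unfolding sum_distrib_left[of "\<theta> _ _" _ W]
      by (intro sum.cong refl) (simp only: N mult.left_commute)
    also have "\<dots> = (\<Sum>x\<in>W. a x * (\<Sum>P\<in>word_pairs. \<Sum>Q\<in>word_pairs. \<theta> P Q *
        (\<Sum>p\<in>Sym n. \<Sum>q\<in>Sym n. if l x = bishift p q P \<and> r x = bishift p q Q then 1 else 0)))"
      unfolding sum_distrib_left[of "a _"] by (subst (2) sum.swap, rule sum.swap)
    also have "\<dots> = (\<Sum>x\<in>W. a x * (of_nat (fact n) * of_nat (fact n) * \<theta> (l x) (r x)))"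
      by (intro sum.cong refl) (simp only: bi_invariant_average[OF \<theta> lr])
    also have "\<dots> = of_nat (fact n) * of_nat (fact n) * (\<Sum>x\<in>W. a x * \<theta> (l x) (r x))"
      by (simp add: sum_distrib_left mult_ac)
    finally have "(\<Sum>x\<in>W. a x * \<theta> (l x) (r x)) = 0" using of_nat_fact_nonzero by simp
    then show "(\<Sum>I\<in>word_pairs. A I J * \<theta> I R) = (\<Sum>I\<in>word_pairs. A R I * \<theta> J I)" unfolding sumW by simp
  qed
qed

lemma invariant_component_iff:
  "f \<in> invariant_component sV sW sT tens n \<longleftrightarrow> (\<exists>A. sym_coeffs A \<and> comm_coeffs A \<and> f = form A)"
proof
  assume f: "f \<in> invariant_component sV sW sT tens n"
  then obtain A where A: "sym_coeffs A" "f = form A"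
    using form_symmetrize by (auto simp: invariant_component_def)
  then show "\<exists>A. sym_coeffs A \<and> comm_coeffs A \<and> f = form A"
    using f form_invariant_iff[OF A(1)] by (auto simp: invariant_component_def invariant_ring_def GL_commuting_iff)
next
  assume "\<exists>A. sym_coeffs A \<and> comm_coeffs A \<and> f = form A"
  then obtain A where A: "sym_coeffs A" "comm_coeffs A" "f = form A" by blast
  have "f \<in> homogeneous_funs (pscale sT) (End sT) n" using form_in_homogeneous A(3) by simp
  then show "f \<in> invariant_component sV sW sT tens n"
    using A form_invariant_iff[OF A(1)] homogeneous_funs_subset_poly_funs[of "pscale sT" "End sT" n]
    by (auto simp: invariant_component_def invariant_ring_def GL_commuting_iff)
qed

end

section \<open>The double commutant\<close>

text \<open>An operator \<open>Z\<close> that commutes with the commutant of a system of matrix units is a combination of them.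
  A block that does not vanish contains a vector \<open>x0\<close> fixed by a diagonal unit \<open>(i0, i0)\<close>.  With a
  functional \<open>\<xi>\<close> that is \<open>1\<close> at \<open>x0\<close>, the operators \<open>z \<mapsto> \<Sum>i. \<xi> (E l i0 i z) E l i i0 w\<close> of the commutant move
  \<open>x0\<close> to an arbitrary vector \<open>w\<close> of its multiplicity space, so \<open>Z\<close> is determined by its values at the
  vectors \<open>E l j i0 x0\<close>.\<close>

lemma double_commutant:
  fixes s :: "'k::field \<Rightarrow> 'a::ab_group_add \<Rightarrow> 'a" and E :: "'b \<Rightarrow> 'i \<Rightarrow> 'i \<Rightarrow> 'a \<Rightarrow> 'a"
  assumes s: "vector_space s" and X: "module.subspace s X"
    and fin: "\<And>l. l \<in> L \<Longrightarrow> finite (Ix l)"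
    and Elin: "\<And>l i j. Vector_Spaces.linear s s (E l i j)"
    and EX: "\<And>l i j x. x \<in> X \<Longrightarrow> E l i j x \<in> X"
    and EE: "\<And>l m i j p q x. l \<in> L \<Longrightarrow> m \<in> L \<Longrightarrow> i \<in> Ix l \<Longrightarrow> j \<in> Ix l \<Longrightarrow> p \<in> Ix m \<Longrightarrow> q \<in> Ix m \<Longrightarrow> x \<in> X \<Longrightarrow>
        E l i j (E m p q x) = (if l = m \<and> j = p then E l i q x else 0)"
    and res: "\<And>x. x \<in> X \<Longrightarrow> (\<Sum>l\<in>L. \<Sum>i\<in>Ix l. E l i i x) = x"
    and Z: "Vector_Spaces.linear s s Z"
    and comm: "\<And>\<theta> x. Vector_Spaces.linear s s \<theta> \<Longrightarrow> (\<And>x. x \<in> X \<Longrightarrow> \<theta> x \<in> X) \<Longrightarrow>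
        (\<And>l i j x. l \<in> L \<Longrightarrow> i \<in> Ix l \<Longrightarrow> j \<in> Ix l \<Longrightarrow> x \<in> X \<Longrightarrow> \<theta> (E l i j x) = E l i j (\<theta> x)) \<Longrightarrow> x \<in> X \<Longrightarrow> Z (\<theta> x) = \<theta> (Z x)"
    and ZX: "\<And>x. x \<in> X \<Longrightarrow> Z x \<in> X"
  shows "\<exists>a. \<forall>x\<in>X. Z x = (\<Sum>l\<in>L. \<Sum>i\<in>Ix l. \<Sum>j\<in>Ix l. s (a l i j) (E l i j x))"
proof -
  interpret vector_space s by fact
  interpret ss: vector_space_pair s s ..
  have Ea: "E l i j (x + y) = E l i j x + E l i j y" and Es: "E l i j (s c x) = s c (E l i j x)" for l i j x y c
    using Elin by (auto simp: Vector_Spaces.linear_iff)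
  note E0 = ss.linear_0[OF Elin] and Esum = ss.linear_sum[OF Elin]
  have block: "\<exists>a. \<forall>j\<in>Ix l. \<forall>x\<in>X. Z (E l j j x) = (\<Sum>i\<in>Ix l. s (a i j) (E l i j x))" if l: "l \<in> L" for l
  proof (cases "\<exists>i0\<in>Ix l. \<exists>x\<in>X. E l i0 i0 x \<noteq> 0")
    case False
    have "E l i j x = 0" if "i \<in> Ix l" "j \<in> Ix l" "x \<in> X" for i j x
      using EE[OF l l that(1,1,1,2,3)] False EX[OF that(3), of l i j] that(1) by force
    then show ?thesis by (intro exI[of _ "\<lambda>_ _. 0"]) (simp add: ss.linear_0[OF Z])
  next
    case True
    then obtain i0 x1 where i0: "i0 \<in> Ix l" and x1: "x1 \<in> X" "E l i0 i0 x1 \<noteq> 0" by blast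
    define x0 where "x0 = E l i0 i0 x1"
    have x0: "x0 \<in> X" "x0 \<noteq> 0" "E l i0 i0 x0 = x0"
      using x1 EX EE[OF l l i0 i0 i0 i0 x1(1)] by (simp_all add: x0_def)
    interpret sk: vector_space_pair s "(*) :: 'k \<Rightarrow> 'k \<Rightarrow> 'k"
      by (simp add: vector_space_pair_def vector_space_axioms vector_space_times)
    have "independent {x0}" using x0(2) by simp
    then obtain \<xi> where \<xi>: "Vector_Spaces.linear s (*) \<xi>" and \<xi>0: "\<xi> x0 = 1"
      using sk.linear_independent_extend[of "{x0}" "\<lambda>_. 1"] by auto
    have \<xi>a: "\<xi> (x + y) = \<xi> x + \<xi> y" and \<xi>s: "\<xi> (s c x) = c * \<xi> x" for x y c
      using \<xi> by (auto simp: Vector_Spaces.linear_iff)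
    define \<theta> where "\<theta> w z = (\<Sum>i\<in>Ix l. s (\<xi> (E l i0 i z)) (E l i i0 w))" for w z
    have \<theta>lin: "Vector_Spaces.linear s s (\<theta> w)" for w
      unfolding Vector_Spaces.linear_iff \<theta>_def Ea Es \<xi>a \<xi>s
      by (intro conjI allI vector_space_axioms) (simp_all only: scale_left_distrib sum.distrib scale_sum_right scale_scale)
    have \<theta>X: "\<theta> w z \<in> X" if "w \<in> X" for w z
      unfolding \<theta>_def by (intro subspace_sum[OF X] subspace_scale[OF X] EX that)
    have \<theta>E: "\<theta> w (E m p q z) = (if m = l then s (\<xi> (E l i0 q z)) (E l p i0 w) else 0)"
      if "m \<in> L" "p \<in> Ix m" "q \<in> Ix m" "z \<in> X" "w \<in> X" for w m p q z
    proof (cases "m = l")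
      case True
      have "\<theta> w (E m p q z) = (\<Sum>i\<in>Ix l. if i = p then s (\<xi> (E l i0 q z)) (E l p i0 w) else 0)"
        unfolding \<theta>_def using that l i0 True sk.linear_0[OF \<xi>] by (intro sum.cong refl) (simp add: EE)
      then show ?thesis using True that fin[OF l] by simp
    next
      case False
      have "\<theta> w (E m p q z) = 0"
        unfolding \<theta>_def using that l i0 False sk.linear_0[OF \<xi>] by (intro sum.neutral ballI) (simp add: EE)
      then show ?thesis using False by simp
    qed
    have E\<theta>: "E m p q (\<theta> w z) = (if m = l then s (\<xi> (E l i0 q z)) (E l p i0 w) else 0)"
      if "m \<in> L" "p \<in> Ix m" "q \<in> Ix m" "w \<in> X" for w m p q z
    proof -
      have "E m p q (\<theta> w z) = (\<Sum>i\<in>Ix l. s (\<xi> (E l i0 i z)) (E m p q (E l i i0 w)))"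
        unfolding \<theta>_def by (simp add: Esum Es)
      also have "\<dots> = (\<Sum>i\<in>Ix l. if i = q then (if m = l then s (\<xi> (E l i0 q z)) (E l p i0 w) else 0) else 0)"
        using that l i0 by (intro sum.cong refl) (auto simp: EE)
      also have "\<dots> = (if m = l then s (\<xi> (E l i0 q z)) (E l p i0 w) else 0)"
        using that fin[OF l] by (cases "m = l") simp_all
      finally show ?thesis .
    qed
    have Z\<theta>: "Z (\<theta> w z) = \<theta> w (Z z)" if "w \<in> X" "z \<in> X" for w z
    proof (rule comm[OF \<theta>lin \<theta>X[OF that(1)] _ that(2)])
      fix m p q x assume "m \<in> L" "p \<in> Ix m" "q \<in> Ix m" "x \<in> X"
      then show "\<theta> w (E m p q x) = E m p q (\<theta> w x)" using that by (simp only: \<theta>E E\<theta>)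
    qed
    define a where "a i j = \<xi> (E l i0 i (Z (E l j i0 x0)))" for i j
    have "Z (E l j j x) = (\<Sum>i\<in>Ix l. s (a i j) (E l i j x))" if j: "j \<in> Ix l" and x: "x \<in> X" for j x
    proof -
      define w where "w = E l i0 j x"
      have w: "w \<in> X" unfolding w_def by (rule EX[OF x])
      have "E l j j x = E l j i0 w" using l j i0 x by (simp add: w_def EE)
      also have "\<dots> = \<theta> w (E l j i0 x0)" using l j i0 x0 w \<xi>0 by (simp add: \<theta>E)
      finally have "Z (E l j j x) = Z (\<theta> w (E l j i0 x0))" by simp
      also have "\<dots> = \<theta> w (Z (E l j i0 x0))" by (rule Z\<theta>[OF w EX[OF x0(1)]])
      also have "\<dots> = (\<Sum>i\<in>Ix l. s (a i j) (E l i i0 w))" by (simp add: \<theta>_def a_def)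
      also have "\<dots> = (\<Sum>i\<in>Ix l. s (a i j) (E l i j x))"
        using l j i0 x by (intro sum.cong refl) (simp add: w_def EE)
      finally show ?thesis .
    qed
    then show ?thesis by blast
  qed
  then have "\<forall>l\<in>L. \<exists>a. \<forall>j\<in>Ix l. \<forall>x\<in>X. Z (E l j j x) = (\<Sum>i\<in>Ix l. s (a i j) (E l i j x))" by blast
  from bchoice[OF this] obtain a where
    a: "\<And>l j x. l \<in> L \<Longrightarrow> j \<in> Ix l \<Longrightarrow> x \<in> X \<Longrightarrow> Z (E l j j x) = (\<Sum>i\<in>Ix l. s (a l i j) (E l i j x))" by blast
  have "Z x = (\<Sum>l\<in>L. \<Sum>i\<in>Ix l. \<Sum>j\<in>Ix l. s (a l i j) (E l i j x))" if x: "x \<in> X" for x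
  proof -
    have "Z x = Z (\<Sum>l\<in>L. \<Sum>i\<in>Ix l. E l i i x)" by (simp only: res[OF x])
    also have "\<dots> = (\<Sum>l\<in>L. \<Sum>j\<in>Ix l. Z (E l j j x))" by (simp only: ss.linear_sum[OF Z])
    also have "\<dots> = (\<Sum>l\<in>L. \<Sum>j\<in>Ix l. \<Sum>i\<in>Ix l. s (a l i j) (E l i j x))"
      using x by (intro sum.cong refl) (simp add: a)
    also have "\<dots> = (\<Sum>l\<in>L. \<Sum>i\<in>Ix l. \<Sum>j\<in>Ix l. s (a l i j) (E l i j x))"
      by (rule sum.cong[OF refl]) (rule sum.swap)
    finally show ?thesis .
  qed
  then show ?thesis by blast
qed

section \<open>Words in two alphabets\<close>

text \<open>The two factors of \<open>S\<^sub>n \<times> S\<^sub>n\<close> permute the places of one word each.\<close>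

definition act1 :: "(nat \<Rightarrow> nat) \<Rightarrow> (word_pair \<Rightarrow> 'k) \<Rightarrow> word_pair \<Rightarrow> 'k" where
  "act1 p F = (\<lambda>I. F (fst I \<circ> p, snd I))"

definition act2 :: "(nat \<Rightarrow> nat) \<Rightarrow> (word_pair \<Rightarrow> 'k) \<Rightarrow> word_pair \<Rightarrow> 'k" where
  "act2 p F = (\<lambda>I. F (fst I, snd I \<circ> p))"

interpretation act1: sym_rep "pscale ((*) :: 'k::field_char_0 \<Rightarrow> 'k \<Rightarrow> 'k)" n act1 for n
  by unfold_locales (simp_all add: act1_def comp_assoc fun_eq_iff)

interpretation act2: sym_rep "pscale ((*) :: 'k::field_char_0 \<Rightarrow> 'k \<Rightarrow> 'k)" n act2 for n
  by unfold_locales (simp_all add: act2_def comp_assoc fun_eq_iff)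

lemma (in unit_rep) U_act:
  assumes \<tau>: "\<tau> permutes {..<n}" and l: "l \<in> L" "i < dm l" "j < dm l"
  shows "U l i j (act \<tau> x) = (\<Sum>k<dm l. s (rho l \<tau> j k) (U l i k x))"
proof -
  have "U l i j (act \<tau> x) = (\<Sum>m\<in>L. \<Sum>p<dm m. \<Sum>q<dm m. s (rho m \<tau> p q) (U l i j (U m p q x)))"
    by (simp only: act_eq_U[OF \<tau>] U_sum U_scale)
  also have "\<dots> = (\<Sum>m\<in>L. if m = l then \<Sum>q<dm l. s (rho l \<tau> j q) (U l i q x) else 0)"
  proof (rule sum.cong[OF refl])
    fix m assume m: "m \<in> L"
    show "(\<Sum>p<dm m. \<Sum>q<dm m. s (rho m \<tau> p q) (U l i j (U m p q x))) =
        (if m = l then \<Sum>q<dm l. s (rho l \<tau> j q) (U l i q x) else 0)"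
    proof (cases "m = l")
      case True
      have "(\<Sum>p<dm m. \<Sum>q<dm m. s (rho m \<tau> p q) (U l i j (U m p q x))) =
          (\<Sum>p<dm l. if p = j then \<Sum>q<dm l. s (rho l \<tau> j q) (U l i q x) else 0)"
      proof (unfold True, rule sum.cong[OF refl])
        fix p assume "p \<in> {..<dm l}"
        then show "(\<Sum>q<dm l. s (rho l \<tau> p q) (U l i j (U l p q x))) =
            (if p = j then \<Sum>q<dm l. s (rho l \<tau> j q) (U l i q x) else 0)"
          using l by (cases "p = j") (simp_all add: U_U)
      qed
      then show ?thesis using True l by simp
    next
      case False
      then show ?thesis using l m by (simp add: U_U)
    qed
  qed
  finally show ?thesis using l finite_L by simp
qed

locale invariant_count = tensor_frame sV sW sT tens BV BW d1 d2 n v w + specht_units n dm b u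
  for sV :: "'k::field_char_0 \<Rightarrow> 'v::ab_group_add \<Rightarrow> 'v" and sW :: "'k \<Rightarrow> 'w::ab_group_add \<Rightarrow> 'w"
    and sT :: "'k \<Rightarrow> 't::ab_group_add \<Rightarrow> 't" and tens :: "'v \<Rightarrow> 'w \<Rightarrow> 't"
    and BV :: "'v set" and BW :: "'w set" and d1 d2 n :: nat and v :: "nat \<Rightarrow> 'v" and w :: "nat \<Rightarrow> 'w"
    and dm and b :: "nat list \<Rightarrow> nat \<Rightarrow> tabloid \<Rightarrow> 'k" and u
begin

sublocale R1: unit_rep n "partitions n" dm rho u "pscale (*)" act1
  by unfold_locales

sublocale R2: unit_rep n "partitions n" dm rho u "pscale (*)" act2
  by unfold_locales

sublocale RW: unit_rep n "partitions n" dm rho u "pscale (*)" word_act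
  by unfold_locales

text \<open>The matrix units of \<open>S\<^sub>n \<times> S\<^sub>n\<close>, as products of matrix units of the factors; the blocks are pairs of
shapes.\<close>

definition E :: "nat list \<times> nat list \<Rightarrow> nat \<times> nat \<Rightarrow> nat \<times> nat \<Rightarrow> (word_pair \<Rightarrow> 'k) \<Rightarrow> word_pair \<Rightarrow> 'k" where
  "E l x y F = R1.U (fst l) (fst x) (fst y) (R2.U (snd l) (snd x) (snd y) F)"

definition Ix :: "nat list \<times> nat list \<Rightarrow> (nat \<times> nat) set" where
  "Ix l = {..<dm (fst l)} \<times> {..<dm (snd l)}"

text \<open>Functions on words are extended by zero, so that one action of the place permutations serves all
alphabets.\<close>

definition on_words :: "(word_pair \<Rightarrow> 'k) set" where "on_words = {F. \<forall>I. I \<notin> word_pairs \<longrightarrow> F I = 0}"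

abbreviation shape_pairs :: "(nat list \<times> nat list) set" where "shape_pairs \<equiv> partitions n \<times> partitions n"

lemma finite_Ix [simp]: "finite (Ix l)" by (simp add: Ix_def)

lemma act12_commute: "act1 p (act2 q F) = act2 q (act1 p F)"
  by (simp add: act1_def act2_def)

lemma act12: "act1 p (act2 q F) I = F (bishift p q I)"
  by (simp add: act1_def act2_def bishift_def)

lemma act2_U1: "q permutes {..<n} \<Longrightarrow> act2 q (R1.U l i j F) = R1.U l i j (act2 q F)"
  unfolding R1.U_def by (simp only: act2.act_sum act2.act_scale act12_commute)

lemma U12_commute: "R1.U l i j (R2.U m p q F) = R2.U m p q (R1.U l i j F)"
proof -
  have "R1.U l i j (R2.U m p q F) = (\<Sum>\<sigma>\<in>Sym n. pscale (*) (u m p q \<sigma>) (R1.U l i j (act2 \<sigma> F)))"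
    by (simp only: R2.U_def R1.U_sum R1.U_scale)
  also have "\<dots> = R2.U m p q (R1.U l i j F)"
    unfolding R2.U_def by (rule sum.cong[OF refl]) (simp only: act2_U1 mem_Collect_eq)
  finally show ?thesis .
qed

lemma E_add: "E l x y (F + G) = E l x y F + E l x y G"
  and E_scale: "E l x y (pscale (*) c F) = pscale (*) c (E l x y F)"
  and E_0: "E l x y 0 = 0"
  by (simp_all only: E_def R1.U_add R2.U_add R1.U_scale R2.U_scale R1.U_0 R2.U_0)

lemma E_sum: "E l x y (\<Sum>k\<in>S. f k) = (\<Sum>k\<in>S. E l x y (f k))"
  by (simp only: E_def R1.U_sum R2.U_sum)

lemma E_linear: "Vector_Spaces.linear (pscale (*)) (pscale (*)) (E l x y)"
  unfolding Vector_Spaces.linear_iff by (intro conjI allI funs.vector_space_axioms E_add E_scale)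

lemma on_words_subspace: "funs.subspace on_words"
  by (auto simp: funs.subspace_def on_words_def)

lemma act_on_words: "p permutes {..<n} \<Longrightarrow> F \<in> on_words \<Longrightarrow> act1 p F \<in> on_words" "p permutes {..<n} \<Longrightarrow> F \<in> on_words \<Longrightarrow> act2 p F \<in> on_words"
  by (auto simp: on_words_def act1_def act2_def word_pairs_def mem_Times_iff words_comp)

lemma E_on_words: "F \<in> on_words \<Longrightarrow> E l x y F \<in> on_words"
  unfolding E_def by (intro R1.U_in R2.U_in on_words_subspace act_on_words)

lemma E_E:
  assumes "l \<in> shape_pairs" "m \<in> shape_pairs" "x \<in> Ix l" "y \<in> Ix l" "p \<in> Ix m" "q \<in> Ix m"
  shows "E l x y (E m p q F) = (if l = m \<and> y = p then E l x q F else 0)"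
proof -
  have "E l x y (E m p q F) = R1.U (fst l) (fst x) (fst y) (R1.U (fst m) (fst p) (fst q)
      (R2.U (snd l) (snd x) (snd y) (R2.U (snd m) (snd p) (snd q) F)))"
    unfolding E_def U12_commute[symmetric] ..
  then show ?thesis
    using assms by (auto simp: R1.U_U R2.U_U Ix_def E_def R1.U_0 prod_eq_iff)
qed

lemma sum_shape_pairs: "(\<Sum>l\<in>shape_pairs. f l) = (\<Sum>la\<in>partitions n. \<Sum>mu\<in>partitions n. f (la, mu))"
  by (simp add: sum.cartesian_product split_beta)

lemma sum_Ix: "(\<Sum>x\<in>Ix l. f x) = (\<Sum>i<dm (fst l). \<Sum>k<dm (snd l). f (i, k))"
  by (simp add: Ix_def sum.cartesian_product split_beta)

lemma E_resolution: "(\<Sum>l\<in>shape_pairs. \<Sum>x\<in>Ix l. E l x x F) = F"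
proof -
  have "(\<Sum>l\<in>shape_pairs. \<Sum>x\<in>Ix l. E l x x F) =
      (\<Sum>la\<in>partitions n. \<Sum>mu\<in>partitions n. \<Sum>i<dm la. \<Sum>k<dm mu. R1.U la i i (R2.U mu k k F))"
    unfolding sum_shape_pairs sum_Ix by (simp only: E_def fst_conv snd_conv)
  also have "\<dots> = (\<Sum>la\<in>partitions n. \<Sum>i<dm la. R1.U la i i (\<Sum>mu\<in>partitions n. \<Sum>k<dm mu. R2.U mu k k F))"
    unfolding R1.U_sum by (rule sum.cong[OF refl]) (rule sum.swap)
  also have "\<dots> = F" by (simp only: R1.U_resolution R2.U_resolution)
  finally show ?thesis .
qed

lemma act12_eq_E:
  assumes "p permutes {..<n}" "q permutes {..<n}"
  shows "act1 p (act2 q F) = (\<Sum>l\<in>shape_pairs. \<Sum>x\<in>Ix l. \<Sum>y\<in>Ix l.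
    pscale (*) (rho (fst l) p (fst x) (fst y) * rho (snd l) q (snd x) (snd y)) (E l x y F))"
proof -
  have "act1 p (act2 q F) = (\<Sum>la\<in>partitions n. \<Sum>i<dm la. \<Sum>j<dm la. \<Sum>mu\<in>partitions n. \<Sum>k<dm mu. \<Sum>r<dm mu.
      pscale (*) (rho la p i j * rho mu q k r) (E (la, mu) (i, k) (j, r) F))"
    by (simp only: R1.act_eq_U[OF assms(1)] R2.act_eq_U[OF assms(2)] R1.U_sum R1.U_scale funs.scale_sum_right funs.scale_scale E_def fst_conv snd_conv)
  also have "\<dots> = (\<Sum>la\<in>partitions n. \<Sum>mu\<in>partitions n. \<Sum>i<dm la. \<Sum>k<dm mu. \<Sum>j<dm la. \<Sum>r<dm mu.
      pscale (*) (rho la p i j * rho mu q k r) (E (la, mu) (i, k) (j, r) F))"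
    by (rule sum.cong[OF refl], subst (2) sum.swap, subst sum.swap, rule sum.cong[OF refl],
        rule sum.cong[OF refl], rule sum.swap)
  finally show ?thesis unfolding sum_shape_pairs sum_Ix by (simp only: fst_conv snd_conv)
qed

definition \<delta> :: "word_pair \<Rightarrow> word_pair \<Rightarrow> 'k" where "\<delta> J I = (if I = J then 1 else 0)"

text \<open>The matrix of \<open>E l x y\<close> on words.\<close>

definition unit_coeffs :: "nat list \<times> nat list \<Rightarrow> nat \<times> nat \<Rightarrow> nat \<times> nat \<Rightarrow> word_pair \<Rightarrow> word_pair \<Rightarrow> 'k" where
  "unit_coeffs l x y I J = E l x y (\<delta> J) I"

lemma \<delta>_on_words: "J \<in> word_pairs \<Longrightarrow> \<delta> J \<in> on_words" by (auto simp: on_words_def \<delta>_def)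

lemma on_words_outside: "F \<in> on_words \<Longrightarrow> I \<notin> word_pairs \<Longrightarrow> F I = 0"
  unfolding on_words_def by blast

lemma on_words_expand: "F \<in> on_words \<Longrightarrow> F = (\<Sum>J\<in>word_pairs. pscale (*) (F J) (\<delta> J))"
proof
  fix I assume F: "F \<in> on_words"
  have "(\<Sum>J\<in>word_pairs. pscale (*) (F J) (\<delta> J)) I = (\<Sum>J\<in>word_pairs. if J = I then F I else 0)"
    unfolding sum_fun_apply by (rule sum.cong) (auto simp: \<delta>_def)
  also have "\<dots> = F I" using on_words_outside[OF F] by (cases "I \<in> word_pairs") simp_all
  finally show "F I = (\<Sum>J\<in>word_pairs. pscale (*) (F J) (\<delta> J)) I" by simp
qed

lemma act12_\<delta>:
  assumes "p permutes {..<n}" "q permutes {..<n}"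
  shows "act1 p (act2 q (\<delta> (bishift p q J))) = \<delta> J"
proof
  fix I
  have "bishift p q I = bishift p q J \<longleftrightarrow> I = J" using bishift_inv[OF assms] by metis
  then show "act1 p (act2 q (\<delta> (bishift p q J))) I = \<delta> J I" by (simp add: act12 \<delta>_def)
qed

lemma E_eval: "E l x y F I = (\<Sum>\<sigma>\<in>Sym n. \<Sum>\<tau>\<in>Sym n.
    u (fst l) (fst x) (fst y) \<sigma> * u (snd l) (snd x) (snd y) \<tau> * F (bishift \<sigma> \<tau> I))"
proof -
  have "E l x y F = (\<Sum>\<sigma>\<in>Sym n. \<Sum>\<tau>\<in>Sym n. pscale (*) (u (fst l) (fst x) (fst y) \<sigma> * u (snd l) (snd x) (snd y) \<tau>) (act1 \<sigma> (act2 \<tau> F)))"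
    unfolding E_def R1.U_def[of "fst l"] R2.U_def
    by (rule sum.cong[OF refl]) (simp only: act1.act_sum act1.act_scale mem_Collect_eq funs.scale_sum_right funs.scale_scale)
  then show ?thesis by (simp only: sum_fun_apply pscale_apply act12)
qed

text \<open>The matrix of an element of the group algebra commutes with the matrices that are invariant under
  the group.\<close>

lemma comm_coeffs_unit_coeffs: "comm_coeffs (unit_coeffs l x y)"
  unfolding comm_coeffs_def
proof (intro allI impI ballI)
  fix \<theta> R J assume \<theta>: "bi_invariant \<theta>" and R: "R \<in> word_pairs" and J: "J \<in> word_pairs"
  define c where "c \<sigma> \<tau> = u (fst l) (fst x) (fst y) \<sigma> * u (snd l) (snd x) (snd y) \<tau>" for \<sigma> \<tau>
  have "(\<Sum>I\<in>word_pairs. unit_coeffs l x y I J * \<theta> I R) = (\<Sum>\<sigma>\<in>Sym n. \<Sum>\<tau>\<in>Sym n. c \<sigma> \<tau> * (\<Sum>I\<in>word_pairs. \<delta> J (bishift \<sigma> \<tau> I) * \<theta> I R))"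
    unfolding unit_coeffs_def E_eval c_def[symmetric] sum_distrib_right sum_distrib_left mult.assoc
    by (subst sum.swap, rule sum.cong[OF refl], rule sum.swap)
  also have "\<dots> = (\<Sum>\<sigma>\<in>Sym n. \<Sum>\<tau>\<in>Sym n. c \<sigma> \<tau> * (\<Sum>I\<in>word_pairs. \<delta> I (bishift \<sigma> \<tau> R) * \<theta> J I))"
  proof (intro sum.cong refl)
    fix \<sigma> \<tau> assume "\<sigma> \<in> Sym n" "\<tau> \<in> Sym n"
    then have p: "\<sigma> permutes {..<n}" "\<tau> permutes {..<n}" by auto
    let ?J = "bishift (inv \<sigma>) (inv \<tau>) J"
    have JO: "?J \<in> word_pairs" using J bishift_word_pairs[OF permutes_inv[OF p(1)] permutes_inv[OF p(2)]] by simp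
    have "bishift \<sigma> \<tau> I = J \<longleftrightarrow> I = ?J" for I using bishift_inv[OF p] by metis
    then have "(\<Sum>I\<in>word_pairs. \<delta> J (bishift \<sigma> \<tau> I) * \<theta> I R) = (\<Sum>I\<in>word_pairs. if I = ?J then \<theta> I R else 0)"
      by (intro sum.cong refl) (simp add: \<delta>_def)
    also have "\<dots> = \<theta> ?J R" using JO by simp
    also have "\<dots> = \<theta> (bishift \<sigma> \<tau> ?J) (bishift \<sigma> \<tau> R)" using \<theta> p JO R by (simp add: bi_invariant_def)
    also have "\<dots> = \<theta> J (bishift \<sigma> \<tau> R)" by (simp only: bishift_inv[OF p])
    also have "\<dots> = (\<Sum>I\<in>word_pairs. if I = bishift \<sigma> \<tau> R then \<theta> J I else 0)" using R bishift_word_pairs[OF p] by simp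
    also have "\<dots> = (\<Sum>I\<in>word_pairs. \<delta> I (bishift \<sigma> \<tau> R) * \<theta> J I)" by (intro sum.cong refl) (simp add: \<delta>_def)
    finally show "c \<sigma> \<tau> * (\<Sum>I\<in>word_pairs. \<delta> J (bishift \<sigma> \<tau> I) * \<theta> I R) = c \<sigma> \<tau> * (\<Sum>I\<in>word_pairs. \<delta> I (bishift \<sigma> \<tau> R) * \<theta> J I)" by simp
  qed
  also have "\<dots> = (\<Sum>I\<in>word_pairs. unit_coeffs l x y R I * \<theta> J I)"
    unfolding unit_coeffs_def E_eval c_def[symmetric] sum_distrib_right sum_distrib_left mult.assoc
    by (rule sym, subst sum.swap, rule sum.cong[OF refl], rule sum.swap)
  finally show "(\<Sum>I\<in>word_pairs. unit_coeffs l x y I J * \<theta> I R) = (\<Sum>I\<in>word_pairs. unit_coeffs l x y R I * \<theta> J I)" .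
qed

lemma comm_coeffs_sum:
  assumes "\<And>k. k \<in> S \<Longrightarrow> comm_coeffs (A k)"
  shows "comm_coeffs (\<lambda>I J. \<Sum>k\<in>S. c k * A k I J)"
  unfolding comm_coeffs_def
proof (intro allI impI ballI)
  fix \<theta> R J assume \<theta>: "bi_invariant \<theta>" and RJ: "R \<in> word_pairs" "J \<in> word_pairs"
  have "(\<Sum>I\<in>word_pairs. (\<Sum>k\<in>S. c k * A k I J) * \<theta> I R) = (\<Sum>k\<in>S. c k * (\<Sum>I\<in>word_pairs. A k I J * \<theta> I R))"
    unfolding sum_distrib_right sum_distrib_left mult.assoc by (rule sum.swap)
  also have "\<dots> = (\<Sum>k\<in>S. c k * (\<Sum>I\<in>word_pairs. A k R I * \<theta> J I))"
    using assms \<theta> RJ by (intro sum.cong refl) (simp add: comm_coeffs_def)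
  also have "\<dots> = (\<Sum>I\<in>word_pairs. (\<Sum>k\<in>S. c k * A k R I) * \<theta> J I)"
    unfolding sum_distrib_right sum_distrib_left mult.assoc by (rule sum.swap)
  finally show "(\<Sum>I\<in>word_pairs. (\<Sum>k\<in>S. c k * A k I J) * \<theta> I R) = (\<Sum>I\<in>word_pairs. (\<Sum>k\<in>S. c k * A k R I) * \<theta> J I)" .
qed

text \<open>The double commutant theorem for \<open>S\<^sub>n \<times> S\<^sub>n\<close>: \<open>A\<close> comes from the group algebra.\<close>

lemma comm_coeffs_expand:
  assumes A: "comm_coeffs A"
  shows "\<exists>a. \<forall>I\<in>word_pairs. \<forall>J\<in>word_pairs. A I J = (\<Sum>l\<in>shape_pairs. \<Sum>x\<in>Ix l. \<Sum>y\<in>Ix l. a l x y * unit_coeffs l x y I J)"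
proof -
  \<comment> \<open>The operator with the matrix \<open>A\<close>.  An operator that commutes with the matrix units also commutes
    with the place permutations, and therefore with \<open>Z\<close>.\<close>
  define Z :: "(word_pair \<Rightarrow> 'k) \<Rightarrow> word_pair \<Rightarrow> 'k"
    where "Z F I = (if I \<in> word_pairs then \<Sum>J\<in>word_pairs. A I J * F J else 0)" for F I
  have Zlin: "Vector_Spaces.linear (pscale (*)) (pscale (*)) Z"
    unfolding Vector_Spaces.linear_iff
  proof (intro conjI allI funs.vector_space_axioms ext)
    fix F G I show "Z (F + G) I = (Z F + Z G) I" by (simp add: Z_def distrib_left sum.distrib)
    fix c show "Z (pscale (*) c F) I = pscale (*) c (Z F) I" by (simp add: Z_def sum_distrib_left mult.left_commute)
  qed
  have ZX: "Z F \<in> on_words" for F by (simp add: on_words_def Z_def)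
  have "\<exists>a. \<forall>F\<in>on_words. Z F = (\<Sum>l\<in>shape_pairs. \<Sum>x\<in>Ix l. \<Sum>y\<in>Ix l. pscale (*) (a l x y) (E l x y F))"
  proof (rule double_commutant[OF funs.vector_space_axioms on_words_subspace _ E_linear E_on_words _ _ Zlin])
    fix \<theta> F assume lin: "Vector_Spaces.linear (pscale (*)) (pscale (*)) \<theta>" and \<theta>X: "\<And>F. F \<in> on_words \<Longrightarrow> \<theta> F \<in> on_words"
      and \<theta>E: "\<And>l x y F. l \<in> shape_pairs \<Longrightarrow> x \<in> Ix l \<Longrightarrow> y \<in> Ix l \<Longrightarrow> F \<in> on_words \<Longrightarrow> \<theta> (E l x y F) = E l x y (\<theta> F)" and F: "F \<in> on_words"
    interpret ff: vector_space_pair "pscale (*) :: 'k \<Rightarrow> (word_pair \<Rightarrow> 'k) \<Rightarrow> _" "pscale (*) :: 'k \<Rightarrow> (word_pair \<Rightarrow> 'k) \<Rightarrow> _" ..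
    have \<theta>act: "\<theta> (act1 p (act2 q G)) = act1 p (act2 q (\<theta> G))"
      if p: "p permutes {..<n}" and q: "q permutes {..<n}" and G: "G \<in> on_words" for p q G
      unfolding act12_eq_E[OF p q] ff.linear_sum[OF lin] ff.linear_scale[OF lin]
      by (intro sum.cong refl) (simp only: \<theta>E G)
    define th where "th I J = \<theta> (\<delta> J) I" for I J
    have \<theta>th: "\<theta> G I = (\<Sum>J\<in>word_pairs. th I J * G J)" if "G \<in> on_words" for G I
    proof -
      have "\<theta> G = (\<Sum>J\<in>word_pairs. pscale (*) (G J) (\<theta> (\<delta> J)))"
        by (subst on_words_expand[OF that]) (simp only: ff.linear_sum[OF lin] ff.linear_scale[OF lin])
      then show ?thesis by (simp add: sum_fun_apply th_def mult.commute)
    qed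
    have "bi_invariant (\<lambda>I J. th J I)"
      unfolding bi_invariant_def
    proof (intro allI impI ballI)
      fix p q I J assume p: "p permutes {..<n}" and q: "q permutes {..<n}" and IJ: "I \<in> word_pairs" "J \<in> word_pairs"
      have "th (bishift p q J) (bishift p q I) = act1 p (act2 q (\<theta> (\<delta> (bishift p q I)))) J"
        by (simp add: th_def act12)
      also have "\<dots> = \<theta> (act1 p (act2 q (\<delta> (bishift p q I)))) J"
        using IJ bishift_word_pairs[OF p q] by (simp add: \<theta>act[OF p q] \<delta>_on_words)
      also have "\<dots> = th J I" unfolding act12_\<delta>[OF p q] th_def ..
      finally show "th (bishift p q J) (bishift p q I) = th J I" .
    qed
    then have com: "(\<Sum>I\<in>word_pairs. A I J * th R I) = (\<Sum>I\<in>word_pairs. A R I * th I J)" if "R \<in> word_pairs" "J \<in> word_pairs" for R J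
      using A that unfolding comm_coeffs_def by blast
    show "Z (\<theta> F) = \<theta> (Z F)"
    proof
      fix R
      show "Z (\<theta> F) R = \<theta> (Z F) R"
      proof (cases "R \<in> word_pairs")
        case True
        have "Z (\<theta> F) R = (\<Sum>I\<in>word_pairs. \<Sum>J\<in>word_pairs. A R I * th I J * F J)"
          using True by (simp add: Z_def \<theta>th[OF F] sum_distrib_left mult.assoc)
        also have "\<dots> = (\<Sum>J\<in>word_pairs. (\<Sum>I\<in>word_pairs. A R I * th I J) * F J)"
          by (subst sum.swap) (simp add: sum_distrib_right)
        also have "\<dots> = (\<Sum>J\<in>word_pairs. (\<Sum>I\<in>word_pairs. A I J * th R I) * F J)" using True com by simp
        also have "\<dots> = (\<Sum>I\<in>word_pairs. \<Sum>J\<in>word_pairs. th R I * (A I J * F J))"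
          by (subst sum.swap) (simp add: sum_distrib_right sum_distrib_left mult_ac)
        also have "\<dots> = \<theta> (Z F) R" by (simp add: \<theta>th[OF ZX] Z_def sum_distrib_left)
        finally show ?thesis .
      next
        case False
        then show ?thesis using on_words_outside[OF \<theta>X[OF ZX[of F]] False] by (simp add: Z_def)
      qed
    qed
  qed (auto simp: E_E E_resolution ZX)
  then obtain a where a: "\<And>F. F \<in> on_words \<Longrightarrow> Z F = (\<Sum>l\<in>shape_pairs. \<Sum>x\<in>Ix l. \<Sum>y\<in>Ix l. pscale (*) (a l x y) (E l x y F))" by blast
  have "A I J = (\<Sum>l\<in>shape_pairs. \<Sum>x\<in>Ix l. \<Sum>y\<in>Ix l. a l x y * unit_coeffs l x y I J)" if "I \<in> word_pairs" "J \<in> word_pairs" for I J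
  proof -
    have "Z (\<delta> J) I = (\<Sum>K\<in>word_pairs. A I K * \<delta> J K)" using that by (simp add: Z_def)
    also have "\<dots> = (\<Sum>K\<in>word_pairs. if K = J then A I J else 0)" by (rule sum.cong) (auto simp: \<delta>_def)
    finally have "Z (\<delta> J) I = (\<Sum>K\<in>word_pairs. if K = J then A I J else 0)" .
    then have "A I J = Z (\<delta> J) I" using that by simp
    also have "\<dots> = (\<Sum>l\<in>shape_pairs. \<Sum>x\<in>Ix l. \<Sum>y\<in>Ix l. a l x y * unit_coeffs l x y I J)"
      unfolding a[OF \<delta>_on_words[OF that(2)]] by (simp only: sum_fun_apply pscale_apply unit_coeffs_def)
    finally show ?thesis .
  qed
  then show ?thesis by blast
qed

end

section \<open>Which blocks occur on words in few letters\<close>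

text \<open>Every row has a box in the first column.\<close>

lemma (in tableau) card_first_column: "length la \<le> card (column 0)"
proof -
  have dg: "(i, 0) \<in> diagram la" if "i < length la" for i
    using that partitionsD(2)[OF la, of "la ! i"] by (simp add: diagram_def)
  have "inj_on (\<lambda>i. t (i, 0)) {..<length la}"
  proof (rule inj_onI)
    fix i j assume "i \<in> {..<length la}" "j \<in> {..<length la}" "t (i, 0) = t (j, 0)"
    then have "(i, 0::nat) = (j, 0)" by (intro inj_onD[OF bij_betw_imp_inj_on[OF bij_t]]) (simp_all add: dg)
    then show "i = j" by simp
  qed
  moreover have "(\<lambda>i. t (i, 0)) ` {..<length la} \<subseteq> column 0"
    using t_less dg by (auto simp: column_def)
  ultimately have "card {..<length la} \<le> card (column 0)"
    by (intro card_inj_on_le[of "\<lambda>i. t (i, 0)"]) (auto simp: column_def)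
  then show ?thesis by simp
qed

context unit_rep
begin

text \<open>Matrix units on both sides single out an entry of the matrix of the column alternator.\<close>

lemma U_sandwich:
  assumes tab: "tableau n la t" and l: "l \<in> L" "i < dm l" "j < dm l" "a < dm l" "c < dm l"
  shows "U l i a (colsum la t (U l c j x)) = s (\<Sum>p\<in>column_stabilizer la t. of_int (sign p) * rho l p a c) (U l i j x)"
proof -
  interpret tableau n la t by (rule tab)
  have "U l i a (act p (U l c j x)) = s (rho l p a c) (U l i j x)" if p: "p permutes {..<n}" for p
  proof -
    have "U l i a (act p (U l c j x)) = (\<Sum>k<dm l. s (rho l p a k) (U l i k (U l c j x)))"
      by (rule U_act[OF p]) (use l in auto)
    also have "\<dots> = (\<Sum>k<dm l. if k = c then s (rho l p a c) (U l i j x) else 0)"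
      using l by (intro sum.cong refl) (simp add: U_U)
    finally show ?thesis using l by simp
  qed
  then show ?thesis
    unfolding colsum_def U_sum U_scale scale_sum_left
    by (intro sum.cong refl) (simp add: column_stabilizer_permutes)
qed

lemma U_eq_0_if_colsum_eq_0:
  assumes tab: "tableau n la t" and l: "l \<in> L" and ac: "a < dm l" "c < dm l"
    and nz: "(\<Sum>p\<in>column_stabilizer la t. of_int (sign p) * rho l p a c) \<noteq> 0"
    and z: "colsum la t (U l c j x) = 0" and ij: "i < dm l" "j < dm l"
  shows "U l i j x = 0"
  using U_sandwich[OF tab l ij ac, of x] nz by (simp add: z U_0)

end

context specht_units
begin

text \<open>The alternator of a tableau multiplies the polytabloid of this tableau by a nonzero number.\<close>

lemma alternator_entry_nonzero:
  assumes tab: "tableau n la t" and la: "la \<in> partitions n"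
  shows "\<exists>a<dm la. \<exists>c<dm la. (\<Sum>p\<in>column_stabilizer la t. of_int (sign p) * rho la p a c) \<noteq> 0"
proof (rule ccontr)
  assume "\<not> ?thesis"
  then have z: "(\<Sum>p\<in>column_stabilizer la t. of_int (sign p) * rho la p a c) = 0" if "a < dm la" "c < dm la" for a c
    using that by blast
  interpret tableau n la t by (rule tab)
  interpret ff: vector_space_pair "pscale (*) :: 'k \<Rightarrow> (tabloid \<Rightarrow> 'k) \<Rightarrow> _" "pscale (*) :: 'k \<Rightarrow> (tabloid \<Rightarrow> 'k) \<Rightarrow> _" ..
  have lin: "Vector_Spaces.linear (pscale (*)) (pscale (*)) (specht.colsum la t :: (tabloid \<Rightarrow> 'k) \<Rightarrow> _)"
    unfolding Vector_Spaces.linear_iff by (intro conjI allI specht.colsum_linear[OF tab] funs.vector_space_axioms)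
  have bz: "specht.colsum la t (b la c) = 0" if c: "c < dm la" for c
  proof -
    have "specht.colsum la t (b la c) =
        (\<Sum>p\<in>column_stabilizer la t. \<Sum>a<dm la. pscale (*) (of_int (sign p) * rho la p a c) (b la a))"
      unfolding specht.colsum_def
      by (rule sum.cong[OF refl]) (simp only: act_b[OF la column_stabilizer_permutes c] funs.scale_sum_right funs.scale_scale)
    also have "\<dots> = (\<Sum>a<dm la. pscale (*) (\<Sum>p\<in>column_stabilizer la t. of_int (sign p) * rho la p a c) (b la a))"
      unfolding funs.scale_sum_left by (rule sum.swap)
    also have "\<dots> = 0" using c by (intro sum.neutral ballI) (simp only: z lessThan_iff funs.scale_zero_left)
    finally show ?thesis .
  qed
  have "specht.colsum la t (polytabloid la t) = specht.colsum la t (\<Sum>j<dm la. pscale (*) (cf la (polytabloid la t) j) (b la j))"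
    by (simp only: coords_expand[OF fb[OF la] polytabloid_in_specht])
  also have "\<dots> = 0"
    unfolding ff.linear_sum[OF lin] ff.linear_scale[OF lin] by (intro sum.neutral ballI) (simp only: bz lessThan_iff funs.scale_zero_right)
  finally have "pscale (*) (of_nat (card (column_stabilizer la t))) (polytabloid la t :: tabloid \<Rightarrow> 'k) = 0"
    unfolding colsum_polytabloid .
  moreover have "card (column_stabilizer la t) \<noteq> 0" using column_stabilizer_id by auto
  ultimately show False using polytabloid_nonzero unfolding funs.scale_eq_0_iff of_nat_eq_0_iff by blast
qed

end

context invariant_count
begin

text \<open>A shape with more than \<open>d\<close> rows does not occur on words in \<open>d\<close> letters: a letter is repeated in
  the first column, so that the column alternator vanishes.\<close>

lemma colsum_words_eq_0:
  fixes F :: "(nat \<Rightarrow> nat) \<Rightarrow> 'k"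
  assumes tab: "tableau n la t" and len: "length la > d" and F: "\<And>i. i \<notin> words d \<Longrightarrow> F i = 0"
  shows "(\<Sum>p\<in>column_stabilizer la t. of_int (sign p) * F (i \<circ> p)) = 0"
proof -
  interpret tableau n la t by (rule tab)
  show ?thesis
  proof (cases "i \<in> words d")
    case True
    have "\<not> inj_on i (column 0)"
    proof
      assume "inj_on i (column 0)"
      moreover have "i ` column 0 \<subseteq> {..<d}" using True by (auto simp: words_def column_def PiE_iff)
      ultimately have "card (column 0) \<le> d" using card_inj_on_le[of i "column 0" "{..<d}"] by simp
      then show False using card_first_column len by simp
    qed
    then show ?thesis by (rule alternating_sum_eq_0)
  next
    case False
    have "F (i \<circ> p) = 0" if "p \<in> column_stabilizer la t" for p
      using False F words_comp[OF column_stabilizer_permutes[OF that]] by blast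
    then show ?thesis by simp
  qed
qed

lemma U1_eq_0:
  assumes "la \<in> partitions n" "length la > d1" "F \<in> on_words" "i < dm la" "j < dm la"
  shows "R1.U la i j F = 0"
proof -
  obtain t where tab: "tableau n la t" using tableau_exists[OF assms(1)] by blast
  obtain a c where ac: "a < dm la" "c < dm la"
    "(\<Sum>p\<in>column_stabilizer la t. of_int (sign p) * rho la p a c) \<noteq> 0"
    using alternator_entry_nonzero[OF tab assms(1)] by blast
  have "act1.colsum la t G = 0" if G: "G \<in> on_words" for G
  proof
    fix I
    have "act1.colsum la t G I = (\<Sum>p\<in>column_stabilizer la t. of_int (sign p) * G (fst I \<circ> p, snd I))"
      unfolding act1.colsum_def sum_fun_apply by (simp add: act1_def)
    also have "\<dots> = 0"
      by (rule colsum_words_eq_0[OF tab assms(2), of "\<lambda>i. G (i, snd I)"]) (use G in \<open>auto simp: on_words_def word_pairs_def\<close>)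
    finally show "act1.colsum la t G I = 0 I" by simp
  qed
  from this[OF R1.U_in[OF on_words_subspace act_on_words(1) assms(3)]]
  show ?thesis by (rule R1.U_eq_0_if_colsum_eq_0[OF tab assms(1) ac _ assms(4,5)])
qed

lemma U2_eq_0:
  assumes "la \<in> partitions n" "length la > d2" "F \<in> on_words" "i < dm la" "j < dm la"
  shows "R2.U la i j F = 0"
proof -
  obtain t where tab: "tableau n la t" using tableau_exists[OF assms(1)] by blast
  obtain a c where ac: "a < dm la" "c < dm la"
    "(\<Sum>p\<in>column_stabilizer la t. of_int (sign p) * rho la p a c) \<noteq> 0"
    using alternator_entry_nonzero[OF tab assms(1)] by blast
  have "act2.colsum la t G = 0" if G: "G \<in> on_words" for G
  proof
    fix I
    have "act2.colsum la t G I = (\<Sum>p\<in>column_stabilizer la t. of_int (sign p) * G (fst I, snd I \<circ> p))"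
      unfolding act2.colsum_def sum_fun_apply by (simp add: act2_def)
    also have "\<dots> = 0"
      by (rule colsum_words_eq_0[OF tab assms(2), of "\<lambda>i. G (fst I, i)"]) (use G in \<open>auto simp: on_words_def word_pairs_def\<close>)
    finally show "act2.colsum la t G I = 0 I" by simp
  qed
  from this[OF R2.U_in[OF on_words_subspace act_on_words(2) assms(3)]]
  show ?thesis by (rule R2.U_eq_0_if_colsum_eq_0[OF tab assms(1) ac _ assms(4,5)])
qed

definition short_shape_pairs :: "(nat list \<times> nat list) set" where
  "short_shape_pairs = {la \<in> partitions n. length la \<le> d1} \<times> {mu \<in> partitions n. length mu \<le> d2}"

lemma short_shape_pairs_subset: "short_shape_pairs \<subseteq> shape_pairs" by (auto simp: short_shape_pairs_def)

lemma finite_short_shape_pairs [simp]: "finite short_shape_pairs"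
  using finite_subset[OF short_shape_pairs_subset] finite_partitions[of n] by simp

lemma E_eq_0:
  assumes "l \<in> shape_pairs - short_shape_pairs" "x \<in> Ix l" "y \<in> Ix l" "F \<in> on_words"
  shows "E l x y F = 0"
proof (cases "length (fst l) > d1")
  case True
  then show ?thesis unfolding E_def
    using assms by (intro U1_eq_0 R2.U_in[OF on_words_subspace act_on_words(2)]) (auto simp: Ix_def)
next
  case False
  then have "length (snd l) > d2" using assms by (auto simp: short_shape_pairs_def mem_Times_iff)
  then have "R2.U (snd l) (snd x) (snd y) F = 0"
    using assms by (intro U2_eq_0) (auto simp: Ix_def)
  then show ?thesis unfolding E_def by (simp only: R1.U_0)
qed

text \<open>A shape with at most \<open>d\<close> rows does occur: tabloids are words, and their letters are row indices.\<close>

definition word_fun :: "nat \<Rightarrow> nat list \<Rightarrow> (tabloid \<Rightarrow> 'k) \<Rightarrow> (nat \<Rightarrow> nat) \<Rightarrow> 'k" where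
  "word_fun d la x = (\<lambda>i. if i \<in> words d then x (word_tabloid n (length la) i) else 0)"

lemma word_act_word_fun: "p permutes {..<n} \<Longrightarrow> word_act p (word_fun d la x) = word_fun d la (specht_act p x)"
  by (auto simp: word_act_def word_fun_def words_comp specht_act_word_tabloid fun_eq_iff)

lemma word_fun_sum: "word_fun d la (\<Sum>k\<in>K. pscale (*) (c k) (x k)) = (\<Sum>k\<in>K. pscale (*) (c k) (word_fun d la (x k)))"
  by (auto simp: word_fun_def fun_eq_iff sum_fun_apply)

lemma word_fun_exists:
  assumes la: "la \<in> partitions n" and len: "length la \<le> d"
  shows "\<exists>f. f \<noteq> 0 \<and> (\<forall>i. i \<notin> words d \<longrightarrow> f i = 0) \<and> RW.U la 0 0 f = f"
proof -
  let ?x = "b la 0"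
  have pos: "0 < dm la" by (rule dm_pos[OF la])
  have "?x \<noteq> 0"
  proof
    assume "?x = 0"
    then have "(\<Sum>j<dm la. pscale (*) (if j = 0 then 1 else 0) (b la j)) = 0"
      by (intro sum.neutral ballI) (auto simp: fun_eq_iff)
    from family_basisD(3)[OF fb[OF la] this, of 0] pos show False by simp
  qed
  then obtain z where z: "?x z \<noteq> 0" by (auto simp: fun_eq_iff)
  from specht_support[OF la b_in[OF la pos] z] obtain t p where tab: "tableau n la t" and p: "p permutes {..<n}"
    and zw: "z = word_tabloid n (length la) (row la t \<circ> p)" by blast
  define i where "i = restrict (row la t \<circ> p) {..<n}"
  have "row la t (p k) < d" if "k < n" for k
    using tableau.row_less[OF tab, of "p k"] permutes_in_image[OF p, of k] that len by simp
  then have i: "i \<in> words d" by (auto simp: i_def words_def)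
  have "word_tabloid n (length la) i = z" unfolding zw by (rule word_tabloid_cong) (simp add: i_def)
  then have "word_fun d la ?x i \<noteq> 0" using i z by (simp add: word_fun_def)
  then have nz: "word_fun d la ?x \<noteq> 0" by (auto simp: fun_eq_iff)
  have "(\<Sum>\<sigma>\<in>Sym n. pscale (*) (u la 0 0 \<sigma>) (specht_act \<sigma> ?x)) =
      (\<Sum>a<dm la. pscale (*) (\<Sum>\<sigma>\<in>Sym n. u la 0 0 \<sigma> * rho la \<sigma> a 0) (b la a))"
  proof -
    have "(\<Sum>\<sigma>\<in>Sym n. pscale (*) (u la 0 0 \<sigma>) (specht_act \<sigma> ?x)) =
        (\<Sum>\<sigma>\<in>Sym n. \<Sum>a<dm la. pscale (*) (u la 0 0 \<sigma> * rho la \<sigma> a 0) (b la a))"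
      by (rule sum.cong[OF refl]) (simp only: mem_Collect_eq act_b[OF la _ pos] funs.scale_sum_right funs.scale_scale)
    then show ?thesis unfolding funs.scale_sum_left by (simp only:) (rule sum.swap)
  qed
  also have "\<dots> = (\<Sum>a<dm la. if a = 0 then ?x else 0)"
    using pos la by (intro sum.cong refl) (auto simp: u_dual)
  also have "\<dots> = ?x" using pos by simp
  finally have "(\<Sum>\<sigma>\<in>Sym n. pscale (*) (u la 0 0 \<sigma>) (specht_act \<sigma> ?x)) = ?x" .
  moreover have "RW.U la 0 0 (word_fun d la ?x) = word_fun d la (\<Sum>\<sigma>\<in>Sym n. pscale (*) (u la 0 0 \<sigma>) (specht_act \<sigma> ?x))"
    unfolding RW.U_def word_fun_sum by (rule sum.cong[OF refl]) (simp only: word_act_word_fun mem_Collect_eq)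
  ultimately have "RW.U la 0 0 (word_fun d la ?x) = word_fun d la ?x" by (simp only:)
  then show ?thesis using nz by (intro exI[of _ "word_fun d la ?x"]) (simp add: word_fun_def)
qed

lemma U_outer:
  "R1.U la i j (outer f g) = outer (RW.U la i j f) g" "R2.U la i j (outer f g) = outer f (RW.U la i j g)"
  by (rule ext, simp add: R1.U_def RW.U_def outer_def act1_def word_act_def sum_fun_apply split_beta sum_distrib_right mult.assoc)
    (rule ext, simp add: R2.U_def RW.U_def outer_def act2_def word_act_def sum_fun_apply split_beta sum_distrib_left mult.left_commute)

text \<open>The fixed function is a product of functions of one word each, fixed by the matrix units of the two
factors.\<close>

lemma E_nonzero:
  assumes "l \<in> short_shape_pairs"
  shows "\<exists>F\<in>on_words. F \<noteq> 0 \<and> E l (0, 0) (0, 0) F = F"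
proof -
  obtain f where f: "f \<noteq> 0" "\<forall>i. i \<notin> words d1 \<longrightarrow> f i = 0" "RW.U (fst l) 0 0 f = f"
    using word_fun_exists[of "fst l" d1] assms by (auto simp: short_shape_pairs_def)
  obtain g where g: "g \<noteq> 0" "\<forall>i. i \<notin> words d2 \<longrightarrow> g i = 0" "RW.U (snd l) 0 0 g = g"
    using word_fun_exists[of "snd l" d2] assms by (auto simp: short_shape_pairs_def)
  obtain i j where "f i \<noteq> 0" "g j \<noteq> 0" using f(1) g(1) by (auto simp: fun_eq_iff)
  then have "outer f g (i, j) \<noteq> 0" by (simp add: outer_def)
  then have "outer f g \<noteq> 0" by (auto simp: fun_eq_iff)
  moreover have "outer f g \<in> on_words" using f(2) g(2) by (auto simp: on_words_def outer_def word_pairs_def)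
  moreover have "E l (0, 0) (0, 0) (outer f g) = outer f g"
    unfolding E_def fst_conv snd_conv U_outer f(3) g(3) ..
  ultimately show ?thesis by blast
qed

lemma zero_in_Ix: "l \<in> shape_pairs \<Longrightarrow> (0, 0) \<in> Ix l"
  using dm_pos by (auto simp: Ix_def)

text \<open>Multiplication by matrix units on both sides reduces a relation to one of its coefficients.\<close>

lemma E_independent:
  assumes z: "\<And>F. F \<in> on_words \<Longrightarrow> (\<Sum>l\<in>short_shape_pairs. \<Sum>x\<in>Ix l. \<Sum>y\<in>Ix l. pscale (*) (a l x y) (E l x y F)) = 0"
    and l: "l \<in> short_shape_pairs" "x \<in> Ix l" "y \<in> Ix l"
  shows "a l x y = 0"
proof -
  obtain F where F: "F \<in> on_words" "F \<noteq> 0" "E l (0, 0) (0, 0) F = F" using E_nonzero[OF l(1)] by blast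
  have lL: "l \<in> shape_pairs" using l short_shape_pairs_subset by blast
  note l0 = zero_in_Ix[OF lL]
  have "0 = E l (0, 0) x (\<Sum>m\<in>short_shape_pairs. \<Sum>p\<in>Ix m. \<Sum>q\<in>Ix m. pscale (*) (a m p q) (E m p q (E l y (0, 0) F)))"
    unfolding z[OF E_on_words[OF F(1)]] E_0 ..
  also have "\<dots> = (\<Sum>m\<in>short_shape_pairs. \<Sum>p\<in>Ix m. \<Sum>q\<in>Ix m. pscale (*) (a m p q) (E l (0, 0) x (E m p q (E l y (0, 0) F))))"
    by (simp only: E_sum E_scale)
  also have "\<dots> = (\<Sum>m\<in>short_shape_pairs. if m = l then pscale (*) (a l x y) F else 0)"
  proof (rule sum.cong[OF refl])
    fix m assume "m \<in> short_shape_pairs"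
    then have mL: "m \<in> shape_pairs" using short_shape_pairs_subset by blast
    show "(\<Sum>p\<in>Ix m. \<Sum>q\<in>Ix m. pscale (*) (a m p q) (E l (0, 0) x (E m p q (E l y (0, 0) F)))) =
        (if m = l then pscale (*) (a l x y) F else 0)"
    proof (cases "m = l")
      case True
      have "(\<Sum>q\<in>Ix l. pscale (*) (a l p q) (E l (0, 0) x (E l p q (E l y (0, 0) F)))) =
          (if p = x then pscale (*) (a l x y) F else 0)" if p: "p \<in> Ix l" for p
      proof -
        have "(\<Sum>q\<in>Ix l. pscale (*) (a l p q) (E l (0, 0) x (E l p q (E l y (0, 0) F)))) =
            (\<Sum>q\<in>Ix l. if q = y then (if p = x then pscale (*) (a l x y) F else 0) else 0)"
        proof (rule sum.cong[OF refl])
          fix q assume q: "q \<in> Ix l"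
          have "E l (0, 0) x (E l p q (E l y (0, 0) F)) = (if p = x \<and> q = y then F else 0)"
            using E_E[OF lL lL l0 l(2) p q] E_E[OF lL lL l0 q l(3) l0] F(3) by (auto simp: E_0)
          then show "pscale (*) (a l p q) (E l (0, 0) x (E l p q (E l y (0, 0) F))) =
              (if q = y then (if p = x then pscale (*) (a l x y) F else 0) else 0)"
            by (auto simp: funs.scale_zero_right)
        qed
        then show ?thesis using l(3) by simp
      qed
      then show ?thesis using True l(2) by simp
    next
      case False
      have "E l (0, 0) x (E m p q (E l y (0, 0) F)) = 0" if "p \<in> Ix m" "q \<in> Ix m" for p q
        using E_E[OF lL mL l0 l(2) that] False by simp
      then show ?thesis using False by (simp add: funs.scale_zero_right)
    qed
  qed
  also have "\<dots> = pscale (*) (a l x y) F" using l(1) by simp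
  finally show ?thesis using F(2) funs.scale_eq_0_iff[of "a l x y" F] by simp
qed

lemma unit_coeffs_independent:
  assumes z: "\<And>I J. I \<in> word_pairs \<Longrightarrow> J \<in> word_pairs \<Longrightarrow> (\<Sum>l\<in>short_shape_pairs. \<Sum>x\<in>Ix l. \<Sum>y\<in>Ix l. a l x y * unit_coeffs l x y I J) = 0"
    and l: "l \<in> short_shape_pairs" "x \<in> Ix l" "y \<in> Ix l"
  shows "a l x y = 0"
proof (rule E_independent[OF _ l])
  fix F assume F: "F \<in> on_words"
  let ?T = "\<lambda>F. \<Sum>l\<in>short_shape_pairs. \<Sum>x\<in>Ix l. \<Sum>y\<in>Ix l. pscale (*) (a l x y) (E l x y F)"
  interpret ff: vector_space_pair "pscale (*) :: 'k \<Rightarrow> (word_pair \<Rightarrow> 'k) \<Rightarrow> _" "pscale (*) :: 'k \<Rightarrow> (word_pair \<Rightarrow> 'k) \<Rightarrow> _" ..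
  have TX: "?T G \<in> on_words" if "G \<in> on_words" for G
    by (intro funs.subspace_sum funs.subspace_scale on_words_subspace E_on_words that)
  have "?T (\<delta> J) = 0" if J: "J \<in> word_pairs" for J
  proof
    fix I show "?T (\<delta> J) I = 0 I"
    proof (cases "I \<in> word_pairs")
      case True
      have "?T (\<delta> J) I = (\<Sum>l\<in>short_shape_pairs. \<Sum>x\<in>Ix l. \<Sum>y\<in>Ix l. a l x y * unit_coeffs l x y I J)"
        by (simp only: sum_fun_apply pscale_apply unit_coeffs_def)
      then show ?thesis using z[OF True J] by simp
    next
      case False
      then show ?thesis using on_words_outside[OF TX[OF \<delta>_on_words[OF J]] False] by simp
    qed
  qed
  moreover have "?T F = (\<Sum>J\<in>word_pairs. pscale (*) (F J) (?T (\<delta> J)))"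
  proof -
    have "?T F = ?T (\<Sum>J\<in>word_pairs. pscale (*) (F J) (\<delta> J))" by (simp only: on_words_expand[OF F, symmetric])
    also have "\<dots> = (\<Sum>l\<in>short_shape_pairs. \<Sum>x\<in>Ix l. \<Sum>y\<in>Ix l. \<Sum>J\<in>word_pairs. pscale (*) (F J) (pscale (*) (a l x y) (E l x y (\<delta> J))))"
      by (simp only: E_sum E_scale funs.scale_sum_right funs.scale_scale mult.commute)
    also have "\<dots> = (\<Sum>J\<in>word_pairs. pscale (*) (F J) (?T (\<delta> J)))"
      unfolding funs.scale_sum_right
      by (rule sym, subst sum.swap, rule sum.cong[OF refl], subst sum.swap, rule sum.cong[OF refl], rule sum.swap)
    finally show ?thesis .
  qed
  ultimately show "?T F = 0" by (simp add: funs.scale_zero_right)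
qed

text \<open>An element of the double commutant is given by one matrix \<open>a l\<close> for each block \<open>l\<close> that occurs.\<close>

definition coeffs where
  "coeffs a I J = (\<Sum>l\<in>short_shape_pairs. \<Sum>x\<in>Ix l. \<Sum>y\<in>Ix l. a l x y * unit_coeffs l x y I J)"

lemma act1_U2: "p permutes {..<n} \<Longrightarrow> R2.U l i j (act1 p F) = act1 p (R2.U l i j F)"
  unfolding R2.U_def by (simp only: act1.act_sum act1.act_scale act12_commute)

lemma act12_E:
  assumes p: "p permutes {..<n}" and l: "l \<in> shape_pairs" "x \<in> Ix l" "y \<in> Ix l"
  shows "act1 p (act2 p (E l x y F)) = (\<Sum>z\<in>Ix l. pscale (*) (tensor_matrix (fst l) (snd l) p z x) (E l z y F))"
    and "E l x y (act1 p (act2 p F)) = (\<Sum>z\<in>Ix l. pscale (*) (tensor_matrix (fst l) (snd l) p y z) (E l x z F))"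
proof -
  have l': "fst l \<in> partitions n" "snd l \<in> partitions n" "fst x < dm (fst l)" "snd x < dm (snd l)" "fst y < dm (fst l)" "snd y < dm (snd l)"
    using l by (auto simp: Ix_def)
  have "act1 p (act2 p (E l x y F)) = act1 p (R1.U (fst l) (fst x) (fst y) (act2 p (R2.U (snd l) (snd x) (snd y) F)))"
    unfolding E_def by (simp only: act2_U1[OF p])
  also have "\<dots> = (\<Sum>i<dm (fst l). \<Sum>k<dm (snd l). pscale (*) (rho (fst l) p i (fst x) * rho (snd l) p k (snd x))
      (R1.U (fst l) i (fst y) (R2.U (snd l) k (snd y) F)))"
    by (simp only: R2.act_U[OF p l'(2,4,6)] R1.U_sum R1.U_scale act1.act_sum[OF p] act1.act_scale[OF p]
        R1.act_U[OF p l'(1,3,5)] funs.scale_sum_right funs.scale_scale mult.commute)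
       (rule sum.swap)
  finally show "act1 p (act2 p (E l x y F)) = (\<Sum>z\<in>Ix l. pscale (*) (tensor_matrix (fst l) (snd l) p z x) (E l z y F))"
    unfolding sum_Ix by (simp only: E_def tensor_matrix_def split_beta fst_conv snd_conv)
  have "E l x y (act1 p (act2 p F)) = R1.U (fst l) (fst x) (fst y) (act1 p (R2.U (snd l) (snd x) (snd y) (act2 p F)))"
    unfolding E_def by (simp only: act1_U2[OF p])
  also have "\<dots> = (\<Sum>i<dm (fst l). \<Sum>k<dm (snd l). pscale (*) (rho (fst l) p (fst y) i * rho (snd l) p (snd y) k)
      (R1.U (fst l) (fst x) i (R2.U (snd l) (snd x) k F)))"
    by (simp only: R2.U_act[OF p l'(2,4,6)] R1.U_act[OF p l'(1,3,5)] R1.U_sum R1.U_scale funs.scale_sum_right funs.scale_scale)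
  finally show "E l x y (act1 p (act2 p F)) = (\<Sum>z\<in>Ix l. pscale (*) (tensor_matrix (fst l) (snd l) p y z) (E l x z F))"
    unfolding sum_Ix by (simp only: E_def tensor_matrix_def split_beta fst_conv snd_conv)
qed

text \<open>Permuting the places of both words simultaneously is the diagonal action.  On the row index it
  multiplies each block by the tensor product representation on the left, on the column index by the
  same on the right.\<close>

lemma coeffs_bishift:
  assumes p: "p permutes {..<n}"
  shows "coeffs a (bishift p p I) J = coeffs (\<lambda>l. mat_mul (Ix l) (tensor_matrix (fst l) (snd l) p) (a l)) I J"
    and "coeffs a I (bishift (inv p) (inv p) J) = coeffs (\<lambda>l. mat_mul (Ix l) (a l) (tensor_matrix (fst l) (snd l) p)) I J"
proof -
  let ?M = "\<lambda>l. tensor_matrix (fst l) (snd l) p"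
  have NL: "l \<in> shape_pairs" if "l \<in> short_shape_pairs" for l using that short_shape_pairs_subset by blast
  have 1: "unit_coeffs l x y (bishift p p I) J = (\<Sum>z\<in>Ix l. ?M l z x * unit_coeffs l z y I J)" if "l \<in> short_shape_pairs" "x \<in> Ix l" "y \<in> Ix l" for l x y
  proof -
    have "unit_coeffs l x y (bishift p p I) J = act1 p (act2 p (E l x y (\<delta> J))) I" by (simp only: unit_coeffs_def act12)
    then show ?thesis by (simp only: act12_E(1)[OF p NL[OF that(1)] that(2,3)] sum_fun_apply pscale_apply unit_coeffs_def)
  qed
  have "coeffs a (bishift p p I) J = (\<Sum>l\<in>short_shape_pairs. \<Sum>x\<in>Ix l. \<Sum>y\<in>Ix l. \<Sum>z\<in>Ix l. ?M l z x * a l x y * unit_coeffs l z y I J)"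
    unfolding coeffs_def by (intro sum.cong refl) (simp add: 1 sum_distrib_left mult_ac)
  also have "\<dots> = (\<Sum>l\<in>short_shape_pairs. \<Sum>z\<in>Ix l. \<Sum>y\<in>Ix l. \<Sum>x\<in>Ix l. ?M l z x * a l x y * unit_coeffs l z y I J)"
    by (rule sum.cong[OF refl], subst (2) sum.swap, subst sum.swap, subst (2) sum.swap) (rule refl)
  finally show "coeffs a (bishift p p I) J = coeffs (\<lambda>l. mat_mul (Ix l) (?M l) (a l)) I J"
    unfolding coeffs_def mat_mul_def sum_distrib_right .
  have ip: "bishift p p (bishift (inv p) (inv p) J) = J" by (rule bishift_inv[OF p p])
  have 2: "unit_coeffs l x y I (bishift (inv p) (inv p) J) = (\<Sum>z\<in>Ix l. ?M l y z * unit_coeffs l x z I J)" if "l \<in> short_shape_pairs" "x \<in> Ix l" "y \<in> Ix l" for l x y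
  proof -
    have "\<delta> (bishift (inv p) (inv p) J) = act1 p (act2 p (\<delta> J))"
      using act12_\<delta>[OF p p, of "bishift (inv p) (inv p) J"] unfolding ip by simp
    then have "unit_coeffs l x y I (bishift (inv p) (inv p) J) = E l x y (act1 p (act2 p (\<delta> J))) I" by (simp only: unit_coeffs_def)
    then show ?thesis by (simp only: act12_E(2)[OF p NL[OF that(1)] that(2,3)] sum_fun_apply pscale_apply unit_coeffs_def)
  qed
  have "coeffs a I (bishift (inv p) (inv p) J) = (\<Sum>l\<in>short_shape_pairs. \<Sum>x\<in>Ix l. \<Sum>y\<in>Ix l. \<Sum>z\<in>Ix l. a l x y * ?M l y z * unit_coeffs l x z I J)"
    unfolding coeffs_def by (intro sum.cong refl) (simp add: 2 sum_distrib_left mult_ac)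
  also have "\<dots> = (\<Sum>l\<in>short_shape_pairs. \<Sum>x\<in>Ix l. \<Sum>z\<in>Ix l. \<Sum>y\<in>Ix l. a l x y * ?M l y z * unit_coeffs l x z I J)"
    by (intro sum.cong refl sum.swap)
  finally show "coeffs a I (bishift (inv p) (inv p) J) = coeffs (\<lambda>l. mat_mul (Ix l) (a l) (?M l)) I J"
    unfolding coeffs_def mat_mul_def sum_distrib_right .
qed

text \<open>By \<open>coeffs_bishift\<close> and the independence of the matrix units, the condition can be read off block by
block.\<close>

lemma sym_coeffs_iff:
  "sym_coeffs (coeffs a) \<longleftrightarrow> (\<forall>l\<in>short_shape_pairs. commutes_with n (Ix l) (tensor_matrix (fst l) (snd l)) (a l))"
proof
  assume S: "sym_coeffs (coeffs a)"
  show "\<forall>l\<in>short_shape_pairs. commutes_with n (Ix l) (tensor_matrix (fst l) (snd l)) (a l)"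
    unfolding commutes_with_def
  proof (intro ballI allI impI)
    fix l p x y assume l: "l \<in> short_shape_pairs" "x \<in> Ix l" "y \<in> Ix l" and p: "p permutes {..<n}"
    let ?M = "\<lambda>l. tensor_matrix (fst l) (snd l) p"
    define D where "D l x y = mat_mul (Ix l) (?M l) (a l) x y - mat_mul (Ix l) (a l) (?M l) x y" for l x y
    have "(\<Sum>l\<in>short_shape_pairs. \<Sum>x\<in>Ix l. \<Sum>y\<in>Ix l. D l x y * unit_coeffs l x y I J) = 0" if IJ: "I \<in> word_pairs" "J \<in> word_pairs" for I J
    proof -
      let ?J = "bishift (inv p) (inv p) J"
      have J: "?J \<in> word_pairs" using IJ bishift_word_pairs[OF permutes_inv[OF p] permutes_inv[OF p]] by simp
      have "coeffs a (bishift p p I) (bishift p p ?J) = coeffs a I ?J" using S p IJ J unfolding sym_coeffs_def by blast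
      then have "coeffs a (bishift p p I) J = coeffs a I ?J" by (simp only: bishift_inv[OF p p])
      then have "coeffs (\<lambda>l. mat_mul (Ix l) (?M l) (a l)) I J = coeffs (\<lambda>l. mat_mul (Ix l) (a l) (?M l)) I J"
        by (simp only: coeffs_bishift[OF p])
      then show ?thesis unfolding D_def left_diff_distrib sum_subtractf coeffs_def by simp
    qed
    from unit_coeffs_independent[OF this l] show "mat_mul (Ix l) (?M l) (a l) x y = mat_mul (Ix l) (a l) (?M l) x y" by (simp add: D_def)
  qed
next
  assume C: "\<forall>l\<in>short_shape_pairs. commutes_with n (Ix l) (tensor_matrix (fst l) (snd l)) (a l)"
  show "sym_coeffs (coeffs a)"
    unfolding sym_coeffs_def
  proof (intro allI impI ballI)
    fix p I J assume p: "p permutes {..<n}" and IJ: "I \<in> word_pairs" "J \<in> word_pairs"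
    have "coeffs a (bishift p p I) (bishift p p J) =
        coeffs (\<lambda>l. mat_mul (Ix l) (a l) (tensor_matrix (fst l) (snd l) p)) I (bishift p p J)"
      unfolding coeffs_bishift(1)[OF p] unfolding coeffs_def
      using C p by (intro sum.cong refl) (simp add: commutes_with_def)
    also have "\<dots> = coeffs a I (bishift (inv p) (inv p) (bishift p p J))" by (rule coeffs_bishift(2)[OF p, symmetric])
    finally show "coeffs a (bishift p p I) (bishift p p J) = coeffs a I J" by (simp only: bishift_inv[OF p p])
  qed
qed

lemma comm_coeffs_coeffs: "comm_coeffs (coeffs a)"
proof -
  have "coeffs a = (\<lambda>I J. \<Sum>k\<in>(SIGMA l:short_shape_pairs. Ix l \<times> Ix l). (case k of (l, x, y) \<Rightarrow> a l x y) * (case k of (l, x, y) \<Rightarrow> unit_coeffs l x y) I J)"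
    by (intro ext) (simp add: coeffs_def sum.Sigma sum.cartesian_product split_beta)
  then show ?thesis using comm_coeffs_sum[of "SIGMA l:short_shape_pairs. Ix l \<times> Ix l" "\<lambda>k. case k of (l, x, y) \<Rightarrow> unit_coeffs l x y"]
    comm_coeffs_unit_coeffs by (simp add: split_beta)
qed

lemma comm_coeffs_expand_short_shape_pairs:
  assumes "comm_coeffs A"
  shows "\<exists>a. \<forall>I\<in>word_pairs. \<forall>J\<in>word_pairs. A I J = coeffs a I J"
proof -
  obtain a where a: "\<And>I J. I \<in> word_pairs \<Longrightarrow> J \<in> word_pairs \<Longrightarrow> A I J = (\<Sum>l\<in>shape_pairs. \<Sum>x\<in>Ix l. \<Sum>y\<in>Ix l. a l x y * unit_coeffs l x y I J)"
    using comm_coeffs_expand[OF assms] by blast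
  have "A I J = coeffs a I J" if IJ: "I \<in> word_pairs" "J \<in> word_pairs" for I J
    unfolding a[OF IJ] coeffs_def
  proof (rule sum.mono_neutral_right)
    show "finite shape_pairs" using finite_partitions by simp
    show "\<forall>l\<in>shape_pairs - short_shape_pairs. (\<Sum>x\<in>Ix l. \<Sum>y\<in>Ix l. a l x y * unit_coeffs l x y I J) = 0"
      using E_eq_0 \<delta>_on_words[OF IJ(2)] by (simp add: unit_coeffs_def)
  qed (rule short_shape_pairs_subset)
  then show ?thesis by blast
qed

text \<open>A basis of the commutant of each tensor product \<open>S\<^sub>\<lambda> \<otimes> S\<^sub>\<mu>\<close> that occurs gives a basis of the symmetric
coefficient matrices in the double commutant, and hence of the invariant forms.\<close>

lemma invariant_component_basis:
  "\<exists>KK f. card KK = (\<Sum>l\<in>short_shape_pairs. \<Sum>nu\<in>partitions n. (kronecker TYPE('k) n (fst l) (snd l) nu)\<^sup>2) \<and>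
    family_basis (pscale (*)) (invariant_component sV sW sT tens n) (KK :: ((nat list \<times> nat list) \<times> nat list \<times> nat \<times> nat) set) f"
proof -
  let ?m = "\<lambda>l. kronecker TYPE('k) n (fst l) (snd l)"
  let ?H = "\<lambda>l. tens.hom_index (?m l)"
  let ?M = "\<lambda>l. tensor_matrix (fst l) (snd l)"
  have "\<exists>B. (\<forall>k\<in>?H l. commutes_with n (Ix l) (?M l) (B k)) \<and>
    (\<forall>c. (\<forall>i\<in>Ix l. \<forall>j\<in>Ix l. (\<Sum>k\<in>?H l. c k * B k i j) = 0) \<longrightarrow> (\<forall>k\<in>?H l. c k = 0)) \<and>
    (\<forall>C. commutes_with n (Ix l) (?M l) C \<longrightarrow> (\<exists>c. \<forall>i\<in>Ix l. \<forall>j\<in>Ix l. C i j = (\<Sum>k\<in>?H l. c k * B k i j)))"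
    if l: "l \<in> short_shape_pairs" for l
  proof -
    have l': "fst l \<in> partitions n" "snd l \<in> partitions n" using l by (auto simp: short_shape_pairs_def)
    obtain y where "matrix_rep_on (pscale (*)) n specht_tensor_act (specht_tensor (fst l) (snd l))
        (tens.block_index (?m l)) y tens.block_matrix"
      using kronecker_adapted_basis[OF l'] by blast
    from tens.commutant_basis[OF specht_tensor_matrix_rep[OF l'] this] show ?thesis unfolding Ix_def .
  qed
  then have "\<forall>l\<in>short_shape_pairs. \<exists>B. (\<forall>k\<in>?H l. commutes_with n (Ix l) (?M l) (B k)) \<and>
    (\<forall>c. (\<forall>i\<in>Ix l. \<forall>j\<in>Ix l. (\<Sum>k\<in>?H l. c k * B k i j) = 0) \<longrightarrow> (\<forall>k\<in>?H l. c k = 0)) \<and>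
    (\<forall>C. commutes_with n (Ix l) (?M l) C \<longrightarrow> (\<exists>c. \<forall>i\<in>Ix l. \<forall>j\<in>Ix l. C i j = (\<Sum>k\<in>?H l. c k * B k i j)))" by blast
  from bchoice[OF this] obtain B where
    Bc: "\<And>l k. l \<in> short_shape_pairs \<Longrightarrow> k \<in> ?H l \<Longrightarrow> commutes_with n (Ix l) (?M l) (B l k)"
    and Bi: "\<And>l c k. l \<in> short_shape_pairs \<Longrightarrow> \<forall>i\<in>Ix l. \<forall>j\<in>Ix l. (\<Sum>k\<in>?H l. c k * B l k i j) = 0 \<Longrightarrow> k \<in> ?H l \<Longrightarrow> c k = 0"
    and Bs: "\<And>l C. l \<in> short_shape_pairs \<Longrightarrow> commutes_with n (Ix l) (?M l) C \<Longrightarrow> \<exists>c. \<forall>i\<in>Ix l. \<forall>j\<in>Ix l. C i j = (\<Sum>k\<in>?H l. c k * B l k i j)"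
    by blast
  define KK where "KK = (SIGMA l:short_shape_pairs. ?H l)"
  have fKK: "finite KK" unfolding KK_def using tens.finite_hom_index by auto
  \<comment> \<open>A basis matrix of the commutant, placed in its block.\<close>
  define a where "a k = (\<lambda>l x y. if l = fst k then B l (snd k) x y else 0)" for k
  define f where "f k = form (coeffs (a k))" for k
  have sum_coeffs: "(\<Sum>k\<in>KK. c k * coeffs (a k) I J) = coeffs (\<lambda>l x y. \<Sum>h\<in>?H l. c (l, h) * B l h x y) I J" for c I J
  proof -
    have "(\<Sum>k\<in>KK. c k * a k l x y) = (\<Sum>h\<in>?H l. c (l, h) * B l h x y)" if l: "l \<in> short_shape_pairs" for l x y
    proof -
      have "(\<Sum>k\<in>KK. c k * a k l x y) = (\<Sum>k\<in>Pair l ` ?H l. c k * B l (snd k) x y)"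
        using l fKK by (intro sum.mono_neutral_cong_right) (auto simp: KK_def a_def)
      also have "\<dots> = (\<Sum>h\<in>?H l. c (l, h) * B l h x y)" by (subst sum.reindex) (auto simp: inj_on_def)
      finally show ?thesis .
    qed
    then have "coeffs (\<lambda>l x y. \<Sum>h\<in>?H l. c (l, h) * B l h x y) I J =
        (\<Sum>l\<in>short_shape_pairs. \<Sum>x\<in>Ix l. \<Sum>y\<in>Ix l. \<Sum>k\<in>KK. c k * (a k l x y * unit_coeffs l x y I J))"
      unfolding coeffs_def by (intro sum.cong refl) (simp add: sum_distrib_right[symmetric] mult.assoc[symmetric])
    also have "\<dots> = (\<Sum>k\<in>KK. c k * coeffs (a k) I J)"
      unfolding coeffs_def sum_distrib_left
      by (rule sym, subst sum.swap, rule sum.cong[OF refl], subst sum.swap, rule sum.cong[OF refl], rule sum.swap)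
    finally show ?thesis by simp
  qed
  have "family_basis (pscale (*)) (invariant_component sV sW sT tens n) KK f"
    unfolding family_basis_def
  proof (intro conjI allI impI ballI)
    show "finite KK" by (rule fKK)
    show "f ` KK \<subseteq> invariant_component sV sW sT tens n"
    proof clarify
      fix l h assume k: "(l, h) \<in> KK"
      have "commutes_with n (Ix m) (?M m) (a (l, h) m)" if "m \<in> short_shape_pairs" for m
      proof (cases "m = l")
        case True
        have "a (l, h) l = B l h" by (simp add: a_def)
        then show ?thesis using True Bc k by (auto simp: KK_def)
      qed (simp add: a_def commutes_with_def mat_mul_def)
      then have "sym_coeffs (coeffs (a (l, h)))" by (simp add: sym_coeffs_iff)
      then show "f (l, h) \<in> invariant_component sV sW sT tens n"
        unfolding invariant_component_iff f_def using comm_coeffs_coeffs by blast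
    qed
  next
    fix c k assume 0: "(\<Sum>k\<in>KK. pscale (*) (c k) (f k)) = 0" and k: "k \<in> KK"
    let ?a = "\<lambda>l x y. \<Sum>h\<in>?H l. c (l, h) * B l h x y"
    have f0: "form (coeffs ?a) = 0"
    proof -
      have "coeffs ?a = (\<lambda>I J. \<Sum>k\<in>KK. c k * coeffs (a k) I J)" by (intro ext) (simp only: sum_coeffs)
      then show ?thesis using 0 unfolding f_def form_sum by simp
    qed
    have "sym_coeffs (coeffs ?a)"
      unfolding sym_coeffs_iff commutes_with_def
    proof (intro ballI allI impI)
      fix l p x y assume l: "l \<in> short_shape_pairs" "x \<in> Ix l" "y \<in> Ix l" and p: "p permutes {..<n}"
      have "mat_mul (Ix l) (?M l p) (?a l) x y = (\<Sum>h\<in>?H l. c (l, h) * mat_mul (Ix l) (?M l p) (B l h) x y)"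
        unfolding mat_mul_def sum_distrib_left by (subst sum.swap) (simp add: mult.left_commute)
      also have "\<dots> = (\<Sum>h\<in>?H l. c (l, h) * mat_mul (Ix l) (B l h) (?M l p) x y)"
        using Bc[OF l(1)] l p by (intro sum.cong refl) (simp add: commutes_with_def)
      also have "\<dots> = mat_mul (Ix l) (?a l) (?M l p) x y"
        unfolding mat_mul_def sum_distrib_left sum_distrib_right by (subst sum.swap) (simp add: mult.assoc)
      finally show "mat_mul (Ix l) (?M l p) (?a l) x y = mat_mul (Ix l) (?a l) (?M l p) x y" .
    qed
    from form_eq_0[OF this f0] have "?a l x y = 0" if "l \<in> short_shape_pairs" "x \<in> Ix l" "y \<in> Ix l" for l x y
      by (intro unit_coeffs_independent[of ?a, OF _ that]) (simp add: coeffs_def)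
    then have "c (fst k, snd k) = 0"
      by (intro Bi[of "fst k" "\<lambda>h. c (fst k, h)" "snd k"]) (use k in \<open>auto simp: KK_def\<close>)
    then show "c k = 0" by simp
  next
    fix g assume "g \<in> invariant_component sV sW sT tens n"
    then obtain A where A: "sym_coeffs A" "comm_coeffs A" "g = form A" unfolding invariant_component_iff by blast
    obtain a' where a': "\<And>I J. I \<in> word_pairs \<Longrightarrow> J \<in> word_pairs \<Longrightarrow> A I J = coeffs a' I J" using comm_coeffs_expand_short_shape_pairs[OF A(2)] by blast
    have "sym_coeffs (coeffs a')"
      unfolding sym_coeffs_def
    proof (intro allI impI ballI)
      fix p I J assume p: "p permutes {..<n}" and IJ: "I \<in> word_pairs" "J \<in> word_pairs"
      have "A (bishift p p I) (bishift p p J) = A I J" using A(1) p IJ by (simp add: sym_coeffs_def)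
      then show "coeffs a' (bishift p p I) (bishift p p J) = coeffs a' I J"
        using IJ bishift_word_pairs[OF p p] by (simp add: a')
    qed
    then have "\<forall>l\<in>short_shape_pairs. \<exists>c. \<forall>i\<in>Ix l. \<forall>j\<in>Ix l. a' l i j = (\<Sum>h\<in>?H l. c h * B l h i j)"
      unfolding sym_coeffs_iff using Bs by blast
    from bchoice[OF this] obtain c where c: "\<And>l i j. l \<in> short_shape_pairs \<Longrightarrow> i \<in> Ix l \<Longrightarrow> j \<in> Ix l \<Longrightarrow> a' l i j = (\<Sum>h\<in>?H l. c l h * B l h i j)" by blast
    have "g = form (\<lambda>I J. \<Sum>k\<in>KK. c (fst k) (snd k) * coeffs (a k) I J)"
      unfolding A(3)
    proof (rule form_cong)
      fix I J assume IJ: "I \<in> word_pairs" "J \<in> word_pairs"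
      show "A I J = (\<Sum>k\<in>KK. c (fst k) (snd k) * coeffs (a k) I J)"
        unfolding a'[OF IJ] sum_coeffs[of "\<lambda>k. c (fst k) (snd k)"]
        unfolding coeffs_def by (intro sum.cong refl) (simp add: c)
    qed
    then show "\<exists>c. g = (\<Sum>k\<in>KK. pscale (*) (c k) (f k))"
      unfolding f_def form_sum by (intro exI[of _ "\<lambda>k. c (fst k) (snd k)"])
  qed
  moreover have "card KK = (\<Sum>l\<in>short_shape_pairs. \<Sum>nu\<in>partitions n. (?m l nu)\<^sup>2)"
    unfolding KK_def by (subst card_SigmaI) (simp_all add: tens.finite_hom_index tens.card_hom_index)
  ultimately show ?thesis by blast
qed

end

theorem theorem1p1:
  fixes sV :: "'k::field_char_0 \<Rightarrow> 'v::ab_group_add \<Rightarrow> 'v"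
    and sW :: "'k \<Rightarrow> 'w::ab_group_add \<Rightarrow> 'w"
    and sT :: "'k \<Rightarrow> 't::ab_group_add \<Rightarrow> 't"
    and BV :: "'v set" and BW :: "'w set"
    and tens :: "'v \<Rightarrow> 'w \<Rightarrow> 't"
    and d1 d2 n :: nat
  assumes "finite_dimensional_vector_space sV BV" and "vector_space.dim sV UNIV = d1"
    and "finite_dimensional_vector_space sW BW" and "vector_space.dim sW UNIV = d2"
    and "is_tensor_product sV sW sT tens"
  shows "(\<exists>B. finite B \<and> invariant_component sV sW sT tens n \<subseteq> module.span (pscale (*)) B) \<and>
    vector_space.dim (pscale (*)) (invariant_component sV sW sT tens n) =
      (\<Sum>la\<in>{la \<in> partitions n. length la \<le> d1}.
        \<Sum>mu\<in>{mu \<in> partitions n. length mu \<le> d2}.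
          \<Sum>nu\<in>partitions n. (kronecker TYPE('k) n la mu nu)\<^sup>2)"
proof -
  interpret V: finite_dimensional_vector_space sV BV by (rule assms(1))
  interpret W: finite_dimensional_vector_space sW BW by (rule assms(3))
  obtain v where v: "family_basis sV UNIV {..<d1} v"
    using V.family_basis_exists[of UNIV BV] V.span_Basis V.finite_Basis assms(2) by auto
  obtain w where w: "family_basis sW UNIV {..<d2} w"
    using W.family_basis_exists[of UNIV BW] W.span_Basis W.finite_Basis assms(4) by auto
  obtain dm and b :: "nat list \<Rightarrow> nat \<Rightarrow> tabloid \<Rightarrow> 'k" where sb: "specht_bases n dm b"
    using specht_bases_exist by blast
  interpret sb: specht_bases n dm b by (rule sb)
  obtain u where mu: "matrix_units n (partitions n) dm sb.rho u" using sb.matrix_units_exist by blast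
  interpret mu: matrix_units n "partitions n" dm sb.rho u by (rule mu)
  interpret invariant_count sV sW sT tens BV BW d1 d2 n v w dm b u
    by unfold_locales (use assms v w in auto)
  obtain KK and f :: "_ \<Rightarrow> ('t \<Rightarrow> 't) \<Rightarrow> 'k" where card: "card KK = (\<Sum>l\<in>short_shape_pairs. \<Sum>nu\<in>partitions n. (kronecker TYPE('k) n (fst l) (snd l) nu)\<^sup>2)"
    and fb: "family_basis (pscale (*)) (invariant_component sV sW sT tens n) (KK :: ((nat list \<times> nat list) \<times> nat list \<times> nat \<times> nat) set) f"
    using invariant_component_basis by blast
  have "finite (f ` KK)" "invariant_component sV sW sT tens n \<subseteq> funs.span (f ` KK)"
    using family_basisD(1)[OF fb] funs.family_basis_independent(3)[OF fb] by auto
  moreover have "funs.dim (invariant_component sV sW sT tens n) = card KK"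
    by (rule funs.family_basis_dim[OF fb])
  moreover have sum_short_shape_pairs: "(\<Sum>l\<in>short_shape_pairs. g l) = (\<Sum>la\<in>{la \<in> partitions n. length la \<le> d1}. \<Sum>mu\<in>{mu \<in> partitions n. length mu \<le> d2}. g (la, mu))"
    for g :: "nat list \<times> nat list \<Rightarrow> nat"
    by (simp add: short_shape_pairs_def sum.cartesian_product split_beta)
  ultimately show ?thesis unfolding card sum_short_shape_pairs fst_conv snd_conv by blast
qed

end
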